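(* Let $d\ge 1$ be an integer and let $\lambda'>\lambda>0$ be real numbers. (1) Let $v_1,\dots,v_d\in\mathbb{R}^d$ be linearly independent. There is no thickening on $\mathbb{R}^d$ from intensity $\lambda$ to intensity $\lambda'$ which commutes with all of the shifts $\sigma_{v_1},\dots,\sigma_{v_d}$. (2) For every $(d-1)$-dimensional linear subspace $V\subset\mathbb{R}^d$, there exists a thickening on $\mathbb{R}^d$ from intensity $\lambda$ to intensity $\lambda'$ which commutes with the shift $\sigma_v$ for every $v\in V$.
   Context: Let $\mathbb{M}_d$ denote the space of locally finite subsets of $\mathbb{R}^d$, endowed with the minimal $\sigma$-algebra under which all maps $S\mapsto |S\cap B|$, for $B\subset\mathbb{R}^d$ Borel, are measurable. Poisson processes on $\mathbb{R}^d$ (homogeneous, with intensity with respect to Lebesgue measure) are viewed as random elements of $\mathbb{M}_d$. A thickening on $\mathbb{R}^d$ from intensity $\lambda$ to intensity $\lambda'$ is a measurable function $f:\mathbb{M}_d\to\mathbb{M}_d$ such that $X\cup f(X)$ is a Poisson process on $\mathbb{R}^d$ of intensity $\lambda'$ when $X$ is a Poisson process on $\mathbb{R}^d$ of intensity $\lambda$. For $v\in\mathbb{R}^d$, the shift $\sigma_v$ is translation by $v$, acting on $\mathbb{M}_d$ by $\sigma_v(S)=\{s+v: s\in S\}$. The function $f$ commutes with $\sigma_v$ if $\sigma_v\circ f=f\circ\sigma_v$ on $\mathbb{M}_d$. *)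

theory Defs
  imports "HOL-Probability.Probability"
begin

definition locally_finite_set :: "'a::metric_space set \<Rightarrow> bool" where
  "locally_finite_set S \<longleftrightarrow> (\<forall>B. bounded B \<longrightarrow> finite (S \<inter> B))"

(* |S \<inter> B| with values in {0, 1, 2, ..., \<infinity>}; card would send infinite sets to 0. *)
definition point_count :: "'a set \<Rightarrow> 'a set \<Rightarrow> ennreal" where
  "point_count S B = emeasure (count_space UNIV) (S \<inter> B)"

definition config_space :: "'a::euclidean_space set measure" where
  "config_space = sigma {S. locally_finite_set S}
     {{S. locally_finite_set S \<and> point_count S B \<in> A} | B A. B \<in> sets borel \<and> A \<in> sets borel}"

(* The Poisson probabilities are written out because the parameter may be 0 (null sets B), where
   poisson_pmf is not characterised; with 0 ^ 0 = 1 the formula gives the point mass at 0. *)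
definition poisson_process ::
    "'w measure \<Rightarrow> ('w \<Rightarrow> 'a::euclidean_space set) \<Rightarrow> real \<Rightarrow> bool" where
  "poisson_process M X lam \<longleftrightarrow>
     prob_space M \<and>
     X \<in> measurable M config_space \<and>
     (\<forall>B \<in> sets borel. emeasure lborel B < \<infinity> \<longrightarrow>
        (\<forall>k::nat. measure M {\<omega> \<in> space M. point_count (X \<omega>) B = of_nat k} =
           exp (- (lam * measure lborel B)) * (lam * measure lborel B) ^ k / fact k)) \<and>
     (\<forall>(B :: nat \<Rightarrow> 'a set) n.
        (\<forall>i<n. B i \<in> sets borel \<and> emeasure lborel (B i) < \<infinity>) \<longrightarrow>
        disjoint_family_on B {..<n} \<longrightarrow>
        prob_space.indep_vars M (\<lambda>_. borel) (\<lambda>i \<omega>. point_count (X \<omega>) (B i)) {..<n})"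

(* HOL cannot quantify over the type of the underlying probability space inside a definition, so
   the space has the type of configurations here.  Nothing is lost: by thickening_any_space below,
   the property transfers to Poisson processes on probability spaces of arbitrary type. *)
definition thickening ::
    "real \<Rightarrow> real \<Rightarrow> ('a::euclidean_space set \<Rightarrow> 'a set) \<Rightarrow> bool" where
  "thickening lam lam' f \<longleftrightarrow>
     f \<in> measurable config_space config_space \<and>
     (\<forall>(M :: 'a set measure) X.
        poisson_process M X lam \<longrightarrow> poisson_process M (\<lambda>\<omega>. X \<omega> \<union> f (X \<omega>)) lam')"

definition shift :: "'a::euclidean_space \<Rightarrow> 'a set \<Rightarrow> 'a set" where
  "shift v S = {s + v | s. s \<in> S}"

definition commutes_with_shift ::
    "('a::euclidean_space set \<Rightarrow> 'a set) \<Rightarrow> 'a \<Rightarrow> bool" where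
  "commutes_with_shift f v \<longleftrightarrow> (\<forall>S \<in> space config_space. shift v (f S) = f (shift v S))"

lemma space_config_space: "space config_space = {S. locally_finite_set S}"
  unfolding config_space_def by (rule space_measure_of) auto

lemma measurable_point_count:
  assumes "B \<in> sets borel"
  shows "(\<lambda>S. point_count S B) \<in> borel_measurable config_space"
proof (rule measurableI)
  fix A :: "ennreal set" assume A: "A \<in> sets borel"
  have "(\<lambda>S. point_count S B) -` A \<inter> space config_space
      = {S. locally_finite_set S \<and> point_count S B \<in> A}"
    by (auto simp: space_config_space)
  also have "\<dots> \<in> sets config_space"
    unfolding config_space_def using assms A
    by (subst sets_measure_of) (auto intro!: sigma_sets.Basic)
  finally show "(\<lambda>S. point_count S B) -` A \<inter> space config_space \<in> sets config_space" .
qed auto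

lemma poisson_process_distr_iff:
  fixes X :: "'w \<Rightarrow> 'a::euclidean_space set" and g :: "'a set \<Rightarrow> 'a set"
  assumes M: "prob_space M" and X: "X \<in> measurable M config_space"
    and g: "g \<in> measurable config_space config_space"
  shows "poisson_process (distr M config_space X) g lam \<longleftrightarrow> poisson_process M (\<lambda>\<omega>. g (X \<omega>)) lam"
proof -
  let ?D = "distr M config_space X"
  interpret M: prob_space M by fact
  interpret D: prob_space ?D using X by (rule M.prob_space_distr)
  have gX: "(\<lambda>\<omega>. g (X \<omega>)) \<in> measurable M config_space"
    using measurable_compose[OF X g] .
  have 1: "measure ?D {S \<in> space ?D. point_count (g S) B = of_nat k}
      = measure M {\<omega> \<in> space M. point_count (g (X \<omega>)) B = of_nat k}"
    if "B \<in> sets borel" for B k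
  proof -
    have m: "(\<lambda>S. point_count (g S) B) \<in> borel_measurable config_space"
      using measurable_compose[OF g measurable_point_count[OF that]] .
    have s: "{S \<in> space config_space. point_count (g S) B = of_nat k} \<in> sets config_space"
      using m by measurable
    show ?thesis
      by (subst measure_distr[OF X])
         (use s measurable_space[OF X] in \<open>auto intro!: arg_cong[where f="measure M"]\<close>)
  qed
  have 2: "D.indep_vars (\<lambda>_. borel) (\<lambda>i S. point_count (g S) (B i)) {..<n}
      \<longleftrightarrow> M.indep_vars (\<lambda>_. borel) (\<lambda>i \<omega>. point_count (g (X \<omega>)) (B i)) {..<n}"
    if B: "\<And>i. i < n \<Longrightarrow> B i \<in> sets borel" for B :: "nat \<Rightarrow> 'a set" and n
  proof (cases "n = 0")
    case True
    then show ?thesis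
      by (simp add: D.indep_vars_def M.indep_vars_def D.indep_sets_def M.indep_sets_def)
  next
    case False
    then have ne: "{..<n} \<noteq> {}" by auto
    have m: "(\<lambda>S. point_count (g S) (B i)) \<in> borel_measurable config_space" if "i \<in> {..<n}" for i
      using measurable_compose[OF g measurable_point_count[OF B]] that by simp
    have mX: "(\<lambda>\<omega>. point_count (g (X \<omega>)) (B i)) \<in> borel_measurable M" if "i \<in> {..<n}" for i
      using measurable_compose[OF X m[OF that]] .
    have mD: "(\<lambda>S. point_count (g S) (B i)) \<in> borel_measurable ?D" if "i \<in> {..<n}" for i
      using m[OF that] by simp
    have a: "distr ?D (Pi\<^sub>M {..<n} (\<lambda>_. borel)) (\<lambda>S. \<lambda>i\<in>{..<n}. point_count (g S) (B i))
        = distr M (Pi\<^sub>M {..<n} (\<lambda>_. borel)) (\<lambda>\<omega>. \<lambda>i\<in>{..<n}. point_count (g (X \<omega>)) (B i))"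
      by (subst distr_distr[OF _ X]) (auto intro!: measurable_restrict m simp: comp_def)
    have b: "distr ?D borel (\<lambda>S. point_count (g S) (B i))
        = distr M borel (\<lambda>\<omega>. point_count (g (X \<omega>)) (B i))" if "i \<in> {..<n}" for i
      by (subst distr_distr[OF _ X]) (use m[OF that] in \<open>auto simp: comp_def\<close>)
    have c: "(\<Pi>\<^sub>M i\<in>{..<n}. distr ?D borel (\<lambda>S. point_count (g S) (B i)))
        = (\<Pi>\<^sub>M i\<in>{..<n}. distr M borel (\<lambda>\<omega>. point_count (g (X \<omega>)) (B i)))"
      by (rule PiM_cong[OF refl b])
    show ?thesis
      using D.indep_vars_iff_distr_eq_PiM'[where M' = "\<lambda>_. borel", OF ne mD]
        M.indep_vars_iff_distr_eq_PiM'[where M' = "\<lambda>_. borel", OF ne mX]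
      by (simp only: a c)
  qed
  show ?thesis
    unfolding poisson_process_def using 1 2 M D.prob_space_axioms g gX by (simp cong: conj_cong)
qed

lemma thickening_any_space:
  fixes M :: "'w measure" and X :: "'w \<Rightarrow> 'a::euclidean_space set"
  assumes f: "thickening lam lam' f" and X: "poisson_process M X lam"
  shows "poisson_process M (\<lambda>\<omega>. X \<omega> \<union> f (X \<omega>)) lam'"
proof -
  have M: "prob_space M" and mX: "X \<in> measurable M config_space"
    using X by (auto simp: poisson_process_def)
  have "poisson_process (distr M config_space X) (\<lambda>S. S) lam"
    using X by (subst poisson_process_distr_iff[OF M mX]) auto
  then have *: "poisson_process (distr M config_space X) (\<lambda>S. S \<union> f S) lam'"
    using f unfolding thickening_def by blast
  then have "(\<lambda>S. S \<union> f S) \<in> measurable config_space config_space"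
    by (simp add: poisson_process_def)
  with * show ?thesis
    by (simp add: poisson_process_distr_iff[OF M mX])
qed

end

theory Submission
  imports Defs
begin

text \<open>
  Everything is done with void probabilities: a random locally finite set is a Poisson process of
  intensity \<open>lam\<close> as soon as it misses every bounded Borel set \<open>B\<close> with probability
  \<open>exp (- (lam * |B|))\<close> (Renyi's theorem, \<open>poisson_iff_void_process\<close>), and these probabilities
  determine its law (\<open>void_process_unique\<close>).

  \<^bold>\<open>Existence for a hyperplane \<open>V\<close>.\<close> The direction \<open>w\<close> orthogonal to \<open>V\<close> may be used
  asymmetrically. The points of the configuration in the slab \<open>0 \<le> w \<bullet> x < 1\<close> whose projections to \<open>V\<close>
  are far from the projections of the other points in the slab choose, equivariantly under \<open>V\<close>, a random
  set of centers in \<open>V\<close>. Above each center stands a half-infinite column of blocks beyond the slab; the columns are disjoint,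
  and given the slab the process in them is still Poisson. One column carries infinitely many independent
  blocks, and this is enough randomness to build everything that is needed: inside the column a Poisson
  process of intensity \<open>lam'\<close> that contains the given one, and outside of it an independent Poisson
  process of intensity \<open>lam' - lam\<close> (\<open>column_thickening\<close>). Each column supplies the new points in the
  Voronoi region of its center (\<open>fixed_slab\<close>).

  The thickening of a column rests on a coding theorem (\<open>coordinate_event_determined\<close>). Start from the
  richer objects: in block \<open>n\<close> a pair of independent Poisson processes of intensities \<open>lam\<close> and
  \<open>lam' - lam\<close>. If there is exactly one point in total, one is free to decide, with the right
  probability, whether this point is kept, because a single point is uniformly distributed whichever
  process it comes from; otherwise the points of the first process are kept. The decision probability
  may depend on the past. It is tilted so that it transmits a bit about an event of earlier blocks,
  with the conditional mean of that event subtracted; then the kept points remain independent Poisson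
  processes of intensity \<open>lam\<close>. Each transmission reduces the conditional variance of the event by a
  definite amount, and every event is transmitted infinitely often, so that almost surely the kept
  points determine all richer data.

  \<^bold>\<open>Nonexistence for a lattice.\<close> Let \<open>X\<close> be Poisson, \<open>Y = X \<union> f X\<close> with \<open>f\<close> equivariant, and cut each
  fundamental cell of the lattice into \<open>K ^ d\<close> small cells. Whether \<open>Y\<close> meets a given small cell is a
  function of \<open>X\<close>, hence is predicted up to a small error by finitely many void events of \<open>X\<close>
  (\<open>approximable_sets\<close>); by equivariance translates of these finitely many predictors serve all
  small cells. In a box of \<open>r ^ d\<close> fundamental cells this predicts a number of small cells proportional
  to \<open>r ^ d\<close>, uniformly in \<open>K\<close>, and a number proportional to \<open>r ^ d\<close> of these are met by \<open>Y\<close> although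
  \<open>X\<close> misses them. But the set of atoms occupied by \<open>X\<close> is one of the \<open>2 ^ m\<close> subsets of the \<open>m\<close> atoms
  occupied by \<open>Y\<close>, and for a fixed prediction each additional success costs a probability of order
  \<open>1 / K ^ d\<close>. A union bound over the subsets shows that \<open>ln (K ^ d)\<close> times the density of successes
  is bounded independently of \<open>K\<close> (\<open>predicted_hits_bound\<close>), which is absurd for large \<open>K\<close>.
\<close>

section \<open>Configurations and their void events\<close>

lemma point_count_eq_0_iff: "point_count S B = 0 \<longleftrightarrow> S \<inter> B = {}"
proof
  assume *: "point_count S B = 0"
  then have "S \<inter> B \<subseteq> {} \<or> finite (S \<inter> B)"
    by (auto simp: point_count_def emeasure_count_space_eq_0)
  with * show "S \<inter> B = {}"
    by (auto simp: point_count_def emeasure_count_space_eq_0)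
qed (simp add: point_count_def)

lemma point_count_finite: "finite (S \<inter> B) \<Longrightarrow> point_count S B = of_nat (card (S \<inter> B))"
  by (simp add: point_count_def)

lemma locally_finite_mono: "locally_finite_set S \<Longrightarrow> T \<subseteq> S \<Longrightarrow> locally_finite_set T"
  unfolding locally_finite_set_def by (meson Int_mono finite_subset order_refl)

lemma locally_finite_Un: "locally_finite_set S \<Longrightarrow> locally_finite_set T \<Longrightarrow> locally_finite_set (S \<union> T)"
  unfolding locally_finite_set_def by (simp add: Int_Un_distrib2)

lemma locally_finite_countable:
  fixes S :: "'a::euclidean_space set"
  assumes "locally_finite_set S" shows "countable S"
proof -
  have "S = (\<Union>r::nat. S \<inter> cball 0 (real r))"
    using real_arch_simple by (auto simp: dist_norm)
  moreover have "countable (S \<inter> cball 0 (real r))" for r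
    using assms bounded_cball unfolding locally_finite_set_def by (intro countable_finite) blast
  ultimately show ?thesis by (metis countableI_type countable_UN)
qed

text \<open>
  The index of the dyadic cube of side \<open>2 ^ - n\<close> containing a point. Counting occupied dyadic cubes turns
  numbers of points into void events, since a finite set is eventually separated by the cubes.
\<close>

definition dyadic :: "nat \<Rightarrow> 'a::euclidean_space \<Rightarrow> 'a \<Rightarrow> int" where
  "dyadic n x = (\<lambda>b\<in>Basis. \<lfloor>2 ^ n * (x \<bullet> b)\<rfloor>)"

lemma dyadic_eq_iff: "dyadic n x = dyadic n y \<longleftrightarrow> (\<forall>b\<in>Basis. \<lfloor>2 ^ n * (x \<bullet> b)\<rfloor> = \<lfloor>2 ^ n * (y \<bullet> b)\<rfloor>)"
  by (auto simp: dyadic_def restrict_def fun_eq_iff)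

lemma dyadic_cell_borel [measurable]: "{x. dyadic n x = z} \<in> sets borel"
proof (cases "\<exists>y. dyadic n y = z")
  case True
  then obtain y where y: "dyadic n y = z" by blast
  have "{x. dyadic n x = z} = {x\<in>space borel. \<forall>b\<in>Basis. \<lfloor>2 ^ n * (x \<bullet> b)\<rfloor> = \<lfloor>2 ^ n * (y \<bullet> b)\<rfloor>}"
    using y by (auto simp: dyadic_eq_iff)
  also have "\<dots> \<in> sets borel" by measurable
  finally show ?thesis .
qed auto

lemma finite_dyadic_image:
  assumes "bounded B" shows "finite (dyadic n ` B)"
proof -
  obtain r where r: "\<And>x. x \<in> B \<Longrightarrow> norm x \<le> r" using assms by (auto simp: bounded_iff)
  have "dyadic n ` B \<subseteq> (\<Pi>\<^sub>E b\<in>Basis. {\<lfloor>- (2^n * r)\<rfloor> .. \<lceil>2^n * r\<rceil>})"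
  proof
    fix z assume "z \<in> dyadic n ` B"
    then obtain x where "x \<in> B" and z: "z = dyadic n x" by blast
    have "dyadic n x b \<in> {\<lfloor>- (2^n * r)\<rfloor> .. \<lceil>2^n * r\<rceil>}" if "b \<in> Basis" for b
    proof -
      have "\<bar>x \<bullet> b\<bar> \<le> r" using r[OF \<open>x \<in> B\<close>] Basis_le_norm[OF that, of x] by linarith
      then have "\<bar>2^n * (x \<bullet> b)\<bar> \<le> 2^n * r" by (simp add: abs_mult)
      then have "- (2^n * r) \<le> 2^n * (x \<bullet> b)" "2^n * (x \<bullet> b) \<le> 2^n * r" by (auto simp: abs_le_iff)
      then have "\<lfloor>- (2 ^ n * r)\<rfloor> \<le> \<lfloor>2 ^ n * (x \<bullet> b)\<rfloor>" "\<lfloor>2 ^ n * (x \<bullet> b)\<rfloor> \<le> \<lceil>2 ^ n * r\<rceil>"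
        by linarith+
      then show ?thesis using that by (simp add: dyadic_def)
    qed
    then show "z \<in> (\<Pi>\<^sub>E b\<in>Basis. {\<lfloor>- (2^n * r)\<rfloor> .. \<lceil>2^n * r\<rceil>})"
      by (auto simp: z dyadic_def PiE_iff)
  qed
  then show ?thesis by (rule finite_subset) (simp add: finite_PiE)
qed

lemma dyadic_separates:
  fixes F :: "'a::euclidean_space set"
  assumes "finite F" shows "\<forall>\<^sub>F n in sequentially. inj_on (dyadic n) F"
proof -
  have 1: "\<forall>\<^sub>F n in sequentially. dyadic n x = dyadic n y \<longrightarrow> x = y" for x y :: 'a
  proof (cases "x = y")
    case False
    then obtain b where b: "b \<in> Basis" "x \<bullet> b \<noteq> y \<bullet> b" using euclidean_eqI by blast
    have "\<forall>\<^sub>F n in sequentially. inverse \<bar>x \<bullet> b - y \<bullet> b\<bar> < 2 ^ n"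
      using real_arch_pow[of 2 "inverse \<bar>x \<bullet> b - y \<bullet> b\<bar>"] unfolding eventually_sequentially
      by (metis less_le_trans numeral_le_one_iff one_le_numeral power_increasing rel_simps(49) semiring_norm(69) less_numeral_extra(1) one_less_numeral_iff semiring_norm(76))
    then show ?thesis
    proof eventually_elim
      case (elim n)
      then have "1 < 2 ^ n * \<bar>x \<bullet> b - y \<bullet> b\<bar>" using b by (simp add: field_simps)
      then have "1 < \<bar>2 ^ n * (x \<bullet> b) - 2 ^ n * (y \<bullet> b)\<bar>"
        by (simp add: abs_mult flip: right_diff_distrib)
      then have "\<lfloor>2 ^ n * (x \<bullet> b)\<rfloor> \<noteq> \<lfloor>2 ^ n * (y \<bullet> b)\<rfloor>" by linarith
      then show ?case using b by (auto simp: dyadic_eq_iff)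
    qed
  qed simp
  have "\<forall>\<^sub>F n in sequentially. \<forall>x\<in>F. \<forall>y\<in>F. dyadic n x = dyadic n y \<longrightarrow> x = y"
    using assms 1 by (intro eventually_ball_finite ballI)
  then show ?thesis by (simp add: inj_on_def)
qed

lemma card_dyadic_image:
  assumes "bounded B"
  shows "card (dyadic n ` (S \<inter> B)) = (\<Sum>z\<in>dyadic n ` B. of_bool (S \<inter> (B \<inter> {x. dyadic n x = z}) \<noteq> {}))"
proof -
  have "dyadic n ` (S \<inter> B) = {z \<in> dyadic n ` B. S \<inter> (B \<inter> {x. dyadic n x = z}) \<noteq> {}}"
    by (auto simp: image_iff) (metis IntI)
  then show ?thesis using finite_dyadic_image[OF assms]
    by (simp add: of_bool_def flip: sum.inter_filter)
qed

lemma card_dyadic_tendsto: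
  assumes "locally_finite_set S" "bounded B"
  shows "\<forall>\<^sub>F n in sequentially. card (dyadic n ` (S \<inter> B)) = card (S \<inter> B)"
proof -
  have "finite (S \<inter> B)" using assms by (auto simp: locally_finite_set_def)
  from dyadic_separates[OF this] show ?thesis by eventually_elim (rule card_image)
qed

lemma point_count_SUP:
  fixes S :: "'a::euclidean_space set"
  shows "point_count S B = (SUP r::nat. point_count S (B \<inter> cball 0 (real r)))"
proof -
  have "(SUP r::nat. emeasure (count_space UNIV) (S \<inter> (B \<inter> cball 0 (real r))))
      = emeasure (count_space UNIV) (\<Union>r::nat. S \<inter> (B \<inter> cball 0 (real r)))"
    by (rule SUP_emeasure_incseq) (auto simp: incseq_def)
  also have "(\<Union>r::nat. S \<inter> (B \<inter> cball 0 (real r))) = S \<inter> B"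
    using real_arch_simple by (auto simp: dist_norm)
  finally show ?thesis by (simp add: point_count_def)
qed

text \<open>
  The number of points in \<open>B\<close> is the limit of the numbers of occupied dyadic pieces of \<open>B\<close>.
\<close>

lemma measurable_card_from_voids:
  fixes X :: "'w \<Rightarrow> 'a::euclidean_space set"
  assumes lf: "\<And>\<omega>. \<omega> \<in> space N \<Longrightarrow> locally_finite_set (X \<omega>)"
    and B: "B \<in> sets borel" "bounded B"
    and voids: "\<And>C. C \<in> sets borel \<Longrightarrow> bounded C \<Longrightarrow> C \<subseteq> B \<Longrightarrow> {\<omega>\<in>space N. X \<omega> \<inter> C = {}} \<in> sets N"
  shows "(\<lambda>\<omega>. real (card (X \<omega> \<inter> B))) \<in> borel_measurable N"
proof (rule borel_measurable_LIMSEQ_real)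
  fix \<omega> assume "\<omega> \<in> space N"
  show "(\<lambda>n. real (card (dyadic n ` (X \<omega> \<inter> B)))) \<longlonglongrightarrow> real (card (X \<omega> \<inter> B))"
    using card_dyadic_tendsto[OF lf[OF \<open>\<omega> \<in> space N\<close>] B(2)]
    by (intro tendsto_eventually) (auto elim: eventually_mono)
next
  fix n
  have "Measurable.pred N (\<lambda>\<omega>. X \<omega> \<inter> (B \<inter> {x. dyadic n x = z}) = {})" for z
    unfolding pred_def using B by (intro voids) (auto intro: bounded_subset)
  note this[measurable]
  show "(\<lambda>\<omega>. real (card (dyadic n ` (X \<omega> \<inter> B)))) \<in> borel_measurable N"
    unfolding card_dyadic_image[OF B(2)] of_nat_sum of_nat_of_bool of_bool_def by measurable
qed

lemma measurable_point_count_from_voids: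
  fixes X :: "'w \<Rightarrow> 'a::euclidean_space set"
  assumes lf: "\<And>\<omega>. \<omega> \<in> space N \<Longrightarrow> locally_finite_set (X \<omega>)"
    and B: "B \<in> sets borel"
    and voids: "\<And>C. C \<in> sets borel \<Longrightarrow> bounded C \<Longrightarrow> C \<subseteq> B \<Longrightarrow> {\<omega>\<in>space N. X \<omega> \<inter> C = {}} \<in> sets N"
  shows "(\<lambda>\<omega>. point_count (X \<omega>) B) \<in> borel_measurable N"
proof -
  have "(\<lambda>\<omega>. point_count (X \<omega>) (B \<inter> cball 0 (real r))) \<in> borel_measurable N" for r :: nat
  proof -
    have "(\<lambda>\<omega>. real (card (X \<omega> \<inter> (B \<inter> cball 0 (real r))))) \<in> borel_measurable N"
      using B by (intro measurable_card_from_voids lf voids) (auto intro: bounded_subset[OF bounded_cball])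
    then have "(\<lambda>\<omega>. ennreal (real (card (X \<omega> \<inter> (B \<inter> cball 0 (real r)))))) \<in> borel_measurable N"
      by measurable
    moreover have "finite (X \<omega> \<inter> (B \<inter> cball 0 (real r)))" if "\<omega> \<in> space N" for \<omega>
      using lf[OF that] by (auto simp: locally_finite_set_def intro: bounded_subset[OF bounded_cball])
    ultimately show ?thesis
      by (subst measurable_cong[where g = "\<lambda>\<omega>. ennreal (real (card (X \<omega> \<inter> (B \<inter> cball 0 (real r)))))"])
        (auto simp: point_count_finite ennreal_of_nat_eq_real_of_nat)
  qed
  then show ?thesis by (subst point_count_SUP) measurable
qed

lemma measurable_configI:
  fixes X :: "'w \<Rightarrow> 'a::euclidean_space set"
  assumes lf: "\<And>\<omega>. \<omega> \<in> space N \<Longrightarrow> locally_finite_set (X \<omega>)"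
    and voids: "\<And>C. C \<in> sets borel \<Longrightarrow> bounded C \<Longrightarrow> {\<omega>\<in>space N. X \<omega> \<inter> C = {}} \<in> sets N"
  shows "X \<in> measurable N config_space"
  unfolding config_space_def
proof (rule measurable_measure_of)
  fix A :: "'a set set" assume "A \<in> {{S. locally_finite_set S \<and> point_count S B \<in> A} | B A. B \<in> sets borel \<and> A \<in> sets borel}"
  then obtain B E where A: "A = {S. locally_finite_set S \<and> point_count S B \<in> E}" "B \<in> sets borel" "E \<in> sets borel"
    by blast
  have "(\<lambda>\<omega>. point_count (X \<omega>) B) \<in> borel_measurable N"
    using A lf voids by (intro measurable_point_count_from_voids) auto
  from measurable_sets[OF this A(3)] show "X -` A \<inter> space N \<in> sets N"
    using lf by (auto simp: A vimage_def Int_def conj_commute cong: conj_cong)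
qed (use lf in auto)

lemma sets_void [measurable]:
  fixes B :: "'a::euclidean_space set"
  assumes "B \<in> sets borel" shows "{S\<in>space config_space. S \<inter> B = {}} \<in> sets config_space"
proof -
  note [measurable] = measurable_point_count[OF assms]
  have "{S\<in>space config_space. point_count S B = 0} \<in> sets config_space" by measurable
  then show ?thesis by (simp add: point_count_eq_0_iff)
qed

lemma void_event:
  fixes X :: "'w \<Rightarrow> 'a::euclidean_space set"
  assumes X: "X \<in> measurable M config_space" and B: "B \<in> sets borel"
  shows "{\<omega>\<in>space M. X \<omega> \<inter> B = {}} \<in> sets M"
proof -
  have "{\<omega>\<in>space M. X \<omega> \<inter> B = {}} = X -` {S\<in>space config_space. S \<inter> B = {}} \<inter> space M"
    using measurable_space[OF X] by auto
  then show ?thesis using measurable_sets[OF X sets_void[OF B]] by simp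
qed

lemma occupied_event:
  fixes X :: "'w \<Rightarrow> 'a::euclidean_space set"
  assumes X: "X \<in> measurable M config_space" and B: "B \<in> sets borel"
  shows "{\<omega>\<in>space M. X \<omega> \<inter> B \<noteq> {}} \<in> sets M"
proof -
  have "{\<omega>\<in>space M. X \<omega> \<inter> B \<noteq> {}} = space M - {\<omega>\<in>space M. X \<omega> \<inter> B = {}}" by blast
  then show ?thesis using sets.compl_sets[OF void_event[OF X B]] by simp
qed

lemma locally_finite_measurable:
  "X \<in> measurable M config_space \<Longrightarrow> \<omega> \<in> space M \<Longrightarrow> locally_finite_set (X \<omega>)"
  using measurable_space[of X M config_space \<omega>] by (simp add: space_config_space)

lemma measurable_card_config:
  fixes X :: "'w \<Rightarrow> 'a::euclidean_space set"
  assumes X: "X \<in> measurable M config_space" and "B \<in> sets borel" "bounded B"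
  shows "(\<lambda>\<omega>. real (card (X \<omega> \<inter> B))) \<in> borel_measurable M"
  by (rule measurable_card_from_voids[OF locally_finite_measurable[OF X] assms(2,3) void_event[OF X]])

definition void_events :: "'a::euclidean_space set set set" where
  "void_events = {{S\<in>space config_space. S \<inter> B = {}} | B. B \<in> sets borel \<and> bounded B}"

lemma Int_stable_void_events: "Int_stable void_events"
proof (rule Int_stableI)
  fix E F :: "'a set set" assume "E \<in> void_events" "F \<in> void_events"
  then obtain B C where *: "E = {S \<in> space config_space. S \<inter> B = {}}" "F = {S \<in> space config_space. S \<inter> C = {}}"
      "B \<in> sets borel" "bounded B" "C \<in> sets borel" "bounded C"
    unfolding void_events_def by blast
  then have "E \<inter> F = {S \<in> space config_space. S \<inter> (B \<union> C) = {}}" by blast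
  then show "E \<inter> F \<in> void_events"
    unfolding void_events_def using sets.Un[OF *(3,5)] bounded_Un[THEN iffD2, OF conjI, OF *(4,6)] by blast
qed

text \<open>
  The counts are limits of functions of void events, so the void events form a generator stable under
  intersection; laws and independence need only be checked on them.
\<close>

lemma sets_config_space_eq: "sets config_space = sigma_sets (space config_space) (void_events :: 'a::euclidean_space set set set)"
proof (rule antisym)
  show "sigma_sets (space config_space) void_events \<subseteq> (sets config_space :: 'a set set set)"
    by (intro sets.sigma_sets_subset) (auto simp: void_events_def intro!: sets_void)
  have sub: "(void_events :: 'a set set set) \<subseteq> Pow (space config_space)" by (auto simp: void_events_def)
  have "(\<lambda>S. S) \<in> measurable (sigma (space config_space) (void_events :: 'a set set set)) config_space"
  proof (rule measurable_configI)
    fix S :: "'a set" assume "S \<in> space (sigma (space config_space) void_events)"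
    then have "S \<in> space config_space" using space_measure_of[OF sub] by simp
    then show "locally_finite_set S" by (simp add: space_config_space)
  next
    fix C :: "'a set" assume "C \<in> sets borel" "bounded C"
    then have "{S \<in> space config_space. S \<inter> C = {}} \<in> void_events" by (auto simp: void_events_def)
    then show "{S \<in> space (sigma (space config_space) void_events). S \<inter> C = {}} \<in> sets (sigma (space config_space) void_events)"
      using sub by (simp add: sets_measure_of)
  qed
  then have "sets config_space \<subseteq> sets (sigma (space config_space) (void_events :: 'a set set set))"
  proof (intro subsetI)
    fix A :: "'a set set" assume m: "(\<lambda>S. S) \<in> measurable (sigma (space config_space) (void_events :: 'a set set set)) config_space"
      and A: "A \<in> sets config_space"
    from measurable_sets[OF m A] show "A \<in> sets (sigma (space config_space) void_events)"
      using sets.sets_into_space[OF A] sub by (simp add: Int_absorb2 space_measure_of)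
  qed
  then show "sets config_space \<subseteq> sigma_sets (space config_space) (void_events :: 'a set set set)"
    using sub by simp
qed

text \<open>
  A measurable property of some point of a random configuration, jointly with an outside parameter \<open>t\<close>, is
  an event, although the points are not enumerated measurably. The number of points in a ball with the
  property is measurable for rectangles, and the class of properties for which it is measurable is closed
  under complements and disjoint unions.
\<close>

lemma sets_ex_point:
  fixes X :: "'t \<Rightarrow> 'a::euclidean_space set"
  assumes X: "X \<in> measurable T config_space" and E: "E \<in> sets (borel \<Otimes>\<^sub>M T)"
  shows "{t\<in>space T. \<exists>x\<in>X t. (x, t) \<in> E} \<in> sets T"
proof -
  let ?D = "\<lambda>r::nat. cball 0 (real r) :: 'a set"
  have fin: "finite (X t \<inter> ?D r)" if "t \<in> space T" for t r
    using locally_finite_measurable[OF X that] bounded_cball by (simp add: locally_finite_set_def)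
  have *: "(\<lambda>t. real (card {x\<in>X t \<inter> ?D r. (x, t) \<in> E})) \<in> borel_measurable T" for r
    using Int_stable_pair_measure_generator pair_measure_closed E[unfolded sets_pair_measure]
  proof (induction rule: sigma_sets_induct_disjoint)
    case (basic E)
    then obtain B F where E: "E = B \<times> F" "B \<in> sets borel" "F \<in> sets T" by auto
    have "(\<lambda>t. real (card (X t \<inter> (B \<inter> ?D r)))) \<in> borel_measurable T"
      using E by (intro measurable_card_config X) (auto intro: bounded_subset[OF bounded_cball])
    then have "(\<lambda>t. indicator F t * real (card (X t \<inter> (B \<inter> ?D r)))) \<in> borel_measurable T"
      using E by measurable
    moreover have "{x\<in>X t \<inter> ?D r. (x, t) \<in> E} = (if t \<in> F then X t \<inter> (B \<inter> ?D r) else {})" for t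
      by (auto simp: E)
    ultimately show ?case by (simp add: if_distrib[of card] if_distrib[of real] indicator_def of_bool_def if_distrib[of "\<lambda>u. u * _"] cong: if_cong)
  next
    case (compl E)
    have "(\<lambda>t. real (card (X t \<inter> ?D r)) - real (card {x\<in>X t \<inter> ?D r. (x, t) \<in> E})) \<in> borel_measurable T"
      using compl(2) by (intro borel_measurable_diff measurable_card_config[OF X]) (simp_all add: borel_closed)
    moreover have "real (card (X t \<inter> ?D r)) - real (card {x\<in>X t \<inter> ?D r. (x, t) \<in> E}) =
        real (card {x\<in>X t \<inter> ?D r. (x, t) \<in> space borel \<times> space T - E})" if "t \<in> space T" for t
    proof -
      have "{x\<in>X t \<inter> ?D r. (x, t) \<in> space borel \<times> space T - E} = X t \<inter> ?D r - {x\<in>X t \<inter> ?D r. (x, t) \<in> E}"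
        using that by auto
      moreover have "{x\<in>X t \<inter> ?D r. (x, t) \<in> E} \<subseteq> X t \<inter> ?D r" by auto
      ultimately show ?thesis using fin[OF that, of r]
        by (simp only: card_Diff_subset finite_subset card_mono of_nat_diff)
    qed
    ultimately show ?case by (subst (asm) measurable_cong) auto
  next
    case (union E)
    have "real (card {x\<in>X t \<inter> ?D r. (x, t) \<in> (\<Union>i. E i)}) = (\<Sum>i. real (card {x\<in>X t \<inter> ?D r. (x, t) \<in> E i}))"
      if t: "t \<in> space T" for t
    proof -
      have "(\<lambda>i. measure (count_space UNIV) {x\<in>X t \<inter> ?D r. (x, t) \<in> E i}) sums
          measure (count_space UNIV) (\<Union>i. {x\<in>X t \<inter> ?D r. (x, t) \<in> E i})"
      proof (rule measure_UNION)
        show "disjoint_family (\<lambda>i. {x \<in> X t \<inter> ?D r. (x, t) \<in> E i})"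
          using union(1) by (fastforce simp: disjoint_family_on_def)
        have "finite (\<Union>i. {x\<in>X t \<inter> ?D r. (x, t) \<in> E i})" by (rule finite_subset[OF _ fin[OF t, of r]]) auto
        then show "emeasure (count_space UNIV) (\<Union>i. {x\<in>X t \<inter> ?D r. (x, t) \<in> E i}) \<noteq> \<infinity>" by simp
      qed auto
      moreover have "(\<Union>i. {x\<in>X t \<inter> ?D r. (x, t) \<in> E i}) = {x\<in>X t \<inter> ?D r. (x, t) \<in> (\<Union>i. E i)}" by auto
      moreover have "measure (count_space UNIV) {x\<in>X t \<inter> ?D r. (x, t) \<in> F} = real (card {x\<in>X t \<inter> ?D r. (x, t) \<in> F})" for F
      proof -
        have "finite {x\<in>X t \<inter> ?D r. (x, t) \<in> F}" by (rule finite_subset[OF _ fin[OF t, of r]]) blast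
        from emeasure_count_space_finite[OF subset_UNIV this] show ?thesis by (simp only: measure_def enn2real_of_nat)
      qed
      ultimately show ?thesis by (simp only: sums_iff)
    qed
    moreover have "(\<lambda>t. \<Sum>i. real (card {x\<in>X t \<inter> ?D r. (x, t) \<in> E i})) \<in> borel_measurable T"
      using union by measurable
    ultimately show ?case by (subst measurable_cong) auto
  qed simp
  have "{t\<in>space T. \<exists>x\<in>X t. (x, t) \<in> E} = (\<Union>r. {t\<in>space T. real (card {x\<in>X t \<inter> ?D r. (x, t) \<in> E}) \<noteq> 0})"
  proof (intro set_eqI iffI)
    fix t assume "t \<in> {t\<in>space T. \<exists>x\<in>X t. (x, t) \<in> E}"
    then obtain x where x: "t \<in> space T" "x \<in> X t" "(x, t) \<in> E" by auto
    obtain r :: nat where "norm x \<le> real r" using real_arch_simple by blast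
    with x have "x \<in> {x\<in>X t \<inter> ?D r. (x, t) \<in> E}" by auto
    moreover have "finite {x\<in>X t \<inter> ?D r. (x, t) \<in> E}" by (rule finite_subset[OF _ fin[OF x(1), of r]]) blast
    ultimately have "card {x\<in>X t \<inter> ?D r. (x, t) \<in> E} \<noteq> 0" by (metis card_0_eq empty_iff)
    then show "t \<in> (\<Union>r. {t\<in>space T. real (card {x\<in>X t \<inter> ?D r. (x, t) \<in> E}) \<noteq> 0})" using x by auto
  next
    fix t assume "t \<in> (\<Union>r. {t\<in>space T. real (card {x\<in>X t \<inter> ?D r. (x, t) \<in> E}) \<noteq> 0})"
    then obtain r where r: "t \<in> space T" "card {x\<in>X t \<inter> ?D r. (x, t) \<in> E} \<noteq> 0" by auto
    then have "{x\<in>X t \<inter> ?D r. (x, t) \<in> E} \<noteq> {}" using card.empty by metis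
    with r show "t \<in> {t\<in>space T. \<exists>x\<in>X t. (x, t) \<in> E}" by auto
  qed
  also have "\<dots> \<in> sets T" using * by measurable
  finally show ?thesis .
qed

section \<open>Void probabilities determine the law\<close>

definition void_process :: "'w measure \<Rightarrow> ('w \<Rightarrow> 'a::euclidean_space set) \<Rightarrow> ('a set \<Rightarrow> real) \<Rightarrow> bool" where
  "void_process M X m \<longleftrightarrow> prob_space M \<and> X \<in> measurable M config_space \<and>
     (\<forall>B \<in> sets borel. bounded B \<longrightarrow> measure M {\<omega> \<in> space M. X \<omega> \<inter> B = {}} = exp (- m B))"

lemma void_processD:
  assumes "void_process M X m"
  shows "prob_space M" "X \<in> measurable M config_space"
    "B \<in> sets borel \<Longrightarrow> bounded B \<Longrightarrow> measure M {\<omega> \<in> space M. X \<omega> \<inter> B = {}} = exp (- m B)"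
  using assms unfolding void_process_def by auto

text \<open>
  The void events generate the sigma-algebra and are stable under intersection.
\<close>

lemma void_process_unique:
  fixes X :: "'w \<Rightarrow> 'a::euclidean_space set" and X' :: "'v \<Rightarrow> 'a set"
  assumes X: "void_process M X m" and X': "void_process M' X' m"
  shows "distr M config_space X = distr M' config_space X'"
proof (rule measure_eqI_generator_eq[where \<Omega> = "space config_space" and E = void_events and A = "\<lambda>_. space config_space"])
  note D = void_processD[OF X] and D' = void_processD[OF X']
  interpret M: prob_space M by fact
  interpret M': prob_space M' by fact
  show "Int_stable (void_events :: 'a set set set)" by (rule Int_stable_void_events)
  show "(void_events :: 'a set set set) \<subseteq> Pow (space config_space)" by (auto simp: void_events_def)
  show "sets (distr M config_space X) = sigma_sets (space config_space) void_events"
    "sets (distr M' config_space X') = sigma_sets (space config_space) void_events"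
    by (simp_all add: sets_config_space_eq)
  show "range (\<lambda>_. space config_space) \<subseteq> (void_events :: 'a set set set)"
    by (auto simp: void_events_def intro!: exI[of _ "{}"])
  show "(\<Union>i. space config_space) = (space config_space :: 'a set set)" by simp
  show "emeasure (distr M config_space X) (space config_space) \<noteq> \<infinity>"
    using M.prob_space_distr[OF D(2)] by (metis emeasure_distr infinity_ennreal_def M.emeasure_finite D(2) sets.top)
  fix E :: "'a set set" assume "E \<in> void_events"
  then obtain B where B: "E = {S\<in>space config_space. S \<inter> B = {}}" "B \<in> sets borel" "bounded B"
    by (auto simp: void_events_def)
  have 1: "X -` E \<inter> space M = {\<omega> \<in> space M. X \<omega> \<inter> B = {}}" "X' -` E \<inter> space M' = {\<omega> \<in> space M'. X' \<omega> \<inter> B = {}}"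
    using measurable_space[OF D(2)] measurable_space[OF D'(2)] by (auto simp: B)
  have "E \<in> sets config_space" unfolding B(1) by (rule sets_void[OF B(2)])
  then show "emeasure (distr M config_space X) E = emeasure (distr M' config_space X') E"
    unfolding emeasure_distr[OF D(2) \<open>E \<in> sets config_space\<close>] emeasure_distr[OF D'(2) \<open>E \<in> sets config_space\<close>] 1
    using D(3)[OF B(2,3)] D'(3)[OF B(2,3)] by (simp add: M.emeasure_eq_measure M'.emeasure_eq_measure)
qed

abbreviation leb :: "real \<Rightarrow> 'a::euclidean_space set \<Rightarrow> real" where
  "leb lam \<equiv> (\<lambda>B. lam * measure lborel B)"

lemma measure_lborel_finite_Union:
  fixes B :: "'i \<Rightarrow> 'a::euclidean_space set"
  assumes "finite I" "\<And>i. i \<in> I \<Longrightarrow> B i \<in> sets borel" "\<And>i. i \<in> I \<Longrightarrow> bounded (B i)" "disjoint_family_on B I"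
  shows "measure lborel (\<Union>i\<in>I. B i) = (\<Sum>i\<in>I. measure lborel (B i))"
  using assms emeasure_bounded_finite by (intro measure_finite_Union) (auto simp: less_top)

lemma prob_void_finite_Union:
  fixes B :: "'i \<Rightarrow> 'a::euclidean_space set"
  assumes X: "void_process M X (leb lam)"
    and "finite I" "\<And>i. i \<in> I \<Longrightarrow> B i \<in> sets borel" "\<And>i. i \<in> I \<Longrightarrow> bounded (B i)" "disjoint_family_on B I"
  shows "measure M {\<omega> \<in> space M. \<forall>i\<in>I. X \<omega> \<inter> B i = {}} = (\<Prod>i\<in>I. exp (- leb lam (B i)))"
proof -
  have "{\<omega> \<in> space M. \<forall>i\<in>I. X \<omega> \<inter> B i = {}} = {\<omega> \<in> space M. X \<omega> \<inter> (\<Union>i\<in>I. B i) = {}}" by blast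
  moreover have "(\<Union>i\<in>I. B i) \<in> sets borel" "bounded (\<Union>i\<in>I. B i)" using assms by (auto simp: sets.finite_UN)
  ultimately show ?thesis
    using void_processD(3)[OF X, of "\<Union>i\<in>I. B i"] measure_lborel_finite_Union[OF assms(2-5)]
    by (simp add: sum_distrib_left exp_sum assms(2) flip: sum_negf)
qed

lemma measurable_config_Int [measurable]:
  fixes D :: "'a::euclidean_space set"
  assumes [measurable]: "D \<in> sets borel" shows "(\<lambda>S. S \<inter> D) \<in> measurable config_space config_space"
proof (rule measurable_configI)
  fix S :: "'a set" assume "S \<in> space config_space"
  then show "locally_finite_set (S \<inter> D)" by (auto simp: space_config_space intro: locally_finite_mono)
next
  fix C :: "'a set" assume "C \<in> sets borel"
  then show "{S \<in> space config_space. S \<inter> D \<inter> C = {}} \<in> sets config_space"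
    using sets_void[of "D \<inter> C"] by (simp add: Int_assoc)
qed

lemma measurable_config_Un:
  fixes X Y :: "'w \<Rightarrow> 'a::euclidean_space set"
  assumes X: "X \<in> measurable M config_space" and Y: "Y \<in> measurable M config_space"
  shows "(\<lambda>\<omega>. X \<omega> \<union> Y \<omega>) \<in> measurable M config_space"
proof (rule measurable_configI)
  fix \<omega> assume "\<omega> \<in> space M"
  then show "locally_finite_set (X \<omega> \<union> Y \<omega>)"
    using locally_finite_measurable[OF X] locally_finite_measurable[OF Y] by (intro locally_finite_Un)
next
  fix C :: "'a set" assume "C \<in> sets borel"
  then have "{\<omega>\<in>space M. X \<omega> \<inter> C = {}} \<inter> {\<omega>\<in>space M. Y \<omega> \<inter> C = {}} \<in> sets M"
    by (intro sets.Int void_event X Y)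
  then show "{\<omega> \<in> space M. (X \<omega> \<union> Y \<omega>) \<inter> C = {}} \<in> sets M"
    by (rule back_subst[of "\<lambda>A. A \<in> sets M"]) auto
qed

text \<open>
  The void probabilities are multiplicative over disjoint sets, so the void events inside \<open>D i\<close> are
  independent for distinct \<open>i\<close>, and these events generate the restriction to \<open>D i\<close>.
\<close>

lemma indep_restrictions:
  fixes X :: "'w \<Rightarrow> 'a::euclidean_space set"
  assumes X: "void_process M X (leb lam)"
    and D: "\<And>i. i \<in> I \<Longrightarrow> D i \<in> sets borel" "disjoint_family_on D I"
  shows "prob_space.indep_vars M (\<lambda>_. config_space) (\<lambda>i \<omega>. X \<omega> \<inter> D i) I"
proof -
  note XD = void_processD[OF X]
  interpret M: prob_space M by fact
  define G where "G i = {{\<omega>\<in>space M. X \<omega> \<inter> B = {}} | B. B \<in> sets borel \<and> bounded B \<and> B \<subseteq> D i}" for i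
  have Gev: "G i \<subseteq> M.events" for i using void_event[OF XD(2)] by (auto simp: G_def)
  have "M.indep_sets G I"
  proof (rule M.indep_setsI)
    fix A J assume J: "J \<noteq> {}" "J \<subseteq> I" "finite J" "\<forall>j\<in>J. A j \<in> G j"
    then have "\<forall>j\<in>J. \<exists>B. A j = {\<omega>\<in>space M. X \<omega> \<inter> B = {}} \<and> B \<in> sets borel \<and> bounded B \<and> B \<subseteq> D j"
      by (auto simp: G_def)
    then obtain B where B: "\<And>j. j \<in> J \<Longrightarrow> A j = {\<omega>\<in>space M. X \<omega> \<inter> B j = {}} \<and> B j \<in> sets borel \<and> bounded (B j) \<and> B j \<subseteq> D j"
      by metis
    have dis: "disjoint_family_on B J"
      using D(2) B J(2) unfolding disjoint_family_on_def by blast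
    have "M.prob (\<Inter>j\<in>J. A j) = M.prob {\<omega>\<in>space M. \<forall>j\<in>J. X \<omega> \<inter> B j = {}}"
      using B J(1) by (intro arg_cong[where f = M.prob]) auto
    also have "\<dots> = (\<Prod>j\<in>J. exp (- leb lam (B j)))"
      using B dis J by (intro prob_void_finite_Union[OF X]) auto
    also have "\<dots> = (\<Prod>j\<in>J. M.prob (A j))"
      using B XD(3) by (intro prod.cong) auto
    finally show "M.prob (\<Inter>j\<in>J. A j) = (\<Prod>j\<in>J. M.prob (A j))" .
  qed (rule Gev)
  moreover have "Int_stable (G i)" for i
  proof (rule Int_stableI)
    fix E F assume "E \<in> G i" "F \<in> G i"
    then obtain B C where *: "E = {\<omega>\<in>space M. X \<omega> \<inter> B = {}}" "F = {\<omega>\<in>space M. X \<omega> \<inter> C = {}}"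
      "B \<in> sets borel" "bounded B" "B \<subseteq> D i" "C \<in> sets borel" "bounded C" "C \<subseteq> D i"
      unfolding G_def by blast
    have "E \<inter> F = {\<omega>\<in>space M. X \<omega> \<inter> (B \<union> C) = {}}" by (auto simp: *)
    then show "E \<inter> F \<in> G i" unfolding G_def
      using sets.Un[OF *(3,6)] bounded_Un[THEN iffD2, OF conjI, OF *(4,7)] *(5,8) by blast
  qed
  ultimately have 1: "M.indep_sets (\<lambda>i. sigma_sets (space M) (G i)) I" by (rule M.indep_sets_sigma)
  have XDi: "(\<lambda>\<omega>. X \<omega> \<inter> D i) \<in> measurable (sigma (space M) (G i)) config_space" if i: "i \<in> I" for i
  proof (rule measurable_configI)
    have sp: "space (sigma (space M) (G i)) = space M" "sets (sigma (space M) (G i)) = sigma_sets (space M) (G i)"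
      using Gev[of i] sets.space_closed[of M] by (auto intro: space_measure_of sets_measure_of)
    fix \<omega> assume "\<omega> \<in> space (sigma (space M) (G i))"
    then show "locally_finite_set (X \<omega> \<inter> D i)"
      using locally_finite_measurable[OF XD(2)] sp by (auto intro: locally_finite_mono)
  next
    have sp: "space (sigma (space M) (G i)) = space M" "sets (sigma (space M) (G i)) = sigma_sets (space M) (G i)"
      using Gev[of i] sets.space_closed[of M] by (auto intro: space_measure_of sets_measure_of)
    fix C :: "'a set" assume "C \<in> sets borel" "bounded C"
    then have "{\<omega>\<in>space M. X \<omega> \<inter> (D i \<inter> C) = {}} \<in> G i"
      using D i by (auto simp: G_def bounded_Int intro!: exI[of _ "D i \<inter> C"])
    then show "{\<omega> \<in> space (sigma (space M) (G i)). X \<omega> \<inter> D i \<inter> C = {}} \<in> sets (sigma (space M) (G i))"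
      unfolding sp by (auto simp: Int_assoc)
  qed
  show ?thesis unfolding M.indep_vars_def2
  proof (intro conjI ballI)
    fix i assume "i \<in> I"
    then show "(\<lambda>\<omega>. X \<omega> \<inter> D i) \<in> measurable M config_space"
      using D by (intro measurable_compose[OF XD(2) measurable_config_Int]) auto
  next
    show "M.indep_sets (\<lambda>i. {(\<lambda>\<omega>. X \<omega> \<inter> D i) -` A \<inter> space M | A. A \<in> sets config_space}) I"
    proof (rule M.indep_sets_mono_sets[OF 1], safe)
      fix i and A :: "'a set set" assume i: "i \<in> I" and A: "A \<in> sets config_space"
      have sp: "space (sigma (space M) (G i)) = space M" "sets (sigma (space M) (G i)) = sigma_sets (space M) (G i)"
        using Gev[of i] sets.space_closed[of M] by (auto intro: space_measure_of sets_measure_of)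
      show "(\<lambda>\<omega>. X \<omega> \<inter> D i) -` A \<inter> space M \<in> sigma_sets (space M) (G i)"
        using measurable_sets[OF XDi[OF i] A] unfolding sp .
    qed
  qed
qed

section \<open>Poisson counts from void probabilities\<close>

lemma dyadic_cell_subset_cbox:
  assumes y: "dyadic n y = z"
  shows "{x::'a::euclidean_space. dyadic n x = z} \<subseteq> cbox (\<Sum>b\<in>Basis. (real_of_int \<lfloor>2 ^ n * (y \<bullet> b)\<rfloor> / 2 ^ n) *\<^sub>R b)
      (\<Sum>b\<in>Basis. (real_of_int \<lfloor>2 ^ n * (y \<bullet> b)\<rfloor> / 2 ^ n + 1 / 2 ^ n) *\<^sub>R b)"
proof
  fix x assume "x \<in> {x. dyadic n x = z}"
  then have *: "\<lfloor>2 ^ n * (x \<bullet> b)\<rfloor> = \<lfloor>2 ^ n * (y \<bullet> b)\<rfloor>" if "b \<in> Basis" for b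
    using that y by (auto simp: dyadic_eq_iff)
  have "real_of_int \<lfloor>2 ^ n * (y \<bullet> b)\<rfloor> / 2 ^ n \<le> x \<bullet> b \<and> x \<bullet> b \<le> real_of_int \<lfloor>2 ^ n * (y \<bullet> b)\<rfloor> / 2 ^ n + 1 / 2 ^ n"
    if "b \<in> Basis" for b
  proof -
    have "real_of_int \<lfloor>2 ^ n * (y \<bullet> b)\<rfloor> \<le> 2 ^ n * (x \<bullet> b)" "2 ^ n * (x \<bullet> b) \<le> real_of_int \<lfloor>2 ^ n * (y \<bullet> b)\<rfloor> + 1"
      unfolding *[OF that, symmetric] by linarith+
    then show ?thesis by (simp add: field_simps)
  qed
  then show "x \<in> cbox (\<Sum>b\<in>Basis. (real_of_int \<lfloor>2 ^ n * (y \<bullet> b)\<rfloor> / 2 ^ n) *\<^sub>R b)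
      (\<Sum>b\<in>Basis. (real_of_int \<lfloor>2 ^ n * (y \<bullet> b)\<rfloor> / 2 ^ n + 1 / 2 ^ n) *\<^sub>R b)"
    by (auto simp: mem_box)
qed

lemma dyadic_cell_measure_le:
  fixes A :: "'a::euclidean_space set"
  assumes "A \<in> sets borel" "A \<subseteq> {x. dyadic n x = z}"
  shows "measure lborel A \<le> 1 / 2 ^ n"
proof (cases "\<exists>y::'a. dyadic n y = z")
  case True
  then obtain y :: 'a where y: "dyadic n y = z" by blast
  let ?a = "\<Sum>b\<in>Basis. (real_of_int \<lfloor>2 ^ n * (y \<bullet> b)\<rfloor> / 2 ^ n) *\<^sub>R b"
  let ?c = "\<Sum>b\<in>Basis. (real_of_int \<lfloor>2 ^ n * (y \<bullet> b)\<rfloor> / 2 ^ n + 1 / 2 ^ n) *\<^sub>R b"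
  have "measure lborel A \<le> measure lborel (cbox ?a ?c)"
    using assms dyadic_cell_subset_cbox[OF y]
    by (intro measure_mono_fmeasurable) (auto simp: fmeasurable_def emeasure_lborel_cbox_eq)
  also have "\<dots> = (\<Prod>b\<in>(Basis::'a set). 1 / 2 ^ n)"
    by (subst measure_lborel_cbox_eq) (auto simp: inner_diff_left intro!: prod.cong)
  also have "\<dots> = (1 / 2 ^ n) ^ DIM('a)" by simp
  also have "\<dots> \<le> (1 / 2 ^ n) ^ 1" by (intro power_decreasing) (auto simp: DIM_positive Suc_leI)
  finally show ?thesis by simp
qed (use assms in auto)

text \<open>
  Count occupied dyadic pieces instead of points. Expanding \<open>t ^ (number of occupied pieces)\<close> as a product
  over the pieces expresses its mean through void probabilities only, and this gives the product of the
  factors \<open>(1 - t) * exp (- \<mu>) + t\<close> over the masses \<open>\<mu>\<close> of the pieces. As the pieces shrink, both sides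
  converge.
\<close>

lemma void_pgf:
  fixes X :: "'w \<Rightarrow> 'a::euclidean_space set"
  assumes X: "void_process M X (leb lam)" and lam: "0 \<le> lam" and B: "B \<in> sets borel" "bounded B"
    and t: "0 \<le> t" "t \<le> 1"
  shows "(\<integral>\<omega>. t ^ card (X \<omega> \<inter> B) \<partial>M) = exp (- (1 - t) * leb lam B)"
proof -
  note XD = void_processD[OF X]
  interpret M: prob_space M by fact
  define c where "c n z = B \<inter> {x. dyadic n x = z}" for n z
  define G where "G n = dyadic n ` B" for n
  have finG: "finite (G n)" for n unfolding G_def by (rule finite_dyadic_image[OF B(2)])
  have cB: "c n z \<in> sets borel" "bounded (c n z)" for n z
    using B by (auto simp: c_def intro: bounded_subset)
  have dis: "disjoint_family_on (c n) J" for n J by (auto simp: disjoint_family_on_def c_def)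
  have Un: "(\<Union>z\<in>G n. c n z) = B" for n by (auto simp: c_def G_def)
  have f: "t ^ card (dyadic n ` (X \<omega> \<inter> B)) = (\<Sum>J\<in>Pow (G n). (1 - t) ^ card J * t ^ card (G n - J) * of_bool (\<forall>z\<in>J. X \<omega> \<inter> c n z = {}))" for n \<omega>
  proof -
    have "t ^ card (dyadic n ` (X \<omega> \<inter> B)) = (\<Prod>z\<in>G n. t ^ of_bool (X \<omega> \<inter> c n z \<noteq> {}))"
      by (simp add: card_dyadic_image[OF B(2)] power_sum c_def G_def)
    also have "\<dots> = (\<Prod>z\<in>G n. (1 - t) * of_bool (X \<omega> \<inter> c n z = {}) + t)"
      by (intro prod.cong) (auto simp: of_bool_def)
    also have "\<dots> = (\<Sum>J\<in>Pow (G n). (\<Prod>z\<in>J. (1 - t) * of_bool (X \<omega> \<inter> c n z = {})) * (\<Prod>z\<in>G n - J. t))"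
      by (rule prod_add[OF finG])
    also have "\<dots> = (\<Sum>J\<in>Pow (G n). (1 - t) ^ card J * t ^ card (G n - J) * of_bool (\<forall>z\<in>J. X \<omega> \<inter> c n z = {}))"
      using finG by (intro sum.cong) (auto simp: prod.distrib of_bool_def finite_subset intro!: prod_zero)
    finally show ?thesis .
  qed
  have mv: "{\<omega>\<in>space M. \<forall>z\<in>J. X \<omega> \<inter> c n z = {}} \<in> sets M" if "J \<subseteq> G n" for n J
    using finite_subset[OF that finG] void_event[OF XD(2) cB(1)] by (intro sets.sets_Collect_finite_All) auto
  have int1: "(\<integral>\<omega>. of_bool (\<forall>z\<in>J. X \<omega> \<inter> c n z = {}) \<partial>M) = (\<Prod>z\<in>J. exp (- leb lam (c n z)))"
    and int2: "integrable M (\<lambda>\<omega>. of_bool (\<forall>z\<in>J. X \<omega> \<inter> c n z = {}) :: real)"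
    if J: "J \<subseteq> G n" for n J
  proof -
    have eq: "of_bool (\<forall>z\<in>J. X \<omega> \<inter> c n z = {}) = (indicator {\<omega>\<in>space M. \<forall>z\<in>J. X \<omega> \<inter> c n z = {}} \<omega> :: real)"
      if "\<omega> \<in> space M" for \<omega> using that by (auto simp: indicator_def)
    show "(\<integral>\<omega>. of_bool (\<forall>z\<in>J. X \<omega> \<inter> c n z = {}) \<partial>M) = (\<Prod>z\<in>J. exp (- leb lam (c n z)))"
      using prob_void_finite_Union[OF X finite_subset[OF J finG] cB dis[of n J]] mv[OF J]
      by (subst Bochner_Integration.integral_cong[OF refl eq]) auto
    show "integrable M (\<lambda>\<omega>. of_bool (\<forall>z\<in>J. X \<omega> \<inter> c n z = {}) :: real)"
      using mv[OF J] by (subst Bochner_Integration.integrable_cong[OF refl eq]) (auto simp: M.emeasure_eq_measure)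
  qed
  have I: "(\<integral>\<omega>. t ^ card (dyadic n ` (X \<omega> \<inter> B)) \<partial>M) = (\<Prod>z\<in>G n. (1 - t) * exp (- leb lam (c n z)) + t)" for n
  proof -
    have "(\<integral>\<omega>. t ^ card (dyadic n ` (X \<omega> \<inter> B)) \<partial>M) =
       (\<Sum>J\<in>Pow (G n). (1 - t) ^ card J * t ^ card (G n - J) * (\<Prod>z\<in>J. exp (- leb lam (c n z))))"
      unfolding f using int1 int2 by (subst Bochner_Integration.integral_sum) auto
    also have "\<dots> = (\<Sum>J\<in>Pow (G n). (\<Prod>z\<in>J. (1 - t) * exp (- leb lam (c n z))) * (\<Prod>z\<in>G n - J. t))"
      by (intro sum.cong) (auto simp: prod.distrib)
    also have "\<dots> = (\<Prod>z\<in>G n. (1 - t) * exp (- leb lam (c n z)) + t)"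
      by (rule prod_add[OF finG, symmetric])
    finally show ?thesis .
  qed
  let ?\<mu> = "\<lambda>n z. leb lam (c n z)"
  have \<mu>0: "0 \<le> ?\<mu> n z" for n z using lam by simp
  have \<mu>le: "?\<mu> n z \<le> lam / 2 ^ n" for n z
    using mult_left_mono[OF dyadic_cell_measure_le[OF cB(1)] lam, of n z n z] by (auto simp: c_def)
  have sum\<mu>: "(\<Sum>z\<in>G n. ?\<mu> n z) = leb lam B" for n
    using measure_lborel_finite_Union[OF finG[of n] cB[of n] dis[of n]] unfolding Un by (simp add: sum_distrib_left)
  have lower: "exp (- (1 - t) * leb lam B) \<le> (\<Prod>z\<in>G n. (1 - t) * exp (- ?\<mu> n z) + t)" for n
  proof -
    have "exp (- (1 - t) * leb lam B) = (\<Prod>z\<in>G n. exp (- (1 - t) * ?\<mu> n z))"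
      unfolding exp_sum[OF finG, symmetric] sum\<mu>[of n, symmetric] by (simp only: sum_distrib_left)
    also have "\<dots> \<le> (\<Prod>z\<in>G n. (1 - t) * exp (- ?\<mu> n z) + t)"
    proof (rule prod_mono, intro conjI)
      fix z
      have "exp (t * 0 + (1 - t) * (- ?\<mu> n z)) \<le> t * exp 0 + (1 - t) * exp (- ?\<mu> n z)"
        using convex_onD[OF exp_convex, of "1 - t" 0 "- ?\<mu> n z"] t by simp
      then show "exp (- (1 - t) * ?\<mu> n z) \<le> (1 - t) * exp (- ?\<mu> n z) + t" by (simp add: algebra_simps)
    qed simp
    finally show ?thesis .
  qed
  have upper: "(\<Prod>z\<in>G n. (1 - t) * exp (- ?\<mu> n z) + t) \<le> exp (- (1 - t) * (leb lam B - lam / 2 ^ n * leb lam B))" for n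
  proof -
    have "(\<Prod>z\<in>G n. (1 - t) * exp (- ?\<mu> n z) + t) \<le> (\<Prod>z\<in>G n. exp (- (1 - t) * (?\<mu> n z - lam / 2 ^ n * ?\<mu> n z)))"
    proof (rule prod_mono, intro conjI)
      fix z
      show "0 \<le> (1 - t) * exp (- ?\<mu> n z) + t" using t by simp
      let ?x = "?\<mu> n z"
      have "1 \<le> 1 + ?x ^ 3" using \<mu>0[of n z] zero_le_power[of ?x 3] by linarith
      also have "\<dots> = (1 - ?x + ?x ^ 2) * (1 + ?x)" by (simp add: algebra_simps power2_eq_square power3_eq_cube)
      also have "\<dots> \<le> (1 - ?x + ?x ^ 2) * exp ?x"
      proof (rule mult_left_mono)
        show "1 + ?x \<le> exp ?x" by (rule exp_ge_add_one_self)
        have "0 \<le> (?x - 1/2) ^ 2 + 3/4" by simp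
        then show "0 \<le> 1 - ?x + ?x ^ 2" by (simp add: power2_eq_square algebra_simps)
      qed
      finally have "exp (- ?x) \<le> 1 - ?x + ?x ^ 2"
        by (simp add: exp_minus field_simps)
      also have "?x ^ 2 \<le> lam / 2 ^ n * ?x"
        using mult_right_mono[OF \<mu>le \<mu>0, of n z n z] by (simp add: power2_eq_square)
      finally have "exp (- ?x) \<le> 1 - (?x - lam / 2 ^ n * ?x)" by simp
      moreover have "(1 - t) * e + t \<le> 1 + - (1 - t) * w" if "e \<le> 1 - w" for e w
        using mult_left_mono[OF that, of "1 - t"] t by (simp add: algebra_simps)
      ultimately have "(1 - t) * exp (- ?x) + t \<le> 1 + - (1 - t) * (?x - lam / 2 ^ n * ?x)" by blast
      also have "\<dots> \<le> exp (- (1 - t) * (?x - lam / 2 ^ n * ?x))" by (rule exp_ge_add_one_self)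
      finally show "(1 - t) * exp (- ?x) + t \<le> exp (- (1 - t) * (?x - lam / 2 ^ n * ?x))" .
    qed
    also have "\<dots> = exp (- (1 - t) * (leb lam B - lam / 2 ^ n * leb lam B))"
      unfolding exp_sum[OF finG, symmetric] sum\<mu>[of n, symmetric] by (simp only: sum_distrib_left sum_subtractf[symmetric])
    finally show ?thesis .
  qed
  have "(\<lambda>n. lam / 2 ^ n) \<longlonglongrightarrow> 0"
    by (rule LIMSEQ_divide_realpow_zero) simp
  then have "(\<lambda>n. exp (- (1 - t) * (leb lam B - lam / 2 ^ n * leb lam B))) \<longlonglongrightarrow> exp (- (1 - t) * (leb lam B - 0 * leb lam B))"
    by (intro tendsto_intros)
  then have lim: "(\<lambda>n. exp (- (1 - t) * (leb lam B - lam / 2 ^ n * leb lam B))) \<longlonglongrightarrow> exp (- (1 - t) * leb lam B)"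
    by (simp only: mult_zero_left diff_zero)
  have L1: "(\<lambda>n. \<Prod>z\<in>G n. (1 - t) * exp (- ?\<mu> n z) + t) \<longlonglongrightarrow> exp (- (1 - t) * leb lam B)"
    by (rule tendsto_sandwich[OF always_eventually[OF allI, OF lower] always_eventually[OF allI, OF upper] tendsto_const lim])
  have L2: "(\<lambda>n. \<integral>\<omega>. t ^ card (dyadic n ` (X \<omega> \<inter> B)) \<partial>M) \<longlonglongrightarrow> (\<integral>\<omega>. t ^ card (X \<omega> \<inter> B) \<partial>M)"
  proof (rule integral_dominated_convergence[where w = "\<lambda>_. 1"])
    have meas: "(\<lambda>\<omega>. t ^ card (dyadic n ` (X \<omega> \<inter> B))) \<in> borel_measurable M" for n
    proof -
      have "(\<lambda>\<omega>. of_bool (\<forall>z\<in>J. X \<omega> \<inter> c n z = {}) :: real) \<in> borel_measurable M" if "J \<subseteq> G n" for J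
        using int2[OF that] by (rule borel_measurable_integrable)
      then show ?thesis unfolding f by (intro borel_measurable_sum borel_measurable_times) auto
    qed
    then show "(\<lambda>\<omega>. t ^ card (dyadic n ` (X \<omega> \<inter> B))) \<in> borel_measurable M" for n .
    have pw: "(\<lambda>n. t ^ card (dyadic n ` (X \<omega> \<inter> B))) \<longlonglongrightarrow> t ^ card (X \<omega> \<inter> B)" if "\<omega> \<in> space M" for \<omega>
      using card_dyadic_tendsto[OF locally_finite_measurable[OF XD(2) that] B(2)]
      by (intro tendsto_eventually) (auto elim: eventually_mono)
    then show "AE \<omega> in M. (\<lambda>n. t ^ card (dyadic n ` (X \<omega> \<inter> B))) \<longlonglongrightarrow> t ^ card (X \<omega> \<inter> B)"
      by (rule AE_I2)
    show "(\<lambda>\<omega>. t ^ card (X \<omega> \<inter> B)) \<in> borel_measurable M"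
      by (rule borel_measurable_LIMSEQ_real[OF pw meas])
    show "AE \<omega> in M. norm (t ^ card (dyadic n ` (X \<omega> \<inter> B))) \<le> 1" for n
      using t by (auto simp: power_le_one)
  qed simp
  show ?thesis by (rule LIMSEQ_unique[OF L2 L1[folded I]])
qed

text \<open>
  Two generating functions that agree on \<open>(0, 1)\<close> have the same coefficients; the coefficients of the difference
  vanish one after the other by letting \<open>t\<close> tend to 0 from the right.
\<close>

lemma powser_unique_right:
  fixes a b :: "nat \<Rightarrow> real"
  assumes a: "\<And>t. 0 < t \<Longrightarrow> t < 1 \<Longrightarrow> (\<lambda>k. a k * t ^ k) sums f t"
    and b: "\<And>t. 0 < t \<Longrightarrow> t < 1 \<Longrightarrow> (\<lambda>k. b k * t ^ k) sums f t"
  shows "a = b"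
proof
  define c where "c k = a k - b k" for k
  have c: "(\<lambda>k. c k * t ^ k) sums 0" if "0 < t" "t < 1" for t
    using sums_diff[OF a[OF that] b[OF that]] by (simp add: c_def left_diff_distrib)
  fix n
  have "c n = 0"
  proof (induction n rule: less_induct)
    case (less n)
    have s0: "(\<lambda>k. c (k + n) * t ^ k) sums 0" if t: "0 < t" "t < 1" for t
    proof -
      have "(\<lambda>k. c (k + n) * t ^ (k + n)) sums (0 - (\<Sum>k<n. c k * t ^ k))"
        using sums_split_initial_segment[OF c[OF t], of n] by simp
      then have "(\<lambda>k. c (k + n) * t ^ (k + n)) sums 0" using less by simp
      from sums_mult[OF this, of "1 / t ^ n"] show ?thesis using t by (simp add: power_add field_simps)
    qed
    have "(\<lambda>k. c (k + n) * x ^ k) sums (\<Sum>k. c (k + n) * x ^ k)" if "norm x < 1/2" for x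
      using powser_inside[OF sums_summable[OF s0[of "1/2"]], of x] that by (intro summable_sums) auto
    then have lim: "((\<lambda>x. \<Sum>k. c (k + n) * x ^ k) \<longlongrightarrow> c n) (at 0)"
      using powser_limit_0[of "1/2" "\<lambda>k. c (k + n)"] by simp
    have "((\<lambda>x. \<Sum>k. c (k + n) * x ^ k) \<longlongrightarrow> c n) (at_right 0)"
      by (rule tendsto_mono[OF _ lim]) (simp add: at_within_le_at)
    moreover have "((\<lambda>x. \<Sum>k. c (k + n) * x ^ k) \<longlongrightarrow> 0) (at_right 0)"
    proof (rule tendsto_eventually)
      show "\<forall>\<^sub>F x in at_right 0. (\<Sum>k. c (k + n) * x ^ k) = 0"
        unfolding eventually_at_right_field using s0 by (intro exI[of _ 1]) (auto simp: sums_iff)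
    qed
    ultimately show "c n = 0" by (intro tendsto_unique[OF trivial_limit_at_right_real])
  qed
  then show "a n = b n" by (simp add: c_def)
qed

lemma void_card_distribution:
  fixes X :: "'w \<Rightarrow> 'a::euclidean_space set"
  assumes X: "void_process M X (leb lam)" and lam: "0 \<le> lam" and B: "B \<in> sets borel" "bounded B"
  shows "measure M {\<omega>\<in>space M. card (X \<omega> \<inter> B) = k} = exp (- leb lam B) * leb lam B ^ k / fact k"
proof -
  note XD = void_processD[OF X]
  interpret M: prob_space M by fact
  let ?\<mu> = "leb lam B"
  let ?E = "\<lambda>k. {\<omega>\<in>space M. card (X \<omega> \<inter> B) = k}"
  have [measurable]: "?E k \<in> sets M" for k
  proof -
    have "{\<omega>\<in>space M. real (card (X \<omega> \<inter> B)) = real k} \<in> sets M"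
      using measurable_card_config[OF XD(2) B] by measurable
    then show ?thesis by simp
  qed
  have "(\<lambda>k. M.prob (?E k)) = (\<lambda>k. exp (- ?\<mu>) * ?\<mu> ^ k / fact k)"
  proof (rule powser_unique_right)
    fix t :: real assume t: "0 < t" "t < 1"
    have "(\<lambda>k. exp (- ?\<mu>) * ((?\<mu> * t) ^ k /\<^sub>R fact k)) sums (exp (- ?\<mu>) * exp (?\<mu> * t))"
      by (intro sums_mult exp_converges)
    moreover have "exp (- ?\<mu>) * exp (?\<mu> * t) = exp (- (1 - t) * ?\<mu>)"
      by (simp add: exp_add[symmetric] algebra_simps)
    ultimately show "(\<lambda>k. exp (- ?\<mu>) * ?\<mu> ^ k / fact k * t ^ k) sums exp (- (1 - t) * ?\<mu>)"
      by (simp add: power_mult_distrib divide_inverse mult_ac)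
    have int: "integrable M (\<lambda>\<omega>. indicator (?E k) \<omega> * t ^ k)" for k
      using integrable_real_mult_indicator[of "?E k" M "\<lambda>_. t ^ k"] by (simp add: mult.commute)
    have "(\<lambda>k. \<integral>\<omega>. indicator (?E k) \<omega> * t ^ k \<partial>M) sums (\<integral>\<omega>. (\<Sum>k. indicator (?E k) \<omega> * t ^ k) \<partial>M)"
    proof (rule sums_integral[OF int])
      show "AE \<omega> in M. summable (\<lambda>k. norm (indicator (?E k) \<omega> * t ^ k))"
        using t by (intro AE_I2 summable_comparison_test'[OF summable_geometric[of t]]) (auto simp: indicator_def)
      show "summable (\<lambda>k. \<integral>\<omega>. norm (indicator (?E k) \<omega> * t ^ k) \<partial>M)"
      proof (rule summable_comparison_test'[OF summable_geometric[of t]])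
        fix k :: nat
        have "(\<integral>\<omega>. norm (indicator (?E k) \<omega> * t ^ k) \<partial>M) = M.prob (?E k) * t ^ k"
          using t by (simp add: abs_mult)
        then show "norm (\<integral>\<omega>. norm (indicator (?E k) \<omega> * t ^ k) \<partial>M) \<le> t ^ k"
          using t mult_right_mono[OF M.prob_le_1, of "t ^ k" "?E k"] by simp
      qed (use t in simp)
    qed
    moreover have "(\<integral>\<omega>. indicator (?E k) \<omega> * t ^ k \<partial>M) = M.prob (?E k) * t ^ k" for k by simp
    moreover have "(\<integral>\<omega>. (\<Sum>k. indicator (?E k) \<omega> * t ^ k) \<partial>M) = (\<integral>\<omega>. t ^ card (X \<omega> \<inter> B) \<partial>M)"
    proof (rule Bochner_Integration.integral_cong[OF refl])
      fix \<omega> assume "\<omega> \<in> space M"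
      then have "(\<lambda>k. indicator (?E k) \<omega> * t ^ k) = (\<lambda>k. if k = card (X \<omega> \<inter> B) then t ^ k else 0)"
        by (auto simp: fun_eq_iff indicator_def)
      then show "(\<Sum>k. indicator (?E k) \<omega> * t ^ k) = t ^ card (X \<omega> \<inter> B)"
        using sums_unique[OF sums_single[of "card (X \<omega> \<inter> B)" "\<lambda>k. t ^ k"]] by simp
    qed
    ultimately show "(\<lambda>k. M.prob (?E k) * t ^ k) sums exp (- (1 - t) * ?\<mu>)"
      using void_pgf[OF X lam B, of t] t by simp
  qed
  then show ?thesis by meson
qed

lemma point_count_le_iff:
  assumes "locally_finite_set S" "bounded B"
  shows "point_count S B \<le> of_nat k \<longleftrightarrow> card (S \<inter> B) \<le> k" "point_count S B = of_nat k \<longleftrightarrow> card (S \<inter> B) = k"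
  using assms by (simp_all add: point_count_finite locally_finite_set_def)

text \<open>
  For bounded sets the counts are Poisson by the generating function. For sets of finite measure one exhausts
  by balls, which is convenient for distribution functions because the events decrease; the value \<open>\<infinity>\<close> of the
  count is thereby excluded automatically. Independence is inherited from the restrictions.
\<close>

theorem void_process_imp_poisson:
  fixes X :: "'w \<Rightarrow> 'a::euclidean_space set"
  assumes X: "void_process M X (leb lam)" and lam: "0 \<le> lam"
  shows "poisson_process M X lam"
proof -
  note XD = void_processD[OF X]
  interpret M: prob_space M by fact
  have pc[measurable]: "(\<lambda>\<omega>. point_count (X \<omega>) B) \<in> borel_measurable M" if "B \<in> sets borel" for B
    using measurable_compose[OF XD(2) measurable_point_count[OF that]] .
  let ?pois = "\<lambda>m k. exp (- (lam * m)) * (lam * m) ^ k / fact k"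
  have cdf: "M.prob {\<omega>\<in>space M. point_count (X \<omega>) B \<le> of_nat k} = (\<Sum>j\<le>k. ?pois (measure lborel B) j)"
    if B: "B \<in> sets borel" "bounded B" for B k
  proof -
    have [measurable]: "{\<omega>\<in>space M. card (X \<omega> \<inter> B) = j} \<in> sets M" for j
    proof -
      have "{\<omega>\<in>space M. real (card (X \<omega> \<inter> B)) = real j} \<in> sets M"
        using measurable_card_config[OF XD(2) B] by measurable
      then show ?thesis by simp
    qed
    have "{\<omega>\<in>space M. point_count (X \<omega>) B \<le> of_nat k} = (\<Union>j\<in>{..k}. {\<omega>\<in>space M. card (X \<omega> \<inter> B) = j})"
      using point_count_le_iff(1)[OF locally_finite_measurable[OF XD(2)] B(2)] by auto
    then have "M.prob {\<omega>\<in>space M. point_count (X \<omega>) B \<le> of_nat k} = (\<Sum>j\<le>k. M.prob {\<omega>\<in>space M. card (X \<omega> \<inter> B) = j})"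
      by (simp, intro M.finite_measure_finite_Union) (auto simp: disjoint_family_on_def)
    then show ?thesis using void_card_distribution[OF X lam B] by simp
  qed
  have cdf': "M.prob {\<omega>\<in>space M. point_count (X \<omega>) B \<le> of_nat k} = (\<Sum>j\<le>k. ?pois (measure lborel B) j)"
    if B: "B \<in> sets borel" "emeasure lborel B < \<infinity>" for B k
  proof -
    let ?B = "\<lambda>r::nat. B \<inter> cball 0 (real r)"
    have UB: "(\<Union>r. ?B r) = B" using real_arch_simple by (auto simp: dist_norm)
    have m: "(\<lambda>r. measure lborel (?B r)) \<longlonglongrightarrow> measure lborel (\<Union>r. ?B r)"
      using B UB by (intro Lim_measure_incseq) (auto simp: incseq_def)
    have "(\<lambda>r. M.prob {\<omega>\<in>space M. point_count (X \<omega>) (?B r) \<le> of_nat k}) \<longlonglongrightarrow>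
        M.prob (\<Inter>r. {\<omega>\<in>space M. point_count (X \<omega>) (?B r) \<le> of_nat k})"
    proof (rule M.finite_Lim_measure_decseq)
      show "range (\<lambda>r. {\<omega>\<in>space M. point_count (X \<omega>) (?B r) \<le> of_nat k}) \<subseteq> M.events"
        using B by auto
      have "point_count S (?B r) \<le> point_count S (?B r')" if "r \<le> r'" for r r' S
        unfolding point_count_def using that by (intro emeasure_mono) auto
      then show "decseq (\<lambda>r. {\<omega>\<in>space M. point_count (X \<omega>) (?B r) \<le> of_nat k})"
        unfolding decseq_def by (auto intro: order_trans)
    qed
    also have "(\<Inter>r. {\<omega>\<in>space M. point_count (X \<omega>) (?B r) \<le> of_nat k}) = {\<omega>\<in>space M. point_count (X \<omega>) B \<le> of_nat k}"
      by (subst (2) point_count_SUP) (auto simp: SUP_le_iff)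
    also have "(\<lambda>r. M.prob {\<omega>\<in>space M. point_count (X \<omega>) (?B r) \<le> of_nat k}) = (\<lambda>r. \<Sum>j\<le>k. ?pois (measure lborel (?B r)) j)"
      using B by (intro ext cdf) (auto intro: bounded_subset[OF bounded_cball])
    finally have 1: "(\<lambda>r. \<Sum>j\<le>k. ?pois (measure lborel (?B r)) j) \<longlonglongrightarrow> M.prob {\<omega>\<in>space M. point_count (X \<omega>) B \<le> of_nat k}" .
    have 2: "(\<lambda>r. \<Sum>j\<le>k. ?pois (measure lborel (?B r)) j) \<longlonglongrightarrow> (\<Sum>j\<le>k. ?pois (measure lborel (\<Union>r. ?B r)) j)"
      by (intro tendsto_intros m) simp
    show ?thesis using LIMSEQ_unique[OF 1 2] UB by simp
  qed
  show ?thesis unfolding poisson_process_def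
  proof (intro conjI ballI allI impI)
    fix B :: "'a set" and k assume B: "B \<in> sets borel" "emeasure lborel B < \<infinity>"
    let ?L = "\<lambda>k::nat. {\<omega>\<in>space M. point_count (X \<omega>) B \<le> of_nat k}"
    have pcE: "(point_count S B::ennreal) = \<infinity> \<or> (\<exists>j. point_count S B = of_nat j)" for S
      by (cases "finite (S \<inter> B)") (auto simp: point_count_def)
    have m: "?L k \<in> sets M" for k using B by auto
    show "M.prob {\<omega>\<in>space M. point_count (X \<omega>) B = of_nat k} = ?pois (measure lborel B) k"
    proof (cases k)
      case 0
      then have "{\<omega>\<in>space M. point_count (X \<omega>) B = of_nat k} = ?L 0" by auto
      then show ?thesis using cdf'[OF B, of 0] 0 by simp
    next
      case (Suc i)
      have "{\<omega>\<in>space M. point_count (X \<omega>) B = of_nat k} = ?L k - ?L i"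
      proof (intro set_eqI iffI)
        fix \<omega> assume "\<omega> \<in> {\<omega>\<in>space M. point_count (X \<omega>) B = of_nat k}"
        then show "\<omega> \<in> ?L k - ?L i" by (auto simp: Suc not_le simp del: of_nat_Suc)
      next
        fix \<omega> assume "\<omega> \<in> ?L k - ?L i"
        then show "\<omega> \<in> {\<omega>\<in>space M. point_count (X \<omega>) B = of_nat k}"
          using pcE[of "X \<omega>"] by (auto simp: Suc not_le top_unique simp del: of_nat_Suc)
      qed
      moreover have "?L i \<subseteq> ?L k" using Suc by (auto intro: order_trans simp del: of_nat_Suc)
      ultimately have "M.prob {\<omega>\<in>space M. point_count (X \<omega>) B = of_nat k} = M.prob (?L k) - M.prob (?L i)"
        using m by (simp add: M.finite_measure_Diff)
      then show ?thesis unfolding cdf'[OF B] by (simp add: Suc)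
    qed
  next
    fix B :: "nat \<Rightarrow> 'a set" and n
    assume B: "\<forall>i<n. B i \<in> sets borel \<and> emeasure lborel (B i) < \<infinity>" and dis: "disjoint_family_on B {..<n}"
    have "M.indep_vars (\<lambda>_. config_space) (\<lambda>i \<omega>. X \<omega> \<inter> B i) {..<n}"
      using B dis by (intro indep_restrictions[OF X]) auto
    then have "M.indep_vars (\<lambda>_. borel) (\<lambda>i \<omega>. point_count (X \<omega> \<inter> B i) (B i)) {..<n}"
      by (rule M.indep_vars_compose2) (use B in \<open>auto intro: measurable_point_count\<close>)
    then show "M.indep_vars (\<lambda>_. borel) (\<lambda>i \<omega>. point_count (X \<omega>) (B i)) {..<n}"
      by (simp add: point_count_def Int_assoc)
  qed (use XD in auto)
qed

theorem poisson_iff_void_process: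
  fixes X :: "'w \<Rightarrow> 'a::euclidean_space set"
  assumes "0 \<le> lam"
  shows "poisson_process M X lam \<longleftrightarrow> void_process M X (leb lam)"
proof
  assume P: "poisson_process M X lam"
  show "void_process M X (leb lam)" unfolding void_process_def
  proof (intro conjI ballI impI)
    fix B :: "'a set" assume "B \<in> sets borel" "bounded B"
    then have "\<forall>k::nat. measure M {\<omega> \<in> space M. point_count (X \<omega>) B = of_nat k} =
           exp (- (lam * measure lborel B)) * (lam * measure lborel B) ^ k / fact k"
      using P emeasure_bounded_finite unfolding poisson_process_def by blast
    from spec[OF this, of 0] show "measure M {\<omega> \<in> space M. X \<omega> \<inter> B = {}} = exp (- leb lam B)"
      by (simp add: point_count_eq_0_iff)
  qed (use P in \<open>auto simp: poisson_process_def\<close>)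
qed (rule void_process_imp_poisson[OF _ assms])

section \<open>Translations\<close>

lemma shift_conv: "shift v S = (\<lambda>x. x + v) ` S"
  by (auto simp: shift_def)

lemma mem_shift: "x \<in> shift v S \<longleftrightarrow> x - v \<in> S"
  unfolding shift_conv by (auto simp: image_iff algebra_simps intro!: bexI[of _ "x - v"])

lemma shift_shift [simp]: "shift v (shift w S) = shift (v + w) S"
  by (auto simp: set_eq_iff mem_shift algebra_simps)

lemma shift_0 [simp]: "shift 0 S = S"
  by (auto simp: set_eq_iff mem_shift)

lemma shift_Int: "shift v (S \<inter> T) = shift v S \<inter> shift v T"
  and shift_Un: "shift v (S \<union> T) = shift v S \<union> shift v T"
  and shift_Diff: "shift v (S - T) = shift v S - shift v T"
  and shift_empty [simp]: "shift v {} = {}"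
  and shift_UN: "shift v (\<Union>i\<in>I. A i) = (\<Union>i\<in>I. shift v (A i))"
  by (auto simp: set_eq_iff mem_shift)

lemma shift_eq_empty [simp]: "shift v S = {} \<longleftrightarrow> S = {}"
  by (simp add: shift_conv)

lemma shift_Int_eq_empty: "shift v S \<inter> B = {} \<longleftrightarrow> S \<inter> shift (- v) B = {}"
  unfolding disjoint_iff mem_shift by (metis add_diff_cancel diff_minus_eq_add)

lemma shift_eq_vimage: "shift v S = (+) (- v) -` S"
  by (auto simp: mem_shift)

lemma shift_borel [measurable]: "B \<in> sets borel \<Longrightarrow> shift v B \<in> sets (borel :: 'a::euclidean_space measure)"
  unfolding shift_eq_vimage
  using measurable_sets[of "(+) (- v)" borel borel B] by simp

lemma bounded_shift: "bounded B \<Longrightarrow> bounded (shift v B)"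
  unfolding shift_conv using bounded_translation[of B v] by (simp add: add.commute)

lemma emeasure_shift:
  assumes "B \<in> sets borel"
  shows "emeasure lborel (shift v B) = emeasure lborel (B :: 'a::euclidean_space set)"
proof -
  have "emeasure lborel B = emeasure (distr lborel borel ((+) (- v))) B" by (simp only: lborel_distr_plus)
  also have "\<dots> = emeasure lborel (shift v B)"
    using assms by (subst emeasure_distr) (auto simp: shift_eq_vimage)
  finally show ?thesis ..
qed

lemma measure_shift: "B \<in> sets borel \<Longrightarrow> measure lborel (shift v B) = measure lborel (B :: 'a::euclidean_space set)"
  by (simp only: measure_def emeasure_shift)

lemma locally_finite_shift:
  fixes S :: "'a::euclidean_space set"
  assumes "locally_finite_set S" shows "locally_finite_set (shift v S)"
  unfolding locally_finite_set_def
proof (intro allI impI)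
  fix B :: "'a set" assume "bounded B"
  then have "finite (S \<inter> shift (- v) B)" using assms bounded_shift by (auto simp: locally_finite_set_def)
  then have "finite (shift v (S \<inter> shift (- v) B))" by (simp add: shift_conv)
  then show "finite (shift v S \<inter> B)" by (simp add: shift_Int)
qed

lemma locally_finite_shift_iff [simp]:
  fixes S :: "'a::euclidean_space set"
  shows "locally_finite_set (shift v S) \<longleftrightarrow> locally_finite_set S"
  using locally_finite_shift[of S v] locally_finite_shift[of "shift v S" "- v"] by auto

lemma measurable_shift [measurable]: "shift v \<in> measurable config_space (config_space :: 'a::euclidean_space set measure)"
proof (rule measurable_configI)
  fix C :: "'a set" assume "C \<in> sets borel"
  then show "{S \<in> space config_space. shift v S \<inter> C = {}} \<in> sets config_space"
    using sets_void[of "shift (- v) C"] by (simp add: shift_Int_eq_empty)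
qed (simp add: space_config_space)

lemma void_process_shift:
  fixes X :: "'w \<Rightarrow> 'a::euclidean_space set"
  assumes X: "void_process M X (leb lam)"
  shows "void_process M (\<lambda>\<omega>. shift v (X \<omega>)) (leb lam)"
  unfolding void_process_def
proof (intro conjI ballI impI)
  note D = void_processD[OF X]
  show "prob_space M" by fact
  show "(\<lambda>\<omega>. shift v (X \<omega>)) \<in> measurable M config_space" by (rule measurable_compose[OF D(2) measurable_shift])
  fix B :: "'a set" assume "B \<in> sets borel" "bounded B"
  then show "measure M {\<omega> \<in> space M. shift v (X \<omega>) \<inter> B = {}} = exp (- leb lam B)"
    using D(3)[of "shift (- v) B"] by (simp add: shift_Int_eq_empty bounded_shift measure_shift)
qed

section \<open>Infinite products and existence\<close>

lemma (in prob_space) prob_all_exp: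
  assumes E: "\<And>n::nat. {\<omega>\<in>space M. P n \<omega>} \<in> events"
    and p: "\<And>k. prob {\<omega>\<in>space M. \<forall>n<k. P n \<omega>} = (\<Prod>n<k. exp (- r n))" and r: "r sums R"
  shows "prob {\<omega>\<in>space M. \<forall>n. P n \<omega>} = exp (- R)"
proof -
  have "(\<lambda>k. prob {\<omega>\<in>space M. \<forall>n<k. P n \<omega>}) \<longlonglongrightarrow> prob (\<Inter>k. {\<omega>\<in>space M. \<forall>n<k. P n \<omega>})"
  proof (rule finite_Lim_measure_decseq)
    have "{\<omega>\<in>space M. \<forall>n\<in>{..<k}. P n \<omega>} \<in> events" for k
      using E by (intro sets.sets_Collect_finite_All) auto
    then show "range (\<lambda>k. {\<omega>\<in>space M. \<forall>n<k. P n \<omega>}) \<subseteq> events"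
      unfolding Ball_def lessThan_iff by blast
    show "decseq (\<lambda>k. {\<omega>\<in>space M. \<forall>n<k. P n \<omega>})"
      unfolding decseq_def using less_le_trans by blast
  qed
  moreover have "(\<Inter>k. {\<omega>\<in>space M. \<forall>n<k. P n \<omega>}) = {\<omega>\<in>space M. \<forall>n. P n \<omega>}" by (blast intro: lessI)
  ultimately have 1: "(\<lambda>k. prob {\<omega>\<in>space M. \<forall>n<k. P n \<omega>}) \<longlonglongrightarrow> prob {\<omega>\<in>space M. \<forall>n. P n \<omega>}" by simp
  have "(\<lambda>k. exp (- (\<Sum>n<k. r n))) \<longlonglongrightarrow> exp (- R)"
    using r unfolding sums_def by (intro tendsto_intros)
  then have 2: "(\<lambda>k. prob {\<omega>\<in>space M. \<forall>n<k. P n \<omega>}) \<longlonglongrightarrow> exp (- R)"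
    unfolding p by (simp add: exp_sum sum_negf[symmetric])
  show ?thesis by (rule LIMSEQ_unique[OF 1 2])
qed

text \<open>
  Independent events whose probabilities are exponentials: infinitely many of them hold simultaneously with the
  probability given by the sum of the exponents. Void probabilities of infinitely many independent regions are
  multiplied in this way.
\<close>

lemma prob_PiM_nat_all_exp:
  fixes K :: "nat \<Rightarrow> 'k measure"
  assumes K: "\<And>n. prob_space (K n)" and E: "\<And>n. {w\<in>space (K n). P n w} \<in> sets (K n)"
    and p: "\<And>n. measure (K n) {w\<in>space (K n). P n w} = exp (- r n)" and r: "r sums R"
  shows "measure (\<Pi>\<^sub>M n\<in>UNIV. K n) {\<omega>\<in>space (\<Pi>\<^sub>M n\<in>UNIV. K n). \<forall>n. P n (\<omega> n)} = exp (- R)"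
proof -
  interpret K: prob_space "K n" for n by (rule K)
  interpret product_prob_space K UNIV by unfold_locales
  interpret P: prob_space "\<Pi>\<^sub>M n\<in>UNIV. K n" by (rule prob_space_PiM[OF K])
  have sp: "\<omega> n \<in> space (K n)" if "\<omega> \<in> space (\<Pi>\<^sub>M n\<in>UNIV. K n)" for \<omega> n
    using that by (auto simp: space_PiM)
  show ?thesis
  proof (rule P.prob_all_exp[OF _ _ r])
    fix n
    have "{\<omega>\<in>space (\<Pi>\<^sub>M n\<in>UNIV. K n). P n (\<omega> n)} = (\<lambda>\<omega>. \<omega> n) -` {w\<in>space (K n). P n w} \<inter> space (\<Pi>\<^sub>M n\<in>UNIV. K n)"
      using sp by auto
    also have "\<dots> \<in> P.events" using E by (intro measurable_sets[OF measurable_component_singleton]) auto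
    finally show "{\<omega>\<in>space (\<Pi>\<^sub>M n\<in>UNIV. K n). P n (\<omega> n)} \<in> P.events" .
  next
    fix k
    have "{\<omega>\<in>space (\<Pi>\<^sub>M n\<in>UNIV. K n). \<forall>n<k. P n (\<omega> n)} = {\<omega>\<in>space (\<Pi>\<^sub>M n\<in>UNIV. K n). \<forall>n\<in>{..<k}. \<omega> n \<in> {w\<in>space (K n). P n w}}"
      using sp by auto
    then have "emeasure (\<Pi>\<^sub>M n\<in>UNIV. K n) {\<omega>\<in>space (\<Pi>\<^sub>M n\<in>UNIV. K n). \<forall>n<k. P n (\<omega> n)} = (\<Prod>n<k. emeasure (K n) {w\<in>space (K n). P n w})"
      using E by (simp only:) (subst emeasure_PiM_Collect; auto)
    also have "\<dots> = ennreal (\<Prod>n<k. exp (- r n))"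
      by (simp add: prod_ennreal p K.emeasure_eq_measure)
    finally show "P.prob {\<omega>\<in>space (\<Pi>\<^sub>M n\<in>UNIV. K n). \<forall>n<k. P n (\<omega> n)} = (\<Prod>n<k. exp (- r n))"
      by (simp add: P.emeasure_eq_measure prod_nonneg)
  qed
qed

text \<open>
  A Poisson process on the whole space is assembled from its restrictions to these bounded pieces.
\<close>

definition annulus :: "nat \<Rightarrow> 'a::euclidean_space set" where
  "annulus k = {x. real k \<le> norm x \<and> norm x < real k + 1}"

lemma annulus_borel [measurable]: "annulus k \<in> sets borel"
  unfolding annulus_def by measurable

lemma bounded_annulus: "bounded (annulus k)"
  unfolding annulus_def bounded_iff by (auto intro!: exI[of _ "real k + 1"])

lemma disjoint_annulus: "disjoint_family annulus"
proof -
  have "m = n" if "x \<in> annulus m" "x \<in> annulus n" for x :: 'a and m n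
    using that unfolding annulus_def mem_Collect_eq by linarith
  then show ?thesis by (auto simp: disjoint_family_on_def)
qed

lemma UN_annulus: "(\<Union>k. annulus k) = UNIV"
proof -
  have "x \<in> annulus (nat \<lfloor>norm x\<rfloor>)" for x :: 'a
    unfolding annulus_def mem_Collect_eq using norm_ge_zero[of x] by linarith
  then show ?thesis by blast
qed

lemma open_measure_pos:
  assumes "open O'" "x \<in> O'" "O' \<subseteq> A" "A \<in> sets borel" "bounded A"
  shows "0 < measure lborel (A :: 'a::euclidean_space set)"
proof -
  obtain e where "e > 0" "cball x e \<subseteq> O'" using assms(1,2) open_contains_cball by blast
  then have "cball x e \<subseteq> A" using assms(3) by blast
  then have "measure lborel (cball x e) \<le> measure lborel A"
    using assms(4) emeasure_bounded_finite[OF assms(5)] by (intro measure_mono_fmeasurable) (auto simp: fmeasurable_def)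
  then show ?thesis using content_cball_pos[OF \<open>e > 0\<close>, of x] by linarith
qed

lemma annulus_measure_pos: "0 < measure lborel (annulus k :: 'a::euclidean_space set)"
proof -
  let ?O = "{x::'a. real k < norm x} \<inter> {x. norm x < real k + 1}"
  have "open ?O" by (intro open_Int open_Collect_less continuous_intros)
  moreover obtain b :: 'a where "b \<in> Basis" using nonempty_Basis by blast
  then have "(real k + 1/2) *\<^sub>R b \<in> ?O" by auto
  moreover have "?O \<subseteq> annulus k" by (auto simp: annulus_def)
  ultimately show ?thesis by (intro open_measure_pos[of ?O _ "annulus k"] annulus_borel bounded_annulus)
qed

text \<open>
  Raw data for one annulus: a Poisson number, and infinitely many uniform points of which only that many
  are used.
\<close>

definition pp_cell :: "real \<Rightarrow> nat \<Rightarrow> (nat \<times> (nat \<Rightarrow> 'a::euclidean_space)) measure" where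
  "pp_cell lam k = measure_pmf (poisson_pmf (lam * measure lborel (annulus k :: 'a set))) \<Otimes>\<^sub>M
     (\<Pi>\<^sub>M i\<in>UNIV. uniform_measure lborel (annulus k))"

definition pp_space :: "real \<Rightarrow> (nat \<Rightarrow> nat \<times> (nat \<Rightarrow> 'a::euclidean_space)) measure" where
  "pp_space lam = (\<Pi>\<^sub>M k\<in>UNIV. pp_cell lam k)"

text \<open>
  The intersection with the annulus removes the null event that a coordinate lies outside of it, so that the
  result is locally finite for every outcome.
\<close>

definition pp_map :: "(nat \<Rightarrow> nat \<times> (nat \<Rightarrow> 'a::euclidean_space)) \<Rightarrow> 'a set" where
  "pp_map \<omega> = (\<Union>k. {snd (\<omega> k) i | i. i < fst (\<omega> k)} \<inter> annulus k)"

lemma prob_space_uniform_annulus: "prob_space (uniform_measure lborel (annulus k :: 'a::euclidean_space set))"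
proof (rule prob_space_uniform_measure)
  show "emeasure lborel (annulus k :: 'a set) \<noteq> 0" using annulus_measure_pos[of k, where ?'a = 'a] by (auto simp: measure_def)
  show "emeasure lborel (annulus k :: 'a set) \<noteq> \<infinity>" using emeasure_bounded_finite[OF bounded_annulus[of k, where ?'a = 'a]] by simp
qed

lemma prob_space_pp_cell: "prob_space (pp_cell lam k)"
  unfolding pp_cell_def
  by (intro prob_space_pair prob_space_PiM prob_space_uniform_annulus measure_pmf.prob_space_axioms)

lemma prob_space_pp_space: "prob_space (pp_space lam)"
  unfolding pp_space_def by (intro prob_space_PiM prob_space_pp_cell)

lemma sets_pp_cell: "sets (pp_cell lam k) = sets (count_space UNIV \<Otimes>\<^sub>M (\<Pi>\<^sub>M i\<in>UNIV. borel))"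
  unfolding pp_cell_def by (intro sets_pair_measure_cong sets_PiM_cong) auto

lemma space_pp_cell: "space (pp_cell lam k) = UNIV"
  by (simp add: sets_eq_imp_space_eq[OF sets_pp_cell] space_pair_measure space_PiM)

lemma space_pp_space [simp]: "space (pp_space lam) = UNIV"
  by (simp add: pp_space_def space_PiM space_pp_cell)

lemma sets_pp_space: "sets (pp_space lam) = sets (\<Pi>\<^sub>M k\<in>UNIV. (count_space UNIV \<Otimes>\<^sub>M (\<Pi>\<^sub>M i\<in>UNIV. borel)))"
  unfolding pp_space_def by (intro sets_PiM_cong sets_pp_cell refl)

lemma pp_cell_event [measurable]:
  fixes B :: "'a::euclidean_space set"
  assumes "B \<in> sets borel"
  shows "{w\<in>space (pp_cell lam k). \<forall>i<fst w. snd w i \<notin> B} \<in> sets (pp_cell lam k)"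
proof -
  have [measurable]: "(\<lambda>w. snd w i) \<in> borel_measurable (count_space UNIV \<Otimes>\<^sub>M (\<Pi>\<^sub>M i\<in>UNIV. borel))" for i :: nat
    using measurable_compose[OF measurable_snd measurable_component_singleton[of i UNIV "\<lambda>_. borel"]] by simp
  have [measurable]: "Measurable.pred (count_space UNIV \<Otimes>\<^sub>M (\<Pi>\<^sub>M i\<in>UNIV. (borel :: 'a measure))) (\<lambda>w. i < fst w)" for i :: nat
    by (rule measurable_compose[OF measurable_fst]) simp
  have "{w\<in>space (count_space UNIV \<Otimes>\<^sub>M (\<Pi>\<^sub>M i\<in>UNIV. (borel :: 'a measure))). \<forall>i::nat. i < fst w \<longrightarrow> snd w i \<notin> B} \<in> sets (count_space UNIV \<Otimes>\<^sub>M (\<Pi>\<^sub>M i\<in>UNIV. borel))"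
    using assms by measurable
  then show ?thesis by (simp add: sets_pp_cell sets_eq_imp_space_eq[OF sets_pp_cell])
qed

lemma poisson_power_nn_integral:
  assumes "0 < m" "0 \<le> y" "y \<le> 1"
  shows "(\<integral>\<^sup>+n. ennreal (y ^ n) \<partial>measure_pmf (poisson_pmf m)) = ennreal (exp (- (m * (1 - y))))"
proof -
  have "(\<lambda>n. exp (- m) * ((m * y) ^ n /\<^sub>R fact n)) sums (exp (- m) * exp (m * y))"
    by (intro sums_mult exp_converges)
  moreover have "exp (- m) * exp (m * y) = exp (- (m * (1 - y)))"
    by (simp add: exp_add[symmetric] algebra_simps)
  moreover have "exp (- m) * ((m * y) ^ n /\<^sub>R fact n) = pmf (poisson_pmf m) n * y ^ n" for n
    using assms by (simp add: power_mult_distrib divide_inverse mult_ac)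
  ultimately have s: "(\<lambda>n. pmf (poisson_pmf m) n * y ^ n) sums exp (- (m * (1 - y)))" by simp
  have "(\<integral>\<^sup>+n. ennreal (y ^ n) \<partial>measure_pmf (poisson_pmf m)) = (\<Sum>n. ennreal (pmf (poisson_pmf m) n * y ^ n))"
    using assms by (simp add: nn_integral_measure_pmf nn_integral_count_space_nat ennreal_mult[symmetric])
  also have "\<dots> = ennreal (exp (- (m * (1 - y))))"
    using s assms by (subst suminf_ennreal2) (auto simp: sums_iff)
  finally show ?thesis .
qed

lemma pp_cell_void:
  fixes B :: "'a::euclidean_space set"
  assumes lam: "0 < lam" and B[measurable]: "B \<in> sets borel"
  shows "measure (pp_cell lam k) {w\<in>space (pp_cell lam k). \<forall>i<fst w. snd w i \<notin> B} = exp (- leb lam (annulus k \<inter> B))"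
proof -
  let ?U = "uniform_measure lborel (annulus k :: 'a set)"
  let ?P = "\<Pi>\<^sub>M i\<in>(UNIV::nat set). ?U"
  let ?a = "measure lborel (annulus k :: 'a set)" and ?b = "measure lborel (annulus k \<inter> B)"
  interpret U: prob_space ?U by (rule prob_space_uniform_annulus)
  interpret P: product_prob_space "\<lambda>_. ?U" "UNIV::nat set" by (intro product_prob_spaceI prob_space_uniform_annulus)
  interpret PP: prob_space ?P by (intro prob_space_PiM prob_space_uniform_annulus)
  interpret C: prob_space "pp_cell lam k" by (rule prob_space_pp_cell)
  have a: "0 < ?a" by (rule annulus_measure_pos)
  have ab: "?b \<le> ?a" using emeasure_bounded_finite[OF bounded_annulus[of k, where ?'a = 'a]] by (intro measure_mono_fmeasurable) (auto simp: fmeasurable_def)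
  have UB: "emeasure ?U (- B) = ennreal (1 - ?b / ?a)"
  proof -
    have "U.prob B = ?b / ?a"
      using emeasure_bounded_finite[OF bounded_annulus[of k, where ?'a = 'a]] a emeasure_eq_ennreal_measure[of lborel "annulus k :: 'a set"]
      by (intro measure_uniform_measure) auto
    then have "U.prob (space ?U - B) = 1 - ?b / ?a" by (subst U.prob_compl) auto
    then show ?thesis by (simp add: U.emeasure_eq_measure Compl_eq_Diff_UNIV)
  qed
  have inner: "emeasure ?P {p\<in>space ?P. \<forall>i<n. p i \<notin> B} = ennreal ((1 - ?b / ?a) ^ n)" for n
  proof -
    have "{p\<in>space ?P. \<forall>i<n. p i \<notin> B} = {p\<in>space ?P. \<forall>i\<in>{..<n}. p i \<in> - B}" by auto
    then have "emeasure ?P {p\<in>space ?P. \<forall>i<n. p i \<notin> B} = (\<Prod>i<n. emeasure ?U (- B))"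
      by (simp only:) (subst P.emeasure_PiM_Collect; auto)
    then show ?thesis unfolding UB using ab a by (simp add: ennreal_power)
  qed
  let ?E = "{w\<in>space (pp_cell lam k). \<forall>i<fst w. snd w i \<notin> B}"
  have "?E \<in> sets (pp_cell lam k)" by (rule pp_cell_event[OF B])
  then have "emeasure (pp_cell lam k) ?E = (\<integral>\<^sup>+n. emeasure ?P (Pair n -` ?E) \<partial>measure_pmf (poisson_pmf (lam * ?a)))"
    unfolding pp_cell_def by (rule sigma_finite_measure.emeasure_pair_measure_alt[OF prob_space_imp_sigma_finite[OF prob_space_PiM[OF prob_space_uniform_annulus]]])
  also have "(\<lambda>n. emeasure ?P (Pair n -` ?E)) = (\<lambda>n. ennreal ((1 - ?b / ?a) ^ n))"
    unfolding inner[symmetric] by (intro ext arg_cong[where f = "emeasure ?P"]) (auto simp: space_pp_cell space_PiM)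
  also have "(\<integral>\<^sup>+n. ennreal ((1 - ?b / ?a) ^ n) \<partial>measure_pmf (poisson_pmf (lam * ?a))) = ennreal (exp (- (lam * ?a * (1 - (1 - ?b / ?a)))))"
    using a lam ab by (intro poisson_power_nn_integral) auto
  also have "lam * ?a * (1 - (1 - ?b / ?a)) = leb lam (annulus k \<inter> B)" using a by simp
  finally show ?thesis by (simp add: C.emeasure_eq_measure)
qed

lemma annulus_sums:
  assumes "B \<in> sets borel" "bounded B"
  shows "(\<lambda>k. leb lam (annulus k \<inter> B)) sums leb lam (B :: 'a::euclidean_space set)"
proof (rule sums_mult)
  have eq: "(\<Union>k. annulus k \<inter> B) = B" using UN_annulus[where ?'a = 'a] by blast
  have "(\<lambda>k. measure lborel (annulus k \<inter> B)) sums measure lborel (\<Union>k. annulus k \<inter> B)"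
  proof (rule measure_UNION)
    show "disjoint_family (\<lambda>k. annulus k \<inter> B)"
      using disjoint_annulus[where ?'a = 'a] unfolding disjoint_family_on_def by blast
    show "emeasure lborel (\<Union>k. annulus k \<inter> B) \<noteq> \<infinity>"
      unfolding eq using emeasure_bounded_finite[OF assms(2)] by auto
  qed (use assms in auto)
  then show "(\<lambda>k. measure lborel (annulus k \<inter> B)) sums measure lborel B" unfolding eq .
qed

lemma pp_map_locally_finite: "locally_finite_set (pp_map \<omega>)"
  unfolding locally_finite_set_def
proof (intro allI impI)
  fix B :: "'a set" assume "bounded B"
  then obtain r where r: "\<And>x. x \<in> B \<Longrightarrow> norm x \<le> r" by (auto simp: bounded_iff)
  have "pp_map \<omega> \<inter> B \<subseteq> (\<Union>k\<in>{..nat \<lceil>r\<rceil>}. (\<lambda>i. snd (\<omega> k) i) ` {..<fst (\<omega> k)})"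
  proof
    fix x assume "x \<in> pp_map \<omega> \<inter> B"
    then obtain k i where *: "x = snd (\<omega> k) i" "i < fst (\<omega> k)" "x \<in> annulus k" "x \<in> B" by (auto simp: pp_map_def)
    then have "real k \<le> r" using r[of x] by (auto simp: annulus_def)
    then have "k \<le> nat \<lceil>r\<rceil>" by linarith
    with * show "x \<in> (\<Union>k\<in>{..nat \<lceil>r\<rceil>}. (\<lambda>i. snd (\<omega> k) i) ` {..<fst (\<omega> k)})" by auto
  qed
  then show "finite (pp_map \<omega> \<inter> B)" by (rule finite_subset) auto
qed

theorem void_process_pp:
  assumes lam: "0 < lam"
  shows "void_process (pp_space lam) (pp_map :: _ \<Rightarrow> 'a::euclidean_space set) (leb lam)"
proof -
  have eq: "{\<omega>\<in>space (pp_space lam). pp_map \<omega> \<inter> B = {}} = {\<omega>\<in>space (pp_space lam). \<forall>k. \<forall>i<fst (\<omega> k). snd (\<omega> k) i \<notin> annulus k \<inter> B}" for B :: "'a set"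
    by (auto simp: pp_map_def)
  have ev: "{\<omega>\<in>space (pp_space lam). \<forall>k. \<forall>i<fst (\<omega> k). snd (\<omega> k) i \<notin> annulus k \<inter> B} \<in> sets (pp_space lam)"
    if B: "B \<in> sets borel" for B :: "'a set"
  proof -
    have "{\<omega>\<in>space (pp_space lam). \<forall>i<fst (\<omega> k). snd (\<omega> k) i \<notin> annulus k \<inter> B} \<in> sets (pp_space lam)" for k
    proof -
      have "(\<lambda>\<omega>. \<omega> k) -` {w\<in>space (pp_cell lam k). \<forall>i<fst w. snd w i \<notin> annulus k \<inter> B} \<inter> space (pp_space lam) \<in> sets (pp_space lam)"
        unfolding pp_space_def using B by (intro measurable_sets[OF measurable_component_singleton] pp_cell_event) auto
      then show ?thesis by (simp add: space_pp_cell vimage_def)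
    qed
    then have "(\<Inter>k. {\<omega>\<in>space (pp_space lam). \<forall>i<fst (\<omega> k). snd (\<omega> k) i \<notin> annulus k \<inter> B}) \<in> sets (pp_space lam)" by auto
    then show ?thesis by (rule back_subst[of "\<lambda>A. A \<in> sets (pp_space lam)"]) auto
  qed
  show ?thesis unfolding void_process_def
  proof (intro conjI ballI impI)
    show "prob_space (pp_space lam :: (nat \<Rightarrow> nat \<times> (nat \<Rightarrow> 'a)) measure)" by (rule prob_space_pp_space)
    show "pp_map \<in> measurable (pp_space lam) (config_space :: 'a set measure)"
      by (rule measurable_configI) (use ev in \<open>simp_all add: eq[simplified] pp_map_locally_finite\<close>)
    fix B :: "'a set" assume B: "B \<in> sets borel" "bounded B"
    have "measure (\<Pi>\<^sub>M k\<in>UNIV. pp_cell lam k) {\<omega>\<in>space (\<Pi>\<^sub>M k\<in>UNIV. pp_cell lam k). \<forall>k. \<forall>i<fst (\<omega> k). snd (\<omega> k) i \<notin> annulus k \<inter> B} = exp (- leb lam B)"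
    proof (rule prob_PiM_nat_all_exp)
      show "(\<lambda>k. leb lam (annulus k \<inter> B)) sums leb lam B" by (rule annulus_sums[OF B])
      fix k
      show "prob_space (pp_cell lam k :: (nat \<times> (nat \<Rightarrow> 'a)) measure)" by (rule prob_space_pp_cell)
      show "{w\<in>space (pp_cell lam k). \<forall>i<fst w. snd w i \<notin> annulus k \<inter> B} \<in> sets (pp_cell lam k)"
        using B by (intro pp_cell_event) auto
      show "measure (pp_cell lam k) {w\<in>space (pp_cell lam k). \<forall>i<fst w. snd w i \<notin> annulus k \<inter> B} = exp (- leb lam (annulus k \<inter> B))"
        using pp_cell_void[OF lam, of "annulus k \<inter> B" k] B by (simp add: Int_assoc[symmetric])
    qed
    then show "measure (pp_space lam) {\<omega>\<in>space (pp_space lam). pp_map \<omega> \<inter> B = {}} = exp (- leb lam B)"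
      unfolding eq by (simp only: pp_space_def)
  qed
qed

lemma ex_void_process:
  assumes "0 < lam"
  shows "\<exists>M :: 'a::euclidean_space set measure. sets M = sets config_space \<and> void_process M (\<lambda>S. S) (leb lam)"
proof -
  let ?P = "pp_space lam :: (nat \<Rightarrow> nat \<times> (nat \<Rightarrow> 'a)) measure"
  let ?M = "distr ?P config_space pp_map"
  note P = void_process_pp[OF assms, where ?'a = 'a]
  note D = void_processD[OF P]
  interpret prob_space ?P by fact
  have "void_process ?M (\<lambda>S. S) (leb lam)" unfolding void_process_def
  proof (intro conjI ballI impI)
    show "prob_space ?M" by (rule prob_space_distr[OF D(2)])
    fix B :: "'a set" assume B: "B \<in> sets borel" "bounded B"
    have "pp_map -` {S\<in>space config_space. S \<inter> B = {}} \<inter> space ?P = {\<omega>\<in>space ?P. pp_map \<omega> \<inter> B = {}}"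
      using measurable_space[OF D(2)] by auto
    then show "measure ?M {S\<in>space ?M. S \<inter> B = {}} = exp (- leb lam B)"
      using D(3)[OF B] sets_void[OF B(1)] by (simp add: measure_distr[OF D(2)])
  qed simp
  then show ?thesis by (intro exI[of _ ?M]) simp
qed

section \<open>Conditional probabilities\<close>

text \<open>
  A version of the conditional probability with values in \<open>[0, 1]\<close> everywhere, not only almost everywhere.
\<close>

definition cprob :: "'w measure \<Rightarrow> 'w measure \<Rightarrow> 'w set \<Rightarrow> 'w \<Rightarrow> real" where
  "cprob M F e \<omega> = max 0 (min 1 (real_cond_exp M F (indicator e) \<omega>))"

lemma cprob_bounds: "0 \<le> cprob M F e \<omega>" "cprob M F e \<omega> \<le> 1"
  by (auto simp: cprob_def)

lemma measurable_cprob [measurable]: "cprob M F e \<in> borel_measurable F"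
  unfolding cprob_def[abs_def] by measurable

lemma (in prob_space) integrable_bounded:
  fixes f :: "'a \<Rightarrow> real"
  assumes "f \<in> borel_measurable M" "\<And>\<omega>. \<omega> \<in> space M \<Longrightarrow> \<bar>f \<omega>\<bar> \<le> C"
  shows "integrable M f"
  by (rule integrable_const_bound[of _ C]) (use assms in auto)

lemma (in prob_space) cprob_integral:
  assumes F: "subalgebra M F" and e: "e \<in> events"
    and g: "g \<in> borel_measurable F" "\<And>\<omega>. \<omega> \<in> space M \<Longrightarrow> \<bar>g \<omega>\<bar> \<le> C"
  shows "(\<integral>\<omega>. g \<omega> * cprob M F e \<omega> \<partial>M) = (\<integral>\<omega>. g \<omega> * indicator e \<omega> \<partial>M)"
proof -
  interpret finite_measure_subalgebra M F by unfold_locales (rule F)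
  have gM: "g \<in> borel_measurable M" by (rule measurable_from_subalg[OF F g(1)])
  have [measurable]: "(indicator e :: _ \<Rightarrow> real) \<in> borel_measurable M" using e by simp
  have int: "integrable M (\<lambda>\<omega>. g \<omega> * indicator e \<omega>)"
    using gM e g(2) by (intro integrable_bounded[of _ C]) (auto simp: indicator_def intro: order_trans[OF abs_ge_zero])
  have inte: "integrable M (indicator e :: _ \<Rightarrow> real)" using e by (intro integrable_bounded[of _ 1]) auto
  have "AE \<omega> in M. real_cond_exp M F (indicator e) \<omega> \<ge> 0"
    by (rule real_cond_exp_pos) auto
  moreover have "AE \<omega> in M. real_cond_exp M F (indicator e) \<omega> \<le> 1"
    by (rule real_cond_exp_le_c[OF inte]) (auto simp: indicator_def)
  ultimately have "AE \<omega> in M. g \<omega> * cprob M F e \<omega> = g \<omega> * real_cond_exp M F (indicator e) \<omega>"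
    by eventually_elim (simp add: cprob_def)
  then have "(\<integral>\<omega>. g \<omega> * cprob M F e \<omega> \<partial>M) = (\<integral>\<omega>. g \<omega> * real_cond_exp M F (indicator e) \<omega> \<partial>M)"
    using gM measurable_from_subalg[OF F measurable_cprob] measurable_from_subalg[OF F borel_measurable_cond_exp]
    by (intro integral_cong_AE) (auto intro!: borel_measurable_times)
  also have "\<dots> = (\<integral>\<omega>. g \<omega> * indicator e \<omega> \<partial>M)"
    by (rule real_cond_exp_intg(2)[OF int g(1)]) measurable
  finally show ?thesis .
qed

text \<open>
  The mean conditional variance of the indicator of \<open>e\<close>: it is 0 iff \<open>F\<close> decides \<open>e\<close> up to a null set.
\<close>

definition cvar :: "'w measure \<Rightarrow> 'w measure \<Rightarrow> 'w set \<Rightarrow> real" where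
  "cvar M F e = (\<integral>\<omega>. (indicator e \<omega> - cprob M F e \<omega>)\<^sup>2 \<partial>M)"

lemma (in prob_space) cvar_eq:
  assumes F: "subalgebra M F" and e: "e \<in> events"
  shows "cvar M F e = prob e - (\<integral>\<omega>. (cprob M F e \<omega>)\<^sup>2 \<partial>M)"
proof -
  let ?m = "cprob M F e"
  have m[measurable]: "?m \<in> borel_measurable M" by (rule measurable_from_subalg[OF F measurable_cprob])
  have [measurable]: "e \<in> sets M" by fact
  have i1: "integrable M (\<lambda>\<omega>. ?m \<omega> * indicator e \<omega>)" "integrable M (\<lambda>\<omega>. (?m \<omega>)\<^sup>2)" "integrable M (indicator e :: _ \<Rightarrow> real)"
    using cprob_bounds[of M F e] by (auto intro!: integrable_bounded[of _ 1] simp: indicator_def power_le_one)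
  have "cvar M F e = (\<integral>\<omega>. indicator e \<omega> - 2 * (?m \<omega> * indicator e \<omega>) + (?m \<omega>)\<^sup>2 \<partial>M)"
    unfolding cvar_def by (intro Bochner_Integration.integral_cong) (auto simp: indicator_def power2_eq_square algebra_simps)
  also have "\<dots> = prob e - 2 * (\<integral>\<omega>. ?m \<omega> * indicator e \<omega> \<partial>M) + (\<integral>\<omega>. (?m \<omega>)\<^sup>2 \<partial>M)"
    using i1 e by (simp add: Bochner_Integration.integral_add Bochner_Integration.integral_diff)
  also have "(\<integral>\<omega>. ?m \<omega> * indicator e \<omega> \<partial>M) = (\<integral>\<omega>. (?m \<omega>)\<^sup>2 \<partial>M)"
    using cprob_integral[OF F e measurable_cprob[of M F e], where C = 1] cprob_bounds[of M F e] by (simp add: power2_eq_square)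
  finally show ?thesis by simp
qed

lemma (in prob_space) cvar_diff:
  assumes F: "subalgebra M F" and F': "subalgebra M F'" and FF': "subalgebra F' F" and e: "e \<in> events"
  shows "cvar M F e - cvar M F' e = (\<integral>\<omega>. (cprob M F' e \<omega> - cprob M F e \<omega>)\<^sup>2 \<partial>M)"
proof -
  let ?m = "cprob M F e" and ?m' = "cprob M F' e"
  have [measurable]: "?m \<in> borel_measurable M" "?m' \<in> borel_measurable M"
    using measurable_from_subalg[OF F measurable_cprob] measurable_from_subalg[OF F' measurable_cprob] by auto
  have mF': "?m \<in> borel_measurable F'" by (rule measurable_from_subalg[OF FF' measurable_cprob])
  have i1: "integrable M (\<lambda>\<omega>. (?m \<omega>)\<^sup>2)" "integrable M (\<lambda>\<omega>. (?m' \<omega>)\<^sup>2)" "integrable M (\<lambda>\<omega>. ?m \<omega> * ?m' \<omega>)"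
    using cprob_bounds[of M F e] cprob_bounds[of M F' e]
    by (auto intro!: integrable_bounded[of _ 1] simp: power_le_one mult_le_one abs_mult)
  have "(\<integral>\<omega>. (?m' \<omega> - ?m \<omega>)\<^sup>2 \<partial>M) = (\<integral>\<omega>. (?m' \<omega>)\<^sup>2 - 2 * (?m \<omega> * ?m' \<omega>) + (?m \<omega>)\<^sup>2 \<partial>M)"
    by (intro Bochner_Integration.integral_cong) (auto simp: power2_eq_square algebra_simps)
  also have "\<dots> = (\<integral>\<omega>. (?m' \<omega>)\<^sup>2 \<partial>M) - 2 * (\<integral>\<omega>. ?m \<omega> * ?m' \<omega> \<partial>M) + (\<integral>\<omega>. (?m \<omega>)\<^sup>2 \<partial>M)"
    using i1 by simp
  also have "(\<integral>\<omega>. ?m \<omega> * ?m' \<omega> \<partial>M) = (\<integral>\<omega>. ?m \<omega> * indicator e \<omega> \<partial>M)"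
    by (rule cprob_integral[OF F' e mF', where C = 1]) (use cprob_bounds[of M F e] in auto)
  also have "\<dots> = (\<integral>\<omega>. ?m \<omega> * ?m \<omega> \<partial>M)"
    by (rule cprob_integral[OF F e measurable_cprob[of M F e], where C = 1, symmetric]) (use cprob_bounds[of M F e] in auto)
  finally show ?thesis unfolding cvar_eq[OF F e] cvar_eq[OF F' e] by (simp add: power2_eq_square)
qed

lemma (in prob_space) cvar_mono:
  assumes "subalgebra M F" "subalgebra M F'" "subalgebra F' F" "e \<in> events"
  shows "cvar M F' e \<le> cvar M F e"
  using cvar_diff[OF assms] by (smt (verit) Bochner_Integration.integral_nonneg zero_le_power2)

lemma cvar_nonneg: "0 \<le> cvar M F e"
  unfolding cvar_def by (intro Bochner_Integration.integral_nonneg) auto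

text \<open>
  Cauchy--Schwarz in the form used below: if a newly observed bounded quantity \<open>\<psi>\<close> correlates with the
  unexplained part of \<open>e\<close>, then observing it reduces the conditional variance.
\<close>

lemma (in prob_space) cvar_diff_ge:
  assumes F: "subalgebra M F" and F': "subalgebra M F'" and FF': "subalgebra F' F" and e: "e \<in> events"
    and \<psi>: "\<psi> \<in> borel_measurable F'" "\<And>\<omega>. \<omega> \<in> space M \<Longrightarrow> \<bar>\<psi> \<omega>\<bar> \<le> 1"
  shows "(\<integral>\<omega>. (indicator e \<omega> - cprob M F e \<omega>) * \<psi> \<omega> \<partial>M)\<^sup>2 \<le> cvar M F e - cvar M F' e"
proof -
  let ?m = "cprob M F e" and ?m' = "cprob M F' e"
  have [measurable]: "?m \<in> borel_measurable M" "?m' \<in> borel_measurable M" "\<psi> \<in> borel_measurable M" "e \<in> sets M"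
    using measurable_from_subalg[OF F measurable_cprob] measurable_from_subalg[OF F' measurable_cprob]
      measurable_from_subalg[OF F' \<psi>(1)] e by auto
  define c where "c = (\<integral>\<omega>. (indicator e \<omega> - ?m \<omega>) * \<psi> \<omega> \<partial>M)"
  have b: "\<bar>?m' \<omega> - ?m \<omega>\<bar> \<le> 1" for \<omega> using cprob_bounds[of M F e \<omega>] cprob_bounds[of M F' e \<omega>] by linarith
  have i: "integrable M (\<lambda>\<omega>. \<psi> \<omega> * indicator e \<omega>)" "integrable M (\<lambda>\<omega>. \<psi> \<omega> * ?m \<omega>)" "integrable M (\<lambda>\<omega>. \<psi> \<omega> * ?m' \<omega>)"
    "integrable M (\<lambda>\<omega>. (?m' \<omega> - ?m \<omega>)\<^sup>2)" "integrable M (\<lambda>\<omega>. (\<psi> \<omega>)\<^sup>2)" "integrable M (\<lambda>\<omega>. (?m' \<omega> - ?m \<omega>) * \<psi> \<omega>)"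
    using cprob_bounds[of M F e] cprob_bounds[of M F' e] \<psi>(2) b
    by (auto intro!: integrable_bounded[of _ 1] simp: abs_mult mult_le_one indicator_def abs_square_le_1)
  have "c = (\<integral>\<omega>. \<psi> \<omega> * indicator e \<omega> - \<psi> \<omega> * ?m \<omega> \<partial>M)"
    unfolding c_def by (intro Bochner_Integration.integral_cong) (auto simp: algebra_simps)
  also have "\<dots> = (\<integral>\<omega>. \<psi> \<omega> * ?m' \<omega> \<partial>M) - (\<integral>\<omega>. \<psi> \<omega> * ?m \<omega> \<partial>M)"
    using cprob_integral[OF F' e \<psi>] i by (subst Bochner_Integration.integral_diff) auto
  also have "\<dots> = (\<integral>\<omega>. (?m' \<omega> - ?m \<omega>) * \<psi> \<omega> \<partial>M)"
    using i by (subst Bochner_Integration.integral_diff[symmetric]) (auto simp: algebra_simps intro!: Bochner_Integration.integral_cong)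
  finally have c: "c = (\<integral>\<omega>. (?m' \<omega> - ?m \<omega>) * \<psi> \<omega> \<partial>M)" .
  have "0 \<le> (\<integral>\<omega>. ((?m' \<omega> - ?m \<omega>) - c * \<psi> \<omega>)\<^sup>2 \<partial>M)" by simp
  also have "\<dots> = (\<integral>\<omega>. (?m' \<omega> - ?m \<omega>)\<^sup>2 - (2 * c) * ((?m' \<omega> - ?m \<omega>) * \<psi> \<omega>) + c\<^sup>2 * (\<psi> \<omega>)\<^sup>2 \<partial>M)"
    by (intro Bochner_Integration.integral_cong) (auto simp: power2_eq_square algebra_simps)
  also have "\<dots> = (\<integral>\<omega>. (?m' \<omega> - ?m \<omega>)\<^sup>2 \<partial>M) - (2 * c) * c + c\<^sup>2 * (\<integral>\<omega>. (\<psi> \<omega>)\<^sup>2 \<partial>M)"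
    using i by (subst (2) c) simp
  also have "(\<integral>\<omega>. (\<psi> \<omega>)\<^sup>2 \<partial>M) \<le> (\<integral>\<omega>. 1 \<partial>M)"
    using i \<psi>(2) by (intro integral_mono) (auto simp: abs_square_le_1)
  finally have "0 \<le> (\<integral>\<omega>. (?m' \<omega> - ?m \<omega>)\<^sup>2 \<partial>M) - (2 * c) * c + c\<^sup>2 * 1"
    by (simp add: prob_space mult_left_mono)
  then have "c\<^sup>2 \<le> (\<integral>\<omega>. (?m' \<omega> - ?m \<omega>)\<^sup>2 \<partial>M)" by (simp add: power2_eq_square)
  then show ?thesis unfolding c_def cvar_diff[OF F F' FF' e] .
qed

lemma (in prob_space) cvar_zero_imp_event:
  assumes F: "subalgebra M F" and e: "e \<in> events" and 0: "cvar M F e = 0"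
  shows "AE \<omega> in M. \<omega> \<in> e \<longleftrightarrow> \<omega> \<in> {\<omega>\<in>space M. cprob M F e \<omega> > 1/2}"
proof -
  let ?m = "cprob M F e"
  have [measurable]: "?m \<in> borel_measurable M" "e \<in> sets M"
    using measurable_from_subalg[OF F measurable_cprob] e by auto
  have "integrable M (\<lambda>\<omega>. (indicator e \<omega> - ?m \<omega>)\<^sup>2)"
    using cprob_bounds[of M F e] by (intro integrable_bounded[of _ 1]) (auto simp: indicator_def abs_square_le_1)
  then have "AE \<omega> in M. (indicator e \<omega> - ?m \<omega>)\<^sup>2 = 0"
    using 0 unfolding cvar_def by (subst (asm) integral_nonneg_eq_0_iff_AE) auto
  then show ?thesis using AE_space
  proof eventually_elim
    case (elim \<omega>)
    then show ?case by (cases "\<omega> \<in> e") auto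
  qed
qed

section \<open>The coding theorem\<close>

text \<open>
  Independent copies of \<open>K\<close> are to be encoded into an independent sequence with values in \<open>T\<close> and law that of
  \<open>x p\<close>. The parameter \<open>\<theta>\<close> of the encoding of the current copy is at one's disposal. The law of \<open>x \<theta>\<close> is affine in
  \<open>\<theta>\<close> with slope \<open>\<beta>\<close>, so that a random \<open>\<theta>\<close> with conditional mean \<open>p\<close> leaves the law unchanged; the slope does
  not vanish on \<open>B0\<close>, so that some information about \<open>\<theta>\<close> is transmitted. The sets \<open>E k\<close> are the events of \<open>K\<close> that
  are to be recovered.
\<close>

locale coding_step = K: prob_space K for K :: "'k measure" +
  fixes T :: "'t measure" and x :: "real \<Rightarrow> 'k \<Rightarrow> 't" and p :: real and \<beta> :: "'t set \<Rightarrow> real"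
    and B0 :: "'t set" and E :: "nat \<Rightarrow> 'k set"
  assumes x_meas: "(\<lambda>(\<theta>, w). x \<theta> w) \<in> measurable (borel \<Otimes>\<^sub>M K) T"
    and p: "0 < p" "p < 1"
    and affine: "\<And>B \<theta>. B \<in> sets T \<Longrightarrow> 0 \<le> \<theta> \<Longrightarrow> \<theta> \<le> 1 \<Longrightarrow>
      K.prob {w\<in>space K. x \<theta> w \<in> B} = K.prob {w\<in>space K. x p w \<in> B} + (\<theta> - p) * \<beta> B"
    and B0: "B0 \<in> sets T" "\<beta> B0 \<noteq> 0"
    and E: "\<And>k. E k \<in> sets K"
begin

definition Om :: "(nat \<Rightarrow> 'k) measure" where "Om = (\<Pi>\<^sub>M n\<in>UNIV. K)"

sublocale Om: prob_space Om
  unfolding Om_def by (intro prob_space_PiM K.prob_space_axioms)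

definition kap :: real where "kap = min p (1 - p)"

definition ev :: "nat \<Rightarrow> nat \<Rightarrow> (nat \<Rightarrow> 'k) set" where "ev i k = {\<omega>\<in>space Om. \<omega> i \<in> E k}"

text \<open>
  The event transmitted at time \<open>n\<close>. The first component of \<open>prod_decode n\<close> takes every value for arbitrarily large
  \<open>n\<close>, hence each event of each coordinate occurs infinitely often; only coordinates before \<open>n\<close> may be transmitted.
\<close>

definition A :: "nat \<Rightarrow> (nat \<Rightarrow> 'k) set" where
  "A n = (let (i, k) = prod_decode (fst (prod_decode n)) in if i < n then ev i k else {})"

text \<open>
  The transmitted event is centered at its conditional probability given the output \<open>s\<close> so far. The receiver knows
  this probability, and the conditional mean of the parameter is \<open>p\<close>. The argument \<open>s\<close> is the map producing the
  output, in order that the recursion for the output refers only to its earlier stage.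
\<close>

definition theta :: "nat \<Rightarrow> ((nat \<Rightarrow> 'k) \<Rightarrow> (nat \<Rightarrow> 't)) \<Rightarrow> (nat \<Rightarrow> 'k) \<Rightarrow> real" where
  "theta n s \<omega> = p + kap * (indicator (A n) \<omega> - cprob Om (vimage_algebra (space Om) s (\<Pi>\<^sub>M i\<in>{..<n}. T)) (A n) \<omega>)"

text \<open>
  The first \<open>n\<close> outputs as a function on the natural numbers, undefined from \<open>n\<close> on, which is the form of
  the elements of a product over \<open>{..<n}\<close>.
\<close>

primrec S :: "nat \<Rightarrow> (nat \<Rightarrow> 'k) \<Rightarrow> (nat \<Rightarrow> 't)" where
  "S 0 = (\<lambda>\<omega> i. undefined)"
| "S (Suc n) = (\<lambda>\<omega>. (S n \<omega>)(n := x (theta n (S n) \<omega>) (\<omega> n)))"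

definition X :: "nat \<Rightarrow> (nat \<Rightarrow> 'k) \<Rightarrow> 't" where "X n \<omega> = x (theta n (S n) \<omega>) (\<omega> n)"

text \<open>
  \<open>G n\<close> is what the receiver knows after \<open>n\<close> outputs, and \<open>F n\<close> what the sender has used.
\<close>

definition G :: "nat \<Rightarrow> (nat \<Rightarrow> 'k) measure" where
  "G n = vimage_algebra (space Om) (S n) (\<Pi>\<^sub>M i\<in>{..<n}. T)"

definition F :: "nat \<Rightarrow> (nat \<Rightarrow> 'k) measure" where
  "F n = vimage_algebra (space Om) (\<lambda>\<omega>. restrict \<omega> {..<n}) (\<Pi>\<^sub>M i\<in>{..<n}. K)"

abbreviation "nu B \<equiv> K.prob {w\<in>space K. x p w \<in> B}"

lemma S_eq: "S n \<omega> = restrict (\<lambda>i. X i \<omega>) {..<n}"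
  by (induction n) (auto simp: fun_eq_iff X_def restrict_def less_Suc_eq)

lemma theta_eq: "theta n (S n) \<omega> = p + kap * (indicator (A n) \<omega> - cprob Om (G n) (A n) \<omega>)"
  by (simp add: theta_def G_def)

lemma kap: "0 < kap" "kap \<le> p" "kap \<le> 1 - p"
  using p by (auto simp: kap_def)

lemma theta_bounds: "0 \<le> theta n (S n) \<omega>" "theta n (S n) \<omega> \<le> 1"
proof -
  let ?d = "indicator (A n) \<omega> - cprob Om (G n) (A n) \<omega>"
  have d: "- 1 \<le> ?d" "?d \<le> 1" using cprob_bounds[of Om "G n" "A n" \<omega>] by (auto simp: indicator_def)
  show "0 \<le> theta n (S n) \<omega>"
    unfolding theta_eq using mult_left_mono[OF d(1) less_imp_le[OF kap(1)]] kap(2) by linarith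
  show "theta n (S n) \<omega> \<le> 1"
    unfolding theta_eq using mult_left_mono[OF d(2) less_imp_le[OF kap(1)]] kap(3) by linarith
qed

lemma space_Om: "\<omega> \<in> space Om \<Longrightarrow> \<omega> i \<in> space K"
  by (auto simp: Om_def space_PiM)

lemma restrict_funcset: "(\<lambda>\<omega>. restrict \<omega> {..<n}) \<in> space Om \<rightarrow> space (\<Pi>\<^sub>M i\<in>{..<n}. K)"
  using space_Om by (auto simp: space_PiM)

lemma space_F [simp]: "space (F n) = space Om" and space_G [simp]: "space (G n) = space Om"
  by (simp_all add: F_def G_def)

lemma coord_F: "i < n \<Longrightarrow> (\<lambda>\<omega>. \<omega> i) \<in> measurable (F n) K"
proof -
  assume i: "i < n"
  have "(\<lambda>\<omega>. restrict \<omega> {..<n}) \<in> measurable (F n) (\<Pi>\<^sub>M i\<in>{..<n}. K)"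
    unfolding F_def by (rule measurable_vimage_algebra1[OF restrict_funcset])
  from measurable_compose[OF this measurable_component_singleton[of i]] i
  show ?thesis by simp
qed

lemma coord_Om: "(\<lambda>\<omega>. \<omega> i) \<in> measurable Om K"
  unfolding Om_def by (rule measurable_component_singleton) simp

lemma subalgebraI_measurable: "space N = space M \<Longrightarrow> (\<lambda>\<omega>. \<omega>) \<in> measurable M N \<Longrightarrow> subalgebra M N"
  unfolding subalgebra_def
proof (intro conjI subsetI)
  fix a assume *: "space N = space M" "(\<lambda>\<omega>. \<omega>) \<in> measurable M N" "a \<in> sets N"
  have "(\<lambda>\<omega>. \<omega>) -` a \<inter> space M = a" using sets.sets_into_space[OF *(3)] *(1) by auto
  with measurable_sets[OF *(2,3)] show "a \<in> sets M" by simp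
qed auto

lemma F_sub: "subalgebra Om (F n)"
proof (rule subalgebraI_measurable)
  show "(\<lambda>\<omega>. \<omega>) \<in> measurable Om (F n)"
    unfolding F_def
  proof (rule measurable_vimage_algebra2)
    show "(\<lambda>\<omega>. restrict \<omega> {..<n}) \<in> measurable Om (\<Pi>\<^sub>M i\<in>{..<n}. K)"
      by (intro measurable_restrict coord_Om)
  qed simp
qed simp

lemma F_mono: assumes "m \<le> n" shows "subalgebra (F n) (F m)"
proof (rule subalgebraI_measurable)
  have "(\<lambda>\<omega>. \<omega>) \<in> measurable (F n) (vimage_algebra (space Om) (\<lambda>\<omega>. restrict \<omega> {..<m}) (\<Pi>\<^sub>M i\<in>{..<m}. K))"
  proof (rule measurable_vimage_algebra2)
    show "(\<lambda>\<omega>. restrict \<omega> {..<m}) \<in> measurable (F n) (\<Pi>\<^sub>M i\<in>{..<m}. K)"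
      using assms by (intro measurable_restrict coord_F) auto
  qed simp
  then show "(\<lambda>\<omega>. \<omega>) \<in> measurable (F n) (F m)" by (simp add: F_def)
qed simp

lemma A_F: "A n \<in> sets (F n)"
proof -
  obtain i k where ik: "prod_decode (fst (prod_decode n)) = (i, k)" by force
  show ?thesis
  proof (cases "i < n")
    case True
    have "ev i k = (\<lambda>\<omega>. \<omega> i) -` E k \<inter> space (F n)" by (auto simp: ev_def)
    also have "\<dots> \<in> sets (F n)" by (rule measurable_sets[OF coord_F[OF True] E])
    finally show ?thesis by (simp add: A_def ik True)
  qed (simp add: A_def ik)
qed

lemma X_F: "X n \<in> measurable (F (Suc n)) T" and G_F: "subalgebra (F n) (G n)"
proof (induction n rule: less_induct)
  case (less n)
  { case 2
    have "S n \<in> measurable (F n) (\<Pi>\<^sub>M i\<in>{..<n}. T)"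
      unfolding S_eq[abs_def]
    proof (intro measurable_restrict)
      fix i assume "i \<in> {..<n}"
      then show "X i \<in> measurable (F n) T"
        using less(1)[of i] measurable_from_subalg[OF F_mono[of "Suc i" n]] by auto
    qed
    then have "(\<lambda>\<omega>. \<omega>) \<in> measurable (F n) (G n)"
      unfolding G_def by (intro measurable_vimage_algebra2) auto
    then show ?case by (intro subalgebraI_measurable) auto }
  note GF = this
  { case 1
    have [measurable]: "A n \<in> sets (F n)" by (rule A_F)
    have [measurable]: "cprob Om (G n) (A n) \<in> borel_measurable (F n)"
      by (rule measurable_from_subalg[OF GF measurable_cprob])
    have "theta n (S n) \<in> borel_measurable (F n)"
      unfolding theta_eq[abs_def] by measurable
    then have "theta n (S n) \<in> borel_measurable (F (Suc n))"
      by (rule measurable_from_subalg[OF F_mono, rotated]) simp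
    then have "(\<lambda>\<omega>. (theta n (S n) \<omega>, \<omega> n)) \<in> measurable (F (Suc n)) (borel \<Otimes>\<^sub>M K)"
      by (intro measurable_Pair coord_F) auto
    from measurable_compose[OF this x_meas] show ?case by (simp add: X_def[abs_def]) }
qed

lemma theta_F: "theta n (S n) \<in> borel_measurable (F n)"
proof -
  have [measurable]: "A n \<in> sets (F n)" by (rule A_F)
  have [measurable]: "cprob Om (G n) (A n) \<in> borel_measurable (F n)"
    by (rule measurable_from_subalg[OF G_F measurable_cprob])
  show ?thesis unfolding theta_eq[abs_def] by measurable
qed

lemma X_Om: "X n \<in> measurable Om T"
  by (rule measurable_from_subalg[OF F_sub X_F])

lemma G_sub: "subalgebra Om (G n)"
  using F_sub[of n] G_F[of n] by (auto simp: subalgebra_def)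

lemma A_Om: "A n \<in> sets Om" using A_F F_sub by (auto simp: subalgebra_def)

lemma S_G: "S n \<in> measurable (G n) (\<Pi>\<^sub>M i\<in>{..<n}. T)"
proof -
  have "S n \<in> space Om \<rightarrow> space (\<Pi>\<^sub>M i\<in>{..<n}. T)"
    using measurable_space[OF X_Om] by (auto simp: S_eq[abs_def] space_PiM)
  then show ?thesis unfolding G_def by (rule measurable_vimage_algebra1)
qed

lemma X_G: assumes "i < n" shows "X i \<in> measurable (G n) T"
proof -
  have "(\<lambda>\<omega>. S n \<omega> i) \<in> measurable (G n) T"
    using measurable_compose[OF S_G measurable_component_singleton[of i]] assms by simp
  then show ?thesis using assms by (simp add: S_eq)
qed

lemma G_mono: assumes "m \<le> n" shows "subalgebra (G n) (G m)"
proof (rule subalgebraI_measurable)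
  have "(\<lambda>\<omega>. \<omega>) \<in> measurable (G n) (vimage_algebra (space Om) (S m) (\<Pi>\<^sub>M i\<in>{..<m}. T))"
  proof (rule measurable_vimage_algebra2)
    show "S m \<in> measurable (G n) (\<Pi>\<^sub>M i\<in>{..<m}. T)"
      unfolding S_eq[abs_def] using assms by (intro measurable_restrict X_G) auto
  qed simp
  then show "(\<lambda>\<omega>. \<omega>) \<in> measurable (G n) (G m)" by (simp add: G_def)
qed simp

lemma distr_coord: "distr Om K (\<lambda>\<omega>. \<omega> i) = K"
proof -
  interpret PP: product_prob_space "\<lambda>_. K" "UNIV :: nat set" by unfold_locales
  show ?thesis unfolding Om_def by (rule PP.PiM_component) simp
qed

lemma indep_coords: "Om.indep_vars (\<lambda>_. K) (\<lambda>i \<omega>. \<omega> i) UNIV"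
proof (subst Om.indep_vars_iff_distr_eq_PiM)
  show "distr Om (\<Pi>\<^sub>M i\<in>UNIV. K) (\<lambda>\<omega>. \<lambda>i\<in>UNIV. \<omega> i) = (\<Pi>\<^sub>M i\<in>UNIV. distr Om K (\<lambda>\<omega>. \<omega> i))"
    unfolding distr_coord Om_def[symmetric] by (simp add: restrict_UNIV distr_id2)
qed (auto intro: coord_Om)

lemma indep_F_coord:
  assumes g: "g \<in> sets (F n)" and b: "b \<in> sets K"
  shows "Om.prob (g \<inter> {\<omega>\<in>space Om. \<omega> n \<in> b}) = Om.prob g * K.prob b"
proof -
  have "Om.indep_var (\<Pi>\<^sub>M i\<in>{..<n}. K) (\<lambda>\<omega>. restrict (\<lambda>i. \<omega> i) {..<n}) (\<Pi>\<^sub>M i\<in>{n}. K) (\<lambda>\<omega>. restrict (\<lambda>i. \<omega> i) {n})"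
    by (rule Om.indep_var_restrict[OF indep_coords]) auto
  then have ind: "Om.indep_set
      (sigma_sets (space Om) {(\<lambda>\<omega>. restrict \<omega> {..<n}) -` a \<inter> space Om | a. a \<in> sets (\<Pi>\<^sub>M i\<in>{..<n}. K)})
      (sigma_sets (space Om) {(\<lambda>\<omega>. restrict \<omega> {n}) -` a \<inter> space Om | a. a \<in> sets (\<Pi>\<^sub>M i\<in>{n}. K)})"
    unfolding Om.indep_var_eq by simp
  have 1: "g \<in> sigma_sets (space Om) {(\<lambda>\<omega>. restrict \<omega> {..<n}) -` a \<inter> space Om | a. a \<in> sets (\<Pi>\<^sub>M i\<in>{..<n}. K)}"
    using g unfolding F_def sets_vimage_algebra .
  have "{f\<in>space (\<Pi>\<^sub>M i\<in>{n}. K). f n \<in> b} \<in> sets (\<Pi>\<^sub>M i\<in>{n}. K)"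
    using measurable_sets[OF measurable_component_singleton[of n "{n}" "\<lambda>_. K"] b]
    by (simp add: vimage_def Int_def conj_commute)
  moreover have "{\<omega>\<in>space Om. \<omega> n \<in> b} = (\<lambda>\<omega>. restrict \<omega> {n}) -` {f\<in>space (\<Pi>\<^sub>M i\<in>{n}. K). f n \<in> b} \<inter> space Om"
    using space_Om by (auto simp: space_PiM)
  ultimately have 2: "{\<omega>\<in>space Om. \<omega> n \<in> b} \<in> sigma_sets (space Om) {(\<lambda>\<omega>. restrict \<omega> {n}) -` a \<inter> space Om | a. a \<in> sets (\<Pi>\<^sub>M i\<in>{n}. K)}"
    by (intro sigma_sets.Basic) blast
  have "Om.prob {\<omega>\<in>space Om. \<omega> n \<in> b} = measure (distr Om K (\<lambda>\<omega>. \<omega> n)) b"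
    using b by (subst measure_distr[OF coord_Om]) (auto simp: vimage_def Int_def conj_commute)
  also have "distr Om K (\<lambda>\<omega>. \<omega> n) = K" by (rule distr_coord)
  finally show ?thesis using Om.indep_setD[OF ind 1 2] by simp
qed

text \<open>
  The parameter of step \<open>n\<close> depends on the coordinates before \<open>n\<close> only and the coordinate \<open>n\<close> is independent of
  them; integrating out this coordinate replaces the output by its law, which is affine in the parameter.
\<close>

lemma fubini_coord:
  assumes a: "a \<in> borel_measurable (F n)" "\<And>\<omega>. \<omega> \<in> space Om \<Longrightarrow> \<bar>a \<omega>\<bar> \<le> 1"
    and B: "B \<in> sets T"
  shows "(\<integral>\<omega>. a \<omega> * indicator B (X n \<omega>) \<partial>Om) = (\<integral>\<omega>. a \<omega> * (nu B + (theta n (S n) \<omega> - p) * \<beta> B) \<partial>Om)"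
proof -
  let ?g = "theta n (S n)"
  let ?V = "\<lambda>\<omega>. (a \<omega>, ?g \<omega>)"
  let ?N = "borel \<Otimes>\<^sub>M borel :: (real \<times> real) measure"
  let ?D = "distr Om ?N ?V"
  \<comment> \<open>The clipping makes the integrand bounded on the whole product space.\<close>
  define h where "h z = (case z of ((u, t), w) \<Rightarrow> (max (- 1) (min 1 u) * indicator B (x t w) :: real))" for z
  have V: "?V \<in> measurable (F n) ?N" using a theta_F by (intro measurable_Pair) auto
  have VO: "?V \<in> measurable Om ?N" by (rule measurable_from_subalg[OF F_sub V])
  note cO[measurable] = coord_Om[of n]
  interpret D: prob_space ?D by (rule Om.prob_space_distr[OF VO])
  have J: "?D \<Otimes>\<^sub>M K = distr Om (?N \<Otimes>\<^sub>M K) (\<lambda>\<omega>. (?V \<omega>, \<omega> n))"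
  proof (rule pair_measure_eqI)
    show "sigma_finite_measure ?D" "sigma_finite_measure K" by unfold_locales
    show "sets (?D \<Otimes>\<^sub>M K) = sets (distr Om (?N \<Otimes>\<^sub>M K) (\<lambda>\<omega>. (?V \<omega>, \<omega> n)))"
      by (simp cong: sets_pair_measure_cong)
    fix u b assume u: "u \<in> sets ?D" and b: "b \<in> sets K"
    have g: "?V -` u \<inter> space Om \<in> sets (F n)" using measurable_sets[OF V] u by simp
    have "(\<lambda>\<omega>. (?V \<omega>, \<omega> n)) -` (u \<times> b) \<inter> space Om = (?V -` u \<inter> space Om) \<inter> {\<omega>\<in>space Om. \<omega> n \<in> b}" by auto
    then have "emeasure (distr Om (?N \<Otimes>\<^sub>M K) (\<lambda>\<omega>. (?V \<omega>, \<omega> n))) (u \<times> b) = Om.prob (?V -` u \<inter> space Om) * K.prob b"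
      using u b VO cO by (subst emeasure_distr) (auto simp: Om.emeasure_eq_measure indep_F_coord[OF g b])
    then show "emeasure ?D u * emeasure K b = emeasure (distr Om (?N \<Otimes>\<^sub>M K) (\<lambda>\<omega>. (?V \<omega>, \<omega> n))) (u \<times> b)"
      using u by (simp add: emeasure_distr[OF VO] Om.emeasure_eq_measure K.emeasure_eq_measure ennreal_mult)
  qed
  interpret DK: pair_prob_space ?D K ..
  have "(\<lambda>z. x (snd (fst z)) (snd z)) \<in> measurable (?N \<Otimes>\<^sub>M K) T"
    using measurable_compose[OF _ x_meas, of "\<lambda>z. (snd (fst z), snd z)" "?N \<Otimes>\<^sub>M K"] by (simp add: case_prod_beta)
  note [measurable] = this
  have [measurable]: "h \<in> borel_measurable (?N \<Otimes>\<^sub>M K)"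
    unfolding h_def[abs_def] case_prod_beta using B by measurable
  then have hD: "h \<in> borel_measurable (?D \<Otimes>\<^sub>M K)" by (simp cong: measurable_cong_sets)
  have int: "integrable (?D \<Otimes>\<^sub>M K) h"
    by (rule DK.integrable_bounded[OF hD, of 1]) (auto simp: h_def indicator_def split: prod.splits)
  have clip: "max (- 1) (min 1 (a \<omega>)) = a \<omega>" if "\<omega> \<in> space Om" for \<omega>
    using a(2)[OF that] by linarith
  have "(\<integral>\<omega>. a \<omega> * indicator B (X n \<omega>) \<partial>Om) = (\<integral>\<omega>. h (?V \<omega>, \<omega> n) \<partial>Om)"
    by (intro Bochner_Integration.integral_cong refl) (simp add: h_def X_def clip)
  also have "\<dots> = (\<integral>z. h z \<partial>(?D \<Otimes>\<^sub>M K))"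
    unfolding J using VO by (subst integral_distr) auto
  also have "\<dots> = (\<integral>v. \<integral>w. h (v, w) \<partial>K \<partial>?D)"
    by (rule DK.integral_fst'[OF int, symmetric])
  also have "\<dots> = (\<integral>\<omega>. \<integral>w. h (?V \<omega>, w) \<partial>K \<partial>Om)"
    by (subst integral_distr[OF VO]) (auto intro!: K.borel_measurable_lebesgue_integral)
  also have "\<dots> = (\<integral>\<omega>. a \<omega> * (nu B + (?g \<omega> - p) * \<beta> B) \<partial>Om)"
  proof (rule Bochner_Integration.integral_cong[OF refl])
    fix \<omega> assume \<omega>: "\<omega> \<in> space Om"
    have "(\<lambda>w. x (?g \<omega>) w) \<in> measurable K T"
      using measurable_compose[OF _ x_meas, of "\<lambda>w. (?g \<omega>, w)" K] by simp
    from measurable_sets[OF this B] have s: "{w\<in>space K. x (?g \<omega>) w \<in> B} \<in> sets K"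
      by (simp add: vimage_def Int_def conj_commute)
    have "(\<integral>w. h (?V \<omega>, w) \<partial>K) = (\<integral>w. a \<omega> * indicator {w\<in>space K. x (?g \<omega>) w \<in> B} w \<partial>K)"
      by (intro Bochner_Integration.integral_cong refl) (simp add: h_def clip[OF \<omega>] indicator_def)
    also have "\<dots> = a \<omega> * K.prob {w\<in>space K. x (?g \<omega>) w \<in> B}" using s by simp
    finally show "(\<integral>w. h (?V \<omega>, w) \<partial>K) = a \<omega> * (nu B + (?g \<omega> - p) * \<beta> B)"
      using affine[OF B theta_bounds] by simp
  qed
  finally show ?thesis .
qed

text \<open>
  For a test function of the past output the tilt of the parameter integrates to zero, by the defining property
  of the conditional probability subtracted in it.
\<close>

lemma indep_step:
  assumes a: "a \<in> borel_measurable (G n)" "\<And>\<omega>. \<omega> \<in> space Om \<Longrightarrow> \<bar>a \<omega>\<bar> \<le> 1" and B: "B \<in> sets T"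
  shows "(\<integral>\<omega>. a \<omega> * indicator B (X n \<omega>) \<partial>Om) = nu B * (\<integral>\<omega>. a \<omega> \<partial>Om)"
proof -
  have aF: "a \<in> borel_measurable (F n)" by (rule measurable_from_subalg[OF G_F a(1)])
  have [measurable]: "a \<in> borel_measurable Om" "A n \<in> sets Om" "cprob Om (G n) (A n) \<in> borel_measurable Om"
    using measurable_from_subalg[OF G_sub a(1)] A_Om measurable_from_subalg[OF G_sub measurable_cprob] by auto
  have i: "integrable Om a" "integrable Om (\<lambda>\<omega>. a \<omega> * indicator (A n) \<omega>)" "integrable Om (\<lambda>\<omega>. a \<omega> * cprob Om (G n) (A n) \<omega>)"
    using a(2) cprob_bounds[of Om "G n" "A n"]
    by (auto intro!: Om.integrable_bounded[of _ 1] simp: abs_mult mult_le_one indicator_def)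
  have "(\<integral>\<omega>. a \<omega> * indicator B (X n \<omega>) \<partial>Om) = (\<integral>\<omega>. nu B * a \<omega> + (kap * \<beta> B) * (a \<omega> * indicator (A n) \<omega>) - (kap * \<beta> B) * (a \<omega> * cprob Om (G n) (A n) \<omega>) \<partial>Om)"
    by (rule trans[OF fubini_coord[OF aF a(2) B]])
      (auto simp: algebra_simps theta_eq intro!: Bochner_Integration.integral_cong)
  also have "\<dots> = nu B * (\<integral>\<omega>. a \<omega> \<partial>Om) + (kap * \<beta> B) * (\<integral>\<omega>. a \<omega> * indicator (A n) \<omega> \<partial>Om) - (kap * \<beta> B) * (\<integral>\<omega>. a \<omega> * cprob Om (G n) (A n) \<omega> \<partial>Om)"
    using i by simp
  finally show ?thesis using Om.cprob_integral[OF G_sub A_Om a] by simp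
qed

lemma prob_X_all:
  assumes "\<And>i. B i \<in> sets T"
  shows "Om.prob {\<omega>\<in>space Om. \<forall>i<n. X i \<omega> \<in> B i} = (\<Prod>i<n. nu (B i))"
proof (induction n)
  case 0
  then show ?case by (simp add: Om.prob_space)
next
  case (Suc n)
  let ?H = "{\<omega>\<in>space Om. \<forall>i<n. X i \<omega> \<in> B i}"
  have HG: "?H \<in> sets (G n)"
  proof -
    have "{\<omega>\<in>space (G n). \<forall>i\<in>{..<n}. X i \<omega> \<in> B i} \<in> sets (G n)"
    proof (intro sets.sets_Collect_finite_All)
      fix i assume "i \<in> {..<n}"
      then show "{\<omega>\<in>space (G n). X i \<omega> \<in> B i} \<in> sets (G n)"
        using measurable_sets[OF X_G assms] by (simp add: vimage_def Int_def conj_commute)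
    qed simp
    then show ?thesis by (simp only: space_G Ball_def lessThan_iff)
  qed
  then have HO: "?H \<in> sets Om" using G_sub[of n] unfolding subalgebra_def by blast
  have XO: "{\<omega>\<in>space Om. X n \<omega> \<in> B n} \<in> sets Om"
    using measurable_sets[OF X_Om assms] by (simp add: vimage_def Int_def conj_commute)
  have pr: "(\<integral>\<omega>. (indicator C \<omega> :: real) \<partial>Om) = Om.prob C" if "C \<in> sets Om" for C
    using that by simp
  have "Om.prob {\<omega>\<in>space Om. \<forall>i<Suc n. X i \<omega> \<in> B i} = Om.prob (?H \<inter> {\<omega>\<in>space Om. X n \<omega> \<in> B n})"
    by (rule arg_cong[where f = Om.prob]) (auto simp: less_Suc_eq)
  also have "\<dots> = (\<integral>\<omega>. (indicator (?H \<inter> {\<omega>\<in>space Om. X n \<omega> \<in> B n}) \<omega> :: real) \<partial>Om)"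
    by (rule pr[OF sets.Int[OF HO XO], symmetric])
  also have "\<dots> = (\<integral>\<omega>. indicator ?H \<omega> * indicator (B n) (X n \<omega>) \<partial>Om)"
    by (intro Bochner_Integration.integral_cong refl) (simp add: indicator_def)
  also have "\<dots> = nu (B n) * (\<integral>\<omega>. indicator ?H \<omega> \<partial>Om)"
    by (rule indep_step[OF borel_measurable_indicator[OF HG] _ assms]) (simp add: indicator_def)
  also have "(\<integral>\<omega>. indicator ?H \<omega> \<partial>Om) = Om.prob ?H" by (rule pr[OF HO])
  also have "\<dots> = (\<Prod>i<n. nu (B i))" by (rule Suc)
  also have "nu (B n) * \<dots> = (\<Prod>i<Suc n. nu (B i))" by (simp only: prod.lessThan_Suc mult.commute)
  finally show ?case .
qed

definition Xs :: "(nat \<Rightarrow> 'k) \<Rightarrow> nat \<Rightarrow> 't" where "Xs \<omega> n = X n \<omega>"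

lemma Xs_Om: "Xs \<in> measurable Om (\<Pi>\<^sub>M n\<in>UNIV. T)"
  unfolding Xs_def[abs_def] by (intro measurable_PiM_single' X_Om) (auto intro: measurable_space[OF X_Om])

theorem distr_Xs: "distr Om (\<Pi>\<^sub>M n\<in>UNIV. T) Xs = (\<Pi>\<^sub>M n\<in>UNIV. distr K T (x p))"
proof (rule measure_eqI_PiM_infinite)
  have xp: "x p \<in> measurable K T"
    using measurable_compose[OF _ x_meas, of "\<lambda>w. (p, w)" K] by simp
  interpret P: prob_space "distr K T (x p)" by (rule K.prob_space_distr[OF xp])
  interpret PP: product_prob_space "\<lambda>_. distr K T (x p)" "UNIV :: nat set" by unfold_locales
  show "sets (distr Om (\<Pi>\<^sub>M n\<in>UNIV. T) Xs) = sets (\<Pi>\<^sub>M n\<in>UNIV. T)" by simp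
  show "sets (\<Pi>\<^sub>M n\<in>UNIV. distr K T (x p)) = sets (\<Pi>\<^sub>M n\<in>UNIV. T)" by (intro sets_PiM_cong) auto
  show "finite_measure (distr Om (\<Pi>\<^sub>M n\<in>UNIV. T) Xs)"
    using Om.prob_space_distr[OF Xs_Om] by (simp add: prob_space_def)
  fix C and J :: "nat set" assume J: "finite J" "J \<subseteq> UNIV" "\<And>i. i \<in> J \<Longrightarrow> C i \<in> sets T"
  obtain n where n: "J \<subseteq> {..<n}" using finite_nat_iff_bounded J(1) by blast
  define B where "B i = (if i \<in> J then C i else space T)" for i
  have B: "B i \<in> sets T" for i using J(3) by (auto simp: B_def)
  have em: "prod_emb UNIV (\<lambda>_. T) J (Pi\<^sub>E J C) = {f\<in>space (\<Pi>\<^sub>M n\<in>UNIV. T). \<forall>i\<in>J. f i \<in> C i}"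
    by (auto simp: prod_emb_def space_PiM PiE_iff)
  have es: "prod_emb UNIV (\<lambda>_. T) J (Pi\<^sub>E J C) \<in> sets (\<Pi>\<^sub>M n\<in>UNIV. T)" using J by (intro sets_PiM_I) auto
  have pre: "Xs -` prod_emb UNIV (\<lambda>_. T) J (Pi\<^sub>E J C) \<inter> space Om = {\<omega>\<in>space Om. \<forall>i<n. X i \<omega> \<in> B i}"
    using n measurable_space[OF X_Om] measurable_space[OF Xs_Om] unfolding em by (auto simp: B_def Xs_def)
  have 1: "emeasure (distr Om (\<Pi>\<^sub>M n\<in>UNIV. T) Xs) (prod_emb UNIV (\<lambda>_. T) J (Pi\<^sub>E J C)) = ennreal (\<Prod>i<n. nu (B i))"
    using es by (subst emeasure_distr[OF Xs_Om]) (auto simp: pre Om.emeasure_eq_measure prob_X_all[OF B])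
  have nuB: "nu (B i) = measure (distr K T (x p)) (B i)" for i
    using B[of i] by (subst measure_distr[OF xp]) (auto simp: vimage_def Int_def conj_commute intro!: arg_cong[where f = K.prob])
  have nu1: "nu (B i) = 1" if "i \<notin> J" for i
    using that P.prob_space by (simp only: nuB) (simp add: B_def)
  have "emeasure (\<Pi>\<^sub>M n\<in>UNIV. distr K T (x p)) (prod_emb UNIV (\<lambda>_. T) J (Pi\<^sub>E J C)) = (\<Prod>i\<in>J. emeasure (distr K T (x p)) (C i))"
    using PP.emeasure_PiM_emb[of J C] J by (simp add: prod_emb_def)
  also have "\<dots> = (\<Prod>i\<in>J. ennreal (nu (B i)))"
    by (intro prod.cong refl) (metis (no_types) B_def P.emeasure_eq_measure nuB)
  also have "\<dots> = (\<Prod>i<n. ennreal (nu (B i)))"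
    using n nu1 by (intro prod.mono_neutral_left) auto
  also have "\<dots> = ennreal (\<Prod>i<n. nu (B i))" by (simp add: prod_ennreal)
  finally show "emeasure (distr Om (\<Pi>\<^sub>M n\<in>UNIV. T) Xs) (prod_emb UNIV (\<lambda>_. T) J (Pi\<^sub>E J C)) =
      emeasure (\<Pi>\<^sub>M n\<in>UNIV. distr K T (x p)) (prod_emb UNIV (\<lambda>_. T) J (Pi\<^sub>E J C))" using 1 by simp
qed

lemma ev_Om: "ev i k \<in> sets Om"
  using measurable_sets[OF coord_Om E] by (simp add: ev_def vimage_def Int_def conj_commute)

text \<open>
  The correlation of the new output with the unexplained part of the event is proportional to the conditional
  variance itself, because the parameter contains this very part.
\<close>

lemma cvar_step:
  assumes A: "A n = e" and e: "e \<in> sets Om"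
  shows "(\<beta> B0 * kap * cvar Om (G n) e)\<^sup>2 \<le> cvar Om (G n) e - cvar Om (G (Suc n)) e"
proof -
  let ?m = "cprob Om (G n) e"
  have [measurable]: "?m \<in> borel_measurable Om" by (rule measurable_from_subalg[OF G_sub measurable_cprob])
  have [measurable]: "e \<in> sets Om" by (rule e)
  have im: "integrable Om ?m" "integrable Om (indicator e :: _ \<Rightarrow> real)"
    using cprob_bounds[of Om "G n" e] by (auto intro!: Om.integrable_bounded[of _ 1] simp: indicator_def)
  have b: "\<bar>indicator e \<omega> - ?m \<omega>\<bar> \<le> 1" for \<omega> using cprob_bounds[of Om "G n" e \<omega>] by (auto simp: indicator_def)
  have aF: "(\<lambda>\<omega>. indicator e \<omega> - ?m \<omega>) \<in> borel_measurable (F n)"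
    using A_F[of n] measurable_from_subalg[OF G_F measurable_cprob] unfolding A by (intro borel_measurable_diff) auto
  have i: "integrable Om (\<lambda>\<omega>. indicator e \<omega> - ?m \<omega>)" "integrable Om (\<lambda>\<omega>. (indicator e \<omega> - ?m \<omega>)\<^sup>2)"
    using b by (auto intro!: Om.integrable_bounded[of _ 1] simp: abs_square_le_1)
  have "(\<lambda>\<omega>. indicator B0 (X n \<omega>) :: real) \<in> borel_measurable (G (Suc n))"
    using X_G[of n "Suc n"] B0(1) by measurable
  from Om.cvar_diff_ge[OF G_sub G_sub G_mono e this]
  have le: "(\<integral>\<omega>. (indicator e \<omega> - ?m \<omega>) * indicator B0 (X n \<omega>) \<partial>Om)\<^sup>2 \<le> cvar Om (G n) e - cvar Om (G (Suc n)) e"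
    by (auto simp: indicator_def)
  have "(\<integral>\<omega>. (indicator e \<omega> - ?m \<omega>) * indicator B0 (X n \<omega>) \<partial>Om) =
      (\<integral>\<omega>. nu B0 * (indicator e \<omega> - ?m \<omega>) + (\<beta> B0 * kap) * (indicator e \<omega> - ?m \<omega>)\<^sup>2 \<partial>Om)"
    by (rule trans[OF fubini_coord[OF aF b B0(1)]])
      (auto simp: algebra_simps power2_eq_square theta_eq A intro!: Bochner_Integration.integral_cong)
  also have "\<dots> = nu B0 * (\<integral>\<omega>. indicator e \<omega> - ?m \<omega> \<partial>Om) + (\<beta> B0 * kap) * cvar Om (G n) e"
    unfolding cvar_def using i by (subst Bochner_Integration.integral_add) auto
  also have "(\<integral>\<omega>. indicator e \<omega> - ?m \<omega> \<partial>Om) = 0"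
    using Om.cprob_integral[OF G_sub[of n] e, where g = "\<lambda>_. 1" and C = 1] e cprob_bounds[of Om "G n" e]
    by (simp add: Bochner_Integration.integral_diff im)
  finally show ?thesis using le by simp
qed

lemma A_infinitely_often: "\<exists>n\<ge>N. A n = ev i k"
proof -
  let ?n = "prod_encode (prod_encode (i, k), max N (Suc i))"
  have "max N (Suc i) \<le> ?n" by (rule le_prod_encode_2)
  then show ?thesis by (intro exI[of _ ?n]) (auto simp: A_def)
qed

text \<open>
  The conditional variance decreases to a limit \<open>L\<close>. Infinitely often it drops by at least a fixed multiple of
  its square, which forces \<open>L = 0\<close>.
\<close>

lemma cvar_tendsto_0: "(\<lambda>n. cvar Om (G n) (ev i k)) \<longlonglongrightarrow> 0"
proof -
  let ?v = "\<lambda>n. cvar Om (G n) (ev i k)"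
  have dec: "decseq ?v"
    unfolding decseq_def by (intro allI impI Om.cvar_mono G_sub G_mono ev_Om)
  then obtain L where L: "?v \<longlonglongrightarrow> L" "\<And>n. L \<le> ?v n"
    using decseq_convergent[OF dec, of 0] cvar_nonneg by blast
  have L0: "0 \<le> L" by (rule LIMSEQ_le_const[OF L(1)]) (auto simp: cvar_nonneg)
  have d: "(\<lambda>n. ?v n - ?v (Suc n)) \<longlonglongrightarrow> L - L" by (intro tendsto_diff L LIMSEQ_Suc)
  have "(\<beta> B0 * kap * L)\<^sup>2 \<le> 0"
  proof (rule ccontr)
    assume "\<not> (\<beta> B0 * kap * L)\<^sup>2 \<le> 0"
    then have "\<forall>\<^sub>F n in sequentially. ?v n - ?v (Suc n) < (\<beta> B0 * kap * L)\<^sup>2"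
      using order_tendstoD(2)[OF d] by simp
    then obtain N where N: "\<And>n. n \<ge> N \<Longrightarrow> ?v n - ?v (Suc n) < (\<beta> B0 * kap * L)\<^sup>2"
      by (auto simp: eventually_sequentially)
    obtain n where n: "n \<ge> N" "A n = ev i k" using A_infinitely_often by blast
    have "(\<beta> B0 * kap * L)\<^sup>2 \<le> (\<beta> B0 * kap * ?v n)\<^sup>2"
      using L(2)[of n] L0 by (simp add: power_mult_distrib mult_left_mono power_mono)
    with N[OF n(1)] cvar_step[OF n(2) ev_Om] show False by linarith
  qed
  then have "L = 0" using B0(2) kap by simp
  with L show ?thesis by simp
qed

theorem coordinate_event_determined:
  "\<exists>H\<in>sets (\<Pi>\<^sub>M n\<in>UNIV. T). AE \<omega> in Om. \<omega> i \<in> E k \<longleftrightarrow> Xs \<omega> \<in> H"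
proof -
  let ?G = "vimage_algebra (space Om) Xs (\<Pi>\<^sub>M n\<in>UNIV. T)"
  have Xsf: "Xs \<in> space Om \<rightarrow> space (\<Pi>\<^sub>M n\<in>UNIV. T)" by (rule funcsetI) (rule measurable_space[OF Xs_Om])
  have sub: "subalgebra Om ?G"
    by (intro subalgebraI_measurable measurable_vimage_algebra2 Xs_Om) auto
  have subG: "subalgebra ?G (G n)" for n
  proof (rule subalgebraI_measurable)
    have XG: "X i \<in> measurable ?G T" for i
      using measurable_compose[OF measurable_vimage_algebra1[OF Xsf] measurable_component_singleton[of i]] by (simp add: Xs_def)
    have "(\<lambda>\<omega>. \<omega>) \<in> measurable ?G (vimage_algebra (space Om) (S n) (\<Pi>\<^sub>M i\<in>{..<n}. T))"
    proof (rule measurable_vimage_algebra2)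
      show "S n \<in> measurable ?G (\<Pi>\<^sub>M i\<in>{..<n}. T)" unfolding S_eq[abs_def] by (intro measurable_restrict XG)
    qed simp
    then show "(\<lambda>\<omega>. \<omega>) \<in> measurable ?G (G n)" by (simp add: G_def)
  qed simp
  have "cvar Om ?G (ev i k) \<le> 0"
    using Om.cvar_mono[OF G_sub sub subG ev_Om] by (intro LIMSEQ_le_const[OF cvar_tendsto_0[of i k]]) auto
  then have "cvar Om ?G (ev i k) = 0" using cvar_nonneg[of Om ?G "ev i k"] by linarith
  from Om.cvar_zero_imp_event[OF sub ev_Om this]
  have ae: "AE \<omega> in Om. \<omega> \<in> ev i k \<longleftrightarrow> \<omega> \<in> {\<omega>\<in>space Om. cprob Om ?G (ev i k) \<omega> > 1/2}" .
  have "{\<omega>\<in>space ?G. cprob Om ?G (ev i k) \<omega> > 1/2} \<in> sets ?G" by measurable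
  then obtain H where H: "H \<in> sets (\<Pi>\<^sub>M n\<in>UNIV. T)" "{\<omega>\<in>space Om. cprob Om ?G (ev i k) \<omega> > 1/2} = Xs -` H \<inter> space Om"
    unfolding sets_vimage_algebra2[OF Xsf] by auto
  show ?thesis
  proof (intro bexI[OF _ H(1)])
    show "AE \<omega> in Om. \<omega> i \<in> E k \<longleftrightarrow> Xs \<omega> \<in> H"
      using ae AE_space unfolding H(2) by eventually_elim (auto simp: ev_def)
  qed
qed

end

section \<open>Recovering random elements almost surely\<close>

text \<open>
  \<open>f\<close> is almost surely a measurable function of \<open>W\<close>. Recovering countably many events is turned into recovering
  values: for countably many values directly, for points through their dyadic approximations.
\<close>

definition determined :: "'w measure \<Rightarrow> ('w \<Rightarrow> 't) \<Rightarrow> 't measure \<Rightarrow> 'n measure \<Rightarrow> ('w \<Rightarrow> 'n) \<Rightarrow> bool" where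
  "determined M W T N f \<longleftrightarrow> (\<exists>\<phi>\<in>measurable T N. AE \<omega> in M. f \<omega> = \<phi> (W \<omega>))"

lemma determined_compose:
  assumes "determined M W T N f" "g \<in> measurable N N'" shows "determined M W T N' (\<lambda>\<omega>. g (f \<omega>))"
proof -
  obtain \<phi> where \<phi>: "\<phi> \<in> measurable T N" "AE \<omega> in M. f \<omega> = \<phi> (W \<omega>)" using assms(1) unfolding determined_def by blast
  have "AE \<omega> in M. g (f \<omega>) = g (\<phi> (W \<omega>))" using \<phi>(2) by eventually_elim simp
  then show ?thesis unfolding determined_def
    by (intro bexI[of _ "\<lambda>x. g (\<phi> x)"] measurable_compose[OF \<phi>(1) assms(2)])
qed

lemma determined_Pair:
  assumes "determined M W T N f" "determined M W T N' f'" shows "determined M W T (N \<Otimes>\<^sub>M N') (\<lambda>\<omega>. (f \<omega>, f' \<omega>))"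
proof -
  obtain \<phi> \<phi>' where \<phi>: "\<phi> \<in> measurable T N" "AE \<omega> in M. f \<omega> = \<phi> (W \<omega>)" "\<phi>' \<in> measurable T N'" "AE \<omega> in M. f' \<omega> = \<phi>' (W \<omega>)"
    using assms unfolding determined_def by blast
  have "AE \<omega> in M. (f \<omega>, f' \<omega>) = (\<phi> (W \<omega>), \<phi>' (W \<omega>))" using \<phi>(2,4) by eventually_elim simp
  then show ?thesis unfolding determined_def
    by (intro bexI[of _ "\<lambda>x. (\<phi> x, \<phi>' x)"] measurable_Pair \<phi>)
qed

lemma determined_PiM:
  assumes "\<And>i::nat. determined M W T (N i) (\<lambda>\<omega>. f \<omega> i)" shows "determined M W T (\<Pi>\<^sub>M i\<in>UNIV. N i) f"
proof -
  have "\<forall>i. \<exists>\<phi>. \<phi> \<in> measurable T (N i) \<and> (AE \<omega> in M. f \<omega> i = \<phi> (W \<omega>))"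
    using assms unfolding determined_def by blast
  then obtain \<phi> where \<phi>: "\<And>i. \<phi> i \<in> measurable T (N i)" "\<And>i. AE \<omega> in M. f \<omega> i = \<phi> i (W \<omega>)" by metis
  have "AE \<omega> in M. \<forall>i. f \<omega> i = \<phi> i (W \<omega>)" using \<phi>(2) by (simp add: AE_all_countable)
  then have "AE \<omega> in M. f \<omega> = (\<lambda>i. \<phi> i (W \<omega>))" by eventually_elim auto
  moreover have "(\<lambda>x i. \<phi> i x) \<in> measurable T (\<Pi>\<^sub>M i\<in>UNIV. N i)"
    by (intro measurable_PiM_single' \<phi>(1)) (auto intro: measurable_space[OF \<phi>(1)])
  ultimately show ?thesis unfolding determined_def by (intro bexI[of _ "\<lambda>x i. \<phi> i x"])
qed

lemma determined_countable:
  assumes C: "countable C" "\<And>\<omega>. f \<omega> \<in> C"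
    and H: "\<And>c. c \<in> C \<Longrightarrow> \<exists>H\<in>sets T. AE \<omega> in M. f \<omega> = c \<longleftrightarrow> W \<omega> \<in> H"
    and W: "W \<in> measurable M T"
  shows "determined M W T (count_space UNIV) f"
proof -
  have "C \<noteq> {}" using C(2) by blast
  then have e: "range (from_nat_into C) = C" by (rule range_from_nat_into[OF _ C(1)])
  have "\<forall>n. \<exists>H. H \<in> sets T \<and> (AE \<omega> in M. f \<omega> = from_nat_into C n \<longleftrightarrow> W \<omega> \<in> H)"
    using H from_nat_into[OF \<open>C \<noteq> {}\<close>] by blast
  then obtain H where H: "\<And>n. H n \<in> sets T" "\<And>n. AE \<omega> in M. f \<omega> = from_nat_into C n \<longleftrightarrow> W \<omega> \<in> H n" by metis
  define \<phi> where "\<phi> x = from_nat_into C (LEAST n. x \<in> H n)" for x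
  note [measurable] = H(1)
  have "(\<lambda>x. LEAST n. x \<in> H n) \<in> measurable T (count_space UNIV)" by measurable
  then have m: "\<phi> \<in> measurable T (count_space UNIV)"
    unfolding \<phi>_def[abs_def] by (rule measurable_compose) simp
  have "AE \<omega> in M. \<forall>n. f \<omega> = from_nat_into C n \<longleftrightarrow> W \<omega> \<in> H n" using H(2) by (simp add: AE_all_countable)
  then have "AE \<omega> in M. f \<omega> = \<phi> (W \<omega>)"
  proof eventually_elim
    case (elim \<omega>)
    obtain n where "f \<omega> = from_nat_into C n" using C(2)[of \<omega>] e by (metis imageE)
    then have "W \<omega> \<in> H n" using elim by blast
    then have "W \<omega> \<in> H (LEAST n. W \<omega> \<in> H n)" by (rule LeastI)
    then show ?case using elim by (simp add: \<phi>_def)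
  qed
  with m show ?thesis unfolding determined_def by (intro bexI[of _ \<phi>])
qed

definition dyadic_point :: "nat \<Rightarrow> 'a::euclidean_space \<Rightarrow> 'a" where
  "dyadic_point n x = (\<Sum>b\<in>Basis. (real_of_int \<lfloor>2 ^ n * (x \<bullet> b)\<rfloor> / 2 ^ n) *\<^sub>R b)"

lemma dyadic_point_countable: "countable (range (dyadic_point n :: 'a::euclidean_space \<Rightarrow> 'a))"
proof -
  have "range (dyadic_point n :: 'a \<Rightarrow> 'a) \<subseteq> (\<lambda>z. \<Sum>b\<in>Basis. (real_of_int (z b) / 2 ^ n) *\<^sub>R b) ` (Basis \<rightarrow>\<^sub>E (UNIV :: int set))"
  proof safe
    fix x :: 'a
    have "dyadic_point n x = (\<Sum>b\<in>Basis. (real_of_int (restrict (\<lambda>b. \<lfloor>2 ^ n * (x \<bullet> b)\<rfloor>) Basis b) / 2 ^ n) *\<^sub>R b)"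
      unfolding dyadic_point_def by (intro sum.cong) auto
    then show "dyadic_point n x \<in> (\<lambda>z. \<Sum>b\<in>Basis. (real_of_int (z b) / 2 ^ n) *\<^sub>R b) ` (Basis \<rightarrow>\<^sub>E (UNIV :: int set))"
      by (rule image_eqI[where x = "restrict (\<lambda>b. \<lfloor>2 ^ n * (x \<bullet> b)\<rfloor>) Basis"]) simp
  qed
  moreover have "countable (Basis \<rightarrow>\<^sub>E (UNIV :: int set) :: ('a \<Rightarrow> int) set)"
    by (intro countable_PiE) auto
  ultimately show ?thesis by (meson countable_image countable_subset)
qed

lemma dyadic_point_measurable [measurable]: "dyadic_point n \<in> borel_measurable borel"
  unfolding dyadic_point_def[abs_def] by measurable

lemma dyadic_point_tendsto: "(\<lambda>n. dyadic_point n x) \<longlonglongrightarrow> x"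
proof -
  have "(\<lambda>n. real_of_int \<lfloor>2 ^ n * c\<rfloor> / 2 ^ n) \<longlonglongrightarrow> c" for c :: real
  proof (rule tendsto_sandwich)
    show "\<forall>\<^sub>F n in sequentially. c - 1 / 2 ^ n \<le> real_of_int \<lfloor>2 ^ n * c\<rfloor> / 2 ^ n"
    proof (intro always_eventually allI)
      fix n
      have "2 ^ n * c - 1 \<le> real_of_int \<lfloor>2 ^ n * c\<rfloor>" by linarith
      then have "(2 ^ n * c - 1) / 2 ^ n \<le> real_of_int \<lfloor>2 ^ n * c\<rfloor> / 2 ^ n" by (rule divide_right_mono) simp
      then show "c - 1 / 2 ^ n \<le> real_of_int \<lfloor>2 ^ n * c\<rfloor> / 2 ^ n" by (simp add: diff_divide_distrib)
    qed
    show "\<forall>\<^sub>F n in sequentially. real_of_int \<lfloor>2 ^ n * c\<rfloor> / 2 ^ n \<le> c"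
    proof (intro always_eventually allI)
      fix n
      have "real_of_int \<lfloor>2 ^ n * c\<rfloor> \<le> 2 ^ n * c" by linarith
      then show "real_of_int \<lfloor>2 ^ n * c\<rfloor> / 2 ^ n \<le> c" by (simp add: field_simps)
    qed
    have "(\<lambda>n. 1 / 2 ^ n :: real) \<longlonglongrightarrow> 0" by (rule LIMSEQ_divide_realpow_zero) simp
    from tendsto_diff[OF tendsto_const this] show "(\<lambda>n. c - 1 / 2 ^ n) \<longlonglongrightarrow> c" by simp
  qed simp
  then have "(\<lambda>n. dyadic_point n x) \<longlonglongrightarrow> (\<Sum>b\<in>Basis. (x \<bullet> b) *\<^sub>R b)"
    unfolding dyadic_point_def by (intro tendsto_sum tendsto_scaleR tendsto_const)
  then show ?thesis by (simp add: euclidean_representation)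
qed

lemma determined_point:
  fixes f :: "'w \<Rightarrow> 'a::euclidean_space"
  assumes H: "\<And>n c. c \<in> range (dyadic_point n :: 'a \<Rightarrow> 'a) \<Longrightarrow> \<exists>H\<in>sets T. AE \<omega> in M. dyadic_point n (f \<omega>) = c \<longleftrightarrow> W \<omega> \<in> H"
    and W: "W \<in> measurable M T"
  shows "determined M W T borel f"
proof -
  have "determined M W T borel (\<lambda>\<omega>. dyadic_point n (f \<omega>))" for n
  proof -
    have "determined M W T (count_space UNIV) (\<lambda>\<omega>. dyadic_point n (f \<omega>))"
      by (rule determined_countable[OF dyadic_point_countable _ H W]) auto
    from determined_compose[OF this, of "\<lambda>x. x" borel] show ?thesis by simp
  qed
  then have "\<forall>n. \<exists>\<phi>. \<phi> \<in> borel_measurable T \<and> (AE \<omega> in M. dyadic_point n (f \<omega>) = \<phi> (W \<omega>))"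
    unfolding determined_def by blast
  then obtain \<phi> where \<phi>[measurable]: "\<And>n. \<phi> n \<in> borel_measurable T" and ae: "\<And>n. AE \<omega> in M. dyadic_point n (f \<omega>) = \<phi> n (W \<omega>)"
    by metis
  have "(\<lambda>x. lim (\<lambda>n. \<phi> n x)) \<in> borel_measurable T" by measurable
  moreover have "AE \<omega> in M. \<forall>n. dyadic_point n (f \<omega>) = \<phi> n (W \<omega>)" using ae by (simp add: AE_all_countable)
  then have "AE \<omega> in M. f \<omega> = lim (\<lambda>n. \<phi> n (W \<omega>))"
  proof eventually_elim
    case (elim \<omega>)
    then have "(\<lambda>n. \<phi> n (W \<omega>)) \<longlonglongrightarrow> f \<omega>" using dyadic_point_tendsto[of "f \<omega>"] by simp
    then show ?case by (simp add: limI)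
  qed
  ultimately show ?thesis unfolding determined_def by (intro bexI[of _ "\<lambda>x. lim (\<lambda>n. \<phi> n x)"])
qed

text \<open>
  Countably many events that separate the outcomes underlying a Poisson process.
\<close>

definition pp_events :: "(nat \<Rightarrow> nat \<times> (nat \<Rightarrow> 'a::euclidean_space)) set set" where
  "pp_events = (\<Union>k. \<Union>m. {{w. fst (w k) = m}}) \<union>
     (\<Union>k. \<Union>i. \<Union>n. (\<lambda>c. {w. dyadic_point n (snd (w k) i) = c}) ` range (dyadic_point n))"

lemma countable_pp_events: "countable pp_events"
  unfolding pp_events_def by (intro countable_Un countable_UN countable_image dyadic_point_countable) auto

lemma pp_events_sets:
  assumes "e \<in> pp_events" shows "e \<in> sets (pp_space lam :: (nat \<Rightarrow> nat \<times> (nat \<Rightarrow> 'a::euclidean_space)) measure)"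
proof -
  let ?C = "count_space UNIV \<Otimes>\<^sub>M (\<Pi>\<^sub>M i\<in>UNIV. (borel :: 'a measure)) :: (nat \<times> (nat \<Rightarrow> 'a)) measure"
  let ?N = "\<Pi>\<^sub>M k\<in>UNIV. ?C"
  have k: "(\<lambda>w. w k) \<in> measurable ?N ?C" for k by (rule measurable_component_singleton) simp
  have 1: "(\<lambda>w. fst (w k)) \<in> measurable ?N (count_space UNIV)" for k
    using measurable_compose[OF k measurable_fst] .
  have 2: "(\<lambda>w. snd (w k) i) \<in> measurable ?N borel" for k i
    using measurable_compose[OF measurable_compose[OF k measurable_snd] measurable_component_singleton[of i UNIV "\<lambda>_. borel"]] by simp
  have sp: "space ?N = UNIV" by (simp add: space_PiM space_pair_measure)
  from assms consider (a) k m where "e = {w. fst (w k) = m}" | (b) k i n c where "e = {w. dyadic_point n (snd (w k) i) = c}"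
    by (auto simp: pp_events_def)
  then have "e \<in> sets ?N"
  proof cases
    case a
    have "(\<lambda>w. fst (w k)) -` {m} \<inter> space ?N \<in> sets ?N" by (rule measurable_sets[OF 1]) simp
    moreover have "(\<lambda>w. fst (w k)) -` {m} \<inter> space ?N = e" by (auto simp: a sp)
    ultimately show ?thesis by simp
  next
    case b
    have "(\<lambda>w. dyadic_point n (snd (w k) i)) -` {c} \<inter> space ?N \<in> sets ?N"
      by (rule measurable_sets[OF measurable_compose[OF 2 dyadic_point_measurable]]) simp
    moreover have "(\<lambda>w. dyadic_point n (snd (w k) i)) -` {c} \<inter> space ?N = e" by (auto simp: b sp)
    ultimately show ?thesis by simp
  qed
  then show ?thesis unfolding sets_pp_space .
qed

lemma determined_pp:
  fixes f :: "'w \<Rightarrow> nat \<Rightarrow> nat \<times> (nat \<Rightarrow> 'a::euclidean_space)"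
  assumes H: "\<And>e. e \<in> pp_events \<Longrightarrow> \<exists>H\<in>sets T. AE \<omega> in M. f \<omega> \<in> e \<longleftrightarrow> W \<omega> \<in> H"
    and W: "W \<in> measurable M T"
  shows "determined M W T config_space (\<lambda>\<omega>. pp_map (f \<omega>))"
proof -
  have "determined M W T (\<Pi>\<^sub>M k\<in>UNIV. count_space UNIV \<Otimes>\<^sub>M (\<Pi>\<^sub>M i\<in>UNIV. (borel :: 'a measure))) f"
  proof (rule determined_PiM)
    fix k
    have 1: "determined M W T (count_space UNIV) (\<lambda>\<omega>. fst (f \<omega> k))"
    proof (rule determined_countable[OF _ _ _ W])
      fix m :: nat
      have "{w. fst (w k) = m} \<in> (pp_events :: (nat \<Rightarrow> nat \<times> (nat \<Rightarrow> 'a)) set set)" unfolding pp_events_def by blast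
      from H[OF this] show "\<exists>H\<in>sets T. AE \<omega> in M. fst (f \<omega> k) = m \<longleftrightarrow> W \<omega> \<in> H" by simp
    qed auto
    have 2: "determined M W T (\<Pi>\<^sub>M i\<in>UNIV. (borel :: 'a measure)) (\<lambda>\<omega>. snd (f \<omega> k))"
    proof (rule determined_PiM, rule determined_point[OF _ W])
      fix i n and c :: 'a assume "c \<in> range (dyadic_point n :: 'a \<Rightarrow> 'a)"
      then have "{w. dyadic_point n (snd (w k) i) = c} \<in> (pp_events :: (nat \<Rightarrow> nat \<times> (nat \<Rightarrow> 'a)) set set)"
        unfolding pp_events_def by (intro UnI2 UN_I[of k] UN_I[of i] UN_I[of n] imageI UNIV_I)
      from H[OF this] show "\<exists>H\<in>sets T. AE \<omega> in M. dyadic_point n (snd (f \<omega> k) i) = c \<longleftrightarrow> W \<omega> \<in> H" by simp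
    qed
    from determined_Pair[OF 1 2] show "determined M W T (count_space UNIV \<Otimes>\<^sub>M (\<Pi>\<^sub>M i\<in>UNIV. (borel :: 'a measure))) (\<lambda>\<omega>. f \<omega> k)" by simp
  qed
  moreover have "pp_map \<in> measurable (\<Pi>\<^sub>M k\<in>UNIV. count_space UNIV \<Otimes>\<^sub>M (\<Pi>\<^sub>M i\<in>UNIV. (borel :: 'a measure))) config_space"
    using void_processD(2)[OF void_process_pp[OF zero_less_one, where ?'a = 'a]]
    unfolding measurable_cong_sets[OF sets_pp_space[of 1] refl] .
  ultimately show ?thesis by (rule determined_compose)
qed

section \<open>Coding the blocks of a column\<close>

lemma single_point_prob:
  fixes X :: "'w \<Rightarrow> 'a::euclidean_space set"
  assumes X: "void_process M X (leb lam)" and lam: "0 \<le> lam"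
    and D: "D \<in> sets borel" "bounded D" and C: "C \<in> sets borel"
  shows "measure M {\<omega>\<in>space M. card (X \<omega> \<inter> D) = 1 \<and> X \<omega> \<inter> D \<inter> C = {}} = leb lam (D - C) * exp (- leb lam D)"
proof -
  note XD = void_processD[OF X]
  interpret M: prob_space M by fact
  define R where "R i = (if i then D - C else D \<inter> C)" for i
  have R: "R i \<in> sets borel" "bounded (R i)" for i
    using D C by (auto simp: R_def intro: bounded_subset)
  have "M.indep_vars (\<lambda>_. config_space) (\<lambda>i \<omega>. X \<omega> \<inter> R i) UNIV"
    by (rule indep_restrictions[OF X]) (use R in \<open>auto simp: disjoint_family_on_def R_def\<close>)
  moreover define A where "A i = (if i then {S\<in>space config_space. card (S \<inter> (D - C)) = 1} else {S\<in>space config_space. S \<inter> (D \<inter> C) = {}})" for i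
  have A: "A i \<in> sets config_space" for i
  proof -
    have [measurable]: "(\<lambda>S. real (card (S \<inter> (D - C)))) \<in> borel_measurable config_space"
      using R[of True] by (intro measurable_card_config) (auto simp: R_def)
    have "{S\<in>space config_space. real (card (S \<inter> (D - C))) = real 1} \<in> sets config_space" by measurable
    then show ?thesis using sets_void[OF R(1)[of False]] by (simp only: A_def R_def of_nat_eq_iff if_False split: if_split) simp
  qed
  ultimately have "M.prob (\<Inter>i\<in>UNIV. (\<lambda>\<omega>. X \<omega> \<inter> R i) -` A i \<inter> space M) = (\<Prod>i\<in>UNIV. M.prob ((\<lambda>\<omega>. X \<omega> \<inter> R i) -` A i \<inter> space M))"
    by (intro M.indep_varsD_finite) auto
  moreover have lfX: "locally_finite_set (X \<omega> \<inter> U)" if "\<omega> \<in> space M" for \<omega> U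
    using locally_finite_measurable[OF XD(2) that] by (rule locally_finite_mono) auto
  have "(\<lambda>\<omega>. X \<omega> \<inter> R True) -` A True \<inter> space M = {\<omega>\<in>space M. card (X \<omega> \<inter> (D - C)) = 1}"
    "(\<lambda>\<omega>. X \<omega> \<inter> R False) -` A False \<inter> space M = {\<omega>\<in>space M. X \<omega> \<inter> (D \<inter> C) = {}}"
    by (auto simp: A_def R_def space_config_space lfX Int_assoc)
  moreover have "{\<omega>\<in>space M. card (X \<omega> \<inter> (D - C)) = 1} \<inter> {\<omega>\<in>space M. X \<omega> \<inter> (D \<inter> C) = {}} =
      {\<omega>\<in>space M. card (X \<omega> \<inter> D) = 1 \<and> X \<omega> \<inter> D \<inter> C = {}}"
  proof -
    have "X \<omega> \<inter> D = X \<omega> \<inter> (D - C)" if "X \<omega> \<inter> D \<inter> C = {}" for \<omega> using that by auto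
    then show ?thesis by (auto simp: Int_assoc)
  qed
  ultimately have "M.prob {\<omega>\<in>space M. card (X \<omega> \<inter> D) = 1 \<and> X \<omega> \<inter> D \<inter> C = {}} =
      M.prob {\<omega>\<in>space M. card (X \<omega> \<inter> (D - C)) = 1} * M.prob {\<omega>\<in>space M. X \<omega> \<inter> (D \<inter> C) = {}}"
    by (simp add: UNIV_bool Int_commute mult.commute)
  also have "\<dots> = (exp (- leb lam (D - C)) * leb lam (D - C)) * exp (- leb lam (D \<inter> C))"
    using void_card_distribution[OF X lam, of "D - C" 1] XD(3)[of "D \<inter> C"] R[of True] R[of False] by (simp add: R_def)
  also have "\<dots> = leb lam (D - C) * exp (- leb lam (D - C) - leb lam (D \<inter> C))"
    by (simp add: exp_diff exp_minus divide_inverse)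
  also have "leb lam (D - C) + leb lam (D \<inter> C) = leb lam D"
  proof -
    have "measure lborel ((D - C) \<union> (D \<inter> C)) = measure lborel (D - C) + measure lborel (D \<inter> C)"
      using R[of True] R[of False] emeasure_bounded_finite
      by (intro measure_Un2[THEN trans]) (auto simp: R_def fmeasurable_def intro!: arg_cong[where f = "measure lborel"])
    moreover have "(D - C) \<union> (D \<inter> C) = D" by blast
    ultimately show ?thesis by (simp add: distrib_left)
  qed
  then have "- leb lam (D - C) - leb lam (D \<inter> C) = - leb lam D" by linarith
  finally show ?thesis .
qed

type_synonym 'a pp = "nat \<Rightarrow> nat \<times> (nat \<Rightarrow> 'a)"

text \<open>
  One block \<open>D\<close> of a column. An outcome of \<open>KK\<close> consists of independent raw data of a process of intensity \<open>lam\<close>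
  (giving \<open>X0\<close>), of two processes of intensity \<open>lam' - lam\<close> (giving \<open>Z0\<close> in the block and \<open>N0\<close> on the whole space), and
  of a uniform random number. The target of the coding is the process in the block, and \<open>Y0\<close> and \<open>N0\<close> are to be
  recovered.
\<close>

locale thicken_block =
  fixes lam lam' :: real and D :: "'a::euclidean_space set"
  assumes lam: "0 < lam" "lam < lam'"
    and D: "D \<in> sets borel" "bounded D" "0 < measure lborel D"
begin

abbreviation "mu \<equiv> lam' - lam"
abbreviation "P1 \<equiv> pp_space lam :: (nat \<Rightarrow> nat \<times> (nat \<Rightarrow> 'a)) measure"
abbreviation "P2 \<equiv> pp_space mu :: (nat \<Rightarrow> nat \<times> (nat \<Rightarrow> 'a)) measure"

definition "Q = P1 \<Otimes>\<^sub>M (P2 \<Otimes>\<^sub>M P2)"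
definition U :: "real measure" where "U = uniform_measure lborel {0..1}"
definition "KK = Q \<Otimes>\<^sub>M U"

definition X0 :: "'a pp \<times> 'a pp \<times> 'a pp \<Rightarrow> 'a set" where "X0 q = pp_map (fst q) \<inter> D"
definition Z0 :: "'a pp \<times> 'a pp \<times> 'a pp \<Rightarrow> 'a set" where "Z0 q = pp_map (fst (snd q)) \<inter> D"
definition Y0 :: "'a pp \<times> 'a pp \<times> 'a pp \<Rightarrow> 'a set" where "Y0 q = X0 q \<union> Z0 q"
definition N0 :: "'a pp \<times> 'a pp \<times> 'a pp \<Rightarrow> 'a set" where "N0 q = pp_map (snd (snd q))"
definition single :: "'a pp \<times> 'a pp \<times> 'a pp \<Rightarrow> bool" where "single q \<longleftrightarrow> card (X0 q) + card (Z0 q) = 1"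

text \<open>
  If the two processes together have exactly one point in the block, this point is kept with probability \<open>\<theta>\<close>;
  otherwise the first process is kept. Conditionally on a single point its position is uniform and comes from
  the first process with probability \<open>lam / lam'\<close>, so for this \<open>\<theta>\<close> the kept points are Poisson of intensity \<open>lam\<close>.
\<close>

definition coup :: "real \<Rightarrow> ('a pp \<times> 'a pp \<times> 'a pp) \<times> real \<Rightarrow> 'a set" where
  "coup \<theta> w = (if single (fst w) then (if snd w < \<theta> then Y0 (fst w) else {}) else X0 (fst w))"

lemma mu: "0 < mu" using lam by simp

sublocale P1: prob_space P1 by (rule prob_space_pp_space)
sublocale P2: prob_space P2 by (rule prob_space_pp_space)
sublocale PP: prob_space "P2 \<Otimes>\<^sub>M P2" by (intro prob_space_pair prob_space_pp_space)
sublocale Q: prob_space Q unfolding Q_def by (intro prob_space_pair prob_space_pp_space)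
sublocale U: prob_space U unfolding U_def by (rule prob_space_uniform_measure) auto
sublocale KK: prob_space KK unfolding KK_def by (intro prob_space_pair Q.prob_space_axioms U.prob_space_axioms)

lemma void_P1: "void_process P1 pp_map (leb lam)" by (rule void_process_pp[OF lam(1)])
lemma void_P2: "void_process P2 pp_map (leb mu)" by (rule void_process_pp[OF mu])

lemma space_Q [simp]: "space Q = UNIV" by (simp add: Q_def space_pair_measure)
lemma space_U [simp]: "space U = UNIV" by (simp add: U_def)
lemma sets_U: "sets U = sets borel" by (simp add: U_def)
lemma space_KK [simp]: "space KK = UNIV" by (simp add: KK_def space_pair_measure)

lemma prob_Q_Times:
  assumes "a \<in> sets P1" "b \<in> sets P2" "c \<in> sets P2"
  shows "Q.prob (a \<times> (b \<times> c)) = P1.prob a * (P2.prob b * P2.prob c)"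
proof -
  have "emeasure Q (a \<times> (b \<times> c)) = emeasure P1 a * (emeasure P2 b * emeasure P2 c)"
    unfolding Q_def using assms
    by (simp add: PP.emeasure_pair_measure_Times P2.emeasure_pair_measure_Times)
  then show ?thesis
    by (simp add: measure_def enn2real_mult)
qed

lemma sets_Q2:
  assumes "a \<in> sets P1" "b \<in> sets P2"
  shows "{q. fst q \<in> a \<and> fst (snd q) \<in> b} \<in> sets Q"
proof -
  have "a \<times> (b \<times> space P2) \<in> sets Q" unfolding Q_def by (intro pair_measureI assms sets.top)
  moreover have "{q. fst q \<in> a \<and> fst (snd q) \<in> b} = a \<times> (b \<times> space P2)" by auto
  ultimately show ?thesis by simp
qed

lemma prob_Q2:
  assumes "a \<in> sets P1" "b \<in> sets P2"
  shows "Q.prob {q. fst q \<in> a \<and> fst (snd q) \<in> b} = P1.prob a * P2.prob b"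
proof -
  have "{q. fst q \<in> a \<and> fst (snd q) \<in> b} = a \<times> (b \<times> space P2)" by auto
  then show ?thesis using prob_Q_Times[OF assms sets.top] P2.prob_space by simp
qed

lemma meas_pp [measurable]: "pp_map \<in> measurable P1 config_space" "pp_map \<in> measurable P2 config_space"
  using void_processD(2)[OF void_P1] void_processD(2)[OF void_P2] by auto

lemma meas_X0 [measurable]: "X0 \<in> measurable Q config_space"
proof -
  have "(\<lambda>q. pp_map (fst q)) \<in> measurable Q config_space"
    unfolding Q_def by (rule measurable_compose[OF measurable_fst meas_pp(1)])
  from measurable_compose[OF this measurable_config_Int[OF D(1)]] show ?thesis by (simp add: X0_def[abs_def])
qed

lemma meas_Z0 [measurable]: "Z0 \<in> measurable Q config_space"
proof -
  have "(\<lambda>q. pp_map (fst (snd q))) \<in> measurable Q config_space"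
    unfolding Q_def by (rule measurable_compose[OF measurable_compose[OF measurable_snd measurable_fst] meas_pp(2)])
  from measurable_compose[OF this measurable_config_Int[OF D(1)]] show ?thesis by (simp add: Z0_def[abs_def])
qed

lemma meas_Y0 [measurable]: "Y0 \<in> measurable Q config_space"
  unfolding Y0_def[abs_def] by (rule measurable_config_Un[OF meas_X0 meas_Z0])

lemma meas_N0 [measurable]: "N0 \<in> measurable Q config_space"
  unfolding Q_def N0_def[abs_def]
  by (rule measurable_compose[OF measurable_compose[OF measurable_snd measurable_snd] meas_pp(2)])

lemma card_D_meas:
  assumes "X \<in> measurable M config_space"
  shows "(\<lambda>\<omega>. real (card (X \<omega> \<inter> D))) \<in> borel_measurable M"
  by (rule measurable_card_config[OF assms D(1,2)])

lemma single_sets: "{q. single q} \<in> sets Q"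
proof -
  have [measurable]: "(\<lambda>q. real (card (X0 q))) \<in> borel_measurable Q" "(\<lambda>q. real (card (Z0 q))) \<in> borel_measurable Q"
    using card_D_meas[OF meas_X0] card_D_meas[OF meas_Z0] by (simp_all add: X0_def Z0_def Int_assoc)
  have "{q\<in>space Q. real (card (X0 q)) + real (card (Z0 q)) = real 1} \<in> sets Q" by measurable
  moreover have "{q\<in>space Q. real (card (X0 q)) + real (card (Z0 q)) = real 1} = {q. single q}"
    unfolding single_def of_nat_add[symmetric] of_nat_eq_iff by simp
  ultimately show ?thesis by simp
qed

lemma finite_pp_D: "finite (pp_map w \<inter> D)"
  using pp_map_locally_finite[of w] D(2) by (simp add: locally_finite_set_def)

lemma single_iff: "single q \<longleftrightarrow> (card (X0 q) = 1 \<and> Z0 q = {}) \<or> (X0 q = {} \<and> card (Z0 q) = 1)"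
proof -
  have "card (X0 q) = 0 \<longleftrightarrow> X0 q = {}" "card (Z0 q) = 0 \<longleftrightarrow> Z0 q = {}"
    using finite_pp_D by (simp_all add: X0_def Z0_def)
  then show ?thesis unfolding single_def by linarith
qed

lemma prob_one_point:
  assumes C: "C \<in> sets borel"
  shows "P1.prob {w. card (pp_map w \<inter> D) = 1 \<and> pp_map w \<inter> D \<inter> C = {}} = leb lam (D - C) * exp (- leb lam D)"
    "P2.prob {w. card (pp_map w \<inter> D) = 1 \<and> pp_map w \<inter> D \<inter> C = {}} = leb mu (D - C) * exp (- leb mu D)"
    "P1.prob {w. pp_map w \<inter> D = {}} = exp (- leb lam D)" "P2.prob {w. pp_map w \<inter> D = {}} = exp (- leb mu D)"
  using single_point_prob[OF void_P1 _ D(1,2) C] single_point_prob[OF void_P2 _ D(1,2) C]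
    void_processD(3)[OF void_P1 D(1,2)] void_processD(3)[OF void_P2 D(1,2)] lam by simp_all

lemma sets_one_point:
  assumes C: "C \<in> sets borel"
  shows "{w. card (pp_map w \<inter> D) = 1 \<and> pp_map w \<inter> D \<inter> C = {}} \<in> sets P1"
    "{w. card (pp_map w \<inter> D) = 1 \<and> pp_map w \<inter> D \<inter> C = {}} \<in> sets P2"
    "{w. pp_map w \<inter> D = {}} \<in> sets P1" "{w. pp_map w \<inter> D = {}} \<in> sets P2"
proof -
  have *: "{w. card (pp_map w \<inter> D) = 1 \<and> pp_map w \<inter> D \<inter> C = {}} \<in> sets M \<and> {w. pp_map w \<inter> D = {}} \<in> sets M"
    if pm: "pp_map \<in> measurable M config_space" and sp: "space M = UNIV" for M :: "(nat \<Rightarrow> nat \<times> (nat \<Rightarrow> 'a)) measure"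
  proof -
    have "{w\<in>space M. real (card (pp_map w \<inter> D)) = real 1} \<in> sets M" using card_D_meas[OF pm] by measurable
    then have "{w\<in>space M. card (pp_map w \<inter> D) = 1} \<in> sets M" by (simp only: of_nat_eq_iff)
    moreover have "{w\<in>space M. pp_map w \<inter> (D \<inter> C) = {}} \<in> sets M" "{w\<in>space M. pp_map w \<inter> D = {}} \<in> sets M"
      using C D(1) by (auto intro!: void_event[OF pm])
    ultimately have "{w\<in>space M. card (pp_map w \<inter> D) = 1} \<inter> {w\<in>space M. pp_map w \<inter> (D \<inter> C) = {}} \<in> sets M"
      by (intro sets.Int)
    moreover have "{w\<in>space M. card (pp_map w \<inter> D) = 1} \<inter> {w\<in>space M. pp_map w \<inter> (D \<inter> C) = {}} =
        {w. card (pp_map w \<inter> D) = 1 \<and> pp_map w \<inter> D \<inter> C = {}}" by (simp add: sp Int_assoc Collect_conj_eq[symmetric])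
    ultimately show ?thesis using \<open>{w\<in>space M. pp_map w \<inter> D = {}} \<in> sets M\<close> by (simp add: sp)
  qed
  show "{w. card (pp_map w \<inter> D) = 1 \<and> pp_map w \<inter> D \<inter> C = {}} \<in> sets P1" "{w. pp_map w \<inter> D = {}} \<in> sets P1"
    using *[OF meas_pp(1)] by auto
  show "{w. card (pp_map w \<inter> D) = 1 \<and> pp_map w \<inter> D \<inter> C = {}} \<in> sets P2" "{w. pp_map w \<inter> D = {}} \<in> sets P2"
    using *[OF meas_pp(2)] by auto
qed

text \<open>
  The two summands are the two ways to have a single point: in the first process, outside of \<open>C\<close>, or in the second
  process, anywhere in the block.
\<close>

lemma prob_single_X0:
  assumes C: "C \<in> sets borel"
  shows "Q.prob {q. single q \<and> X0 q \<inter> C = {}} = exp (- leb lam' D) * (leb lam (D - C) + leb mu D)"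
proof -
  let ?a = "{w. card (pp_map w \<inter> D) = 1 \<and> pp_map w \<inter> D \<inter> C = {}}" and ?v = "{w. pp_map w \<inter> D = {}}"
  let ?b = "{w. card (pp_map w \<inter> D) = 1 \<and> pp_map w \<inter> D \<inter> {} = {}}"
  have e: "{q. single q \<and> X0 q \<inter> C = {}} = {q. fst q \<in> ?a \<and> fst (snd q) \<in> ?v} \<union> {q. fst q \<in> ?v \<and> fst (snd q) \<in> ?b}"
    unfolding single_iff X0_def Z0_def by auto
  have "Q.prob {q. single q \<and> X0 q \<inter> C = {}} = Q.prob {q. fst q \<in> ?a \<and> fst (snd q) \<in> ?v} + Q.prob {q. fst q \<in> ?v \<and> fst (snd q) \<in> ?b}"
    unfolding e by (intro Q.finite_measure_Union sets_Q2 sets_one_point[OF C] sets_one_point[OF sets.empty_sets]) auto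
  also have "\<dots> = leb lam (D - C) * exp (- leb lam D) * exp (- leb mu D) + exp (- leb lam D) * (leb mu (D - {}) * exp (- leb mu D))"
    by (simp only: prob_Q2 sets_one_point[OF C] sets_one_point[OF sets.empty_sets] prob_one_point[OF C] prob_one_point[OF sets.empty_sets])
  also have "\<dots> = exp (- leb lam D) * exp (- leb mu D) * (leb lam (D - C) + leb mu D)"
    by (simp add: algebra_simps)
  also have "exp (- leb lam D) * exp (- leb mu D) = exp (- leb lam' D)"
    by (simp add: exp_add[symmetric] algebra_simps)
  finally show ?thesis .
qed

lemma prob_single_Y0:
  assumes C: "C \<in> sets borel"
  shows "Q.prob {q. single q \<and> Y0 q \<inter> C = {}} = exp (- leb lam' D) * leb lam' (D - C)"
proof -
  let ?a = "{w. card (pp_map w \<inter> D) = 1 \<and> pp_map w \<inter> D \<inter> C = {}}" and ?v = "{w. pp_map w \<inter> D = {}}"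
  have e: "{q. single q \<and> Y0 q \<inter> C = {}} = {q. fst q \<in> ?a \<and> fst (snd q) \<in> ?v} \<union> {q. fst q \<in> ?v \<and> fst (snd q) \<in> ?a}"
    unfolding single_iff X0_def Z0_def Y0_def by auto
  have "Q.prob {q. single q \<and> Y0 q \<inter> C = {}} = Q.prob {q. fst q \<in> ?a \<and> fst (snd q) \<in> ?v} + Q.prob {q. fst q \<in> ?v \<and> fst (snd q) \<in> ?a}"
    unfolding e by (intro Q.finite_measure_Union sets_Q2 sets_one_point[OF C]) auto
  also have "\<dots> = leb lam (D - C) * exp (- leb lam D) * exp (- leb mu D) + exp (- leb lam D) * (leb mu (D - C) * exp (- leb mu D))"
    by (simp only: prob_Q2 sets_one_point[OF C] prob_one_point[OF C])
  also have "\<dots> = exp (- leb lam D) * exp (- leb mu D) * leb lam' (D - C)"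
    by (simp add: algebra_simps)
  also have "exp (- leb lam D) * exp (- leb mu D) = exp (- leb lam' D)"
    by (simp add: exp_add[symmetric] algebra_simps)
  finally show ?thesis .
qed

lemma prob_single: "Q.prob {q. single q} = exp (- leb lam' D) * leb lam' D"
  using prob_single_Y0[of "{}"] by simp

lemma prob_U:
  assumes "0 \<le> \<theta>" "\<theta> \<le> 1" shows "U.prob {..<\<theta>} = \<theta>" "U.prob {\<theta>..} = 1 - \<theta>"
proof -
  have "{0..1} \<inter> {..<\<theta>} = {0..<\<theta>}" "{0..1} \<inter> {\<theta>..} = {\<theta>..1}" using assms by auto
  then show "U.prob {..<\<theta>} = \<theta>" "U.prob {\<theta>..} = 1 - \<theta>"
    unfolding U_def using assms by (simp_all add: measure_uniform_measure)
qed

lemma prob_KK_Times: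
  assumes "a \<in> sets Q" "b \<in> sets borel" shows "KK.prob (a \<times> b) = Q.prob a * U.prob b"
proof -
  have "emeasure KK (a \<times> b) = emeasure Q a * emeasure U b"
    unfolding KK_def using assms by (intro U.emeasure_pair_measure_Times) (auto simp: sets_U)
  then show ?thesis by (simp add: measure_def enn2real_mult)
qed

definition slope :: "'a set set \<Rightarrow> real" where
  "slope B = Q.prob {q. single q \<and> Y0 q \<in> B} - Q.prob {q. single q} * of_bool ({} \<in> B)"

lemma Collect_in_sets:
  assumes "X \<in> measurable Q N" "B \<in> sets N" shows "{q. X q \<in> B} \<in> sets Q"
  using measurable_sets[OF assms] by (simp add: vimage_def)

text \<open>
  The parameter enters in the single-point case only, where the outcome is \<open>Y0\<close> with probability \<open>\<theta>\<close> and empty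
  otherwise. Hence the law is affine in \<open>\<theta>\<close>.
\<close>

lemma prob_coup:
  assumes B: "B \<in> sets config_space" and \<theta>: "0 \<le> \<theta>" "\<theta> \<le> 1"
  shows "KK.prob {w\<in>space KK. coup \<theta> w \<in> B} =
    Q.prob {q. \<not> single q \<and> X0 q \<in> B} + \<theta> * Q.prob {q. single q \<and> Y0 q \<in> B} + (1 - \<theta>) * (Q.prob {q. single q} * of_bool ({} \<in> B))"
proof -
  let ?a = "{q. \<not> single q \<and> X0 q \<in> B}" and ?b = "{q. single q \<and> Y0 q \<in> B}" and ?c = "{q. single q \<and> {} \<in> B}"
  have ns: "{q. \<not> single q} \<in> sets Q" using sets.compl_sets[OF single_sets] by (simp add: Compl_eq_Diff_UNIV[symmetric] Collect_neg_eq)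
  have s: "?a \<in> sets Q" "?b \<in> sets Q" "?c \<in> sets Q"
    using sets.Int[OF ns Collect_in_sets[OF meas_X0 B]] sets.Int[OF single_sets Collect_in_sets[OF meas_Y0 B]] single_sets
    by (auto simp: Collect_conj_eq)
  have sK: "x \<times> y \<in> sets KK" if "x \<in> sets Q" "y \<in> sets borel" for x y
    unfolding KK_def using that by (auto simp: sets_U)
  have "{w\<in>space KK. coup \<theta> w \<in> B} = ?a \<times> UNIV \<union> (?b \<times> {..<\<theta>} \<union> ?c \<times> {\<theta>..})"
    by (auto simp: coup_def split: if_splits)
  then have "KK.prob {w\<in>space KK. coup \<theta> w \<in> B} = KK.prob (?a \<times> UNIV \<union> (?b \<times> {..<\<theta>} \<union> ?c \<times> {\<theta>..}))" by (rule arg_cong)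
  also have "\<dots> = KK.prob (?a \<times> UNIV) + KK.prob (?b \<times> {..<\<theta>} \<union> ?c \<times> {\<theta>..})"
    by (intro KK.finite_measure_Union sets.Un sK s) auto
  also have "KK.prob (?b \<times> {..<\<theta>} \<union> ?c \<times> {\<theta>..}) = KK.prob (?b \<times> {..<\<theta>}) + KK.prob (?c \<times> {\<theta>..})"
    by (intro KK.finite_measure_Union sK s) auto
  also have "KK.prob (?a \<times> UNIV) = Q.prob ?a" using prob_KK_Times[OF s(1), of UNIV] U.prob_space by simp
  also have "KK.prob (?b \<times> {..<\<theta>}) = \<theta> * Q.prob ?b" using prob_KK_Times[OF s(2), of "{..<\<theta>}"] prob_U[OF \<theta>] by simp
  also have "KK.prob (?c \<times> {\<theta>..}) = (1 - \<theta>) * Q.prob ?c" using prob_KK_Times[OF s(3), of "{\<theta>..}"] prob_U[OF \<theta>] by simp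
  also have "Q.prob ?c = Q.prob {q. single q} * of_bool ({} \<in> B)" by (cases "{} \<in> B") auto
  finally show ?thesis by simp
qed

abbreviation "pr \<equiv> lam / lam'"

lemma pr: "0 < pr" "pr < 1" using lam by auto

lemma affine_coup:
  assumes B: "B \<in> sets config_space" and \<theta>: "0 \<le> \<theta>" "\<theta> \<le> 1"
  shows "KK.prob {w\<in>space KK. coup \<theta> w \<in> B} = KK.prob {w\<in>space KK. coup pr w \<in> B} + (\<theta> - pr) * slope B"
  unfolding prob_coup[OF B \<theta>] prob_coup[OF B less_imp_le[OF pr(1)] less_imp_le[OF pr(2)]] slope_def
  by (simp only: algebra_simps)

lemma meas_coup: "(\<lambda>(\<theta>, w). coup \<theta> w) \<in> measurable (borel \<Otimes>\<^sub>M KK) config_space"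
proof -
  let ?M = "borel \<Otimes>\<^sub>M KK :: (real \<times> _) measure"
  have f: "(\<lambda>z. fst (snd z)) \<in> measurable ?M Q"
    unfolding KK_def by (rule measurable_compose[OF measurable_snd measurable_fst])
  have u: "(\<lambda>z. snd (snd z)) \<in> borel_measurable ?M"
    unfolding KK_def using measurable_compose[OF measurable_snd measurable_snd, of borel Q U] sets_U by (simp cong: measurable_cong_sets)
  have [measurable]: "Measurable.pred ?M (\<lambda>z. single (fst (snd z)))"
    using measurable_sets[OF f single_sets] by (simp add: pred_def vimage_def Int_def conj_commute)
  have [measurable]: "Measurable.pred ?M (\<lambda>z. snd (snd z) < fst z)" using u by measurable
  have em: "(\<lambda>z. {}) \<in> measurable ?M (config_space :: 'a set measure)"
    by (rule measurable_const) (simp add: space_config_space locally_finite_set_def)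
  have "(\<lambda>z. if single (fst (snd z)) then (if snd (snd z) < fst z then Y0 (fst (snd z)) else {}) else X0 (fst (snd z))) \<in> measurable ?M config_space"
    by (intro measurable_If em measurable_compose[OF f meas_Y0] measurable_compose[OF f meas_X0]) measurable
  then show ?thesis by (simp add: coup_def case_prod_beta')
qed

text \<open>
  Compared with \<open>X0\<close>, the kept points differ only in the single-point case, where the correct proportion of
  empty outcomes makes the void probabilities agree.
\<close>

lemma coup_void: "void_process KK (coup pr) (\<lambda>B. leb lam (D \<inter> B))"
  unfolding void_process_def
proof (intro conjI ballI impI)
  show "prob_space KK" by (rule KK.prob_space_axioms)
  show "coup pr \<in> measurable KK config_space"
    using measurable_compose[OF _ meas_coup, of "\<lambda>w. (pr, w)" KK] by simp
  fix C :: "'a set" assume C: "C \<in> sets borel" "bounded C"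
  let ?B = "{S\<in>space config_space. S \<inter> C = {}}"
  have lf: "coup pr w \<in> space config_space" for w
    using measurable_space[OF measurable_compose[OF _ meas_coup, of "\<lambda>w. (pr, w)" KK], of w] by simp
  have lfQ: "X0 q \<in> space config_space" "Y0 q \<in> space config_space" for q
    using measurable_space[OF meas_X0, of q] measurable_space[OF meas_Y0, of q] by auto
  have "{w\<in>space KK. coup pr w \<inter> C = {}} = {w\<in>space KK. coup pr w \<in> ?B}" using lf by auto
  then have "KK.prob {w\<in>space KK. coup pr w \<inter> C = {}} =
    Q.prob {q. \<not> single q \<and> X0 q \<inter> C = {}} + pr * Q.prob {q. single q \<and> Y0 q \<inter> C = {}} + (1 - pr) * Q.prob {q. single q}"
    using prob_coup[OF sets_void[OF C(1)] less_imp_le[OF pr(1)] less_imp_le[OF pr(2)]] lfQ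
    by (simp add: space_config_space locally_finite_set_def)
  also have "Q.prob {q. \<not> single q \<and> X0 q \<inter> C = {}} = Q.prob {q. X0 q \<inter> C = {}} - Q.prob {q. single q \<and> X0 q \<inter> C = {}}"
  proof -
    have s: "{q. X0 q \<inter> C = {}} \<in> sets Q" using void_event[OF meas_X0 C(1)] by simp
    have "{q. \<not> single q \<and> X0 q \<inter> C = {}} = {q. X0 q \<inter> C = {}} - ({q. single q} \<inter> {q. X0 q \<inter> C = {}})" by auto
    then show ?thesis using s single_sets by (simp add: Q.finite_measure_Diff' Int_absorb1 Collect_conj_eq Q.finite_measure_Diff sets.Int)
  qed
  also have "Q.prob {q. X0 q \<inter> C = {}} = exp (- leb lam (D \<inter> C))"
  proof -
    have "{q. X0 q \<inter> C = {}} = {q. fst q \<in> {w. pp_map w \<inter> (D \<inter> C) = {}} \<and> fst (snd q) \<in> space P2}"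
      by (auto simp: X0_def)
    then show ?thesis
      using prob_Q2[of "{w. pp_map w \<inter> (D \<inter> C) = {}}" "space P2"] void_processD(3)[OF void_P1, of "D \<inter> C"]
        void_event[OF meas_pp(1), of "D \<inter> C"] C D P2.prob_space sets.top[of P2] by (simp add: bounded_Int)
  qed
  also have "exp (- leb lam (D \<inter> C)) - Q.prob {q. single q \<and> X0 q \<inter> C = {}} + pr * Q.prob {q. single q \<and> Y0 q \<inter> C = {}} + (1 - pr) * Q.prob {q. single q}
      = exp (- leb lam (D \<inter> C))"
    unfolding prob_single_X0[OF C(1)] prob_single_Y0[OF C(1)] prob_single using lam by (simp add: field_simps)
  finally show "KK.prob {w\<in>space KK. coup pr w \<inter> C = {}} = exp (- leb lam (D \<inter> C))" .
qed

lemma coup_subset: "coup \<theta> w \<subseteq> Y0 (fst w)"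
  by (auto simp: coup_def Y0_def)

lemma YN_void:
  assumes B: "B \<in> sets borel" "bounded B" and C: "C \<in> sets borel" "bounded C"
  shows "KK.prob {w\<in>space KK. Y0 (fst w) \<inter> B = {} \<and> N0 (fst w) \<inter> C = {}} = exp (- (leb lam' (D \<inter> B) + leb mu C))"
proof -
  have DB: "D \<inter> B \<in> sets borel" "bounded (D \<inter> B)" using D B by (auto simp: bounded_Int)
  let ?v = "\<lambda>B. {w. pp_map w \<inter> B = {}}"
  have s: "?v (D \<inter> B) \<in> sets P1" "?v (D \<inter> B) \<in> sets P2" "?v C \<in> sets P2"
    using void_event[OF meas_pp(1) DB(1)] void_event[OF meas_pp(2) DB(1)] void_event[OF meas_pp(2) C(1)] by auto
  have e: "{w\<in>space KK. Y0 (fst w) \<inter> B = {} \<and> N0 (fst w) \<inter> C = {}} = (?v (D \<inter> B) \<times> (?v (D \<inter> B) \<times> ?v C)) \<times> UNIV"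
    by (auto simp: Y0_def X0_def Z0_def N0_def)
  have "?v (D \<inter> B) \<times> (?v (D \<inter> B) \<times> ?v C) \<in> sets Q" unfolding Q_def using s by auto
  from prob_KK_Times[OF this, of UNIV]
  have "KK.prob {w\<in>space KK. Y0 (fst w) \<inter> B = {} \<and> N0 (fst w) \<inter> C = {}} = P1.prob (?v (D \<inter> B)) * (P2.prob (?v (D \<inter> B)) * P2.prob (?v C))"
    unfolding e prob_Q_Times[OF s] using U.prob_space by simp
  also have "\<dots> = exp (- leb lam (D \<inter> B)) * (exp (- leb mu (D \<inter> B)) * exp (- leb mu C))"
    using void_processD(3)[OF void_P1 DB] void_processD(3)[OF void_P2 DB] void_processD(3)[OF void_P2 C] by simp
  also have "\<dots> = exp (- (leb lam' (D \<inter> B) + leb mu C))"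
    by (simp add: exp_add[symmetric] algebra_simps)
  finally show ?thesis .
qed

definition events3 :: "(('a pp \<times> 'a pp \<times> 'a pp) \<times> real) set set" where
  "events3 = (\<lambda>e. {w. fst (fst w) \<in> e}) ` pp_events \<union> (\<lambda>e. {w. fst (snd (fst w)) \<in> e}) ` pp_events \<union>
     (\<lambda>e. {w. snd (snd (fst w)) \<in> e}) ` pp_events"

lemma countable_events3: "countable events3"
  unfolding events3_def by (intro countable_Un countable_image countable_pp_events)

lemma events3_sets: assumes "e \<in> events3" shows "e \<in> sets KK"
proof -
  have f: "fst \<in> measurable KK Q" unfolding KK_def by (rule measurable_fst)
  have m: "(\<lambda>w. fst (fst w)) \<in> measurable KK P1" "(\<lambda>w. fst (snd (fst w))) \<in> measurable KK P2" "(\<lambda>w. snd (snd (fst w))) \<in> measurable KK P2"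
    using measurable_compose[OF f[unfolded Q_def] measurable_fst]
      measurable_compose[OF measurable_compose[OF f[unfolded Q_def] measurable_snd] measurable_fst]
      measurable_compose[OF measurable_compose[OF f[unfolded Q_def] measurable_snd] measurable_snd] by auto
  from assms show ?thesis
    using measurable_sets[OF m(1) pp_events_sets] measurable_sets[OF m(2) pp_events_sets] measurable_sets[OF m(3) pp_events_sets]
    unfolding events3_def by (auto simp: vimage_def)
qed

lemma slope_nonzero: "slope {S\<in>space config_space. S \<inter> UNIV \<noteq> {}} \<noteq> 0"
proof -
  have "Y0 q \<in> space config_space" for q using measurable_space[OF meas_Y0, of q] by auto
  moreover have "Y0 q \<noteq> {}" if "single q" for q
    using that unfolding single_iff Y0_def by auto
  ultimately have "{q. single q \<and> Y0 q \<in> {S\<in>space config_space. S \<inter> UNIV \<noteq> {}}} = {q. single q}" by auto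
  then have "slope {S\<in>space config_space. S \<inter> UNIV \<noteq> {}} = Q.prob {q. single q}" unfolding slope_def by simp
  then show ?thesis using prob_single D(3) lam by simp
qed

text \<open>
  The coding theorem applied to the blocks. From a sequence \<open>Xs\<close> of independent Poisson processes of intensity \<open>lam\<close>
  in the block one recovers the larger processes \<open>Y0\<close> of all indices, and additionally the process \<open>N0\<close> of index 0,
  which later fills the space outside of the column.
\<close>

theorem block_coding:
  "\<exists>Xs \<phi>Y \<phi>N. Xs \<in> measurable (\<Pi>\<^sub>M n\<in>UNIV. KK) (\<Pi>\<^sub>M n\<in>UNIV. config_space) \<and>
     distr (\<Pi>\<^sub>M n\<in>UNIV. KK) (\<Pi>\<^sub>M n\<in>UNIV. config_space) Xs = (\<Pi>\<^sub>M n\<in>UNIV. distr KK config_space (coup pr)) \<and>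
     (\<forall>n::nat. \<phi>Y n \<in> measurable (\<Pi>\<^sub>M n\<in>UNIV. config_space) (config_space :: 'a set measure)) \<and>
     \<phi>N \<in> measurable (\<Pi>\<^sub>M n\<in>UNIV. config_space) (config_space :: 'a set measure) \<and>
     (\<forall>\<omega>\<in>space (\<Pi>\<^sub>M n\<in>UNIV. KK). \<forall>n. Xs \<omega> n \<subseteq> Y0 (fst (\<omega> n))) \<and>
     (AE \<omega> in (\<Pi>\<^sub>M n\<in>UNIV. KK). (\<forall>n. \<phi>Y n (Xs \<omega>) = Y0 (fst (\<omega> n))) \<and> \<phi>N (Xs \<omega>) = N0 (fst (\<omega> 0)))"
proof -
  let ?E = "from_nat_into events3"
  have ne: "events3 \<noteq> {}"
  proof -
    define e0 :: "'a pp set" where "e0 = {w. fst (w 0) = 0}"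
    have "e0 \<in> pp_events"
      unfolding pp_events_def e0_def by (intro UnI1 UN_I[of "0::nat"] UNIV_I singletonI)
    then have "{w. fst (fst w) \<in> e0} \<in> events3"
      unfolding events3_def by (rule UnI1[OF UnI1[OF imageI]])
    then show ?thesis by blast
  qed
  have rE: "range ?E = events3" by (rule range_from_nat_into[OF ne countable_events3])
  interpret C: coding_step KK "config_space :: 'a set measure" coup pr slope "{S\<in>space config_space. S \<inter> UNIV \<noteq> {}}" ?E
  proof unfold_locales
    show "(\<lambda>(\<theta>, w). coup \<theta> w) \<in> measurable (borel \<Otimes>\<^sub>M KK) config_space" by (rule meas_coup)
    show "0 < pr" "pr < 1" by (rule pr)+
    show "slope {S \<in> space config_space. S \<inter> UNIV \<noteq> {}} \<noteq> 0" by (rule slope_nonzero)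
    show "{S \<in> space config_space. S \<inter> UNIV \<noteq> {}} \<in> sets (config_space :: 'a set measure)"
    proof -
      have "space config_space - {S \<in> space config_space. S \<inter> UNIV = {}} \<in> sets (config_space :: 'a set measure)"
        by (intro sets.compl_sets sets_void) simp
      moreover have "space config_space - {S \<in> space config_space. S \<inter> UNIV = {}} = {S \<in> space config_space. S \<inter> UNIV \<noteq> ({} :: 'a set)}" by blast
      ultimately show ?thesis by simp
    qed
    show "?E k \<in> sets KK" for k by (intro events3_sets from_nat_into ne)
  qed (rule affine_coup)
  let ?W = C.Xs
  have det: "\<exists>H\<in>sets (\<Pi>\<^sub>M n\<in>UNIV. config_space). AE \<omega> in C.Om. \<omega> i \<in> e \<longleftrightarrow> ?W \<omega> \<in> H" if "e \<in> events3" for e i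
  proof -
    have "e \<in> range ?E" unfolding rE by (rule that)
    then obtain k where k: "e = ?E k" by (rule rangeE)
    show ?thesis unfolding k by (rule C.coordinate_event_determined)
  qed
  have d1: "determined C.Om ?W (\<Pi>\<^sub>M n\<in>UNIV. config_space) config_space (\<lambda>\<omega>. pp_map (fst (fst (\<omega> n))) :: 'a set)" for n
  proof (rule determined_pp[OF _ C.Xs_Om])
    fix e :: "(nat \<Rightarrow> nat \<times> (nat \<Rightarrow> 'a)) set" assume "e \<in> pp_events"
    then have "{w. fst (fst w) \<in> e} \<in> events3" unfolding events3_def by (rule UnI1[OF UnI1[OF imageI]])
    from det[OF this] show "\<exists>H\<in>sets (\<Pi>\<^sub>M n\<in>UNIV. config_space). AE \<omega> in C.Om. fst (fst (\<omega> n)) \<in> e \<longleftrightarrow> ?W \<omega> \<in> H" by (simp only: mem_Collect_eq)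
  qed
  have d2: "determined C.Om ?W (\<Pi>\<^sub>M n\<in>UNIV. config_space) config_space (\<lambda>\<omega>. pp_map (fst (snd (fst (\<omega> n)))) :: 'a set)" for n
  proof (rule determined_pp[OF _ C.Xs_Om])
    fix e :: "(nat \<Rightarrow> nat \<times> (nat \<Rightarrow> 'a)) set" assume "e \<in> pp_events"
    then have "{w. fst (snd (fst w)) \<in> e} \<in> events3" unfolding events3_def by (rule UnI1[OF UnI2[OF imageI]])
    from det[OF this] show "\<exists>H\<in>sets (\<Pi>\<^sub>M n\<in>UNIV. config_space). AE \<omega> in C.Om. fst (snd (fst (\<omega> n))) \<in> e \<longleftrightarrow> ?W \<omega> \<in> H" by (simp only: mem_Collect_eq)
  qed
  have d3: "determined C.Om ?W (\<Pi>\<^sub>M n\<in>UNIV. config_space) config_space (\<lambda>\<omega>. pp_map (snd (snd (fst (\<omega> n)))) :: 'a set)" for n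
  proof (rule determined_pp[OF _ C.Xs_Om])
    fix e :: "(nat \<Rightarrow> nat \<times> (nat \<Rightarrow> 'a)) set" assume "e \<in> pp_events"
    then have "{w. snd (snd (fst w)) \<in> e} \<in> events3" unfolding events3_def by (rule UnI2[OF imageI])
    from det[OF this] show "\<exists>H\<in>sets (\<Pi>\<^sub>M n\<in>UNIV. config_space). AE \<omega> in C.Om. snd (snd (fst (\<omega> n))) \<in> e \<longleftrightarrow> ?W \<omega> \<in> H" by (simp only: mem_Collect_eq)
  qed
  have un: "(\<lambda>(S, S'). (S \<inter> D) \<union> (S' \<inter> D)) \<in> measurable (config_space \<Otimes>\<^sub>M config_space) (config_space :: 'a set measure)"
    unfolding case_prod_beta'
    by (intro measurable_config_Un measurable_compose[OF measurable_fst measurable_config_Int] measurable_compose[OF measurable_snd measurable_config_Int] D(1))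
  have dY: "determined C.Om ?W (\<Pi>\<^sub>M n\<in>UNIV. config_space) config_space (\<lambda>\<omega>. Y0 (fst (\<omega> n)))" for n
    using determined_compose[OF determined_Pair[OF d1[of n] d2[of n]] un] by (simp add: Y0_def X0_def Z0_def)
  have "\<forall>n. \<exists>\<phi>. \<phi> \<in> measurable (\<Pi>\<^sub>M n\<in>UNIV. config_space) config_space \<and> (AE \<omega> in C.Om. Y0 (fst (\<omega> n)) = \<phi> (?W \<omega>))"
    using dY unfolding determined_def Bex_def by (rule allI)
  then obtain \<phi>Y where \<phi>Y: "\<And>n. \<phi>Y n \<in> measurable (\<Pi>\<^sub>M n\<in>UNIV. config_space) config_space" "\<And>n. AE \<omega> in C.Om. Y0 (fst (\<omega> n)) = \<phi>Y n (?W \<omega>)"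
    by (rule choice[THEN exE]) blast
  from d3[of 0] obtain \<phi>N where \<phi>N: "\<phi>N \<in> measurable (\<Pi>\<^sub>M n\<in>UNIV. config_space) config_space" "AE \<omega> in C.Om. N0 (fst (\<omega> 0)) = \<phi>N (?W \<omega>)"
    unfolding determined_def N0_def by (rule bexE)
  have "AE \<omega> in C.Om. \<forall>n. Y0 (fst (\<omega> n)) = \<phi>Y n (?W \<omega>)" unfolding AE_all_countable using \<phi>Y(2) by (rule allI)
  then have ae: "AE \<omega> in C.Om. (\<forall>n. \<phi>Y n (?W \<omega>) = Y0 (fst (\<omega> n))) \<and> \<phi>N (?W \<omega>) = N0 (fst (\<omega> 0))"
    using \<phi>N(2) by eventually_elim simp
  have sub: "\<forall>\<omega>\<in>space (\<Pi>\<^sub>M n\<in>UNIV. KK). \<forall>n. ?W \<omega> n \<subseteq> Y0 (fst (\<omega> n))"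
    by (simp add: C.Xs_def C.X_def coup_subset)
  show ?thesis
    by (intro exI[of _ ?W] exI[of _ \<phi>Y] exI[of _ \<phi>N] conjI allI C.Xs_Om[unfolded C.Om_def] C.distr_Xs[unfolded C.Om_def]
        \<phi>Y(1) \<phi>N(1) sub ae[unfolded C.Om_def])
qed

end

section \<open>A column of blocks\<close>

locale thicken_column = thicken_block lam lam' D for lam lam' :: real and D :: "'a::euclidean_space set" +
  fixes t :: "nat \<Rightarrow> 'a"
  assumes disj: "disjoint_family (\<lambda>n. shift (t n) D)"
    and lfin: "\<And>B. bounded B \<Longrightarrow> finite {n. shift (t n) D \<inter> B \<noteq> {}}"
begin

definition Dinf :: "'a set" where "Dinf = (\<Union>n. shift (t n) D)"

definition assemble :: "(nat \<Rightarrow> 'a set) \<Rightarrow> 'a set" where "assemble s = (\<Union>n. shift (t n) (s n \<inter> D))"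

definition blocks :: "'a set \<Rightarrow> nat \<Rightarrow> 'a set" where "blocks S n = shift (- t n) S \<inter> D"

lemma Dinf_borel [measurable]: "Dinf \<in> sets borel"
  unfolding Dinf_def using D(1) by (intro sets.countable_UN) (auto intro: shift_borel)

lemma assemble_blocks: "assemble (blocks S) = S \<inter> Dinf"
  by (simp add: assemble_def blocks_def Dinf_def shift_Int)

lemma blocks_Int_Dinf: "blocks (S \<inter> Dinf) = blocks S"
proof
  fix n
  have "D \<subseteq> shift (- t n) Dinf" unfolding Dinf_def by (auto simp: mem_shift intro!: exI[of _ n])
  then show "blocks (S \<inter> Dinf) n = blocks S n" unfolding blocks_def shift_Int by blast
qed

lemma assemble_void: "assemble s \<inter> B = {} \<longleftrightarrow> (\<forall>n. s n \<inter> D \<inter> shift (- t n) B = {})"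
proof -
  have "assemble s \<inter> B = {} \<longleftrightarrow> (\<forall>n. shift (t n) (s n \<inter> D) \<inter> B = {})" unfolding assemble_def by blast
  then show ?thesis by (simp only: shift_Int_eq_empty)
qed

lemma assemble_locally_finite:
  assumes s: "\<And>n. locally_finite_set (s n)" shows "locally_finite_set (assemble s)"
  unfolding locally_finite_set_def
proof (intro allI impI)
  fix B :: "'a set" assume B: "bounded B"
  have "assemble s \<inter> B \<subseteq> (\<Union>n\<in>{n. shift (t n) D \<inter> B \<noteq> {}}. shift (t n) (s n) \<inter> B)"
    unfolding assemble_def shift_Int by blast
  moreover have "finite (shift (t n) (s n) \<inter> B)" for n
    using locally_finite_shift[OF s[of n], of "t n"] B by (simp add: locally_finite_set_def)
  ultimately show "finite (assemble s \<inter> B)"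
    using lfin[OF B] by (meson finite_UN_I finite_subset)
qed

lemma meas_assemble: "assemble \<in> measurable (\<Pi>\<^sub>M n\<in>UNIV. config_space) config_space"
proof (rule measurable_configI)
  fix s :: "nat \<Rightarrow> 'a set" assume "s \<in> space (\<Pi>\<^sub>M n\<in>UNIV. config_space)"
  then show "locally_finite_set (assemble s)"
    by (intro assemble_locally_finite) (auto simp: space_PiM space_config_space PiE_iff)
next
  fix C :: "'a set" assume C: "C \<in> sets borel"
  have "{s\<in>space (\<Pi>\<^sub>M n\<in>UNIV. config_space). s n \<inter> (D \<inter> shift (- t n) C) = {}} \<in> sets (\<Pi>\<^sub>M n\<in>UNIV. (config_space :: 'a set measure))" for n
    using C D(1) by (intro void_event[OF measurable_component_singleton[of n UNIV "\<lambda>_. config_space"]]) (auto intro: shift_borel)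
  then have "(\<Inter>n. {s\<in>space (\<Pi>\<^sub>M n\<in>UNIV. config_space). s n \<inter> (D \<inter> shift (- t n) C) = {}}) \<in> sets (\<Pi>\<^sub>M n\<in>UNIV. (config_space :: 'a set measure))"
    by (intro sets.countable_INT) auto
  moreover have "(\<Inter>n. {s\<in>space (\<Pi>\<^sub>M n\<in>UNIV. config_space). s n \<inter> (D \<inter> shift (- t n) C) = {}}) =
      {s\<in>space (\<Pi>\<^sub>M n\<in>UNIV. (config_space :: 'a set measure)). assemble s \<inter> C = {}}"
    unfolding assemble_void Int_assoc by blast
  ultimately show "{s\<in>space (\<Pi>\<^sub>M n\<in>UNIV. (config_space :: 'a set measure)). assemble s \<inter> C = {}} \<in> sets (\<Pi>\<^sub>M n\<in>UNIV. config_space)" by simp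
qed

lemma meas_block: "(\<lambda>S. blocks S n) \<in> measurable config_space config_space"
  unfolding blocks_def by (rule measurable_compose[OF measurable_shift measurable_config_Int[OF D(1)]])

lemma meas_blocks: "blocks \<in> measurable config_space (\<Pi>\<^sub>M n\<in>UNIV. config_space)"
  by (intro measurable_PiM_single' meas_block) (auto intro: measurable_space[OF meas_block])

text \<open>
  The blocks are restrictions to disjoint sets, hence independent, and each has the void probabilities of an output
  of the coding.
\<close>

lemma blocks_law:
  assumes T: "void_process M T (leb lam)"
  shows "distr M (\<Pi>\<^sub>M n\<in>UNIV. config_space) (\<lambda>\<omega>. blocks (T \<omega>)) = (\<Pi>\<^sub>M n\<in>UNIV. distr KK config_space (coup pr))"
proof -
  note TD = void_processD[OF T]
  interpret M: prob_space M by fact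
  have bT: "(\<lambda>\<omega>. blocks (T \<omega>) n) \<in> measurable M config_space" for n
    by (rule measurable_compose[OF TD(2) meas_block])
  have "M.indep_vars (\<lambda>_. config_space) (\<lambda>n \<omega>. T \<omega> \<inter> shift (t n) D) UNIV"
    using disj D(1) by (intro indep_restrictions[OF T]) (auto intro: shift_borel)
  then have "M.indep_vars (\<lambda>_. config_space) (\<lambda>n \<omega>. shift (- t n) (T \<omega> \<inter> shift (t n) D)) UNIV"
    by (rule M.indep_vars_compose2) (rule measurable_shift)
  moreover have "shift (- t n) (T \<omega> \<inter> shift (t n) D) = blocks (T \<omega>) n" for n \<omega>
    by (simp add: blocks_def shift_Int)
  ultimately have "M.indep_vars (\<lambda>_. config_space) (\<lambda>n \<omega>. blocks (T \<omega>) n) UNIV" by simp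
  then have "distr M (\<Pi>\<^sub>M n\<in>UNIV. config_space) (\<lambda>\<omega>. \<lambda>n\<in>UNIV. blocks (T \<omega>) n) =
      (\<Pi>\<^sub>M n\<in>UNIV. distr M config_space (\<lambda>\<omega>. blocks (T \<omega>) n))"
    using bT by (subst (asm) M.indep_vars_iff_distr_eq_PiM) auto
  moreover have "distr M config_space (\<lambda>\<omega>. blocks (T \<omega>) n) = distr KK config_space (coup pr)" for n
  proof (rule void_process_unique[OF _ coup_void])
    show "void_process M (\<lambda>\<omega>. blocks (T \<omega>) n) (\<lambda>B. leb lam (D \<inter> B))" unfolding void_process_def
    proof (intro conjI ballI impI TD(1) bT)
      fix B :: "'a set" assume B: "B \<in> sets borel" "bounded B"
      have "M.prob {\<omega> \<in> space M. T \<omega> \<inter> shift (t n) (D \<inter> B) = {}} = exp (- leb lam (shift (t n) (D \<inter> B)))"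
        using B D by (intro TD(3) shift_borel bounded_shift) (auto simp: bounded_Int)
      then show "M.prob {\<omega> \<in> space M. blocks (T \<omega>) n \<inter> B = {}} = exp (- leb lam (D \<inter> B))"
        using B D by (simp add: measure_shift blocks_def Int_assoc shift_Int_eq_empty)
    qed
  qed
  ultimately show ?thesis by (simp add: restrict_UNIV)
qed

text \<open>
  Feed the blocks of the given process to the decoder: by equality of laws the decoded processes are, jointly with the
  blocks, distributed as \<open>Y0\<close> and \<open>N0\<close> with the encoded sequence. The union with the given process is harmless, since the
  encoded sequence is contained in \<open>Y0\<close>. The map depends on the column only.
\<close>

theorem column_thickening:
  "\<exists>\<Phi>. \<Phi> \<in> measurable config_space (config_space :: 'a set measure) \<and> (\<forall>S. \<Phi> (S \<inter> Dinf) = \<Phi> S) \<and>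
    (\<forall>(M :: 'w measure) T B. void_process M T (leb lam) \<longrightarrow> B \<in> sets borel \<longrightarrow> bounded B \<longrightarrow>
      measure M {\<omega>\<in>space M. (T \<omega> \<inter> Dinf \<union> \<Phi> (T \<omega>)) \<inter> B = {}} = exp (- (leb lam' (B \<inter> Dinf) + leb mu (B - Dinf))))"
proof -
  let ?PK = "\<Pi>\<^sub>M n\<in>(UNIV::nat set). KK" and ?PC = "\<Pi>\<^sub>M n\<in>(UNIV::nat set). (config_space :: 'a set measure)"
  obtain Xs \<phi>Y \<phi>N where Xs: "Xs \<in> measurable ?PK ?PC" "distr ?PK ?PC Xs = (\<Pi>\<^sub>M n\<in>UNIV. distr KK config_space (coup pr))"
    and \<phi>Y: "\<And>n. \<phi>Y n \<in> measurable ?PC config_space" and \<phi>N: "\<phi>N \<in> measurable ?PC config_space"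
    and sub: "\<And>\<omega> n. \<omega> \<in> space ?PK \<Longrightarrow> Xs \<omega> n \<subseteq> Y0 (fst (\<omega> n))"
    and ae: "AE \<omega> in ?PK. (\<forall>n. \<phi>Y n (Xs \<omega>) = Y0 (fst (\<omega> n))) \<and> \<phi>N (Xs \<omega>) = N0 (fst (\<omega> 0))"
    using block_coding by blast
  interpret PK: prob_space ?PK by (intro prob_space_PiM KK.prob_space_axioms)
  define \<Psi> where "\<Psi> s = assemble (\<lambda>n. \<phi>Y n s) \<union> (\<phi>N s \<inter> - Dinf)" for s
  have mY: "(\<lambda>s n. \<phi>Y n s) \<in> measurable ?PC ?PC"
    by (intro measurable_PiM_single' \<phi>Y) (auto intro: measurable_space[OF \<phi>Y])
  have \<Psi>: "\<Psi> \<in> measurable ?PC config_space"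
    unfolding \<Psi>_def[abs_def]
    by (intro measurable_config_Un measurable_compose[OF mY meas_assemble] measurable_compose[OF \<phi>N measurable_config_Int]) simp
  define \<Phi> where "\<Phi> S = \<Psi> (blocks S)" for S
  have "measure M {\<omega>\<in>space M. (T \<omega> \<inter> Dinf \<union> \<Phi> (T \<omega>)) \<inter> B = {}} = exp (- (leb lam' (B \<inter> Dinf) + leb mu (B - Dinf)))"
    if T: "void_process M T (leb lam)" and B: "B \<in> sets borel" "bounded B" for M :: "'w measure" and T B
  proof -
    note TD = void_processD[OF T]
    let ?V = "{s\<in>space ?PC. (assemble s \<union> \<Psi> s) \<inter> B = {}}"
    have V: "?V \<in> sets ?PC" by (rule void_event[OF measurable_config_Un[OF meas_assemble \<Psi>] B(1)])
    have bT: "(\<lambda>\<omega>. blocks (T \<omega>)) \<in> measurable M ?PC" by (rule measurable_compose[OF TD(2) meas_blocks])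
    have "{\<omega>\<in>space M. (T \<omega> \<inter> Dinf \<union> \<Phi> (T \<omega>)) \<inter> B = {}} = (\<lambda>\<omega>. blocks (T \<omega>)) -` ?V \<inter> space M"
      using measurable_space[OF bT] by (auto simp: assemble_blocks \<Phi>_def)
    then have "measure M {\<omega>\<in>space M. (T \<omega> \<inter> Dinf \<union> \<Phi> (T \<omega>)) \<inter> B = {}} = measure (distr M ?PC (\<lambda>\<omega>. blocks (T \<omega>))) ?V"
      using measure_distr[OF bT V] by simp
    also have "distr M ?PC (\<lambda>\<omega>. blocks (T \<omega>)) = distr ?PK ?PC Xs" unfolding blocks_law[OF T] Xs(2) ..
    also have "measure (distr ?PK ?PC Xs) ?V = PK.prob (Xs -` ?V \<inter> space ?PK)" by (rule measure_distr[OF Xs(1) V])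
    also have "\<dots> = PK.prob {\<omega>\<in>space ?PK. \<forall>n. Y0 (fst (\<omega> n)) \<inter> shift (- t n) B = {} \<and> N0 (fst (\<omega> n)) \<inter> (if n = 0 then B - Dinf else {}) = {}}"
    proof (rule PK.finite_measure_eq_AE)
      have "Y0 q \<inter> D = Y0 q" for q by (auto simp: Y0_def X0_def Z0_def)
      then have *: "(assemble s \<union> \<Psi> s) \<inter> B = {} \<longleftrightarrow> (\<forall>n. Y0 (fst (\<omega> n)) \<inter> shift (- t n) B = {} \<and> N0 (fst (\<omega> n)) \<inter> (if n = 0 then B - Dinf else {}) = {})"
        if s: "\<And>n. s n \<subseteq> Y0 (fst (\<omega> n))" "\<And>n. \<phi>Y n s = Y0 (fst (\<omega> n))" "\<phi>N s = N0 (fst (\<omega> 0))" for s \<omega>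
      proof -
        have "(assemble s \<union> \<Psi> s) \<inter> B = {} \<longleftrightarrow> assemble s \<inter> B = {} \<and> assemble (\<lambda>n. \<phi>Y n s) \<inter> B = {} \<and> N0 (fst (\<omega> 0)) \<inter> (B - Dinf) = {}"
          unfolding \<Psi>_def s(3) by blast
        also have "\<dots> \<longleftrightarrow> assemble (\<lambda>n. Y0 (fst (\<omega> n))) \<inter> B = {} \<and> N0 (fst (\<omega> 0)) \<inter> (B - Dinf) = {}"
          unfolding s(2) assemble_void using s(1) by blast
        also have "\<dots> \<longleftrightarrow> (\<forall>n. Y0 (fst (\<omega> n)) \<inter> shift (- t n) B = {} \<and> N0 (fst (\<omega> n)) \<inter> (if n = 0 then B - Dinf else {}) = {})"
          unfolding assemble_void \<open>\<And>q. Y0 q \<inter> D = Y0 q\<close> by auto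
        finally show ?thesis .
      qed
      show "AE \<omega> in ?PK. \<omega> \<in> Xs -` ?V \<inter> space ?PK \<longleftrightarrow>
        \<omega> \<in> {\<omega>\<in>space ?PK. \<forall>n. Y0 (fst (\<omega> n)) \<inter> shift (- t n) B = {} \<and> N0 (fst (\<omega> n)) \<inter> (if n = 0 then B - Dinf else {}) = {}}"
        using ae AE_space
      proof eventually_elim
        case (elim \<omega>)
        from *[of "Xs \<omega>" \<omega>] elim sub[of \<omega>] measurable_space[OF Xs(1), of \<omega>] show ?case by simp
      qed
      show "Xs -` ?V \<inter> space ?PK \<in> PK.events" by (rule measurable_sets[OF Xs(1) V])
      have f: "(\<lambda>w. fst w) \<in> measurable KK Q" unfolding KK_def by (rule measurable_fst)
      have c: "(\<lambda>\<omega>. fst (\<omega> n)) \<in> measurable ?PK Q" for n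
        by (rule measurable_compose[OF measurable_component_singleton[of n UNIV "\<lambda>_. KK"] f]) simp
      have "{\<omega>\<in>space ?PK. Y0 (fst (\<omega> n)) \<inter> shift (- t n) B = {}} \<inter> {\<omega>\<in>space ?PK. N0 (fst (\<omega> n)) \<inter> (if n = 0 then B - Dinf else {}) = {}} \<in> PK.events" for n
        using B(1) by (intro sets.Int void_event[OF measurable_compose[OF c meas_Y0]] void_event[OF measurable_compose[OF c meas_N0]]) (auto intro: shift_borel)
      then have "(\<Inter>n. {\<omega>\<in>space ?PK. Y0 (fst (\<omega> n)) \<inter> shift (- t n) B = {}} \<inter> {\<omega>\<in>space ?PK. N0 (fst (\<omega> n)) \<inter> (if n = 0 then B - Dinf else {}) = {}}) \<in> PK.events"
        by (intro sets.countable_INT) blast+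
      also have "(\<Inter>n. {\<omega>\<in>space ?PK. Y0 (fst (\<omega> n)) \<inter> shift (- t n) B = {}} \<inter> {\<omega>\<in>space ?PK. N0 (fst (\<omega> n)) \<inter> (if n = 0 then B - Dinf else {}) = {}}) =
        {\<omega>\<in>space ?PK. \<forall>n. Y0 (fst (\<omega> n)) \<inter> shift (- t n) B = {} \<and> N0 (fst (\<omega> n)) \<inter> (if n = 0 then B - Dinf else {}) = {}}" by blast
      finally show "{\<omega>\<in>space ?PK. \<forall>n. Y0 (fst (\<omega> n)) \<inter> shift (- t n) B = {} \<and> N0 (fst (\<omega> n)) \<inter> (if n = 0 then B - Dinf else {}) = {}} \<in> PK.events" .
    qed
    also have "\<dots> = exp (- (leb lam' (B \<inter> Dinf) + leb mu (B - Dinf)))"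
    proof (rule prob_PiM_nat_all_exp)
      fix n :: nat
      let ?C = "if n = 0 then B - Dinf else {}"
      have sB: "shift (- t n) B \<in> sets borel" "bounded (shift (- t n) B)" using B by (auto intro: shift_borel bounded_shift)
      have C: "?C \<in> sets borel" "bounded ?C" using B by (auto intro: bounded_subset)
      show "prob_space KK" by (rule KK.prob_space_axioms)
      have f: "(\<lambda>w. fst w) \<in> measurable KK Q" unfolding KK_def by (rule measurable_fst)
      have "{w\<in>space KK. Y0 (fst w) \<inter> shift (- t n) B = {}} \<inter> {w\<in>space KK. N0 (fst w) \<inter> ?C = {}} \<in> sets KK"
        by (intro sets.Int void_event[OF measurable_compose[OF f meas_Y0] sB(1)] void_event[OF measurable_compose[OF f meas_N0] C(1)])
      then show "{w\<in>space KK. Y0 (fst w) \<inter> shift (- t n) B = {} \<and> N0 (fst w) \<inter> ?C = {}} \<in> sets KK"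
        by (rule back_subst[of "\<lambda>A. A \<in> sets KK"]) blast
      show "KK.prob {w\<in>space KK. Y0 (fst w) \<inter> shift (- t n) B = {} \<and> N0 (fst w) \<inter> ?C = {}} =
          exp (- (leb lam' (D \<inter> shift (- t n) B) + (if n = 0 then leb mu (B - Dinf) else 0)))"
        unfolding YN_void[OF sB C] by simp
    next
      have "(\<lambda>n. measure lborel (shift (t n) D \<inter> B)) sums measure lborel (\<Union>n. shift (t n) D \<inter> B)"
      proof (rule measure_UNION)
        show "disjoint_family (\<lambda>n. shift (t n) D \<inter> B)" using disj unfolding disjoint_family_on_def by blast
        show "range (\<lambda>n. shift (t n) D \<inter> B) \<subseteq> sets lborel" using D B by (auto intro: shift_borel)
        have "bounded (\<Union>n. shift (t n) D \<inter> B)" by (rule bounded_subset[OF B(2)]) auto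
        from emeasure_bounded_finite[OF this] show "emeasure lborel (\<Union>n. shift (t n) D \<inter> B) \<noteq> \<infinity>" by simp
      qed
      also have "(\<Union>n. shift (t n) D \<inter> B) = B \<inter> Dinf" by (auto simp: Dinf_def)
      also have "(\<lambda>n. measure lborel (shift (t n) D \<inter> B)) = (\<lambda>n. measure lborel (D \<inter> shift (- t n) B))"
      proof
        fix n
        have "measure lborel (shift (t n) (D \<inter> shift (- t n) B)) = measure lborel (D \<inter> shift (- t n) B)"
          using D B by (intro measure_shift) (auto intro: shift_borel)
        then show "measure lborel (shift (t n) D \<inter> B) = measure lborel (D \<inter> shift (- t n) B)" by (simp add: shift_Int)
      qed
      finally show "(\<lambda>n. leb lam' (D \<inter> shift (- t n) B) + (if n = 0 then leb mu (B - Dinf) else 0)) sums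
          (leb lam' (B \<inter> Dinf) + leb mu (B - Dinf))"
        by (intro sums_add sums_mult sums_single)
    qed
    finally show ?thesis .
  qed
  moreover have "\<Phi> \<in> measurable config_space config_space"
    unfolding \<Phi>_def[abs_def] by (rule measurable_compose[OF meas_blocks \<Psi>])
  moreover have "\<Phi> (S \<inter> Dinf) = \<Phi> S" for S by (simp add: \<Phi>_def blocks_Int_Dinf)
  ultimately show ?thesis by (intro exI[of _ \<Phi>]) blast
qed

end

section \<open>Filling the Voronoi regions of equivariant centers\<close>

lemma measurable_shift_pair:
  "(\<lambda>z. shift (- fst z) (snd z)) \<in> measurable (borel \<Otimes>\<^sub>M config_space) (config_space :: 'a::euclidean_space set measure)"
proof (rule measurable_configI)
  let ?T = "borel \<Otimes>\<^sub>M config_space :: ('a \<times> 'a set) measure"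
  fix z assume "z \<in> space ?T"
  then show "locally_finite_set (shift (- fst z) (snd z))" by (auto simp: space_pair_measure space_config_space)
next
  let ?T = "borel \<Otimes>\<^sub>M config_space :: ('a \<times> 'a set) measure"
  fix B :: "'a set" assume B: "B \<in> sets borel"
  let ?E = "{u\<in>space (borel \<Otimes>\<^sub>M ?T). fst u - fst (snd u) \<in> B}"
  have "(\<lambda>u. fst u - fst (snd u)) \<in> borel_measurable (borel \<Otimes>\<^sub>M ?T)" by measurable
  from measurable_sets[OF this B] have E: "?E \<in> sets (borel \<Otimes>\<^sub>M ?T)" by (simp add: vimage_def Int_def conj_commute)
  have "{z\<in>space ?T. \<exists>x\<in>snd z. (x, z) \<in> ?E} \<in> sets ?T" by (rule sets_ex_point[OF measurable_snd E])
  then have "space ?T - {z\<in>space ?T. \<exists>x\<in>snd z. (x, z) \<in> ?E} \<in> sets ?T" by (rule sets.compl_sets)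
  moreover have "space ?T - {z\<in>space ?T. \<exists>x\<in>snd z. (x, z) \<in> ?E} = {z\<in>space ?T. shift (- fst z) (snd z) \<inter> B = {}}"
  proof -
    have "shift (- c) S \<inter> B = {} \<longleftrightarrow> (\<forall>x\<in>S. x - c \<notin> B)" for c :: 'a and S
      unfolding shift_conv by auto
    then show ?thesis by (auto simp: space_pair_measure)
  qed
  ultimately show "{z\<in>space ?T. shift (- fst z) (snd z) \<inter> B = {}} \<in> sets ?T" by simp
qed

text \<open>
  Voronoi regions of the projections; ties belong to no region.
\<close>

definition voronoi :: "('a::euclidean_space \<Rightarrow> 'a) \<Rightarrow> 'a set \<Rightarrow> 'a \<Rightarrow> 'a set" where
  "voronoi pj C c = {x. \<forall>c'\<in>C. c' \<noteq> c \<longrightarrow> norm (pj x - c) < norm (pj x - c')}"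

lemma Un_Int_empty: "(P \<union> Q) \<inter> R = {} \<longleftrightarrow> P \<inter> R = {} \<and> Q \<inter> R = {}"
  by blast

lemma all_nat_split: "(\<forall>n::nat. Q n) \<longleftrightarrow> Q 0 \<and> (\<forall>m. Q (Suc m))"
  by (metis not0_implies_Suc)

text \<open>
  \<open>w\<close> is a unit normal of the hyperplane \<open>V\<close> and \<open>pj\<close> the orthogonal projection to it. The column \<open>Dinf\<close> over the unit
  ball starts at height 1, beyond the slab.
\<close>

locale slab =
  fixes w :: "'a::euclidean_space"
  assumes w: "norm w = 1"
begin

definition pj :: "'a \<Rightarrow> 'a" where "pj x = x - (w \<bullet> x) *\<^sub>R w"
definition V :: "'a set" where "V = {v. w \<bullet> v = 0}"
definition slab :: "'a set" where "slab = {x. 0 \<le> w \<bullet> x \<and> w \<bullet> x < 1}"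
definition D :: "'a set" where "D = {x. norm (pj x) < 1 \<and> 1 \<le> w \<bullet> x \<and> w \<bullet> x < 2}"
definition t :: "nat \<Rightarrow> 'a" where "t n = real n *\<^sub>R w"

lemma ww: "w \<bullet> w = 1" using w by (simp add: norm_eq_1)

lemma pj_add: "pj (x + y) = pj x + pj y" and pj_diff: "pj (x - y) = pj x - pj y"
  by (simp_all add: pj_def inner_add_right inner_diff_right algebra_simps)

lemma pj_V: "v \<in> V \<Longrightarrow> pj v = v" by (simp add: pj_def V_def)

lemma w_V: "v \<in> V \<Longrightarrow> w \<bullet> v = 0" by (simp add: V_def)

lemma pj_in_V: "pj x \<in> V" by (simp add: pj_def V_def inner_diff_right ww)

lemma pj_t: "pj (t n) = 0" by (simp add: pj_def t_def ww)

lemma inner_pj: "v \<in> V \<Longrightarrow> pj x \<bullet> v = x \<bullet> v" by (simp add: pj_def V_def inner_diff_left)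

lemma norm_pj_le: "norm (pj x) \<le> norm x"
proof -
  have "(norm (pj x))\<^sup>2 = (norm x)\<^sup>2 - (w \<bullet> x)\<^sup>2"
    unfolding pj_def power2_norm_eq_inner
    by (simp add: inner_diff_left inner_diff_right ww inner_commute power2_eq_square algebra_simps)
  then have "(norm (pj x))\<^sup>2 \<le> (norm x)\<^sup>2" by simp
  then show ?thesis by (rule power2_le_imp_le) simp
qed

lemma norm_le_pj: "norm x \<le> norm (pj x) + \<bar>w \<bullet> x\<bar>"
proof -
  have "x = pj x + (w \<bullet> x) *\<^sub>R w" by (simp add: pj_def)
  then have "norm x \<le> norm (pj x) + norm ((w \<bullet> x) *\<^sub>R w)" by (metis norm_triangle_ineq)
  then show ?thesis using w by simp
qed

lemma pj_measurable [measurable]: "pj \<in> borel_measurable borel"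
  unfolding pj_def[abs_def] by measurable

lemma continuous_pj: "continuous_on UNIV pj"
  unfolding pj_def[abs_def] by (intro continuous_intros)

lemma slab_borel [measurable]: "slab \<in> sets borel" unfolding slab_def by measurable

lemma D_borel [measurable]: "D \<in> sets borel" unfolding D_def by measurable

lemma D_bounded: "bounded D"
  unfolding bounded_iff
proof (intro exI ballI)
  fix x assume "x \<in> D"
  then show "norm x \<le> 3" using norm_le_pj[of x] by (auto simp: D_def)
qed

lemma D_pos: "0 < measure lborel D"
proof (rule open_measure_pos[OF _ _ _ D_borel D_bounded])
  have o1: "open {x. norm (pj x) < 1}"
    by (intro open_Collect_less continuous_on_norm continuous_pj continuous_on_const)
  have o2: "open {x. 1 < w \<bullet> x}" "open {x. w \<bullet> x < 2}"
    by (intro open_Collect_less continuous_intros)+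
  show "open ({x. norm (pj x) < 1} \<inter> ({x. 1 < w \<bullet> x} \<inter> {x. w \<bullet> x < 2}))"
    by (intro open_Int o1 o2)
  show "(3/2) *\<^sub>R w \<in> {x. norm (pj x) < 1} \<inter> ({x. 1 < w \<bullet> x} \<inter> {x. w \<bullet> x < 2})"
    by (simp add: pj_def ww)
  show "{x. norm (pj x) < 1} \<inter> ({x. 1 < w \<bullet> x} \<inter> {x. w \<bullet> x < 2}) \<subseteq> D" by (auto simp: D_def)
qed

lemma shift_D: "shift (t n) D = {x. norm (pj x) < 1 \<and> real n + 1 \<le> w \<bullet> x \<and> w \<bullet> x < real n + 2}"
proof -
  have "w \<bullet> t n = real n" by (simp add: t_def ww)
  then show ?thesis by (auto simp: mem_shift D_def pj_diff pj_t inner_diff_right)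
qed

lemma disjoint_shift_D: "disjoint_family (\<lambda>n. shift (t n) D)"
proof -
  have "m = n" if "x \<in> shift (t m) D" "x \<in> shift (t n) D" for x m n
    using that unfolding shift_D mem_Collect_eq by linarith
  then show ?thesis unfolding disjoint_family_on_def by blast
qed

lemma finite_shift_D:
  assumes "bounded B" shows "finite {n. shift (t n) D \<inter> B \<noteq> {}}"
proof -
  obtain r where r: "\<And>x. x \<in> B \<Longrightarrow> norm x \<le> r" using assms by (auto simp: bounded_iff)
  have "{n. shift (t n) D \<inter> B \<noteq> {}} \<subseteq> {..nat \<lceil>r\<rceil>}"
  proof
    fix n assume "n \<in> {n. shift (t n) D \<inter> B \<noteq> {}}"
    then obtain x where x: "x \<in> B" "real n + 1 \<le> w \<bullet> x" by (auto simp: shift_D)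
    have "w \<bullet> x \<le> norm w * norm x" by (rule norm_cauchy_schwarz)
    then have "real n \<le> r" using x r[OF x(1)] w by simp
    then show "n \<in> {..nat \<lceil>r\<rceil>}" by simp linarith
  qed
  then show ?thesis by (rule finite_subset) simp
qed

definition Dinf :: "'a set" where "Dinf = {x. norm (pj x) < 1 \<and> 1 \<le> w \<bullet> x}"

lemma UN_shift_D: "(\<Union>n. shift (t n) D) = Dinf"
proof
  show "(\<Union>n. shift (t n) D) \<subseteq> Dinf" unfolding shift_D Dinf_def by auto
  show "Dinf \<subseteq> (\<Union>n. shift (t n) D)"
  proof
    fix x assume x: "x \<in> Dinf"
    let ?n = "nat (\<lfloor>w \<bullet> x\<rfloor> - 1)"
    have "real ?n + 1 \<le> w \<bullet> x \<and> w \<bullet> x < real ?n + 2" using x unfolding Dinf_def mem_Collect_eq by linarith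
    then show "x \<in> (\<Union>n. shift (t n) D)" using x unfolding shift_D Dinf_def by blast
  qed
qed

lemma ex_Phi:
  assumes "0 < lam" "lam < lam'"
  shows "\<exists>\<Phi>. \<Phi> \<in> measurable config_space (config_space :: 'a set measure) \<and> (\<forall>S. \<Phi> (S \<inter> Dinf) = \<Phi> S) \<and>
    (\<forall>(M :: 'a set measure) T B. void_process M T (leb lam) \<longrightarrow> B \<in> sets borel \<longrightarrow> bounded B \<longrightarrow>
      measure M {\<omega>\<in>space M. (T \<omega> \<inter> Dinf \<union> \<Phi> (T \<omega>)) \<inter> B = {}} = exp (- (leb lam' (B \<inter> Dinf) + leb (lam' - lam) (B - Dinf))))"
proof -
  interpret C: thicken_column lam lam' D t
    by unfold_locales (use assms D_borel D_bounded D_pos disjoint_shift_D finite_shift_D in auto)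
  have "C.Dinf = Dinf" unfolding C.Dinf_def by (rule UN_shift_D)
  then show ?thesis using C.column_thickening[where ?'w = "'a set"] by simp
qed

lemma voronoi_borel:
  assumes "countable C" shows "voronoi pj C c \<in> sets borel"
proof -
  have "{x. c' \<noteq> c \<longrightarrow> norm (pj x - c) < norm (pj x - c')} \<in> sets borel" for c' by measurable
  then have "(\<Inter>c'\<in>C. {x. c' \<noteq> c \<longrightarrow> norm (pj x - c) < norm (pj x - c')}) \<in> sets borel"
    using assms by (intro sets.countable_INT'') auto
  then show ?thesis by (rule back_subst[of "\<lambda>A. A \<in> sets borel"]) (auto simp: voronoi_def)
qed

lemma voronoi_disjoint: "c \<in> C \<Longrightarrow> c' \<in> C \<Longrightarrow> c \<noteq> c' \<Longrightarrow> voronoi pj C c \<inter> voronoi pj C c' = {}"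
  unfolding disjoint_iff voronoi_def mem_Collect_eq by (metis less_asym)

lemma voronoi_shift: "v \<in> V \<Longrightarrow> voronoi pj (shift v C) (c + v) = shift v (voronoi pj C c)"
proof -
  assume v: "v \<in> V"
  show ?thesis
  proof (intro set_eqI)
    fix x
    have "x \<in> voronoi pj (shift v C) (c + v) \<longleftrightarrow> (\<forall>d\<in>C. d + v \<noteq> c + v \<longrightarrow> norm (pj x - (c + v)) < norm (pj x - (d + v)))"
      by (simp add: voronoi_def shift_conv)
    also have "\<dots> \<longleftrightarrow> x \<in> shift v (voronoi pj C c)"
      by (simp add: mem_shift voronoi_def pj_diff pj_V[OF v] algebra_simps)
    finally show "x \<in> voronoi pj (shift v C) (c + v) \<longleftrightarrow> x \<in> shift v (voronoi pj C c)" .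
  qed
qed

text \<open>
  A point outside of all regions has two nearest centers, hence lies on one of countably many bisecting hyperplanes.
  Local finiteness provides a nearest center.
\<close>

lemma voronoi_null:
  assumes C: "locally_finite_set C" "C \<subseteq> V" "C \<noteq> {}"
  shows "\<exists>N. N \<in> null_sets lborel \<and> - (\<Union>c\<in>C. voronoi pj C c) \<subseteq> N"
proof -
  have cC: "countable C" by (rule locally_finite_countable[OF C(1)])
  let ?H = "\<lambda>c c'. {x. (2 *\<^sub>R (c' - c)) \<bullet> x = c' \<bullet> c' - c \<bullet> c}"
  let ?N = "\<Union>c\<in>C. \<Union>c'\<in>C - {c}. ?H c c'"
  have H: "?H c c' \<in> null_sets lborel" if "c \<noteq> c'" for c c'
  proof -
    have "negligible (?H c c')" by (rule negligible_hyperplane) (use that in auto)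
    moreover have "?H c c' \<in> sets borel" by (intro borel_closed closed_hyperplane)
    ultimately show ?thesis by (simp add: negligible_iff_null_sets null_sets_completion_iff)
  qed
  have "?N \<in> null_sets lborel"
    by (intro null_sets_UN' cC H countable_subset[OF _ cC]) auto
  moreover have "- (\<Union>c\<in>C. voronoi pj C c) \<subseteq> ?N"
  proof
    fix x assume x: "x \<in> - (\<Union>c\<in>C. voronoi pj C c)"
    obtain c0 where c0: "c0 \<in> C" using C(3) by blast
    let ?F = "C \<inter> cball (pj x) (norm (pj x - c0))"
    have F: "finite ?F" using C(1) by (auto simp: locally_finite_set_def)
    have ne: "?F \<noteq> {}" using c0 by (auto simp: dist_norm)
    obtain c where c: "c \<in> ?F" "\<And>d. d \<in> ?F \<Longrightarrow> norm (pj x - c) \<le> norm (pj x - d)"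
      using arg_min_if_finite[OF F ne, of "\<lambda>d. norm (pj x - d)"] not_less by blast
    have min: "norm (pj x - c) \<le> norm (pj x - d)" if "d \<in> C" for d
    proof (cases "d \<in> ?F")
      case False
      then have "norm (pj x - c0) < norm (pj x - d)" using that by (auto simp: dist_norm)
      moreover have "norm (pj x - c) \<le> norm (pj x - c0)" using c(1) by (auto simp: dist_norm)
      ultimately show ?thesis by linarith
    qed (rule c(2))
    have "x \<notin> voronoi pj C c" using x c(1) by auto
    then obtain d where d: "d \<in> C" "d \<noteq> c" "norm (pj x - d) \<le> norm (pj x - c)" by (auto simp: voronoi_def not_less)
    with min[OF d(1)] have "norm (pj x - d) = norm (pj x - c)" by linarith
    then have "(pj x - d) \<bullet> (pj x - d) = (pj x - c) \<bullet> (pj x - c)" by (simp add: norm_eq)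
    then have "2 * (pj x \<bullet> d) - 2 * (pj x \<bullet> c) = d \<bullet> d - c \<bullet> c"
      by (simp add: inner_diff_left inner_diff_right inner_commute)
    moreover have "pj x \<bullet> d = x \<bullet> d" "pj x \<bullet> c = x \<bullet> c" using inner_pj d(1) c(1) C(2) by auto
    ultimately have "x \<in> ?H c d" by (simp add: inner_diff_left inner_commute algebra_simps)
    then show "x \<in> ?N" using c(1) d(1,2) by blast
  qed
  ultimately show ?thesis by blast
qed

end

text \<open>
  The properties of the centers \<open>ctr\<close> and of the column map \<open>\<Phi>\<close> under which the column of each center can fill the Voronoi
  region of this center: the centers depend on the slab only, equivariantly, and are separated enough for the
  columns to be disjoint.
\<close>

locale centered = slab w for w :: "'a::euclidean_space" +
  fixes lam lam' :: real and ctr :: "'a set \<Rightarrow> 'a set" and \<Phi> :: "'a set \<Rightarrow> 'a set"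
  assumes lam: "0 < lam" "lam < lam'"
    and ctr_meas: "ctr \<in> measurable config_space config_space"
    and ctr_V: "\<And>S. ctr S \<subseteq> V"
    and ctr_sep: "\<And>S c c'. c \<in> ctr S \<Longrightarrow> c' \<in> ctr S \<Longrightarrow> c \<noteq> c' \<Longrightarrow> 2 \<le> norm (c - c')"
    and ctr_slab: "\<And>S. ctr (S \<inter> slab) = ctr S"
    and ctr_shift: "\<And>S v. v \<in> V \<Longrightarrow> ctr (shift v S) = shift v (ctr S)"
    and ctr_ne: "\<And>(M :: 'a set measure) T. void_process M T (leb lam) \<Longrightarrow> AE \<omega> in M. ctr (T \<omega>) \<noteq> {}"
    and Phi_meas: "\<Phi> \<in> measurable config_space config_space"
    and Phi_Dinf: "\<And>S. \<Phi> (S \<inter> Dinf) = \<Phi> S"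
    and Phi_void: "\<And>(M :: 'a set measure) T B. void_process M T (leb lam) \<Longrightarrow> B \<in> sets borel \<Longrightarrow> bounded B \<Longrightarrow>
      measure M {\<omega>\<in>space M. (T \<omega> \<inter> Dinf \<union> \<Phi> (T \<omega>)) \<inter> B = {}} = exp (- (leb lam' (B \<inter> Dinf) + leb (lam' - lam) (B - Dinf)))"
begin

definition f :: "'a set \<Rightarrow> 'a set" where
  "f S = (\<Union>c\<in>ctr S. shift c (\<Phi> (shift (- c) S)) \<inter> voronoi pj (ctr S) c)"

lemma f_shift: assumes v: "v \<in> V" shows "f (shift v S) = shift v (f S)"
proof -
  have "f (shift v S) = (\<Union>c\<in>ctr S. shift (c + v) (\<Phi> (shift (- (c + v)) (shift v S))) \<inter> voronoi pj (shift v (ctr S)) (c + v))"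
    unfolding f_def ctr_shift[OF v] by (simp only: shift_conv[of v "ctr S"] UN_simps image_image)
  also have "\<dots> = (\<Union>c\<in>ctr S. shift v (shift c (\<Phi> (shift (- c) S)) \<inter> voronoi pj (ctr S) c))"
    by (simp add: voronoi_shift[OF v] shift_Int add.commute)
  finally show ?thesis unfolding f_def by (simp only: shift_UN)
qed

lemma lf_ctr: "locally_finite_set S \<Longrightarrow> locally_finite_set (ctr S)"
  using measurable_space[OF ctr_meas, of S] by (simp add: space_config_space)

lemma lf_Phi: "locally_finite_set S \<Longrightarrow> locally_finite_set (\<Phi> S)"
  using measurable_space[OF Phi_meas, of S] by (simp add: space_config_space)

lemma f_locally_finite:
  assumes S: "locally_finite_set S" shows "locally_finite_set (f S)"
proof (cases "ctr S = {}")
  case True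
  then show ?thesis by (simp add: f_def locally_finite_set_def)
next
  case False
  then obtain c0 where c0: "c0 \<in> ctr S" by blast
  show ?thesis unfolding locally_finite_set_def
  proof (intro allI impI)
    fix B :: "'a set" assume B: "bounded B"
    then obtain R where R: "\<And>x. x \<in> B \<Longrightarrow> norm x \<le> R" by (auto simp: bounded_iff)
    let ?F = "ctr S \<inter> cball 0 (2 * R + norm c0)"
    have F: "finite ?F" using lf_ctr[OF S] by (auto simp: locally_finite_set_def)
    have "f S \<inter> B \<subseteq> (\<Union>c\<in>?F. shift c (\<Phi> (shift (- c) S)) \<inter> B)"
    proof
      fix x assume x: "x \<in> f S \<inter> B"
      then obtain c where c: "c \<in> ctr S" "x \<in> shift c (\<Phi> (shift (- c) S))" "x \<in> voronoi pj (ctr S) c" by (auto simp: f_def)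
      have "norm (pj x - c) \<le> norm (pj x - c0)" using c c0 by (cases "c = c0") (auto simp: voronoi_def)
      moreover have "norm (pj x - c0) \<le> norm (pj x) + norm c0" by (rule norm_triangle_ineq4)
      moreover have "norm c \<le> norm (pj x - c) + norm (pj x)" using norm_triangle_sub[of c "pj x"] by (simp add: norm_minus_commute)
      moreover have "norm (pj x) \<le> R" using norm_pj_le[of x] R[of x] x by auto
      ultimately have "c \<in> ?F" using c by simp
      then show "x \<in> (\<Union>c\<in>?F. shift c (\<Phi> (shift (- c) S)) \<inter> B)" using c x by blast
    qed
    moreover have "finite (shift c (\<Phi> (shift (- c) S)) \<inter> B)" for c
    proof -
      have "locally_finite_set (shift c (\<Phi> (shift (- c) S)))" by (intro locally_finite_shift lf_Phi S)
      then show ?thesis using B by (simp only: locally_finite_set_def)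
    qed
    ultimately show "finite (f S \<inter> B)" using F by (meson finite_UN_I finite_subset)
  qed
qed

text \<open>
  \<open>f S\<close> meets \<open>B\<close> iff some center \<open>c\<close> and some point \<open>y\<close> of its column map satisfy a measurable condition, where
  lying in the Voronoi region is the absence of a nearer center; so the claim follows from three nested statements
  about existence of points.
\<close>

lemma f_meas: "f \<in> measurable config_space config_space"
proof (rule measurable_configI)
  fix S assume "S \<in> space (config_space :: 'a set measure)"
  then show "locally_finite_set (f S)" by (simp add: f_locally_finite space_config_space)
next
  fix B :: "'a set" assume B: "B \<in> sets borel"
  let ?C = "config_space :: 'a set measure"
  let ?T = "(borel :: 'a measure) \<Otimes>\<^sub>M ?C"
  let ?T3 = "(borel :: 'a measure) \<Otimes>\<^sub>M ?T"
  define bad where "bad = {u\<in>space (borel \<Otimes>\<^sub>M ?T3). fst u \<noteq> fst (snd (snd u)) \<and>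
      \<not> norm (pj (fst (snd u) + fst (snd (snd u))) - fst (snd (snd u))) < norm (pj (fst (snd u) + fst (snd (snd u))) - fst u)}"
  have bad: "bad \<in> sets (borel \<Otimes>\<^sub>M ?T3)" unfolding bad_def by measurable
  have ctr3: "(\<lambda>z. ctr (snd (snd z))) \<in> measurable ?T3 ?C"
    by (rule measurable_compose[OF _ ctr_meas]) simp
  define E3 where "E3 = {z\<in>space ?T3. fst z + fst (snd z) \<in> B} \<inter> (space ?T3 - {z\<in>space ?T3. \<exists>c'\<in>ctr (snd (snd z)). (c', z) \<in> bad})"
  have "(\<lambda>z. fst z + fst (snd z)) \<in> borel_measurable ?T3"
    by (intro borel_measurable_add measurable_fst measurable_compose[OF measurable_snd measurable_fst])
  from measurable_sets[OF this B] have "{z\<in>space ?T3. fst z + fst (snd z) \<in> B} \<in> sets ?T3" by (simp add: vimage_def Int_def conj_commute)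
  then have E3: "E3 \<in> sets ?T3" unfolding E3_def by (intro sets.Int sets.compl_sets sets_ex_point[OF ctr3 bad])
  define E2 where "E2 = {z\<in>space ?T. \<exists>y\<in>\<Phi> (shift (- fst z) (snd z)). (y, z) \<in> E3}"
  have E2: "E2 \<in> sets ?T" unfolding E2_def
    by (rule sets_ex_point[OF measurable_compose[OF measurable_shift_pair Phi_meas] E3])
  have "space ?C - {S\<in>space ?C. \<exists>c\<in>ctr S. (c, S) \<in> E2} \<in> sets ?C"
    by (intro sets.compl_sets sets_ex_point[OF ctr_meas E2])
  moreover have "space ?C - {S\<in>space ?C. \<exists>c\<in>ctr S. (c, S) \<in> E2} = {S\<in>space ?C. f S \<inter> B = {}}"
  proof -
    have "(\<exists>c\<in>ctr S. (c, S) \<in> E2) \<longleftrightarrow> f S \<inter> B \<noteq> {}" if S: "S \<in> space ?C" for S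
    proof -
      have 3: "(y, c, S) \<in> E3 \<longleftrightarrow> y + c \<in> B \<and> y + c \<in> voronoi pj (ctr S) c" for y c
        using S unfolding E3_def bad_def voronoi_def by (auto simp: space_pair_measure)
      have "(\<exists>c\<in>ctr S. (c, S) \<in> E2) \<longleftrightarrow> (\<exists>c\<in>ctr S. \<exists>y\<in>\<Phi> (shift (- c) S). y + c \<in> B \<and> y + c \<in> voronoi pj (ctr S) c)"
        unfolding E2_def using S by (simp add: 3 space_pair_measure)
      also have "\<dots> \<longleftrightarrow> f S \<inter> B \<noteq> {}"
        unfolding f_def shift_conv[of _ "\<Phi> _"] by blast
      finally show ?thesis .
    qed
    then show ?thesis by blast
  qed
  ultimately show "{S\<in>space ?C. f S \<inter> B = {}} \<in> sets ?C" by simp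
qed

lemma measure_null_part:
  fixes B N :: "'a set"
  assumes B: "B \<in> sets borel" and A: "A \<in> sets borel" "A \<subseteq> B" and N: "N \<in> null_sets lborel" "B - A \<subseteq> N"
  shows "measure lborel A = measure lborel B"
proof -
  have "B - A \<in> null_sets lborel" using N B A by (intro null_sets_subset[OF N(1)]) auto
  then have "measure lborel (B - (B - A)) = measure lborel B" using B by (intro measure_Diff_null_set) auto
  moreover have "B - (B - A) = A" using A by auto
  ultimately show ?thesis by simp
qed

lemma measure_split:
  assumes "bounded B" "B \<in> sets borel" "A \<in> sets borel"
  shows "measure lborel (B \<inter> A) + measure lborel (B - A) = measure lborel (B :: 'a set)"
proof -
  have "measure lborel ((B \<inter> A) \<union> (B - A)) = measure lborel (B \<inter> A) + measure lborel (B - A)"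
    using assms emeasure_bounded_finite[OF bounded_subset[OF assms(1)]]
    by (intro measure_Union) (auto simp: less_top[symmetric])
  moreover have "(B \<inter> A) \<union> (B - A) = B" by blast
  ultimately show ?thesis by simp
qed

lemma col_slab: assumes "c \<in> V" shows "shift c Dinf \<inter> slab = {}"
  using w_V[OF assms] by (auto simp: mem_shift Dinf_def slab_def inner_diff_right)

lemma col_voronoi:
  assumes c: "c \<in> ctr S" shows "shift c Dinf \<subseteq> voronoi pj (ctr S) c"
proof
  fix x assume "x \<in> shift c Dinf"
  moreover have "pj c = c" using ctr_V c pj_V by blast
  ultimately have x: "norm (pj x - c) < 1" by (simp add: mem_shift Dinf_def pj_diff)
  show "x \<in> voronoi pj (ctr S) c" unfolding voronoi_def
  proof (intro CollectI ballI impI)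
    fix d assume d: "d \<in> ctr S" "d \<noteq> c"
    have "2 \<le> norm (d - c)" by (rule ctr_sep[OF d(1) c d(2)])
    also have "\<dots> \<le> norm (d - pj x) + norm (pj x - c)" using norm_triangle_ineq[of "d - pj x" "pj x - c"] by simp
    finally show "norm (pj x - c) < norm (pj x - d)" using x by (simp add: norm_minus_commute)
  qed
qed

text \<open>
  Fix the part of the configuration in the slab, and with it the centers. The rest is a Poisson process independent of
  this part. The event of being void on \<open>B\<close> then splits into independent events, one for each column and one for the
  space outside of the slab and the columns: the region of a center receives intensity \<open>lam'\<close> in the column and
  \<open>lam' - lam\<close> from it elsewhere, to which the given points add \<open>lam\<close> outside of the slab.
\<close>

lemma fixed_slab:
  fixes M :: "'a set measure"
  assumes M: "void_process M (\<lambda>S. S) (leb lam)" and S: "locally_finite_set S" "ctr S \<noteq> {}" "S \<inter> slab \<inter> B = {}"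
    and B: "B \<in> sets borel" "bounded B"
  shows "measure M {T\<in>space M. ((S \<inter> slab \<union> (T - slab)) \<union> f (S \<inter> slab \<union> (T - slab))) \<inter> B = {}} =
    exp (- (leb lam' (B - slab) + leb (lam' - lam) (B \<inter> slab)))"
proof -
  note MD = void_processD[OF M]
  interpret M: prob_space M by fact
  define CS where "CS = ctr S"
  have lfCS: "locally_finite_set CS" unfolding CS_def by (rule lf_ctr[OF S(1)])
  have cCS: "countable CS" by (rule locally_finite_countable[OF lfCS])
  have CSV: "CS \<subseteq> V" unfolding CS_def by (rule ctr_V)
  have colb: "shift c Dinf \<in> sets borel" for c
  proof -
    have "Dinf \<in> sets borel" unfolding Dinf_def by measurable
    then show ?thesis by (rule shift_borel)
  qed
  have Vb: "voronoi pj CS c \<in> sets borel" for c by (rule voronoi_borel[OF cCS])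
  define cols where "cols = (\<Union>c\<in>CS. shift c Dinf)"
  have colsb: "cols \<in> sets borel" unfolding cols_def by (intro sets.countable_UN'[OF cCS]) (use colb in auto)
  have col_voronoi_CS: "shift c Dinf \<subseteq> voronoi pj CS c" if "c \<in> CS" for c using col_voronoi that unfolding CS_def by blast
  have coldis: "shift c Dinf \<inter> shift d Dinf = {}" if "c \<in> CS" "d \<in> CS" "c \<noteq> d" for c d
    using col_voronoi_CS that voronoi_disjoint[OF that] by blast
  let ?X = "\<lambda>T. S \<inter> slab \<union> (T - slab)"
  define Bc where "Bc c = shift (- c) (B \<inter> voronoi pj CS c)" for c
  have Bcb: "Bc c \<in> sets borel" "bounded (Bc c)" for c
    unfolding Bc_def using B Vb by (auto intro!: shift_borel bounded_shift simp: bounded_Int)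
  define Ev where "Ev c T \<longleftrightarrow> (shift (- c) T \<inter> Dinf \<union> \<Phi> (shift (- c) T)) \<inter> Bc c = {}" for c T
  have ctrX: "ctr (?X T) = CS" for T
  proof -
    have "?X T \<inter> slab = S \<inter> slab" by blast
    then have "ctr (?X T) = ctr (S \<inter> slab)" by (metis ctr_slab)
    then show ?thesis unfolding CS_def by (simp add: ctr_slab)
  qed
  have Ev_col: "Ev c (T \<inter> shift c Dinf) \<longleftrightarrow> Ev c T" for c T
  proof -
    have "shift (- c) (T \<inter> shift c Dinf) = shift (- c) T \<inter> Dinf" by (simp add: shift_Int)
    then show ?thesis unfolding Ev_def using Phi_Dinf[of "shift (- c) T"] by simp
  qed
  have PhiX: "\<Phi> (shift (- c) (?X T)) = \<Phi> (shift (- c) T)" if "c \<in> CS" for c T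
  proof -
    have "?X T \<inter> shift c Dinf = T \<inter> shift c Dinf" using col_slab[of c] that CSV by blast
    then have "shift (- c) (?X T \<inter> shift c Dinf) = shift (- c) (T \<inter> shift c Dinf)" by simp
    then have "shift (- c) (?X T) \<inter> Dinf = shift (- c) T \<inter> Dinf" by (simp add: shift_Int)
    then show ?thesis by (metis Phi_Dinf)
  qed
  define Rest where "Rest = - slab - cols"
  have Restb: "Rest \<in> sets borel" unfolding Rest_def using colsb by (intro sets.Diff) auto
  have event: "(?X T \<union> f (?X T)) \<inter> B = {} \<longleftrightarrow> T \<inter> (Rest \<inter> B) = {} \<and> (\<forall>c\<in>CS. Ev c T)" for T
  proof -
    have fX: "f (?X T) \<inter> B = {} \<longleftrightarrow> (\<forall>c\<in>CS. \<Phi> (shift (- c) T) \<inter> Bc c = {})"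
    proof -
      have "f (?X T) \<inter> B = {} \<longleftrightarrow> (\<forall>c\<in>CS. shift c (\<Phi> (shift (- c) T)) \<inter> (B \<inter> voronoi pj CS c) = {})"
        unfolding f_def ctrX using PhiX by (auto 4 4)
      then show ?thesis unfolding Bc_def by (simp only: shift_Int_eq_empty)
    qed
    have XB: "?X T \<inter> B = {} \<longleftrightarrow> T \<inter> (Rest \<inter> B) = {} \<and> (\<forall>c\<in>CS. shift (- c) T \<inter> Dinf \<inter> Bc c = {})"
    proof -
      have "?X T \<inter> B = {} \<longleftrightarrow> T \<inter> (- slab \<inter> B) = {}" using S(3) by blast
      also have "\<dots> \<longleftrightarrow> T \<inter> (Rest \<inter> B) = {} \<and> (\<forall>c\<in>CS. T \<inter> (shift c Dinf \<inter> B) = {})"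
        unfolding Rest_def cols_def using col_slab CSV by blast
      also have "(\<forall>c\<in>CS. T \<inter> (shift c Dinf \<inter> B) = {}) \<longleftrightarrow> (\<forall>c\<in>CS. T \<inter> (shift c Dinf \<inter> (B \<inter> voronoi pj CS c)) = {})"
        using col_voronoi_CS by blast
      also have "\<dots> \<longleftrightarrow> (\<forall>c\<in>CS. shift (- c) T \<inter> Dinf \<inter> Bc c = {})"
        unfolding Bc_def by (simp add: shift_Int_eq_empty shift_Int Int_assoc)
      finally show ?thesis .
    qed
    show ?thesis unfolding Un_Int_empty[of "?X T"] fX XB unfolding Ev_def Un_Int_empty
      by (simp only: ball_conj_distrib conj_assoc)
  qed
  let ?act = "\<lambda>n. n \<in> to_nat_on CS ` CS"
  let ?cc = "from_nat_into CS"
  have cc: "?cc n \<in> CS" for n using from_nat_into[of CS n] S(2) unfolding CS_def by blast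
  have cc_inj: "?cc m \<noteq> ?cc n" if "?act m" "?act n" "m \<noteq> n" for m n
    using that cCS by (metis (no_types, lifting) from_nat_into_to_nat_on imageE)
  have act_all: "(\<forall>c\<in>CS. P c) \<longleftrightarrow> (\<forall>n. ?act n \<longrightarrow> P (?cc n))" for P
    using cCS cc by (metis (no_types, lifting) from_nat_into_to_nat_on imageI)
  have UN_act: "(\<Union>n. if ?act n then g (?cc n) else {}) = (\<Union>c\<in>CS. g c)" for g :: "'a \<Rightarrow> 'a set"
  proof (intro set_eqI)
    fix x
    have "x \<notin> (\<Union>n. if ?act n then g (?cc n) else {}) \<longleftrightarrow> (\<forall>n. ?act n \<longrightarrow> x \<notin> g (?cc n))" by auto
    also have "\<dots> \<longleftrightarrow> (\<forall>c\<in>CS. x \<notin> g c)" by (rule act_all[symmetric])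
    finally show "x \<in> (\<Union>n. if ?act n then g (?cc n) else {}) \<longleftrightarrow> x \<in> (\<Union>c\<in>CS. g c)" by blast
  qed
  \<comment> \<open>Region 0 is what is outside of slab and columns; region m + 1 is the m-th column, or empty if there is none.\<close>
  define Rg where "Rg n = (case n of 0 \<Rightarrow> Rest | Suc m \<Rightarrow> if ?act m then shift (?cc m) Dinf else {})" for n
  define P where "P n T \<longleftrightarrow> (case n of 0 \<Rightarrow> T \<inter> (Rest \<inter> B) = {} | Suc m \<Rightarrow> ?act m \<longrightarrow> Ev (?cc m) T)" for n T
  define r where "r n = (case n of 0 \<Rightarrow> leb lam (Rest \<inter> B) | Suc m \<Rightarrow> if ?act m then
      leb lam' (B \<inter> shift (?cc m) Dinf) + leb (lam' - lam) (B \<inter> voronoi pj CS (?cc m) - shift (?cc m) Dinf) else 0)" for n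
  have Rgb: "Rg n \<in> sets borel" for n by (auto simp: Rg_def Restb colb split: nat.split)
  have Rgdis: "disjoint_family Rg"
    unfolding disjoint_family_on_def
  proof (intro ballI impI)
    fix m n :: nat assume mn: "m \<noteq> n"
    have R0: "Rest \<inter> shift (?cc k) Dinf = {}" for k using cc unfolding Rest_def cols_def by blast
    show "Rg m \<inter> Rg n = {}"
      using mn R0 coldis[OF cc cc cc_inj] by (cases m; cases n) (auto simp: Rg_def)
  qed
  have Pev: "{T\<in>space M. P n T} \<in> sets M" for n
  proof (cases n)
    case 0
    then show ?thesis using void_event[OF MD(2), of "Rest \<inter> B"] Restb B by (simp add: P_def)
  next
    case (Suc m)
    have "(\<lambda>T. shift (- c) T \<inter> Dinf \<union> \<Phi> (shift (- c) T)) \<in> measurable M config_space" for c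
      using colb[of 0] by (intro measurable_config_Un measurable_compose[OF MD(2) measurable_compose[OF measurable_shift Phi_meas]]
        measurable_compose[OF MD(2) measurable_compose[OF measurable_shift measurable_config_Int]]) simp
    from void_event[OF this Bcb(1)] show ?thesis by (cases "?act m") (simp_all add: P_def Suc Ev_def)
  qed
  have PC: "{T\<in>space config_space. P n T} \<in> sets config_space" for n
  proof (cases n)
    case 0
    then show ?thesis using sets_void[of "Rest \<inter> B"] Restb B by (simp add: P_def)
  next
    case (Suc m)
    have "(\<lambda>T. shift (- c) T \<inter> Dinf \<union> \<Phi> (shift (- c) T)) \<in> measurable config_space config_space" for c
      using colb[of 0] by (intro measurable_config_Un measurable_compose[OF measurable_shift Phi_meas] measurable_compose[OF measurable_shift measurable_config_Int]) simp
    from void_event[OF this Bcb(1)] show ?thesis by (cases "?act m") (simp_all add: P_def Suc Ev_def)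
  qed
  have PRg: "P n (T \<inter> Rg n) \<longleftrightarrow> P n T" for n T
  proof (cases n)
    case 0
    then show ?thesis by (auto simp: P_def Rg_def)
  next
    case (Suc m)
    then show ?thesis by (cases "?act m") (simp_all add: P_def Rg_def Ev_col)
  qed
  have Pprob: "M.prob {T\<in>space M. P n T} = exp (- r n)" for n
  proof (cases n)
    case 0
    then show ?thesis using MD(3)[of "Rest \<inter> B"] Restb B by (simp add: P_def r_def bounded_Int)
  next
    case (Suc m)
    show ?thesis
    proof (cases "?act m")
      case True
      let ?c = "?cc m"
      have "M.prob {T\<in>space M. Ev ?c T} = exp (- (leb lam' (Bc ?c \<inter> Dinf) + leb (lam' - lam) (Bc ?c - Dinf)))"
        unfolding Ev_def by (rule Phi_void[OF void_process_shift[OF M] Bcb])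
      moreover have "measure lborel (Bc ?c \<inter> Dinf) = measure lborel (B \<inter> shift ?c Dinf)"
      proof -
        have "shift ?c (Bc ?c \<inter> Dinf) = B \<inter> shift ?c Dinf" unfolding Bc_def shift_Int using col_voronoi_CS[OF cc[of m]] by auto
        moreover have "measure lborel (shift ?c (Bc ?c \<inter> Dinf)) = measure lborel (Bc ?c \<inter> Dinf)"
          using Bcb(1) colb[of 0] by (intro measure_shift) simp
        ultimately show ?thesis by simp
      qed
      moreover have "measure lborel (Bc ?c - Dinf) = measure lborel (B \<inter> voronoi pj CS ?c - shift ?c Dinf)"
      proof -
        have "shift ?c (Bc ?c - Dinf) = B \<inter> voronoi pj CS ?c - shift ?c Dinf" unfolding Bc_def shift_Diff by simp
        moreover have "measure lborel (shift ?c (Bc ?c - Dinf)) = measure lborel (Bc ?c - Dinf)"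
          using Bcb(1) colb[of 0] by (intro measure_shift) simp
        ultimately show ?thesis by simp
      qed
      ultimately show ?thesis using True by (simp add: P_def r_def Suc)
    next
      case False
      then show ?thesis by (simp add: P_def r_def Suc M.prob_space)
    qed
  qed
  have pre: "M.prob {T\<in>space M. \<forall>n<k. P n T} = (\<Prod>n<k. exp (- r n))" for k
  proof (cases "k = 0")
    case True
    then show ?thesis by (simp add: M.prob_space)
  next
    case False
    have "M.indep_vars (\<lambda>_. config_space) (\<lambda>n T. T \<inter> Rg n) UNIV"
      by (rule indep_restrictions[OF M]) (use Rgb Rgdis in auto)
    from M.indep_varsD[OF this, of "{..<k}" "\<lambda>n. {T\<in>space config_space. P n T}"]
    have "M.prob (\<Inter>n\<in>{..<k}. (\<lambda>T. T \<inter> Rg n) -` {T\<in>space config_space. P n T} \<inter> space M) =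
      (\<Prod>n\<in>{..<k}. M.prob ((\<lambda>T. T \<inter> Rg n) -` {T\<in>space config_space. P n T} \<inter> space M))"
      using False PC by auto
    moreover have eq: "(\<lambda>T. T \<inter> Rg n) -` {T\<in>space config_space. P n T} \<inter> space M = {T\<in>space M. P n T}" for n
    proof -
      have "T \<inter> Rg n \<in> space config_space" if "T \<in> space M" for T
        using measurable_space[OF measurable_compose[OF MD(2) measurable_config_Int[OF Rgb]] that] by simp
      then show ?thesis by (auto simp: PRg)
    qed
    moreover have "(\<Inter>n\<in>{..<k}. {T\<in>space M. P n T}) = {T\<in>space M. \<forall>n<k. P n T}" using False by auto
    ultimately show ?thesis by (simp only: Pprob)
  qed
  have sums: "r sums (leb lam' (B \<inter> cols) + leb (lam' - lam) (B - cols) + leb lam (Rest \<inter> B))"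
  proof -
    have finB: "emeasure lborel A \<noteq> \<infinity>" if "A \<subseteq> B" for A
      using emeasure_bounded_finite[OF bounded_subset[OF B(2) that]] by simp
    let ?F1 = "\<lambda>m. if ?act m then B \<inter> shift (?cc m) Dinf else {}"
    let ?F2 = "\<lambda>m. if ?act m then B \<inter> voronoi pj CS (?cc m) - shift (?cc m) Dinf else {}"
    have U1: "(\<Union>m. ?F1 m) = B \<inter> cols" unfolding UN_act[of "\<lambda>c. B \<inter> shift c Dinf"] cols_def by blast
    have U2: "(\<Union>m. ?F2 m) = B \<inter> (\<Union>c\<in>CS. voronoi pj CS c) - cols"
    proof -
      have "voronoi pj CS c - shift c Dinf = voronoi pj CS c - cols" if "c \<in> CS" for c
        unfolding cols_def using col_voronoi_CS voronoi_disjoint[OF that] that by blast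
      then show ?thesis unfolding UN_act[of "\<lambda>c. B \<inter> voronoi pj CS c - shift c Dinf"] by blast
    qed
    have s1: "(\<lambda>m. measure lborel (?F1 m)) sums measure lborel (\<Union>m. ?F1 m)"
    proof (rule measure_UNION)
      show "range ?F1 \<subseteq> sets lborel" using B colb by auto
      show "disjoint_family ?F1" using coldis[OF cc cc cc_inj] by (fastforce simp: disjoint_family_on_def)
      show "emeasure lborel (\<Union>m. ?F1 m) \<noteq> \<infinity>" unfolding U1 by (rule finB) blast
    qed
    have s2: "(\<lambda>m. measure lborel (?F2 m)) sums measure lborel (\<Union>m. ?F2 m)"
    proof (rule measure_UNION)
      show "range ?F2 \<subseteq> sets lborel" using B colb Vb by auto
      show "disjoint_family ?F2" using voronoi_disjoint[OF cc cc cc_inj] by (fastforce simp: disjoint_family_on_def)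
      show "emeasure lborel (\<Union>m. ?F2 m) \<noteq> \<infinity>" unfolding U2 by (rule finB) blast
    qed
    obtain N where N: "N \<in> null_sets lborel" "- (\<Union>c\<in>CS. voronoi pj CS c) \<subseteq> N"
      using voronoi_null[OF lfCS CSV] S(2) unfolding CS_def by blast
    have m2: "measure lborel (\<Union>m. ?F2 m) = measure lborel (B - cols)"
    proof (rule measure_null_part[OF _ _ _ N(1)])
      show "(\<Union>m. ?F2 m) \<in> sets borel" using B colb Vb by (intro sets.countable_UN) auto
      show "(\<Union>m. ?F2 m) \<subseteq> B - cols" unfolding U2 by blast
      show "B - cols - (\<Union>m. ?F2 m) \<subseteq> N" unfolding U2 using N(2) by blast
    qed (use B colsb in auto)
    have "(\<lambda>m. r (Suc m)) sums (leb lam' (B \<inter> cols) + leb (lam' - lam) (B - cols))"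
    proof -
      have "(\<lambda>m. leb lam' (?F1 m) + leb (lam' - lam) (?F2 m)) sums (leb lam' (\<Union>m. ?F1 m) + leb (lam' - lam) (\<Union>m. ?F2 m))"
        by (intro sums_add sums_mult s1 s2)
      moreover have "leb lam' (?F1 m) + leb (lam' - lam) (?F2 m) = r (Suc m)" for m by (simp add: r_def)
      ultimately show ?thesis unfolding m2 U1 by simp
    qed
    from sums_Suc[OF this] have "r sums (leb lam' (B \<inter> cols) + leb (lam' - lam) (B - cols) + r 0)" .
    moreover have "r 0 = leb lam (Rest \<inter> B)" by (simp add: r_def)
    ultimately show ?thesis by simp
  qed
  have "{T\<in>space M. (?X T \<union> f (?X T)) \<inter> B = {}} = {T\<in>space M. \<forall>n. P n T}"
  proof -
    have "(\<forall>n. P n T) \<longleftrightarrow> T \<inter> (Rest \<inter> B) = {} \<and> (\<forall>n. ?act n \<longrightarrow> Ev (?cc n) T)" for T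
      unfolding P_def by (subst all_nat_split) simp
    then show ?thesis unfolding event act_all[of "\<lambda>c. Ev c _"] by simp
  qed
  then have "M.prob {T\<in>space M. (?X T \<union> f (?X T)) \<inter> B = {}} = exp (- (leb lam' (B \<inter> cols) + leb (lam' - lam) (B - cols) + leb lam (Rest \<inter> B)))"
    using M.prob_all_exp[OF Pev pre sums] by simp
  also have "leb lam' (B \<inter> cols) + leb (lam' - lam) (B - cols) + leb lam (Rest \<inter> B) = leb lam' (B - slab) + leb (lam' - lam) (B \<inter> slab)"
  proof -
    have cs: "cols \<inter> slab = {}" unfolding cols_def using col_slab CSV by blast
    have "measure lborel ((B - cols) \<inter> slab) + measure lborel ((B - cols) - slab) = measure lborel (B - cols)"
      using B colsb by (intro measure_split) (auto intro: bounded_subset)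
    moreover have "(B - cols) \<inter> slab = B \<inter> slab" "(B - cols) - slab = Rest \<inter> B" using cs unfolding Rest_def by blast+
    ultimately have 1: "measure lborel (B - cols) = measure lborel (B \<inter> slab) + measure lborel (Rest \<inter> B)" by simp
    have "measure lborel ((B - slab) \<inter> cols) + measure lborel ((B - slab) - cols) = measure lborel (B - slab)"
      using B colsb by (intro measure_split) (auto intro: bounded_subset)
    moreover have "(B - slab) \<inter> cols = B \<inter> cols" "(B - slab) - cols = Rest \<inter> B" using cs unfolding Rest_def by blast+
    ultimately have 2: "measure lborel (B - slab) = measure lborel (B \<inter> cols) + measure lborel (Rest \<inter> B)" by simp
    show ?thesis unfolding 1 2 by (simp add: algebra_simps)
  qed
  finally show ?thesis .
qed

end

context centered
begin

text \<open>
  The process is resampled as the slab part of one copy together with the rest of an independent copy. Integrating the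
  formula for a fixed slab over the event that the slab part is void on \<open>B\<close> supplies the missing \<open>lam\<close> in the slab.
\<close>

theorem f_thickening: "thickening lam lam' f"
  unfolding thickening_def
proof (intro conjI allI impI)
  show "f \<in> measurable config_space config_space" by (rule f_meas)
  fix M :: "'a set measure" and X :: "'a set \<Rightarrow> 'a set"
  assume "poisson_process M X lam"
  then have X: "void_process M X (leb lam)" using lam by (simp add: poisson_iff_void_process)
  note XD = void_processD[OF X]
  interpret M: prob_space M by fact
  obtain M0 :: "'a set measure" where M0: "sets M0 = sets config_space" "void_process M0 (\<lambda>S. S) (leb lam)"
    using ex_void_process[OF lam(1)] by blast
  note M0D = void_processD[OF M0(2)]
  interpret M0: prob_space M0 by fact
  have sp0: "space M0 = space config_space" by (rule sets_eq_imp_space_eq[OF M0(1)])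
  interpret MM: pair_prob_space M0 M0 ..
  let ?MM = "M0 \<Otimes>\<^sub>M M0"
  define XX where "XX z = (fst z \<inter> slab) \<union> (snd z \<inter> - slab)" for z :: "'a set \<times> 'a set"
  have XXm: "XX \<in> measurable ?MM config_space"
    unfolding XX_def[abs_def]
    by (intro measurable_config_Un measurable_compose[OF measurable_compose[OF measurable_fst M0D(2)] measurable_config_Int]
      measurable_compose[OF measurable_compose[OF measurable_snd M0D(2)] measurable_config_Int]) auto
  have XX: "void_process ?MM XX (leb lam)" unfolding void_process_def
  proof (intro conjI ballI impI XXm)
    show "prob_space ?MM" by (rule MM.prob_space_axioms)
    fix B :: "'a set" assume B: "B \<in> sets borel" "bounded B"
    let ?a = "{S\<in>space M0. S \<inter> (B \<inter> slab) = {}}" and ?b = "{S\<in>space M0. S \<inter> (B - slab) = {}}"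
    have B1: "B \<inter> slab \<in> sets borel" "bounded (B \<inter> slab)" "B - slab \<in> sets borel" "bounded (B - slab)"
      using B by (auto intro: bounded_subset)
    have s: "?a \<in> sets M0" "?b \<in> sets M0" using B1 by (auto intro!: void_event[OF M0D(2)])
    have "{z\<in>space ?MM. XX z \<inter> B = {}} = ?a \<times> ?b"
      unfolding XX_def by (auto simp: space_pair_measure)
    then have "MM.prob {z\<in>space ?MM. XX z \<inter> B = {}} = M0.prob ?a * M0.prob ?b"
      using M0.emeasure_pair_measure_Times[OF s] by (simp only: measure_def enn2real_mult)
    also have "\<dots> = exp (- (leb lam (B \<inter> slab) + leb lam (B - slab)))"
      unfolding M0D(3)[OF B1(1,2)] M0D(3)[OF B1(3,4)] by (simp add: exp_add[symmetric])
    also have "leb lam (B \<inter> slab) + leb lam (B - slab) = leb lam B"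
      using measure_split[OF B(2,1) slab_borel] by (simp add: distrib_left[symmetric])
    finally show "MM.prob {z\<in>space ?MM. XX z \<inter> B = {}} = exp (- leb lam B)" .
  qed
  have Un: "(\<lambda>S. S \<union> f S) \<in> measurable config_space config_space"
    by (intro measurable_config_Un f_meas) simp
  have "void_process M (\<lambda>\<omega>. X \<omega> \<union> f (X \<omega>)) (leb lam')" unfolding void_process_def
  proof (intro conjI ballI impI)
    show "prob_space M" by fact
    show "(\<lambda>\<omega>. X \<omega> \<union> f (X \<omega>)) \<in> measurable M config_space" by (rule measurable_compose[OF XD(2) Un])
    fix B :: "'a set" assume B: "B \<in> sets borel" "bounded B"
    let ?E = "{S\<in>space config_space. (S \<union> f S) \<inter> B = {}}"
    have E: "?E \<in> sets config_space" by (rule void_event[OF Un B(1)])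
    have "{\<omega>\<in>space M. (X \<omega> \<union> f (X \<omega>)) \<inter> B = {}} = X -` ?E \<inter> space M" using measurable_space[OF XD(2)] by auto
    then have "M.prob {\<omega>\<in>space M. (X \<omega> \<union> f (X \<omega>)) \<inter> B = {}} = measure (distr M config_space X) ?E"
      by (simp add: measure_distr[OF XD(2) E])
    also have "distr M config_space X = distr ?MM config_space XX" by (rule void_process_unique[OF X XX])
    also have "measure (distr ?MM config_space XX) ?E = MM.prob (XX -` ?E \<inter> space ?MM)" by (rule measure_distr[OF XXm E])
    finally have 1: "M.prob {\<omega>\<in>space M. (X \<omega> \<union> f (X \<omega>)) \<inter> B = {}} = MM.prob (XX -` ?E \<inter> space ?MM)" .
    let ?c = "exp (- (leb lam' (B - slab) + leb (lam' - lam) (B \<inter> slab)))"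
    let ?A = "{S\<in>space M0. S \<inter> (slab \<inter> B) = {}}"
    have sB: "slab \<inter> B \<in> sets borel" "bounded (slab \<inter> B)" using B by (auto intro: bounded_subset)
    have A: "?A \<in> sets M0" by (rule void_event[OF M0D(2) sB(1)])
    have "emeasure ?MM (XX -` ?E \<inter> space ?MM) = (\<integral>\<^sup>+S. emeasure M0 (Pair S -` (XX -` ?E \<inter> space ?MM)) \<partial>M0)"
      by (rule M0.emeasure_pair_measure_alt[OF measurable_sets[OF XXm E]])
    also have "\<dots> = (\<integral>\<^sup>+S. ennreal ?c * indicator ?A S \<partial>M0)"
    proof (rule nn_integral_cong_AE)
      show "AE S in M0. emeasure M0 (Pair S -` (XX -` ?E \<inter> space ?MM)) = ennreal ?c * indicator ?A S"
        using ctr_ne[OF M0(2)] AE_space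
      proof eventually_elim
        case (elim S)
        then have S: "locally_finite_set S" by (simp add: sp0 space_config_space)
        have eq: "Pair S -` (XX -` ?E \<inter> space ?MM) = {T\<in>space M0. ((S \<inter> slab \<union> (T - slab)) \<union> f (S \<inter> slab \<union> (T - slab))) \<inter> B = {}}"
        proof -
          have "XX (S, T) = S \<inter> slab \<union> (T - slab)" for T unfolding XX_def by auto
          moreover have "XX (S, T) \<in> space config_space" if "T \<in> space M0" for T
            using measurable_space[OF XXm, of "(S, T)"] that elim by (simp add: space_pair_measure)
          ultimately show ?thesis using elim by (auto simp: space_pair_measure)
        qed
        show ?case
        proof (cases "S \<inter> slab \<inter> B = {}")
          case True
          then have "S \<in> ?A" using elim by (simp add: Int_assoc)
          then show ?thesis unfolding eq M0.emeasure_eq_measure fixed_slab[OF M0(2) S elim(1) True B] by simp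
        next
          case False
          then have empty: "{T\<in>space M0. ((S \<inter> slab \<union> (T - slab)) \<union> f (S \<inter> slab \<union> (T - slab))) \<inter> B = {}} = {}" by blast
          have "S \<notin> ?A" using False by (simp add: Int_assoc)
          then show ?thesis unfolding eq empty by simp
        qed
      qed
    qed
    also have "\<dots> = ennreal ?c * emeasure M0 ?A" using A by (rule nn_integral_cmult_indicator)
    also have "\<dots> = ennreal (?c * exp (- leb lam (slab \<inter> B)))"
      using M0D(3)[OF sB] by (simp add: M0.emeasure_eq_measure ennreal_mult)
    also have "?c * exp (- leb lam (slab \<inter> B)) = exp (- leb lam' B)"
    proof -
      have "measure lborel (B \<inter> slab) + measure lborel (B - slab) = measure lborel B" by (rule measure_split[OF B(2,1) slab_borel])
      then have "leb lam' B = leb lam' (B - slab) + leb (lam' - lam) (B \<inter> slab) + leb lam (slab \<inter> B)"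
        by (simp add: Int_commute algebra_simps flip: distrib_left)
      then show ?thesis by (simp add: exp_add[symmetric])
    qed
    finally have "MM.prob (XX -` ?E \<inter> space ?MM) = exp (- leb lam' B)" by (simp add: measure_def)
    with 1 show "M.prob {\<omega>\<in>space M. (X \<omega> \<union> f (X \<omega>)) \<inter> B = {}} = exp (- leb lam' B)" by simp
  qed
  then show "poisson_process M (\<lambda>\<omega>. X \<omega> \<union> f (X \<omega>)) lam'" using lam by (simp add: poisson_iff_void_process)
qed

lemma f_commutes: "v \<in> V \<Longrightarrow> commutes_with_shift f v"
  unfolding commutes_with_shift_def by (simp add: f_shift)

end

section \<open>Isolated points as centers\<close>

context slab
begin

text \<open>
  Distance 2 between centers makes the columns over balls of radius 1 disjoint.
\<close>

definition isolated :: "'a set \<Rightarrow> 'a set" where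
  "isolated S = {x\<in>S \<inter> slab. \<forall>y\<in>S \<inter> slab. y \<noteq> x \<longrightarrow> 2 \<le> norm (pj y - pj x)}"

definition centers :: "'a set \<Rightarrow> 'a set" where "centers S = pj ` isolated S"

lemma norm_slab: "x \<in> slab \<Longrightarrow> norm x \<le> norm (pj x) + 1"
  using norm_le_pj[of x] by (auto simp: slab_def)

lemma centers_locally_finite:
  assumes "locally_finite_set S" shows "locally_finite_set (centers S)"
  unfolding locally_finite_set_def
proof (intro allI impI)
  fix B :: "'a set" assume "bounded B"
  then obtain R where R: "\<And>x. x \<in> B \<Longrightarrow> norm x \<le> R" by (auto simp: bounded_iff)
  have "centers S \<inter> B \<subseteq> pj ` (S \<inter> cball 0 (R + 1))"
  proof
    fix c assume "c \<in> centers S \<inter> B"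
    then obtain x where x: "c = pj x" "x \<in> S" "x \<in> slab" "norm (pj x) \<le> R" using R by (auto simp: centers_def isolated_def)
    then have "norm x \<le> R + 1" using norm_slab[of x] by linarith
    then show "c \<in> pj ` (S \<inter> cball 0 (R + 1))" using x by auto
  qed
  moreover have "finite (S \<inter> cball 0 (R + 1))" using assms by (auto simp: locally_finite_set_def)
  ultimately show "finite (centers S \<inter> B)" by (meson finite_imageI finite_subset)
qed

lemma centers_meas: "centers \<in> measurable config_space config_space"
proof (rule measurable_configI)
  fix S assume "S \<in> space (config_space :: 'a set measure)"
  then show "locally_finite_set (centers S)" by (simp add: centers_locally_finite space_config_space)
next
  fix B :: "'a set" assume B: "B \<in> sets borel"
  let ?C = "config_space :: 'a set measure"
  let ?T = "(borel :: 'a measure) \<Otimes>\<^sub>M ?C"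
  define bad where "bad = {u\<in>space ((borel :: 'a measure) \<Otimes>\<^sub>M ?T). fst u \<in> slab \<and> fst u \<noteq> fst (snd u) \<and> \<not> 2 \<le> norm (pj (fst u) - pj (fst (snd u)))}"
  have bad: "bad \<in> sets ((borel :: 'a measure) \<Otimes>\<^sub>M ?T)" unfolding bad_def by measurable
  define E where "E = {z\<in>space ?T. fst z \<in> slab \<and> pj (fst z) \<in> B} \<inter> (space ?T - {z\<in>space ?T. \<exists>y\<in>snd z. (y, z) \<in> bad})"
  have "{z\<in>space ?T. fst z \<in> slab \<and> pj (fst z) \<in> B} \<in> sets ?T" using B by measurable
  then have E: "E \<in> sets ?T" unfolding E_def by (intro sets.Int sets.compl_sets sets_ex_point[OF measurable_snd bad])
  have "space ?C - {S\<in>space ?C. \<exists>x\<in>S. (x, S) \<in> E} \<in> sets ?C"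
    by (intro sets.compl_sets sets_ex_point[OF measurable_ident_sets E]) simp
  moreover have "space ?C - {S\<in>space ?C. \<exists>x\<in>S. (x, S) \<in> E} = {S\<in>space ?C. centers S \<inter> B = {}}"
  proof -
    have "(\<exists>x\<in>S. (x, S) \<in> E) \<longleftrightarrow> centers S \<inter> B \<noteq> {}" if S: "S \<in> space ?C" for S
    proof -
      have "(x, S) \<in> E \<longleftrightarrow> x \<in> slab \<and> pj x \<in> B \<and> (\<forall>y\<in>S \<inter> slab. y \<noteq> x \<longrightarrow> 2 \<le> norm (pj y - pj x))" for x
        using S unfolding E_def bad_def by (auto simp: space_pair_measure)
      then show ?thesis unfolding centers_def isolated_def by auto
    qed
    then show ?thesis by blast
  qed
  ultimately show "{S\<in>space ?C. centers S \<inter> B = {}} \<in> sets ?C" by simp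
qed

lemma shift_slab: "v \<in> V \<Longrightarrow> shift v slab = slab"
  by (auto simp: mem_shift slab_def V_def inner_diff_right)

lemma centers_shift: assumes v: "v \<in> V" shows "centers (shift v S) = shift v (centers S)"
proof -
  have "shift v S \<inter> slab = shift v (S \<inter> slab)" by (simp add: shift_Int shift_slab[OF v])
  then have "isolated (shift v S) = shift v (isolated S)"
    unfolding isolated_def by (auto simp: shift_conv pj_add)
  then show ?thesis unfolding centers_def shift_conv by (simp add: image_image pj_add pj_V[OF v])
qed

lemma centers_sep:
  assumes "c \<in> centers S" "c' \<in> centers S" "c \<noteq> c'" shows "2 \<le> norm (c - c')"
proof -
  obtain x y where xy: "c = pj x" "x \<in> isolated S" "c' = pj y" "y \<in> isolated S" using assms(1,2) by (auto simp: centers_def)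
  then have "x \<noteq> y" "x \<in> S \<inter> slab" "\<forall>x\<in>S \<inter> slab. x \<noteq> y \<longrightarrow> 2 \<le> norm (pj x - pj y)"
    using assms(3) by (auto simp: isolated_def)
  then show ?thesis using xy by blast
qed

text \<open>
  In the disjoint translates of a large disc of the slab along \<open>V\<close>, independently and with the same positive
  probability, the disc contains a single point and this point is near the middle; such a point is isolated.
\<close>

lemma centers_nonempty:
  assumes v: "v \<in> V" "norm v = 1" and lam: "0 < lam" and T: "void_process M T (leb lam)"
  shows "AE \<omega> in M. centers (T \<omega>) \<noteq> {}"
proof -
  note TD = void_processD[OF T]
  interpret M: prob_space M by fact
  \<comment> \<open>Discs of radius 4 around these points are disjoint, and a point within 1 of the middle of such a disc has distance at least 2 from the complement.\<close>
  define a where "a k = (8 * real k) *\<^sub>R v" for k :: nat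
  have aV: "a k \<in> V" for k using v(1) by (simp add: a_def V_def)
  define outer where "outer = {x\<in>slab. norm (pj x) < 4}"
  define inner where "inner = {x\<in>slab. norm (pj x) < 1}"
  have ob: "outer \<in> sets borel" "inner \<in> sets borel"
    using slab_borel unfolding outer_def inner_def by measurable
  have obd: "bounded outer" "bounded inner"
    unfolding bounded_iff using norm_slab by (force simp: outer_def inner_def intro!: exI[of _ 5])+
  have io: "inner \<subseteq> outer" by (auto simp: inner_def outer_def)
  have ipos: "0 < measure lborel inner"
  proof (rule open_measure_pos[OF _ _ _ ob(2) obd(2)])
    have o1: "open {x. norm (pj x) < 1}"
      by (intro open_Collect_less continuous_on_norm continuous_pj continuous_on_const)
    have o2: "open {x. 0 < w \<bullet> x}" "open {x. w \<bullet> x < 1}"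
      by (intro open_Collect_less continuous_intros)+
    show "open ({x. norm (pj x) < 1} \<inter> ({x. 0 < w \<bullet> x} \<inter> {x. w \<bullet> x < 1}))" by (intro open_Int o1 o2)
    show "(1/2) *\<^sub>R w \<in> {x. norm (pj x) < 1} \<inter> ({x. 0 < w \<bullet> x} \<inter> {x. w \<bullet> x < 1})" by (simp add: pj_def ww)
    show "{x. norm (pj x) < 1} \<inter> ({x. 0 < w \<bullet> x} \<inter> {x. w \<bullet> x < 1}) \<subseteq> inner" by (auto simp: inner_def slab_def)
  qed
  have so: "shift (a k) outer = {x\<in>slab. norm (pj x - a k) < 4}" for k
  proof -
    have "shift (a k) outer = shift (a k) slab \<inter> {x. norm (pj (x - a k)) < 4}" unfolding outer_def by (auto simp: mem_shift)
    then show ?thesis unfolding shift_slab[OF aV] pj_diff pj_V[OF aV] by auto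
  qed
  have dis: "disjoint_family (\<lambda>k. shift (a k) outer)"
  proof -
    have "m = n" if x: "x \<in> shift (a m) outer" "x \<in> shift (a n) outer" for x m n
    proof (rule ccontr)
      assume "m \<noteq> n"
      have "a m - a n = (8 * (real m - real n)) *\<^sub>R v" by (simp add: a_def scaleR_diff_left[symmetric] right_diff_distrib)
      then have "norm (a m - a n) = \<bar>8 * (real m - real n)\<bar>" using v(2) by (simp only: norm_scaleR real_norm_def mult_1_right)
      then have "norm (a m - a n) = 8 * \<bar>real m - real n\<bar>" by (simp only: abs_mult abs_numeral)
      moreover have "1 \<le> \<bar>real m - real n\<bar>" using \<open>m \<noteq> n\<close> by linarith
      moreover have "norm (a m - a n) \<le> norm (pj x - a n) + norm (pj x - a m)"
        using norm_triangle_ineq4[of "pj x - a n" "pj x - a m"] by simp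
      ultimately show False using x unfolding so by auto
    qed
    then show ?thesis unfolding disjoint_family_on_def by blast
  qed
  define good where "good S \<longleftrightarrow> card (S \<inter> outer) = 1 \<and> S \<inter> outer \<inter> - inner = {}" for S :: "'a set"
  have good_center: "centers S \<noteq> {}" if "good (shift (- a k) S)" for S k
  proof -
    from that obtain x0 where x0: "shift (- a k) S \<inter> outer = {x0}" unfolding good_def by (auto simp: card_1_singleton_iff)
    have "x0 \<in> inner" using that x0 unfolding good_def by auto
    define x where "x = x0 + a k"
    have x: "S \<inter> shift (a k) outer = {x}"
    proof -
      have "shift (a k) (shift (- a k) S \<inter> outer) = {x}" unfolding x0 by (simp add: shift_conv x_def)
      then show ?thesis by (simp add: shift_Int)
    qed
    have px: "norm (pj x - a k) < 1" using \<open>x0 \<in> inner\<close> by (simp add: x_def pj_add pj_V[OF aV] inner_def)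
    have "x \<in> isolated S" unfolding isolated_def
    proof (intro CollectI conjI ballI impI)
      show "x \<in> S \<inter> slab" using x unfolding so by blast
      fix y assume y: "y \<in> S \<inter> slab" "y \<noteq> x"
      then have "y \<notin> shift (a k) outer" using x by blast
      then have "4 \<le> norm (pj y - a k)" using y unfolding so by auto
      moreover have "norm (pj y - a k) \<le> norm (pj y - pj x) + norm (pj x - a k)"
        using norm_triangle_ineq[of "pj y - pj x" "pj x - a k"] by simp
      ultimately show "2 \<le> norm (pj y - pj x)" using px by linarith
    qed
    then show ?thesis unfolding centers_def by blast
  qed
  define e where "e = leb lam inner * exp (- leb lam outer)"
  have e0: "0 < e" using ipos lam by (simp add: e_def)
  have pe: "M.prob {\<omega>\<in>space M. good (shift (- a k) (T \<omega>))} = e" for k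
  proof -
    have "outer - - inner = inner" using io by auto
    then show ?thesis
      using single_point_prob[OF void_process_shift[OF T] less_imp_le[OF lam] ob(1) obd(1), of "- inner" "- a k"] ob(2)
      by (simp add: good_def e_def)
  qed
  have gC: "{S\<in>space config_space. \<not> good (shift (- a k) S)} \<in> sets config_space" for k
  proof -
    have m: "shift (- a k) \<in> measurable config_space config_space" by (rule measurable_shift)
    have "{S\<in>space config_space. real (card (shift (- a k) S \<inter> outer)) = real 1} \<in> sets config_space"
      using measurable_card_config[OF m ob(1) obd(1)] by measurable
    moreover have "{S\<in>space config_space. shift (- a k) S \<inter> (outer \<inter> - inner) = {}} \<in> sets config_space"
      using ob by (intro void_event[OF m]) auto
    ultimately have "space config_space - ({S\<in>space config_space. real (card (shift (- a k) S \<inter> outer)) = real 1} \<inter>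
        {S\<in>space config_space. shift (- a k) S \<inter> (outer \<inter> - inner) = {}}) \<in> sets config_space"
      by (intro sets.compl_sets sets.Int)
    also have "space config_space - ({S\<in>space config_space. real (card (shift (- a k) S \<inter> outer)) = real 1} \<inter>
        {S\<in>space config_space. shift (- a k) S \<inter> (outer \<inter> - inner) = {}}) = {S\<in>space config_space. \<not> good (shift (- a k) S)}"
      unfolding of_nat_eq_iff good_def Int_assoc by blast
    finally show ?thesis .
  qed
  let ?bad = "{\<omega>\<in>space M. centers (T \<omega>) \<inter> UNIV = {}}"
  have bad: "?bad \<in> sets M" by (rule void_event[OF measurable_compose[OF TD(2) centers_meas]]) simp
  have le: "M.prob ?bad \<le> (1 - e) ^ n" for n
  proof (cases "n = 0")
    case False
    let ?Y = "\<lambda>k \<omega>. T \<omega> \<inter> shift (a k) outer"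
    let ?N = "\<lambda>k. {S\<in>space config_space. \<not> good (shift (- a k) S)}"
    have ind: "M.indep_vars (\<lambda>_. config_space) ?Y UNIV"
      using ob dis by (intro indep_restrictions[OF T]) (auto intro: shift_borel)
    have eq: "?Y k -` ?N k \<inter> space M = space M - {\<omega>\<in>space M. good (shift (- a k) (T \<omega>))}" for k
    proof -
      have "?Y k \<omega> \<in> space config_space" if "\<omega> \<in> space M" for \<omega>
        using ob measurable_space[OF measurable_compose[OF TD(2) measurable_config_Int[of "shift (a k) outer"]] that] by (auto intro: shift_borel)
      moreover have "good (shift (- a k) (T \<omega> \<inter> shift (a k) outer)) = good (shift (- a k) (T \<omega>))" for \<omega>
        unfolding good_def by (simp add: shift_Int Int_assoc)
      ultimately show ?thesis by auto
    qed
    have gM: "{\<omega>\<in>space M. good (shift (- a k) (T \<omega>))} \<in> sets M" for k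
    proof -
      have "T -` ?N k \<inter> space M \<in> sets M" by (rule measurable_sets[OF TD(2) gC])
      then have "space M - (T -` ?N k \<inter> space M) \<in> sets M" by (rule sets.compl_sets)
      also have "space M - (T -` ?N k \<inter> space M) = {\<omega>\<in>space M. good (shift (- a k) (T \<omega>))}"
        using measurable_space[OF TD(2)] by auto
      finally show ?thesis .
    qed
    have inM: "?Y k -` ?N k \<inter> space M \<in> sets M" for k unfolding eq using gM by (intro sets.compl_sets)
    have "M.prob ?bad \<le> M.prob (\<Inter>k\<in>{..<n}. ?Y k -` ?N k \<inter> space M)"
    proof (rule M.finite_measure_mono)
      show "?bad \<subseteq> (\<Inter>k\<in>{..<n}. ?Y k -` ?N k \<inter> space M)" unfolding eq using good_center by blast
      show "(\<Inter>k\<in>{..<n}. ?Y k -` ?N k \<inter> space M) \<in> M.events" using False inM by (intro sets.finite_INT) auto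
    qed
    also have "\<dots> = (\<Prod>k\<in>{..<n}. M.prob (?Y k -` ?N k \<inter> space M))"
      using False gC by (intro M.indep_varsD[OF ind]) auto
    also have "\<dots> = (1 - e) ^ n"
      unfolding eq using gM by (simp add: M.prob_compl pe)
    finally show ?thesis .
  qed simp
  have "e \<le> 1" using pe[of 0] M.prob_le_1 by metis
  then have "(\<lambda>n. (1 - e) ^ n) \<longlonglongrightarrow> 0" using e0 by (intro LIMSEQ_realpow_zero) auto
  then have "M.prob ?bad \<le> 0" using le by (intro LIMSEQ_le_const) auto
  then have "M.prob ?bad = 0" by (simp add: measure_le_0_iff)
  then have nb: "?bad \<in> null_sets M" using bad by (simp add: null_sets_def M.emeasure_eq_measure)
  show ?thesis by (rule AE_I'[OF nb]) auto
qed

text \<open>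
  If \<open>V = {0}\<close>, the slab is bounded and may contain no point, but the constant center 0 is equivariant. Otherwise \<open>V\<close>
  contains a unit vector, and isolated points exist almost surely.
\<close>

theorem ex_thickening_hyperplane:
  assumes lam: "0 < lam" "lam < lam'"
  shows "\<exists>f. thickening lam lam' f \<and> (\<forall>v\<in>V. commutes_with_shift f v)"
proof -
  obtain \<Phi> where \<Phi>: "\<Phi> \<in> measurable config_space (config_space :: 'a set measure)" "\<And>S. \<Phi> (S \<inter> Dinf) = \<Phi> S"
    "\<And>(M :: 'a set measure) T B. void_process M T (leb lam) \<Longrightarrow> B \<in> sets borel \<Longrightarrow> bounded B \<Longrightarrow>
      measure M {\<omega>\<in>space M. (T \<omega> \<inter> Dinf \<union> \<Phi> (T \<omega>)) \<inter> B = {}} = exp (- (leb lam' (B \<inter> Dinf) + leb (lam' - lam) (B - Dinf)))"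
    using ex_Phi[OF lam] by blast
  show ?thesis
  proof (cases "V = {0}")
    case True
    interpret C: centered w lam lam' "\<lambda>S. {0}" \<Phi>
    proof
      show "(\<lambda>S. {0}) \<in> measurable config_space (config_space :: 'a set measure)"
        by (rule measurable_const) (simp add: space_config_space locally_finite_set_def)
      show "{0} = shift v {0}" if "v \<in> V" for v using that True by simp
    qed (use lam \<Phi> True in auto)
    show ?thesis using C.f_thickening C.f_commutes by blast
  next
    case False
    have "0 \<in> V" by (simp add: V_def)
    with False obtain u where u: "u \<in> V" "u \<noteq> 0" by blast
    define v where "v = (1 / norm u) *\<^sub>R u"
    have v: "v \<in> V" "norm v = 1" using u by (auto simp: v_def V_def)
    interpret C: centered w lam lam' centers \<Phi>
    proof
      show "centers S \<subseteq> V" for S using pj_in_V by (auto simp: centers_def)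
      show "centers (S \<inter> slab) = centers S" for S by (simp add: centers_def isolated_def Int_assoc)
    qed (use lam \<Phi> centers_meas centers_sep centers_shift centers_nonempty[OF v lam(1)] in auto)
    show ?thesis using C.f_thickening C.f_commutes by blast
  qed
qed

end

theorem ex_thickening_subspace:
  fixes V :: "'a::euclidean_space set"
  assumes lam: "0 < lam" "lam < lam'" and V: "subspace V" "dim V + 1 = DIM('a)"
  shows "\<exists>f. thickening lam lam' f \<and> (\<forall>v\<in>V. commutes_with_shift f v)"
proof -
  have "dim V = DIM('a) - 1" using V(2) by simp
  then obtain a where a: "a \<noteq> 0" "span V = {x. a \<bullet> x = 0}" using dim_eq_hyperplane[of V] by blast
  define w where "w = (1 / norm a) *\<^sub>R a"
  interpret slab w by unfold_locales (use a in \<open>simp add: w_def\<close>)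
  have "slab.V w = V"
  proof -
    have "span V = V" using V(1) by (simp add: span_eq_iff)
    then show ?thesis using a unfolding V_def by (auto simp: w_def)
  qed
  then show ?thesis using ex_thickening_hyperplane[OF lam] by simp
qed

section \<open>Approximation by finitely many void events\<close>

text \<open>
  For finite \<open>F\<close>, an event decided by finitely many void events.
\<close>

definition void_simple :: "'a::euclidean_space set set \<Rightarrow> ('a set set \<Rightarrow> bool) \<Rightarrow> 'a set set" where
  "void_simple F g = {S\<in>space config_space. g {B\<in>F. S \<inter> B = {}}}"

definition bounded_family :: "'a::euclidean_space set set \<Rightarrow> bool" where
  "bounded_family F \<longleftrightarrow> finite F \<and> (\<forall>B\<in>F. B \<in> sets borel \<and> bounded B)"

lemma void_simple_sets:
  assumes F: "bounded_family F" shows "void_simple F g \<in> sets config_space"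
proof -
  have fin: "finite F" and b: "\<And>B. B \<in> F \<Longrightarrow> B \<in> sets borel" using F by (auto simp: bounded_family_def)
  have 1: "{S\<in>space config_space. \<forall>B\<in>F. (S \<inter> B = {}) = (B \<in> P)} \<in> sets config_space" for P
  proof (intro sets.sets_Collect_finite_All fin)
    fix B assume B: "B \<in> F"
    have "{S\<in>space config_space. S \<inter> B = {}} \<in> sets config_space" by (rule sets_void[OF b[OF B]])
    moreover from this have "space config_space - {S\<in>space config_space. S \<inter> B = {}} \<in> sets config_space" by (rule sets.compl_sets)
    moreover have "space config_space - {S\<in>space config_space. S \<inter> B = {}} = {S\<in>space config_space. S \<inter> B \<noteq> {}}" by blast
    ultimately show "{S\<in>space config_space. (S \<inter> B = {}) = (B \<in> P)} \<in> sets config_space" by (cases "B \<in> P") simp_all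
  qed
  have "void_simple F g = (\<Union>P\<in>{P\<in>Pow F. g P}. {S\<in>space config_space. \<forall>B\<in>F. (S \<inter> B = {}) = (B \<in> P)})"
  proof (intro set_eqI iffI)
    fix S assume "S \<in> void_simple F g"
    then show "S \<in> (\<Union>P\<in>{P\<in>Pow F. g P}. {S\<in>space config_space. \<forall>B\<in>F. (S \<inter> B = {}) = (B \<in> P)})"
      unfolding void_simple_def by (intro UN_I[of "{B\<in>F. S \<inter> B = {}}"]) auto
  next
    fix S assume "S \<in> (\<Union>P\<in>{P\<in>Pow F. g P}. {S\<in>space config_space. \<forall>B\<in>F. (S \<inter> B = {}) = (B \<in> P)})"
    then obtain P where P: "P \<subseteq> F" "g P" "S \<in> space config_space" "\<forall>B\<in>F. (S \<inter> B = {}) = (B \<in> P)" by blast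
    then have "{B\<in>F. S \<inter> B = {}} = P" by blast
    then show "S \<in> void_simple F g" unfolding void_simple_def using P by simp
  qed
  also have "\<dots> \<in> sets config_space" using fin by (intro sets.finite_UN 1) auto
  finally show ?thesis .
qed

definition approximable :: "'a::euclidean_space set measure \<Rightarrow> 'a set set \<Rightarrow> bool" where
  "approximable M E \<longleftrightarrow> (\<forall>\<eta>>0. \<exists>F g. bounded_family F \<and> measure M ((E - void_simple F g) \<union> (void_simple F g - E)) < \<eta>)"

lemma void_simple_Un:
  assumes "bounded_family F" "bounded_family F'"
  shows "\<exists>H h. bounded_family H \<and> void_simple H h = void_simple F g \<union> void_simple F' g'"
proof (intro exI[of _ "F \<union> F'"] exI[of _ "\<lambda>P. g (P \<inter> F) \<or> g' (P \<inter> F')"] conjI)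
  show "bounded_family (F \<union> F')" using assms by (auto simp: bounded_family_def)
  have "{B\<in>F \<union> F'. S \<inter> B = {}} \<inter> F = {B\<in>F. S \<inter> B = {}}" "{B\<in>F \<union> F'. S \<inter> B = {}} \<inter> F' = {B\<in>F'. S \<inter> B = {}}" for S by blast+
  then show "void_simple (F \<union> F') (\<lambda>P. g (P \<inter> F) \<or> g' (P \<inter> F')) = void_simple F g \<union> void_simple F' g'"
    unfolding void_simple_def by auto
qed

lemma void_simple_finite_Union:
  fixes F :: "nat \<Rightarrow> 'a::euclidean_space set set"
  assumes "\<And>i. i < n \<Longrightarrow> bounded_family (F i)"
  shows "\<exists>H h. bounded_family H \<and> void_simple H h = (\<Union>i<n. void_simple (F i) (g i))"
  using assms
proof (induction n)
  case 0
  show ?case by (intro exI[of _ "{}"] exI[of _ "\<lambda>_. False"]) (simp add: bounded_family_def void_simple_def)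
next
  case (Suc n)
  then obtain H h where H: "bounded_family H" "void_simple H h = (\<Union>i<n. void_simple (F i) (g i))" by fastforce
  from void_simple_Un[OF H(1) Suc.prems[of n], of h "g n"] show ?case
    unfolding H(2) by (simp add: lessThan_Suc Un_commute)
qed

text \<open>
  Void events generate the sigma-algebra, and approximability up to small probability passes to complements and to
  countable unions, the latter by truncation.
\<close>

theorem approximable_sets:
  fixes M :: "'a::euclidean_space set measure"
  assumes M: "prob_space M" "sets M = sets config_space" and E: "E \<in> sets config_space"
  shows "approximable M E"
proof -
  interpret M: prob_space M by fact
  have vs: "bounded_family F \<Longrightarrow> void_simple F g \<in> sets M" for F and g using void_simple_sets M(2) by blast
  have "E \<in> sets M \<and> approximable M E"
    using E unfolding sets_config_space_eq
  proof (induction rule: sigma_sets.induct)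
    case (Basic E)
    then obtain B where B: "E = {S\<in>space config_space. S \<inter> B = {}}" "B \<in> sets borel" "bounded B" by (auto simp: void_events_def)
    have v: "void_simple {B} (\<lambda>P. P \<noteq> {}) = E" unfolding void_simple_def B by auto
    have bf: "bounded_family {B}" using B by (simp add: bounded_family_def)
    show ?case
    proof
      show "E \<in> sets M" using vs[OF bf] v by metis
      show "approximable M E" unfolding approximable_def
        using bf v by (intro allI impI exI[of _ "{B}"] exI[of _ "\<lambda>P. P \<noteq> {}"]) simp
    qed
  next
    case Empty
    have "void_simple {} (\<lambda>_. False) = ({} :: 'a set set)" by (simp add: void_simple_def)
    moreover have "bounded_family {}" by (simp add: bounded_family_def)
    ultimately show ?case unfolding approximable_def
      by (intro conjI allI impI exI[of _ "{}"] exI[of _ "\<lambda>_. False"]) simp_all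
  next
    case (Compl E)
    have sp: "space config_space = space M" using sets_eq_imp_space_eq[OF M(2)] by simp
    show ?case
    proof
      show "space config_space - E \<in> sets M" using Compl unfolding sp by auto
      show "approximable M (space config_space - E)" unfolding approximable_def
      proof (intro allI impI)
        fix \<eta> :: real assume "\<eta> > 0"
        then obtain F g where F: "bounded_family F" "measure M ((E - void_simple F g) \<union> (void_simple F g - E)) < \<eta>"
          using Compl unfolding approximable_def by blast
        have "E \<subseteq> space config_space" using Compl sets.sets_into_space unfolding sp by blast
        then have "(space config_space - E - void_simple F (\<lambda>P. \<not> g P)) \<union> (void_simple F (\<lambda>P. \<not> g P) - (space config_space - E)) =
            (E - void_simple F g) \<union> (void_simple F g - E)"
          unfolding void_simple_def by blast
        with F show "\<exists>F g. bounded_family F \<and> measure M ((space config_space - E - void_simple F g) \<union> (void_simple F g - (space config_space - E))) < \<eta>"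
          by (intro exI[of _ F] exI[of _ "\<lambda>P. \<not> g P"]) simp
      qed
    qed
  next
    case (Union E)
    then have Es: "E i \<in> sets M" and Ea: "approximable M (E i)" for i by auto
    show ?case
    proof
      show "(\<Union>i. E i) \<in> sets M" using Es by auto
      show "approximable M (\<Union>i. E i)" unfolding approximable_def
      proof (intro allI impI)
        fix \<eta> :: real assume \<eta>: "\<eta> > 0"
        have "(\<lambda>n. M.prob (\<Union>i<n. E i)) \<longlonglongrightarrow> M.prob (\<Union>n. \<Union>i<n. E i)"
          using Es by (intro M.finite_Lim_measure_incseq) (auto simp: incseq_def intro: less_le_trans)
        also have "(\<Union>n. \<Union>i<n. E i) = (\<Union>i. E i)" by blast
        finally have "\<forall>\<^sub>F n in sequentially. M.prob (\<Union>i. E i) - \<eta> / 2 < M.prob (\<Union>i<n. E i)"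
          by (rule order_tendstoD) (use \<eta> in simp)
        then obtain n where n: "M.prob (\<Union>i. E i) - \<eta> / 2 < M.prob (\<Union>i<n. E i)" by (auto simp: eventually_sequentially)
        have "M.prob ((\<Union>i. E i) - (\<Union>i<n. E i)) = M.prob (\<Union>i. E i) - M.prob (\<Union>i<n. E i)"
          using Es by (intro M.finite_measure_Diff) auto
        with n have tail: "M.prob ((\<Union>i. E i) - (\<Union>i<n. E i)) < \<eta> / 2" by linarith
        have "0 < \<eta> / (2 * (real n + 1))" using \<eta> by simp
        then have "\<forall>i. \<exists>F g. bounded_family F \<and> measure M ((E i - void_simple F g) \<union> (void_simple F g - E i)) < \<eta> / (2 * (real n + 1))"
          using Ea unfolding approximable_def by blast
        then obtain F g where F: "\<And>i. bounded_family (F i)"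
          "\<And>i. measure M ((E i - void_simple (F i) (g i)) \<union> (void_simple (F i) (g i) - E i)) < \<eta> / (2 * (real n + 1))" by metis
        let ?d = "\<lambda>i. (E i - void_simple (F i) (g i)) \<union> (void_simple (F i) (g i) - E i)"
        have dM: "?d i \<in> sets M" for i using Es vs[OF F(1)] by auto
        obtain H h where H: "bounded_family H" "void_simple H h = (\<Union>i<n. void_simple (F i) (g i))"
          using void_simple_finite_Union[of n F g] F(1) by blast
        have "((\<Union>i. E i) - void_simple H h) \<union> (void_simple H h - (\<Union>i. E i)) \<subseteq> ((\<Union>i. E i) - (\<Union>i<n. E i)) \<union> (\<Union>i<n. ?d i)"
          unfolding H(2) by blast
        then have "M.prob (((\<Union>i. E i) - void_simple H h) \<union> (void_simple H h - (\<Union>i. E i))) \<le> M.prob (((\<Union>i. E i) - (\<Union>i<n. E i)) \<union> (\<Union>i<n. ?d i))"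
          using Es dM by (intro M.finite_measure_mono) auto
        also have "\<dots> \<le> M.prob ((\<Union>i. E i) - (\<Union>i<n. E i)) + M.prob (\<Union>i<n. ?d i)"
          using Es dM by (intro measure_Un_le) auto
        also have "M.prob (\<Union>i<n. ?d i) \<le> (\<Sum>i<n. M.prob (?d i))"
          using dM by (intro M.finite_measure_subadditive_finite) auto
        also have "\<dots> \<le> (\<Sum>i<n. \<eta> / (2 * (real n + 1)))" using F(2) by (intro sum_mono less_imp_le)
        also have "\<dots> \<le> \<eta> / 2" using \<eta> by (simp add: field_simps)
        finally have "M.prob (((\<Union>i. E i) - void_simple H h) \<union> (void_simple H h - (\<Union>i. E i))) < \<eta>" using tail by linarith
        then show "\<exists>F g. bounded_family F \<and> M.prob (((\<Union>i. E i) - void_simple F g) \<union> (void_simple F g - (\<Union>i. E i))) < \<eta>"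
          using H(1) by blast
      qed
    qed
  qed
  then show ?thesis by simp
qed

section \<open>The counting inequality\<close>

lemma sum_subsets_swap:
  fixes h :: "'x set \<Rightarrow> 'x set \<Rightarrow> real"
  assumes A: "finite A"
  shows "(\<Sum>y\<in>Pow A. \<Sum>w\<in>Pow y. h w y) = (\<Sum>w\<in>Pow A. \<Sum>z\<in>Pow (A - w). h w (w \<union> z))"
proof -
  have "(\<Sum>y\<in>Pow A. \<Sum>w\<in>Pow y. h w y) = (\<Sum>(y, w)\<in>Sigma (Pow A) Pow. h w y)"
    using A by (intro sum.Sigma) (auto intro: finite_subset)
  also have "\<dots> = (\<Sum>(w, z)\<in>Sigma (Pow A) (\<lambda>w. Pow (A - w)). h w (w \<union> z))"
    by (rule sum.reindex_bij_witness[of _ "\<lambda>(w, z). (w \<union> z, w)" "\<lambda>(y, w). (w, y - w)"]) (auto simp: Un_absorb1)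
  also have "\<dots> = (\<Sum>w\<in>Pow A. \<Sum>z\<in>Pow (A - w). h w (w \<union> z))"
    using A by (intro sum.Sigma[symmetric]) (auto intro: finite_subset)
  finally show ?thesis .
qed

text \<open>
  \<open>y\<close> stands for the random set of atoms occupied by \<open>Y\<close>, each atom \<open>a\<close> occupied independently with probability \<open>p a\<close>,
  and \<open>w \<subseteq> y\<close> for a candidate of the set occupied by \<open>X\<close>, from which cells \<open>pred w\<close> are predicted. For fixed \<open>w\<close> the
  number of successes is governed by the atoms outside of \<open>w\<close>, each predicted cell contributing at most a factor
  \<open>exp 1\<close> to the mean of \<open>s ^ successes\<close>, which the factor \<open>exp (- card (pred w))\<close> cancels. With the
  weights \<open>(1/2) ^ card y\<close>, what remains of the sum over \<open>w\<close> is at most the total mass 1 of independent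
  occupations with probabilities \<open>p a / 2\<close>.
\<close>

lemma counting_inequality:
  fixes p :: "'x \<Rightarrow> real" and cell :: "'q \<Rightarrow> 'x set" and pred :: "'x set \<Rightarrow> 'q set"
  assumes A: "finite A" and p: "\<And>a. a \<in> A \<Longrightarrow> 0 \<le> p a" "\<And>a. a \<in> A \<Longrightarrow> p a \<le> 1"
    and Q: "finite Q" "\<And>q. q \<in> Q \<Longrightarrow> cell q \<subseteq> A" "disjoint_family_on cell Q"
    and s: "0 \<le> s" "\<And>q. q \<in> Q \<Longrightarrow> s * (\<Sum>a\<in>cell q. p a) \<le> 1"
    and pred: "\<And>w. pred w \<subseteq> Q"
  shows "(\<Sum>y\<in>Pow A. (\<Prod>a\<in>y. p a) * (\<Prod>a\<in>A - y. 1 - p a) * (\<Sum>w\<in>Pow y.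
      s ^ card {q\<in>pred w. y \<inter> cell q \<noteq> {} \<and> w \<inter> cell q = {}} * exp (- real (card (pred w))) * (1/2) ^ card y)) \<le> 1"
proof -
  let ?c = "\<lambda>w y. s ^ card {q\<in>pred w. y \<inter> cell q \<noteq> {} \<and> w \<inter> cell q = {}}"
  let ?e = "\<lambda>w. exp (- real (card (pred w)))"
  have "(\<Sum>y\<in>Pow A. (\<Prod>a\<in>y. p a) * (\<Prod>a\<in>A - y. 1 - p a) * (\<Sum>w\<in>Pow y. ?c w y * ?e w * (1/2) ^ card y))
      = (\<Sum>w\<in>Pow A. \<Sum>z\<in>Pow (A - w). (\<Prod>a\<in>w \<union> z. p a) * (\<Prod>a\<in>A - (w \<union> z). 1 - p a) * (?c w (w \<union> z) * ?e w * (1/2) ^ card (w \<union> z)))"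
    unfolding sum_distrib_left by (rule sum_subsets_swap[OF A])
  also have "\<dots> \<le> (\<Sum>w\<in>Pow A. (\<Prod>a\<in>w. p a / 2) * (\<Prod>a\<in>A - w. 1 - p a / 2))"
  proof (rule sum_mono)
    fix w assume w: "w \<in> Pow A"
    then have finw: "finite w" using A finite_subset by blast
    define R where "R = {q\<in>pred w. w \<inter> cell q = {}}"
    have RQ: "R \<subseteq> Q" using pred[of w] unfolding R_def by blast
    have finR: "finite R" by (rule finite_subset[OF RQ Q(1)])
    have half: "0 \<le> 1 - p a / 2" if "a \<in> A" for a using p(2)[OF that] by simp
    define UR where "UR = (\<Union>q\<in>R. cell q)"
    have finc: "finite (cell q)" if "q \<in> Q" for q using Q(2)[OF that] A finite_subset by blast
    \<comment> \<open>A bound for the gain of a factor \<open>s\<close>: each occupied atom in a predicted cell that \<open>w\<close> misses pays \<open>1 + s\<close>.\<close>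
    define \<tau> where "\<tau> a = (if a \<in> UR then 1 + s else 1)" for a
    have 1: "?c w (w \<union> z) \<le> (\<Prod>a\<in>z. \<tau> a)" if z: "z \<in> Pow (A - w)" for z
    proof -
      have finz: "finite z" using z A finite_subset by blast
      let ?hit = "{q\<in>R. z \<inter> cell q \<noteq> {}}"
      have eq: "{q\<in>pred w. (w \<union> z) \<inter> cell q \<noteq> {} \<and> w \<inter> cell q = {}} = ?hit" unfolding R_def by blast
      have "card ?hit = (\<Sum>q\<in>?hit. 1)" by simp
      also have "\<dots> \<le> (\<Sum>q\<in>?hit. card (z \<inter> cell q))"
        using finz by (intro sum_mono) (auto simp: Suc_le_eq card_gt_0_iff)
      also have "\<dots> \<le> (\<Sum>q\<in>R. card (z \<inter> cell q))" using finR by (intro sum_mono2) auto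
      also have "\<dots> = card (\<Union>q\<in>R. z \<inter> cell q)"
        using finR finz Q(3) RQ by (intro card_UN_disjoint[symmetric]) (auto simp: disjoint_family_on_def)
      also have "(\<Union>q\<in>R. z \<inter> cell q) = z \<inter> UR" unfolding UR_def by blast
      finally have le: "card ?hit \<le> card (z \<inter> UR)" .
      have "s ^ card ?hit \<le> (1 + s) ^ card ?hit" using s by (intro power_mono) auto
      also have "\<dots> \<le> (1 + s) ^ card (z \<inter> UR)" using s le by (intro power_increasing) auto
      also have "\<dots> = (\<Prod>a\<in>z. \<tau> a)"
        using finz unfolding \<tau>_def by (subst prod.If_cases) auto
      finally show ?thesis unfolding eq .
    qed
    have "(\<Sum>z\<in>Pow (A - w). (\<Prod>a\<in>w \<union> z. p a) * (\<Prod>a\<in>A - (w \<union> z). 1 - p a) * (?c w (w \<union> z) * ?e w * (1/2) ^ card (w \<union> z)))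
        \<le> (\<Sum>z\<in>Pow (A - w). (\<Prod>a\<in>w. p a / 2) * ?e w * ((\<Prod>a\<in>z. p a / 2 * \<tau> a) * (\<Prod>a\<in>A - w - z. 1 - p a)))"
    proof (rule sum_mono)
      fix z assume z: "z \<in> Pow (A - w)"
      then have finz: "finite z" using A finite_subset by blast
      have dis: "w \<inter> z = {}" using z by blast
      have "(\<Prod>a\<in>w \<union> z. p a) * (1/2) ^ card (w \<union> z) = (\<Prod>a\<in>w. p a / 2) * (\<Prod>a\<in>z. p a / 2)"
        using finw finz dis by (simp add: prod.union_disjoint card_Un_disjoint power_add prod_dividef divide_simps)
      moreover have "A - (w \<union> z) = A - w - z" by blast
      ultimately have "(\<Prod>a\<in>w \<union> z. p a) * (\<Prod>a\<in>A - (w \<union> z). 1 - p a) * (?c w (w \<union> z) * ?e w * (1/2) ^ card (w \<union> z))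
          = ((\<Prod>a\<in>w. p a / 2) * (\<Prod>a\<in>z. p a / 2) * (\<Prod>a\<in>A - w - z. 1 - p a) * ?e w) * ?c w (w \<union> z)"
        by (simp add: mult_ac)
      also have "\<dots> \<le> ((\<Prod>a\<in>w. p a / 2) * (\<Prod>a\<in>z. p a / 2) * (\<Prod>a\<in>A - w - z. 1 - p a) * ?e w) * (\<Prod>a\<in>z. \<tau> a)"
        using w z p by (intro mult_left_mono 1 mult_nonneg_nonneg prod_nonneg) auto
      also have "\<dots> = (\<Prod>a\<in>w. p a / 2) * ?e w * ((\<Prod>a\<in>z. p a / 2 * \<tau> a) * (\<Prod>a\<in>A - w - z. 1 - p a))"
        by (simp only: prod.distrib mult_ac)
      finally show "(\<Prod>a\<in>w \<union> z. p a) * (\<Prod>a\<in>A - (w \<union> z). 1 - p a) * (?c w (w \<union> z) * ?e w * (1/2) ^ card (w \<union> z))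
          \<le> (\<Prod>a\<in>w. p a / 2) * ?e w * ((\<Prod>a\<in>z. p a / 2 * \<tau> a) * (\<Prod>a\<in>A - w - z. 1 - p a))" .
    qed
    also have "\<dots> = (\<Prod>a\<in>w. p a / 2) * ?e w * (\<Prod>a\<in>A - w. p a / 2 * \<tau> a + (1 - p a))"
      using A by (simp only: sum_distrib_left[symmetric] prod_add finite_Diff)
    also have "\<dots> \<le> (\<Prod>a\<in>w. p a / 2) * ?e w * ((\<Prod>a\<in>A - w. 1 - p a / 2) * exp (real (card (pred w))))"
    proof (intro mult_left_mono mult_nonneg_nonneg prod_nonneg)
      have "(\<Prod>a\<in>A - w. p a / 2 * \<tau> a + (1 - p a)) \<le> (\<Prod>a\<in>A - w. (1 - p a / 2) * exp (if a \<in> UR then s * p a else 0))"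
      proof (rule prod_mono, intro conjI)
        fix a assume "a \<in> A - w"
        then have pa: "0 \<le> p a" "p a \<le> 1" using p by auto
        show "0 \<le> p a / 2 * \<tau> a + (1 - p a)" unfolding \<tau>_def using pa s by simp
        show "p a / 2 * \<tau> a + (1 - p a) \<le> (1 - p a / 2) * exp (if a \<in> UR then s * p a else 0)"
        proof (cases "a \<in> UR")
          case True
          have "0 \<le> s * p a * (1 - p a)" using s pa by simp
          moreover have "(1 - p a / 2) * (1 + s * p a) - (p a / 2 * (1 + s) + (1 - p a)) = s * p a * (1 - p a) / 2" by (simp add: field_simps)
          ultimately have "p a / 2 * (1 + s) + (1 - p a) \<le> (1 - p a / 2) * (1 + s * p a)" by linarith
          also have "\<dots> \<le> (1 - p a / 2) * exp (s * p a)" using pa exp_ge_add_one_self[of "s * p a"] by (intro mult_left_mono) auto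
          finally show ?thesis using True by (simp add: \<tau>_def)
        qed (simp add: \<tau>_def)
      qed
      also have "\<dots> = (\<Prod>a\<in>A - w. 1 - p a / 2) * exp (\<Sum>a\<in>A - w. if a \<in> UR then s * p a else 0)"
        using A by (simp add: prod.distrib exp_sum)
      also have "\<dots> \<le> (\<Prod>a\<in>A - w. 1 - p a / 2) * exp (real (card (pred w)))"
      proof (intro mult_left_mono prod_nonneg)
        have "(\<Sum>a\<in>A - w. if a \<in> UR then s * p a else 0) = (\<Sum>a\<in>(A - w) \<inter> UR. s * p a)"
          using A by (subst sum.inter_restrict) auto
        also have "\<dots> \<le> (\<Sum>a\<in>UR. s * p a)"
        proof (rule sum_mono2)
          show "finite UR" unfolding UR_def using finR finc RQ by blast
          fix a assume "a \<in> UR - (A - w) \<inter> UR"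
          then have "a \<in> A" unfolding UR_def using RQ Q(2) by blast
          then show "0 \<le> s * p a" using s p by simp
        qed blast
        also have "\<dots> = (\<Sum>q\<in>R. \<Sum>a\<in>cell q. s * p a)"
          unfolding UR_def
        proof (rule sum.UNION_disjoint[OF finR])
          show "\<forall>i\<in>R. finite (cell i)" using finc RQ by blast
          show "\<forall>i\<in>R. \<forall>j\<in>R. i \<noteq> j \<longrightarrow> cell i \<inter> cell j = {}" using Q(3) RQ unfolding disjoint_family_on_def by blast
        qed
        also have "\<dots> \<le> (\<Sum>q\<in>R. 1)" using s(2) RQ by (intro sum_mono) (auto simp: sum_distrib_left[symmetric])
        also have "\<dots> = real (card R)" by simp
        also have "card R \<le> card (pred w)" unfolding R_def using pred[of w] Q(1) finite_subset by (intro card_mono) auto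
        finally show "exp (\<Sum>a\<in>A - w. if a \<in> UR then s * p a else 0) \<le> exp (real (card (pred w)))" by simp
      qed (use half in auto)
      finally show "(\<Prod>a\<in>A - w. p a / 2 * \<tau> a + (1 - p a)) \<le> (\<Prod>a\<in>A - w. 1 - p a / 2) * exp (real (card (pred w)))" .
    qed (use w p in auto)
    also have "\<dots> = (\<Prod>a\<in>w. p a / 2) * (\<Prod>a\<in>A - w. 1 - p a / 2)"
      by (simp add: exp_minus)
    finally show "(\<Sum>z\<in>Pow (A - w). (\<Prod>a\<in>w \<union> z. p a) * (\<Prod>a\<in>A - (w \<union> z). 1 - p a) * (?c w (w \<union> z) * ?e w * (1/2) ^ card (w \<union> z)))
        \<le> (\<Prod>a\<in>w. p a / 2) * (\<Prod>a\<in>A - w. 1 - p a / 2)" .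
  qed
  also have "\<dots> = (\<Prod>a\<in>A. p a / 2 + (1 - p a / 2))" by (rule prod_add[OF A, symmetric])
  also have "\<dots> = 1" by simp
  finally show ?thesis .
qed

lemma (in prob_space) finite_rv:
  fixes h :: "'z \<Rightarrow> real"
  assumes A: "finite A" and Z: "\<And>\<omega>. \<omega> \<in> space M \<Longrightarrow> Z \<omega> \<in> A" "\<And>a. a \<in> A \<Longrightarrow> {\<omega>\<in>space M. Z \<omega> = a} \<in> events"
  shows "integrable M (\<lambda>\<omega>. h (Z \<omega>))" "expectation (\<lambda>\<omega>. h (Z \<omega>)) = (\<Sum>a\<in>A. h a * prob {\<omega>\<in>space M. Z \<omega> = a})"
proof -
  have eq: "h (Z \<omega>) = (\<Sum>a\<in>A. h a * indicator {\<omega>\<in>space M. Z \<omega> = a} \<omega>)" if \<omega>: "\<omega> \<in> space M" for \<omega>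
  proof -
    have "(\<Sum>a\<in>A. h a * indicator {\<omega>\<in>space M. Z \<omega> = a} \<omega>) = (\<Sum>a\<in>A. if a = Z \<omega> then h a else 0)"
      using \<omega> by (intro sum.cong) (auto simp: indicator_def)
    then show ?thesis using A Z(1)[OF \<omega>] by simp
  qed
  have int: "integrable M (\<lambda>\<omega>. h a * indicator {\<omega>\<in>space M. Z \<omega> = a} \<omega>)" if "a \<in> A" for a
    using Z(2)[OF that] by (intro integrable_mult_right integrable_real_indicator) (auto simp: emeasure_eq_measure)
  show "integrable M (\<lambda>\<omega>. h (Z \<omega>))"
    by (subst Bochner_Integration.integrable_cong[OF refl eq], assumption) (intro Bochner_Integration.integrable_sum int)
  have "expectation (\<lambda>\<omega>. h (Z \<omega>)) = expectation (\<lambda>\<omega>. \<Sum>a\<in>A. h a * indicator {\<omega>\<in>space M. Z \<omega> = a} \<omega>)"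
    by (rule Bochner_Integration.integral_cong[OF refl eq])
  also have "\<dots> = (\<Sum>a\<in>A. h a * prob {\<omega>\<in>space M. Z \<omega> = a})"
    using int Z(2) by (subst Bochner_Integration.integral_sum) auto
  finally show "expectation (\<lambda>\<omega>. h (Z \<omega>)) = (\<Sum>a\<in>A. h a * prob {\<omega>\<in>space M. Z \<omega> = a})" .
qed

section \<open>A bound on predicted hits\<close>

lemma (in prob_space) expectation_card:
  assumes Q: "finite Q" and P: "\<And>q. q \<in> Q \<Longrightarrow> {\<omega>\<in>space M. P q \<omega>} \<in> events"
  shows "integrable M (\<lambda>\<omega>. real (card {q\<in>Q. P q \<omega>}))"
    "expectation (\<lambda>\<omega>. real (card {q\<in>Q. P q \<omega>})) = (\<Sum>q\<in>Q. prob {\<omega>\<in>space M. P q \<omega>})"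
proof -
  have eq: "real (card {q\<in>Q. P q \<omega>}) = (\<Sum>q\<in>Q. indicator {\<omega>\<in>space M. P q \<omega>} \<omega>)" if "\<omega> \<in> space M" for \<omega>
  proof -
    have "real (card {q\<in>Q. P q \<omega>}) = (\<Sum>q | q \<in> Q \<and> P q \<omega>. 1)" by simp
    also have "\<dots> = (\<Sum>q\<in>Q. if P q \<omega> then 1 else 0)" by (rule sum.inter_filter[OF Q])
    also have "\<dots> = (\<Sum>q\<in>Q. indicator {\<omega>\<in>space M. P q \<omega>} \<omega>)" using that by (intro sum.cong) (auto simp: indicator_def)
    finally show ?thesis .
  qed
  have int: "integrable M (\<lambda>\<omega>. indicator {\<omega>\<in>space M. P q \<omega>} \<omega> :: real)" if "q \<in> Q" for q
    using P[OF that] by (intro integrable_real_indicator) (auto simp: emeasure_eq_measure)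
  show "integrable M (\<lambda>\<omega>. real (card {q\<in>Q. P q \<omega>}))"
    by (subst Bochner_Integration.integrable_cong[OF refl eq], assumption) (intro Bochner_Integration.integrable_sum int)
  have "expectation (\<lambda>\<omega>. real (card {q\<in>Q. P q \<omega>})) = expectation (\<lambda>\<omega>. \<Sum>q\<in>Q. indicator {\<omega>\<in>space M. P q \<omega>} \<omega>)"
    by (rule Bochner_Integration.integral_cong[OF refl eq])
  also have "\<dots> = (\<Sum>q\<in>Q. prob {\<omega>\<in>space M. P q \<omega>})"
    using int P by (subst Bochner_Integration.integral_sum) auto
  finally show "expectation (\<lambda>\<omega>. real (card {q\<in>Q. P q \<omega>})) = (\<Sum>q\<in>Q. prob {\<omega>\<in>space M. P q \<omega>})" .
qed

lemma prob_occupied_set: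
  fixes X :: "'w \<Rightarrow> 'a::euclidean_space set" and D :: "'i \<Rightarrow> 'a set"
  assumes X: "void_process M X (leb lam)"
    and I: "finite I" "\<And>i. i \<in> I \<Longrightarrow> D i \<in> sets borel" "\<And>i. i \<in> I \<Longrightarrow> bounded (D i)" "disjoint_family_on D I"
    and y: "y \<subseteq> I"
  shows "measure M {\<omega>\<in>space M. {i\<in>I. X \<omega> \<inter> D i \<noteq> {}} = y} = (\<Prod>i\<in>y. 1 - exp (- leb lam (D i))) * (\<Prod>i\<in>I - y. exp (- leb lam (D i)))"
proof -
  note XD = void_processD[OF X]
  interpret M: prob_space M by fact
  have v: "M.prob {\<omega>\<in>space M. X \<omega> \<inter> D i = {}} = exp (- leb lam (D i))" if "i \<in> I" for i
    using XD(3)[of "D i"] I that by blast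
  have ne: "M.prob {\<omega>\<in>space M. X \<omega> \<inter> D i \<noteq> {}} = 1 - exp (- leb lam (D i))" if i: "i \<in> I" for i
  proof -
    have "M.prob (space M - {\<omega>\<in>space M. X \<omega> \<inter> D i = {}}) = 1 - M.prob {\<omega>\<in>space M. X \<omega> \<inter> D i = {}}"
      by (rule M.prob_compl[OF void_event[OF XD(2) I(2)[OF i]]])
    moreover have "space M - {\<omega>\<in>space M. X \<omega> \<inter> D i = {}} = {\<omega>\<in>space M. X \<omega> \<inter> D i \<noteq> {}}" by blast
    ultimately show ?thesis using v[OF i] by simp
  qed
  show ?thesis
  proof (cases "I = {}")
    case True
    then show ?thesis using y M.prob_space by simp
  next
    case False
    define A where "A i = (if i \<in> y then space config_space - {{}} else {{} :: 'a set})" for i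
    have "{S\<in>space config_space. S \<inter> UNIV = {}} = {{} :: 'a set}" by (auto simp: space_config_space locally_finite_set_def)
    then have emp: "{{} :: 'a set} \<in> sets config_space" using sets_void[of "UNIV :: 'a set"] by simp
    then have A: "A i \<in> sets config_space" for i unfolding A_def by auto
    have pre: "(\<lambda>\<omega>. X \<omega> \<inter> D i) -` A i \<inter> space M = (if i \<in> y then {\<omega>\<in>space M. X \<omega> \<inter> D i \<noteq> {}} else {\<omega>\<in>space M. X \<omega> \<inter> D i = {}})" if "i \<in> I" for i
      using measurable_space[OF XD(2)] measurable_space[OF measurable_config_Int[OF I(2)[OF that]]] unfolding A_def by auto
    have "{\<omega>\<in>space M. {i\<in>I. X \<omega> \<inter> D i \<noteq> {}} = y} = (\<Inter>i\<in>I. (\<lambda>\<omega>. X \<omega> \<inter> D i) -` A i \<inter> space M)"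
    proof (intro set_eqI iffI)
      fix \<omega> assume "\<omega> \<in> {\<omega>\<in>space M. {i\<in>I. X \<omega> \<inter> D i \<noteq> {}} = y}"
      then show "\<omega> \<in> (\<Inter>i\<in>I. (\<lambda>\<omega>. X \<omega> \<inter> D i) -` A i \<inter> space M)" by (subst INT_iff) (auto simp: pre)
    next
      fix \<omega> assume "\<omega> \<in> (\<Inter>i\<in>I. (\<lambda>\<omega>. X \<omega> \<inter> D i) -` A i \<inter> space M)"
      then have *: "\<omega> \<in> (if i \<in> y then {\<omega>\<in>space M. X \<omega> \<inter> D i \<noteq> {}} else {\<omega>\<in>space M. X \<omega> \<inter> D i = {}})" if "i \<in> I" for i
        using that pre[OF that] by blast
      from False obtain i where "i \<in> I" by blast
      from *[OF this] have "\<omega> \<in> space M" by (simp split: if_splits)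
      moreover have "{i\<in>I. X \<omega> \<inter> D i \<noteq> {}} = y"
      proof -
        have "(X \<omega> \<inter> D i \<noteq> {}) = (i \<in> y)" if "i \<in> I" for i using *[OF that] by (cases "i \<in> y") simp_all
        then show ?thesis using y by blast
      qed
      ultimately show "\<omega> \<in> {\<omega>\<in>space M. {i\<in>I. X \<omega> \<inter> D i \<noteq> {}} = y}" by simp
    qed
    also have "M.prob \<dots> = (\<Prod>i\<in>I. M.prob ((\<lambda>\<omega>. X \<omega> \<inter> D i) -` A i \<inter> space M))"
      using indep_restrictions[OF X I(2) I(4)] False I(1) A by (intro M.indep_varsD_finite)
    also have "\<dots> = (\<Prod>i\<in>I. if i \<in> y then 1 - exp (- leb lam (D i)) else exp (- leb lam (D i)))"
      by (intro prod.cong refl) (simp add: pre v ne)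
    also have "\<dots> = (\<Prod>i\<in>I \<inter> y. 1 - exp (- leb lam (D i))) * (\<Prod>i\<in>I \<inter> - y. exp (- leb lam (D i)))"
      using I(1) by (subst prod.If_cases) (auto simp: Int_def)
    also have "I \<inter> y = y" using y by blast
    finally show ?thesis by (simp add: Diff_eq)
  qed
qed

text \<open>
  For each index \<open>q\<close> a predictor \<open>pr q\<close> looks at the void pattern of \<open>X\<close> in a finite family \<open>G\<close> of sets. A success
  is a predicted cell \<open>C q\<close> that \<open>Y\<close> meets and \<open>X\<close> misses. With \<open>V = ln s * successes - predictions - ln 2 * occupied
  atoms\<close> the counting inequality bounds the mean of \<open>exp V\<close> by 1: the occupied atoms of \<open>X\<close> form some subset of those of
  \<open>Y\<close>, and one simply sums over all subsets. Since \<open>1 + V \<le> exp V\<close>, the mean of \<open>V\<close> is at most 0, and this is the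
  claim, because the mean number of occupied atoms is at most \<open>lam\<close> times the volume.
\<close>

theorem predicted_hits_bound:
  fixes X Y :: "'w \<Rightarrow> 'a::euclidean_space set" and C :: "'q \<Rightarrow> 'a set" and pr :: "'q \<Rightarrow> 'a set set \<Rightarrow> bool"
  assumes Y: "void_process M Y (leb lam)" and lam: "0 \<le> lam"
    and X: "X \<in> measurable M config_space" and XY: "\<And>\<omega>. \<omega> \<in> space M \<Longrightarrow> X \<omega> \<subseteq> Y \<omega>"
    and G: "bounded_family G" and Q: "finite Q" "C ` Q \<subseteq> G" "disjoint_family_on C Q"
    and s: "1 \<le> s" "\<And>q. q \<in> Q \<Longrightarrow> s * leb lam (C q) \<le> 1"
  shows "ln s * (\<Sum>q\<in>Q. measure M {\<omega>\<in>space M. pr q {B\<in>G. X \<omega> \<inter> B = {}} \<and> Y \<omega> \<inter> C q \<noteq> {} \<and> X \<omega> \<inter> C q = {}})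
    \<le> (\<Sum>q\<in>Q. measure M {\<omega>\<in>space M. pr q {B\<in>G. X \<omega> \<inter> B = {}}}) + ln 2 * leb lam (\<Union>G)"
proof -
  note YD = void_processD[OF Y]
  interpret M: prob_space M by fact
  have G: "finite G" "\<And>B. B \<in> G \<Longrightarrow> B \<in> sets borel" "\<And>B. B \<in> G \<Longrightarrow> bounded B" and bfG: "bounded_family G"
    using G by (auto simp: bounded_family_def)
  define U where "U = \<Union>G"
  have U: "U \<in> sets borel" "bounded U" unfolding U_def using G by auto
  \<comment> \<open>Points with the same type are indistinguishable by the members of \<open>G\<close>; the atoms are the classes.\<close>
  define ty where "ty x = {B\<in>G. x \<in> B}" for x
  define \<A> where "\<A> = ty ` U"
  define atom where "atom I = {x\<in>U. ty x = I}" for I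
  have A: "finite \<A>" by (rule finite_subset[of _ "Pow G"]) (auto simp: \<A>_def ty_def G(1))
  have atom: "atom I \<in> sets borel" "bounded (atom I)" if "I \<in> \<A>" for I
  proof -
    have "I \<subseteq> G" using that by (auto simp: \<A>_def ty_def)
    then have "atom I = (\<Inter>B\<in>G. if B \<in> I then B else - B) \<inter> U" unfolding atom_def ty_def by auto
    also have "\<dots> \<in> sets borel"
    proof (cases "G = {}")
      case True
      then show ?thesis unfolding U_def by simp
    next
      case False
      then show ?thesis using G U by (intro sets.Int sets.finite_INT) auto
    qed
    finally show "atom I \<in> sets borel" .
    show "bounded (atom I)" using U(2) by (rule bounded_subset) (auto simp: atom_def)
  qed
  have dis: "disjoint_family_on atom \<A>" by (auto simp: disjoint_family_on_def atom_def)
  have UA: "(\<Union>I\<in>\<A>. atom I) = U" by (auto simp: \<A>_def atom_def)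
  define occ where "occ S = {I\<in>\<A>. S \<inter> atom I \<noteq> {}}" for S
  have occA: "occ S \<in> Pow \<A>" for S by (auto simp: occ_def)
  \<comment> \<open>The void pattern is a function of the set of occupied atoms.\<close>
  define vd where "vd w = {B\<in>G. \<forall>I\<in>w. B \<notin> I}" for w
  have vd: "{B\<in>G. S \<inter> B = {}} = vd (occ S)" for S
  proof (intro set_eqI iffI)
    fix B assume "B \<in> {B\<in>G. S \<inter> B = {}}"
    then show "B \<in> vd (occ S)" unfolding vd_def occ_def atom_def ty_def by blast
  next
    fix B assume B: "B \<in> vd (occ S)"
    have False if x: "x \<in> S" "x \<in> B" for x
    proof -
      have "x \<in> U" "B \<in> ty x" using x B unfolding vd_def U_def ty_def by auto
      moreover from this have "ty x \<in> occ S" using x unfolding occ_def \<A>_def atom_def by blast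
      ultimately show False using B unfolding vd_def by blast
    qed
    then show "B \<in> {B\<in>G. S \<inter> B = {}}" using B unfolding vd_def by blast
  qed
  define cell where "cell q = {I\<in>\<A>. C q \<in> I}" for q
  have cellU: "(\<Union>I\<in>cell q. atom I) = C q" if "q \<in> Q" for q
  proof -
    have q: "C q \<in> G" using that Q(2) by blast
    show ?thesis
    proof (intro set_eqI iffI)
      fix x assume "x \<in> (\<Union>I\<in>cell q. atom I)"
      then show "x \<in> C q" unfolding cell_def atom_def ty_def by blast
    next
      fix x assume x: "x \<in> C q"
      then have "x \<in> U" "C q \<in> ty x" using q unfolding U_def ty_def by auto
      then show "x \<in> (\<Union>I\<in>cell q. atom I)" unfolding cell_def \<A>_def atom_def by blast
    qed
  qed
  have cell: "S \<inter> C q \<noteq> {} \<longleftrightarrow> occ S \<inter> cell q \<noteq> {}" if "q \<in> Q" for q S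
  proof -
    have "S \<inter> C q \<noteq> {} \<longleftrightarrow> (\<exists>I\<in>cell q. S \<inter> atom I \<noteq> {})" unfolding cellU[OF that, symmetric] by blast
    also have "\<dots> \<longleftrightarrow> occ S \<inter> cell q \<noteq> {}" unfolding occ_def cell_def by blast
    finally show ?thesis .
  qed
  have cellA: "cell q \<subseteq> \<A>" for q by (auto simp: cell_def)
  have celldis: "disjoint_family_on cell Q"
    unfolding disjoint_family_on_def
  proof (intro ballI impI)
    fix q r assume qr: "q \<in> Q" "r \<in> Q" "q \<noteq> r"
    then have "C q \<inter> C r = {}" using Q(3) by (auto simp: disjoint_family_on_def)
    then show "cell q \<inter> cell r = {}" unfolding cell_def \<A>_def ty_def by blast
  qed
  define p where "p I = 1 - exp (- leb lam (atom I))" for I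
  have p: "0 \<le> p I" "p I \<le> 1" "p I \<le> leb lam (atom I)" for I
    using lam exp_ge_add_one_self[of "- leb lam (atom I)"] unfolding p_def by (auto simp: mult_nonneg_nonneg)
  have sump: "(\<Sum>I\<in>J. p I) \<le> leb lam (\<Union>I\<in>J. atom I)" if J: "J \<subseteq> \<A>" for J
  proof -
    have "(\<Sum>I\<in>J. p I) \<le> (\<Sum>I\<in>J. leb lam (atom I))" by (intro sum_mono p)
    also have "\<dots> = lam * (\<Sum>I\<in>J. measure lborel (atom I))" by (simp add: sum_distrib_left)
    also have "(\<Sum>I\<in>J. measure lborel (atom I)) = measure lborel (\<Union>I\<in>J. atom I)"
      using J A atom dis by (intro measure_lborel_finite_Union[symmetric]) (auto intro: finite_subset disjoint_family_on_mono)
    finally show ?thesis .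
  qed
  define pset where "pset w = {q\<in>Q. pr q (vd w)}" for w
  define hits where "hits w y = {q\<in>pset w. y \<inter> cell q \<noteq> {} \<and> w \<inter> cell q = {}}" for w y
  have psetX: "pset (occ (X \<omega>)) = {q\<in>Q. pr q {B\<in>G. X \<omega> \<inter> B = {}}}" for \<omega> by (simp add: pset_def vd)
  have hitsX: "hits (occ (X \<omega>)) (occ (Y \<omega>)) = {q\<in>Q. pr q {B\<in>G. X \<omega> \<inter> B = {}} \<and> Y \<omega> \<inter> C q \<noteq> {} \<and> X \<omega> \<inter> C q = {}}" for \<omega>
    unfolding hits_def psetX using cell by blast
  define V where "V w y = ln s * real (card (hits w y)) - real (card (pset w)) - ln 2 * real (card y)" for w y
  define g where "g y = (\<Sum>w\<in>Pow y. s ^ card (hits w y) * exp (- real (card (pset w))) * (1/2) ^ card y)" for y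
  have expV: "exp (V w y) = s ^ card (hits w y) * exp (- real (card (pset w))) * (1/2) ^ card y" for w y
  proof -
    have 1: "exp (ln s * real n) = s ^ n" for n
      using s(1) exp_of_nat_mult[of n "ln s"] by (simp add: mult.commute)
    have 2: "exp (- (ln 2 * real n)) = (1/2) ^ n" for n
      using exp_of_nat_mult[of n "- ln 2 :: real"] by (simp add: exp_minus mult.commute inverse_eq_divide)
    have "V w y = ln s * real (card (hits w y)) + (- real (card (pset w))) + (- (ln 2 * real (card y)))" by (simp add: V_def)
    then show ?thesis by (simp only: exp_add 1 2)
  qed
  have Xv: "{\<omega>\<in>space M. X \<omega> \<inter> B = {}} \<in> M.events" "{\<omega>\<in>space M. X \<omega> \<inter> B \<noteq> {}} \<in> M.events"
    and Yv: "{\<omega>\<in>space M. Y \<omega> \<inter> B = {}} \<in> M.events" "{\<omega>\<in>space M. Y \<omega> \<inter> B \<noteq> {}} \<in> M.events" if "B \<in> sets borel" for B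
    using void_event[OF X that] occupied_event[OF X that] void_event[OF YD(2) that] occupied_event[OF YD(2) that] by auto
  have Xpr: "{\<omega>\<in>space M. pr q {B\<in>G. X \<omega> \<inter> B = {}}} \<in> M.events" for q
  proof -
    have "X -` void_simple G (pr q) \<inter> space M \<in> M.events" using X by (rule measurable_sets[OF _ void_simple_sets[OF bfG]])
    moreover have "X -` void_simple G (pr q) \<inter> space M = {\<omega>\<in>space M. pr q {B\<in>G. X \<omega> \<inter> B = {}}}"
      using measurable_space[OF X] unfolding void_simple_def by auto
    ultimately show ?thesis by simp
  qed
  have Xhit: "{\<omega>\<in>space M. pr q {B\<in>G. X \<omega> \<inter> B = {}} \<and> Y \<omega> \<inter> C q \<noteq> {} \<and> X \<omega> \<inter> C q = {}} \<in> M.events" if "q \<in> Q" for q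
  proof -
    have "C q \<in> sets borel" using Q(2) G(2) that by blast
    then show ?thesis using Xpr[of q] Xv(1)[of "C q"] Yv(2)[of "C q"] by (intro sets.sets_Collect_conj)
  qed
  have occev: "{\<omega>\<in>space M. occ (Z \<omega>) = y} \<in> M.events" if Z: "Z \<in> measurable M config_space" and y: "y \<in> Pow \<A>" for Z y
  proof -
    have "{\<omega>\<in>space M. occ (Z \<omega>) = y} = {\<omega>\<in>space M. \<forall>I\<in>\<A>. (Z \<omega> \<inter> atom I \<noteq> {}) = (I \<in> y)}"
      using y unfolding occ_def by blast
    also have "\<dots> \<in> M.events"
    proof (intro sets.sets_Collect_finite_All A)
      fix I assume "I \<in> \<A>"
      then show "{\<omega>\<in>space M. (Z \<omega> \<inter> atom I \<noteq> {}) = (I \<in> y)} \<in> M.events"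
        using void_event[OF Z atom(1)[of I]] occupied_event[OF Z atom(1)[of I]] by (cases "I \<in> y") auto
    qed
    finally show ?thesis .
  qed
  have fin: "finite (Pow \<A>)" using A by simp
  have g: "integrable M (\<lambda>\<omega>. g (occ (Y \<omega>)))" "M.expectation (\<lambda>\<omega>. g (occ (Y \<omega>))) = (\<Sum>y\<in>Pow \<A>. g y * M.prob {\<omega>\<in>space M. occ (Y \<omega>) = y})"
    using M.finite_rv[OF fin occA occev[OF YD(2)]] by auto
  have py: "M.prob {\<omega>\<in>space M. occ (Y \<omega>) = y} = (\<Prod>I\<in>y. p I) * (\<Prod>I\<in>\<A> - y. 1 - p I)" if "y \<in> Pow \<A>" for y
    using prob_occupied_set[OF Y A atom dis, of y] that unfolding occ_def p_def by simp
  have "(\<Sum>y\<in>Pow \<A>. g y * M.prob {\<omega>\<in>space M. occ (Y \<omega>) = y}) = (\<Sum>y\<in>Pow \<A>. (\<Prod>I\<in>y. p I) * (\<Prod>I\<in>\<A> - y. 1 - p I) *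
      (\<Sum>w\<in>Pow y. s ^ card (hits w y) * exp (- real (card (pset w))) * (1/2) ^ card y))"
    unfolding g_def by (intro sum.cong refl) (simp add: py)
  also have "\<dots> \<le> 1" unfolding hits_def
  proof (rule counting_inequality[OF A p(1,2) Q(1) cellA celldis])
    show "0 \<le> s" using s(1) by simp
    show "pset w \<subseteq> Q" for w by (auto simp: pset_def)
    fix q assume q: "q \<in> Q"
    have "s * (\<Sum>I\<in>cell q. p I) \<le> s * leb lam (C q)" using sump[OF cellA, of q] cellU[OF q] s(1) by (intro mult_left_mono) auto
    then show "s * (\<Sum>I\<in>cell q. p I) \<le> 1" using s(2)[OF q] by linarith
  qed
  finally have gle: "M.expectation (\<lambda>\<omega>. g (occ (Y \<omega>))) \<le> 1" unfolding g(2) .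
  have Vle: "V (occ (X \<omega>)) (occ (Y \<omega>)) \<le> g (occ (Y \<omega>)) - 1" if \<omega>: "\<omega> \<in> space M" for \<omega>
  proof -
    have sub: "occ (X \<omega>) \<in> Pow (occ (Y \<omega>))" using XY[OF \<omega>] by (auto simp: occ_def)
    have fy: "finite (Pow (occ (Y \<omega>)))" using A by (auto simp: occ_def)
    have "exp (V (occ (X \<omega>)) (occ (Y \<omega>))) \<le> g (occ (Y \<omega>))" unfolding expV g_def
      using s(1) by (intro member_le_sum[OF sub _ fy]) auto
    then show ?thesis using exp_ge_add_one_self[of "V (occ (X \<omega>)) (occ (Y \<omega>))"] by linarith
  qed
  note h = M.expectation_card[OF Q(1) Xhit] and q = M.expectation_card[OF Q(1) Xpr]
  have o: "integrable M (\<lambda>\<omega>. real (card (occ (Y \<omega>))))" "M.expectation (\<lambda>\<omega>. real (card (occ (Y \<omega>)))) = (\<Sum>I\<in>\<A>. M.prob {\<omega>\<in>space M. Y \<omega> \<inter> atom I \<noteq> {}})"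
    unfolding occ_def using M.expectation_card[OF A Yv(2)[OF atom(1)]] by auto
  have Vint: "integrable M (\<lambda>\<omega>. V (occ (X \<omega>)) (occ (Y \<omega>)))"
    "M.expectation (\<lambda>\<omega>. V (occ (X \<omega>)) (occ (Y \<omega>))) = ln s * (\<Sum>q\<in>Q. M.prob {\<omega>\<in>space M. pr q {B\<in>G. X \<omega> \<inter> B = {}} \<and> Y \<omega> \<inter> C q \<noteq> {} \<and> X \<omega> \<inter> C q = {}})
      - (\<Sum>q\<in>Q. M.prob {\<omega>\<in>space M. pr q {B\<in>G. X \<omega> \<inter> B = {}}}) - ln 2 * (\<Sum>I\<in>\<A>. M.prob {\<omega>\<in>space M. Y \<omega> \<inter> atom I \<noteq> {}})"
    unfolding V_def hitsX psetX using h q o by simp_all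
  have "M.expectation (\<lambda>\<omega>. V (occ (X \<omega>)) (occ (Y \<omega>))) \<le> M.expectation (\<lambda>\<omega>. g (occ (Y \<omega>)) - 1)"
    using Vint(1) g(1) Vle by (intro integral_mono) auto
  also have "\<dots> = M.expectation (\<lambda>\<omega>. g (occ (Y \<omega>))) - 1" using g(1) by (simp add: M.prob_space)
  finally have "M.expectation (\<lambda>\<omega>. V (occ (X \<omega>)) (occ (Y \<omega>))) \<le> 0" using gle by simp
  moreover have "(\<Sum>I\<in>\<A>. M.prob {\<omega>\<in>space M. Y \<omega> \<inter> atom I \<noteq> {}}) \<le> leb lam U"
  proof -
    have "M.prob {\<omega>\<in>space M. Y \<omega> \<inter> atom I \<noteq> {}} = p I" if I: "I \<in> \<A>" for I
    proof -
      have "M.prob (space M - {\<omega>\<in>space M. Y \<omega> \<inter> atom I = {}}) = 1 - M.prob {\<omega>\<in>space M. Y \<omega> \<inter> atom I = {}}"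
        by (rule M.prob_compl[OF Yv(1)[OF atom(1)[OF I]]])
      moreover have "space M - {\<omega>\<in>space M. Y \<omega> \<inter> atom I = {}} = {\<omega>\<in>space M. Y \<omega> \<inter> atom I \<noteq> {}}" by blast
      ultimately show ?thesis using YD(3)[OF atom[OF I]] by (simp add: p_def)
    qed
    then show ?thesis using sump[of \<A>] UA by simp
  qed
  then have "ln 2 * (\<Sum>I\<in>\<A>. M.prob {\<omega>\<in>space M. Y \<omega> \<inter> atom I \<noteq> {}}) \<le> ln 2 * leb lam U" by (intro mult_left_mono) auto
  ultimately show ?thesis unfolding Vint(2) U_def by linarith
qed

section \<open>Lattices and their cells\<close>

locale lattice_basis =
  fixes v :: "'n::finite \<Rightarrow> real ^ 'n"
  assumes inj_v: "inj v" and indep_v: "independent (range v)"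
begin

definition lin :: "real ^ 'n \<Rightarrow> real ^ 'n" where "lin t = (\<Sum>i\<in>UNIV. t $ i *\<^sub>R v i)"

definition coord :: "real ^ 'n \<Rightarrow> real ^ 'n" where "coord = inv lin"

lemma linear_lin: "linear lin"
  by (rule linearI) (simp_all add: lin_def scaleR_left_distrib sum.distrib scaleR_sum_right)

lemma inj_lin: "inj lin"
proof -
  have "t = 0" if t: "lin t = 0" for t
  proof -
    have "(\<Sum>w\<in>range v. (t $ inv v w) *\<^sub>R w) = 0"
      using t inj_v unfolding lin_def by (subst sum.reindex[OF inj_v]) simp
    then have "t $ inv v (v i) = 0" for i
      using independentD[OF indep_v, of "range v" "\<lambda>w. t $ inv v w" "v i"] by simp
    then show "t = 0" using inj_v by (simp add: vec_eq_iff)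
  qed
  then show ?thesis using linear_injective_0[OF linear_lin] by blast
qed

lemma lin_coord [simp]: "lin (coord x) = x"
  unfolding coord_def using linear_injective_imp_surjective[OF linear_lin inj_lin] by (simp add: surj_f_inv_f)

lemma coord_lin [simp]: "coord (lin t) = t"
  unfolding coord_def using inj_lin by simp

lemma linear_coord: "linear coord"
  unfolding coord_def using linear_lin inj_lin by (rule inj_linear_imp_inv_linear)

lemma coord_diff: "coord (x - y) = coord x - coord y"
  using linear_coord by (rule linear_diff)

lemma continuous_coord: "continuous_on UNIV (\<lambda>x. coord x $ i)"
  using linear_continuous_on[OF linear_conv_bounded_linear[THEN iffD1, OF linear_coord]] by (intro continuous_on_component)

lemma measurable_coord [measurable]: "(\<lambda>x. coord x $ i) \<in> borel_measurable borel"
  by (rule borel_measurable_continuous_onI[OF continuous_coord])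

text \<open>
  The small cells of side \<open>1 / K\<close> in the coordinates of the basis; \<open>K = 1\<close> gives the fundamental cells of the lattice.
\<close>

definition cell :: "nat \<Rightarrow> ('n \<Rightarrow> int) \<Rightarrow> (real ^ 'n) set" where
  "cell K z = {x. \<forall>i. \<lfloor>real K * coord x $ i\<rfloor> = z i}"

definition box :: "int \<Rightarrow> int \<Rightarrow> (real ^ 'n) set" where
  "box lo hi = {x. \<forall>i. of_int lo \<le> coord x $ i \<and> coord x $ i < of_int hi}"

definition idx :: "int \<Rightarrow> int \<Rightarrow> ('n \<Rightarrow> int) set" where
  "idx lo hi = {z. \<forall>i. lo \<le> z i \<and> z i < hi}"

lemma idx_PiE: "idx lo hi = Pi\<^sub>E UNIV (\<lambda>_. {lo..<hi})"
  by (auto simp: idx_def PiE_def)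

lemma finite_idx: "finite (idx lo hi)"
  unfolding idx_PiE by (intro finite_PiE) auto

lemma card_idx: "card (idx lo hi) = nat (hi - lo) ^ CARD('n)"
  unfolding idx_PiE by (simp add: card_PiE)

lemma borel_cell [measurable]: "cell K z \<in> sets borel"
  unfolding cell_def floor_eq_iff by measurable

lemma borel_box [measurable]: "box lo hi \<in> sets borel"
  unfolding box_def by measurable

lemma bounded_box: "bounded (box lo hi)"
proof -
  let ?c = "real CARD('n) * (\<bar>real_of_int lo\<bar> + \<bar>real_of_int hi\<bar>)"
  have "box lo hi \<subseteq> lin ` cball 0 ?c"
  proof
    fix x assume x: "x \<in> box lo hi"
    have "norm (coord x) \<le> (\<Sum>i\<in>UNIV. \<bar>coord x $ i\<bar>)" by (rule norm_le_l1_cart)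
    also have "\<dots> \<le> (\<Sum>i\<in>(UNIV :: 'n set). \<bar>real_of_int lo\<bar> + \<bar>real_of_int hi\<bar>)"
    proof (rule sum_mono)
      fix i
      have "of_int lo \<le> coord x $ i" "coord x $ i < of_int hi" using x by (auto simp: box_def)
      then show "\<bar>coord x $ i\<bar> \<le> \<bar>real_of_int lo\<bar> + \<bar>real_of_int hi\<bar>" by linarith
    qed
    finally have "coord x \<in> cball 0 ?c" by simp
    then show "x \<in> lin ` cball 0 ?c" by (metis imageI lin_coord)
  qed
  moreover have "bounded (lin ` cball 0 ?c)"
    using bounded_cball linear_conv_bounded_linear[THEN iffD1, OF linear_lin] by (rule bounded_linear_image)
  ultimately show ?thesis by (rule bounded_subset[rotated])
qed

lemma ex_box: assumes "bounded B" shows "\<exists>r\<ge>1. B \<subseteq> box (- r) r"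
proof -
  have "bounded (coord ` B)"
    using assms linear_conv_bounded_linear[THEN iffD1, OF linear_coord] by (rule bounded_linear_image)
  then obtain c where c: "\<And>x. x \<in> B \<Longrightarrow> norm (coord x) \<le> c" by (auto simp: bounded_iff)
  define r where "r = max 1 (\<lfloor>c\<rfloor> + 1)"
  have "B \<subseteq> box (- r) r"
  proof
    fix x assume "x \<in> B"
    have "\<bar>coord x $ i\<bar> < of_int r" for i
      using component_le_norm_cart[of "coord x" i] c[OF \<open>x \<in> B\<close>] unfolding r_def by linarith
    then show "x \<in> box (- r) r" unfolding box_def by (auto simp: abs_less_iff less_imp_le minus_less_iff)
  qed
  then show ?thesis by (intro exI[of _ r]) (simp add: r_def)
qed

lemma disjoint_cell: "disjoint_family_on (cell K) I"
  unfolding disjoint_family_on_def cell_def by (auto simp: fun_eq_iff)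

lemma UN_cell:
  assumes K: "1 \<le> K" shows "(\<Union>z\<in>idx (int K * lo) (int K * hi). cell K z) = box lo hi"
proof -
  have "(\<lambda>i. \<lfloor>real K * coord x $ i\<rfloor>) \<in> idx (int K * lo) (int K * hi) \<longleftrightarrow> x \<in> box lo hi" for x
  proof -
    have "int K * lo \<le> \<lfloor>real K * coord x $ i\<rfloor> \<longleftrightarrow> of_int lo \<le> coord x $ i" for i
      using K by (simp add: le_floor_iff)
    moreover have "\<lfloor>real K * coord x $ i\<rfloor> < int K * hi \<longleftrightarrow> coord x $ i < of_int hi" for i
      using K by (simp add: floor_less_iff)
    ultimately show ?thesis unfolding idx_def box_def by simp
  qed
  moreover have "x \<in> cell K z \<longleftrightarrow> (\<lambda>i. \<lfloor>real K * coord x $ i\<rfloor>) = z" for x z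
    by (simp add: cell_def fun_eq_iff)
  ultimately show ?thesis by (simp add: set_eq_iff)
qed

lemma cell_subset_box:
  assumes "1 \<le> K" "z \<in> idx (int K * lo) (int K * hi)" shows "cell K z \<subseteq> box lo hi"
  using UN_cell[OF assms(1), of lo hi] assms(2) by blast

lemma bounded_cell: assumes K: "1 \<le> K" shows "bounded (cell K z)"
proof -
  define m where "m = (\<Sum>i\<in>UNIV. \<bar>z i\<bar>) + 1"
  have "\<bar>z i\<bar> < m" for i
    using member_le_sum[of i UNIV "\<lambda>i. \<bar>z i\<bar>"] unfolding m_def by simp
  moreover have "m \<le> int K * m" using K unfolding m_def by (simp add: sum_nonneg)
  ultimately have "\<bar>z i\<bar> < int K * m" for i using less_le_trans by blast
  then have "- (int K * m) \<le> z i \<and> z i < int K * m" for i by (smt (verit, best))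
  then have "z \<in> idx (int K * - m) (int K * m)" unfolding idx_def by simp
  from bounded_subset[OF bounded_box cell_subset_box[OF K this]] show ?thesis .
qed

abbreviation translation :: "('n \<Rightarrow> int) \<Rightarrow> real ^ 'n" where "translation j \<equiv> lin (\<chi> i. of_int (j i))"

lemma shift_cell:
  assumes K: "1 \<le> K"
  shows "shift (lin (\<chi> i. of_int (w i) / real K)) (cell K z) = cell K (\<lambda>i. z i + w i)"
proof -
  have "\<lfloor>real K * coord (x - lin (\<chi> i. of_int (w i) / real K)) $ i\<rfloor> = \<lfloor>real K * coord x $ i\<rfloor> - w i" for x i
  proof -
    have "real K * coord (x - lin (\<chi> i. of_int (w i) / real K)) $ i = real K * coord x $ i - of_int (w i)"
      using K by (simp add: coord_diff right_diff_distrib)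
    then show ?thesis by simp
  qed
  then have "\<lfloor>real K * coord (x - lin (\<chi> i. of_int (w i) / real K)) $ i\<rfloor> = z i \<longleftrightarrow> \<lfloor>real K * coord x $ i\<rfloor> = z i + w i" for x i
    by (simp only: diff_eq_eq)
  then show ?thesis by (simp only: set_eq_iff mem_shift cell_def mem_Collect_eq simp_thms)
qed

lemma shift_translation_cell:
  assumes K: "1 \<le> K" shows "shift (translation j) (cell K z) = cell K (\<lambda>i. z i + int K * j i)"
  using shift_cell[OF K, of "\<lambda>i. int K * j i" z] K by simp

lemma shift_translation_box: "shift (translation j) (box lo hi) \<subseteq> box lo' hi'"
  if "\<And>i. lo' \<le> lo + j i" "\<And>i. hi + j i \<le> hi'"
proof
  fix x assume x: "x \<in> shift (translation j) (box lo hi)"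
  have "of_int lo' \<le> coord x $ i \<and> coord x $ i < of_int hi'" for i
  proof -
    have "of_int lo \<le> coord x $ i - of_int (j i) \<and> coord x $ i - of_int (j i) < of_int hi"
      using x by (simp add: mem_shift box_def coord_diff)
    moreover have "real_of_int lo' \<le> of_int (lo + j i)" "real_of_int (hi + j i) \<le> of_int hi'"
      using that[of i] by (simp_all only: of_int_le_iff)
    ultimately show ?thesis by (simp only: of_int_add) linarith
  qed
  then show "x \<in> box lo' hi'" by (simp add: box_def)
qed

definition vol :: "nat \<Rightarrow> real" where "vol K = measure lborel (cell K (\<lambda>_. 0))"

lemma measure_cell:
  assumes K: "1 \<le> K" shows "measure lborel (cell K z) = vol K"
proof -
  have "cell K z = shift (lin (\<chi> i. of_int (z i) / real K)) (cell K (\<lambda>_. 0))"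
    unfolding shift_cell[OF K] by simp
  then show ?thesis unfolding vol_def by (simp only: measure_shift[OF borel_cell])
qed

lemma measure_box_card: "1 \<le> K \<Longrightarrow> measure lborel (box lo hi) = real (card (idx (int K * lo) (int K * hi))) * vol K"
  unfolding UN_cell[symmetric]
  by (subst measure_lborel_finite_Union[OF finite_idx _ _ disjoint_cell]) (simp_all add: bounded_cell measure_cell)

lemma measure_box: "lo \<le> hi \<Longrightarrow> measure lborel (box lo hi) = of_int (hi - lo) ^ CARD('n) * vol 1"
  using measure_box_card[of 1 lo hi] by (simp add: card_idx)

lemma vol_scale: assumes "1 \<le> K" shows "vol 1 = real K ^ CARD('n) * vol K"
  using measure_box_card[OF assms, of 0 1] measure_box[of 0 1] by (simp add: card_idx)

lemma vol_pos: "0 < vol 1"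
proof -
  let ?O = "\<Inter>i. {x. 0 < coord x $ i} \<inter> {x. coord x $ i < 1}"
  have "open ?O"
    by (intro open_INT ballI open_Int open_Collect_less continuous_on_const continuous_coord) simp
  moreover have "lin (\<chi> i. 1/2) \<in> ?O" by simp
  moreover have "?O \<subseteq> box 0 1" by (auto simp: box_def less_imp_le)
  ultimately have "0 < measure lborel (box 0 1)" by (intro open_measure_pos[of ?O _ "box 0 1"] borel_box bounded_box)
  then show ?thesis using measure_box[of 0 1] by simp
qed

end

section \<open>Equivariance under a lattice\<close>

lemma commutes_with_shift_add:
  assumes "commutes_with_shift f v" "commutes_with_shift f w" shows "commutes_with_shift f (v + w)"
  unfolding commutes_with_shift_def
proof
  fix S :: "'a set" assume S: "S \<in> space config_space"
  then have "shift w S \<in> space config_space" by (simp add: space_config_space)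
  then show "shift (v + w) (f S) = f (shift (v + w) S)"
    using assms S unfolding commutes_with_shift_def by (simp flip: shift_shift)
qed

lemma commutes_with_shift_uminus:
  assumes "commutes_with_shift f v" shows "commutes_with_shift f (- v)"
  unfolding commutes_with_shift_def
proof
  fix S :: "'a set" assume S: "S \<in> space config_space"
  then have "shift (- v) S \<in> space config_space" by (simp add: space_config_space)
  then have "shift v (f (shift (- v) S)) = f (shift v (shift (- v) S))"
    using assms unfolding commutes_with_shift_def by blast
  then have "shift (- v) (shift v (f (shift (- v) S))) = shift (- v) (f S)" by simp
  then show "shift (- v) (f S) = f (shift (- v) S)" by simp
qed

lemma commutes_with_shift_0: "commutes_with_shift f 0"
  by (simp add: commutes_with_shift_def)

text \<open>
  Negative multiples are admissible because a map that commutes with a shift commutes with its inverse.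
\<close>

lemma commutes_with_shift_int:
  assumes v: "commutes_with_shift f v" shows "commutes_with_shift f (of_int k *\<^sub>R v)"
proof -
  have nat: "commutes_with_shift f (real n *\<^sub>R v)" for n
    by (induction n) (simp_all add: commutes_with_shift_0 commutes_with_shift_add v scaleR_left_distrib)
  show ?thesis
  proof (cases "0 \<le> k")
    case True
    then show ?thesis using nat[of "nat k"] by simp
  next
    case False
    then show ?thesis using commutes_with_shift_uminus[OF nat[of "nat (- k)"]] by simp
  qed
qed

lemma commutes_with_shift_sum:
  "finite I \<Longrightarrow> (\<And>i. i \<in> I \<Longrightarrow> commutes_with_shift f (w i)) \<Longrightarrow> commutes_with_shift f (\<Sum>i\<in>I. w i)"
  by (induction I rule: finite_induct) (simp_all add: commutes_with_shift_0 commutes_with_shift_add)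

lemma (in lattice_basis) commutes_with_translation:
  assumes "\<And>i. commutes_with_shift f (v i)" shows "commutes_with_shift f (translation j)"
  unfolding lin_def using assms by (intro commutes_with_shift_sum) (simp_all add: commutes_with_shift_int)

lemma void_process_shift_law:
  fixes M :: "'a::euclidean_space set measure"
  assumes sM: "sets M = sets config_space" and M: "void_process M (\<lambda>S. S) (leb lam)" and A: "A \<in> sets config_space"
  shows "measure M {S\<in>space M. shift w S \<in> A} = measure M A"
proof -
  have id: "(\<lambda>S. S) \<in> measurable M config_space" using void_processD(2)[OF M] .
  have sh: "shift w \<in> measurable M config_space" using void_processD(2)[OF void_process_shift[OF M, of w]] .
  have "measure (distr M config_space (shift w)) A = measure (distr M config_space (\<lambda>S. S)) A"
    using void_process_unique[OF void_process_shift[OF M, of w] M] by simp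
  then have "measure M (shift w -` A \<inter> space M) = measure M (A \<inter> space M)"
    by (simp add: measure_distr[OF sh A] measure_distr[OF id A])
  moreover have "A \<inter> space M = A" using A sets.sets_into_space[of A M] sM by auto
  moreover have "shift w -` A \<inter> space M = {S\<in>space M. shift w S \<in> A}" by blast
  ultimately show ?thesis by simp
qed

text \<open>
  An event \<open>P\<close> approximating the event that \<open>Y\<close> meets \<open>C\<close> occurs with about the probability of the latter, which is at
  most \<open>lam' * a\<close>. With probability at least \<open>exp (- lam * a) - exp (- lam' * a)\<close> the set \<open>C\<close> is void for \<open>X\<close> but not for
  \<open>Y\<close>; half of this survives the approximation error.
\<close>

lemma predictor_estimates:
  fixes M :: "'a::euclidean_space set measure"
  assumes sM: "sets M = sets config_space"
    and X: "void_process M (\<lambda>S. S) (leb lam)" and Y: "void_process M Y (leb lam')"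
    and C: "C \<in> sets borel" "bounded C" "measure lborel C = a"
    and E: "E = {S\<in>space config_space. Y S \<inter> C \<noteq> {}}"
    and P: "P \<in> sets config_space" "measure M ((E - P) \<union> (P - E)) < \<eta>"
    and \<eta>: "2 * \<eta> \<le> exp (- (lam * a)) - exp (- (lam' * a))"
  shows "measure M P \<le> lam' * a + \<eta>" "\<eta> \<le> measure M {S\<in>P. Y S \<inter> C \<noteq> {} \<and> S \<inter> C = {}}"
proof -
  note XD = void_processD[OF X] and YD = void_processD[OF Y]
  interpret M: prob_space M by fact
  have sp: "space M = space config_space" using sets_eq_imp_space_eq[OF sM] .
  have EM: "E \<in> sets M" using occupied_event[OF YD(2) C(1)] unfolding E sp .
  have PM: "P \<in> sets M" using P(1) sM by simp
  let ?V = "{S\<in>space M. Y S \<inter> C = {}}" and ?W = "{S\<in>space M. S \<inter> C = {}}"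
  have VM: "?V \<in> sets M" and WM: "?W \<in> sets M"
    using void_event[OF YD(2) C(1)] void_event[OF XD(2) C(1)] by auto
  have pV: "M.prob ?V = exp (- (lam' * a))" and pW: "M.prob ?W = exp (- (lam * a))"
    using YD(3)[OF C(1,2)] XD(3)[OF C(1,2)] C(3) by auto
  have "E = space M - ?V" unfolding E sp by blast
  then have pE: "M.prob E = 1 - exp (- (lam' * a))" using M.prob_compl[OF VM] pV by simp
  have "M.prob P \<le> M.prob (E \<union> ((E - P) \<union> (P - E)))" using EM PM by (intro M.finite_measure_mono) auto
  also have "\<dots> \<le> M.prob E + M.prob ((E - P) \<union> (P - E))" using EM PM by (intro measure_Un_le) auto
  finally show "M.prob P \<le> lam' * a + \<eta>" using P(2) pE exp_ge_add_one_self[of "- (lam' * a)"] by linarith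
  let ?H = "{S\<in>P. Y S \<inter> C \<noteq> {} \<and> S \<inter> C = {}}"
  have "?H = P \<inter> E \<inter> ?W" using sets.sets_into_space[OF PM] unfolding E sp by blast
  then have HM: "?H \<in> sets M" using PM EM WM by simp
  have "M.prob ?W \<le> M.prob (?V \<union> (?H \<union> ((E - P) \<union> (P - E))))"
    using VM HM EM PM by (intro M.finite_measure_mono) (auto simp: E sp)
  also have "\<dots> \<le> M.prob ?V + (M.prob ?H + M.prob ((E - P) \<union> (P - E)))"
    using VM HM EM PM by (intro order_trans[OF measure_Un_le] add_left_mono measure_Un_le) auto
  finally show "\<eta> \<le> M.prob ?H" using P(2) pV pW \<eta> by linarith
qed

lemma exp_diff_lower:
  fixes a b x :: real
  assumes "0 \<le> x" "a \<le> b"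
  shows "(b - a) * x * exp (- (b * x)) \<le> exp (- (a * x)) - exp (- (b * x))"
proof -
  have "exp (- (a * x)) = exp (- (b * x)) * exp ((b - a) * x)" by (simp add: exp_add[symmetric] algebra_simps)
  moreover have "exp (- (b * x)) * (1 + (b - a) * x) \<le> exp (- (b * x)) * exp ((b - a) * x)"
    using exp_ge_add_one_self[of "(b - a) * x"] by (intro mult_left_mono) auto
  ultimately show ?thesis by (simp add: algebra_simps)
qed

text \<open>
  The bound on predicted hits for the \<open>(K * r) ^ d\<close> small cells of a box of side \<open>r\<close>, divided by \<open>r ^ d\<close>. The
  windows of all predictors lie in a box of side \<open>3 * r\<close>, which explains the factor \<open>3 ^ d\<close>. On the right only
  constants remain, whereas the logarithm on the left grows with \<open>K\<close>.
\<close>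

lemma (in lattice_basis) equivariant_thickening_bound:
  fixes M :: "(real ^ 'n) set measure" and f :: "(real ^ 'n) set \<Rightarrow> (real ^ 'n) set"
  assumes lam: "0 < lam" "lam < lam'"
    and sM: "sets M = sets config_space"
    and X: "void_process M (\<lambda>S. S) (leb lam)" and Y: "void_process M (\<lambda>S. S \<union> f S) (leb lam')"
    and comm: "\<And>j. commutes_with_shift f (translation j)"
    and K: "1 \<le> K" "lam' * vol K \<le> 1"
  defines "\<kappa> \<equiv> (lam' - lam) * vol 1 * exp (- (lam' * vol 1)) / 2"
  shows "\<kappa> * ln (1 / (lam' * vol K)) \<le> lam' * vol 1 + \<kappa> + ln 2 * lam' * 3 ^ CARD('n) * vol 1"
proof -
  let ?d = "CARD('n)"
  note XD = void_processD[OF X] and YD = void_processD[OF Y]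
  interpret M: prob_space M by fact
  have sp: "space M = space config_space" using sets_eq_imp_space_eq[OF sM] .
  have lam': "0 < lam'" using lam by simp
  have vs: "vol 1 = real K ^ ?d * vol K" by (rule vol_scale[OF K(1)])
  have Kd: "1 \<le> real K ^ ?d" using K(1) by (intro one_le_power) simp
  have vK: "0 < vol K" using vol_pos vs Kd by (simp add: zero_less_mult_iff)
  have vK1: "vol K \<le> vol 1" unfolding vs using Kd vK mult_right_mono[of 1 "real K ^ ?d" "vol K"] by simp
  \<comment> \<open>Half of a lower bound for the probability that a small cell is met by \<open>Y\<close> but not by \<open>X\<close>.\<close>
  define \<eta> where "\<eta> = (lam' - lam) * vol K * exp (- (lam' * vol 1)) / 2"
  have \<eta>: "0 < \<eta>" unfolding \<eta>_def using lam vK by simp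
  have \<kappa>: "\<kappa> = real K ^ ?d * \<eta>" unfolding \<kappa>_def \<eta>_def vs by simp
  have \<eta>2: "2 * \<eta> \<le> exp (- (lam * vol K)) - exp (- (lam' * vol K))"
  proof -
    have "exp (- (lam' * vol 1)) \<le> exp (- (lam' * vol K))" using lam' vK1 by simp
    then have "(lam' - lam) * vol K * exp (- (lam' * vol 1)) \<le> (lam' - lam) * vol K * exp (- (lam' * vol K))"
      using lam vK by (intro mult_left_mono) auto
    also have "\<dots> \<le> exp (- (lam * vol K)) - exp (- (lam' * vol K))" using lam vK by (intro exp_diff_lower) auto
    finally show ?thesis by (simp add: \<eta>_def)
  qed
  define E where "E z = {S\<in>space config_space. (S \<union> f S) \<inter> cell K z \<noteq> {}}" for z
  have E: "E z \<in> sets config_space" for z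
    using occupied_event[OF YD(2) borel_cell[of K z]] unfolding E_def sp sM .
  have "\<forall>z. \<exists>F g. bounded_family F \<and> M.prob ((E z - void_simple F g) \<union> (void_simple F g - E z)) < \<eta>"
    using approximable_sets[OF XD(1) sM E] \<eta> unfolding approximable_def by blast
  then obtain F g where F: "\<And>z. bounded_family (F z)"
    and err: "\<And>z. M.prob ((E z - void_simple (F z) (g z)) \<union> (void_simple (F z) (g z) - E z)) < \<eta>" by metis
  have "finite (\<Union>z\<in>idx 0 (int K). F z)" using finite_idx F by (auto simp: bounded_family_def)
  moreover have "\<forall>B\<in>(\<Union>z\<in>idx 0 (int K). F z). bounded B" using F by (auto simp: bounded_family_def)
  ultimately have "bounded (\<Union>(\<Union>z\<in>idx 0 (int K). F z))" by (rule bounded_Union)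
  then obtain r where r: "1 \<le> r" "\<Union>(\<Union>z\<in>idx 0 (int K). F z) \<subseteq> box (- r) r" using ex_box by blast
  define Q where "Q = idx 0 (int K * r)"
  \<comment> \<open>The small cell z is the translate by the lattice vector j z of a small cell b z of the fundamental cell.\<close>
  define j where "j z = (\<lambda>i. z i div int K)" for z :: "'n \<Rightarrow> int"
  define b where "b z = (\<lambda>i. z i mod int K)" for z :: "'n \<Rightarrow> int"
  have b: "b z \<in> idx 0 (int K)" for z using K(1) by (simp add: b_def idx_def)
  have j: "0 \<le> j z i" "j z i < r" if "z \<in> Q" for z i
  proof -
    have z: "0 \<le> z i" "z i < int K * r" using that by (auto simp: Q_def idx_def)
    show "0 \<le> j z i" using z K(1) by (simp add: j_def pos_imp_zdiv_nonneg_iff)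
    show "j z i < r"
    proof (rule ccontr)
      assume "\<not> j z i < r"
      then have "int K * r \<le> int K * (z i div int K)" unfolding j_def by (intro mult_left_mono) auto
      also have "\<dots> \<le> z i" using mult_div_mod_eq[of "int K" "z i"] pos_mod_sign[of "int K" "z i"] K(1) by linarith
      finally show False using z by simp
    qed
  qed
  have zb: "cell K z = shift (translation (j z)) (cell K (b z))" for z
    unfolding shift_translation_cell[OF K(1)] by (simp add: j_def b_def)
  define G where "G = cell K ` Q \<union> (\<Union>z\<in>Q. shift (translation (j z)) ` F (b z))"
  have G: "bounded_family G"
    unfolding bounded_family_def G_def Q_def using finite_idx F K(1) unfolding bounded_family_def
    by (auto intro!: bounded_cell borel_cell shift_borel bounded_shift)
  have GU: "\<Union>G \<subseteq> box (- r) (2 * r)"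
  proof -
    have "cell K z \<subseteq> box (- r) (2 * r)" if z: "z \<in> Q" for z
    proof -
      have "cell K z \<subseteq> box 0 r" using cell_subset_box[OF K(1), of z 0 r] z by (simp add: Q_def)
      also have "\<dots> \<subseteq> box (- r) (2 * r)" using shift_translation_box[of "- r" 0 "\<lambda>_. 0" r "2 * r"] r(1) by (simp flip: zero_vec_def add: linear_0[OF linear_lin])
      finally show ?thesis .
    qed
    moreover have "shift (translation (j z)) B \<subseteq> box (- r) (2 * r)" if z: "z \<in> Q" and B: "B \<in> F (b z)" for z B
    proof -
      have "B \<subseteq> box (- r) r" using r(2) b B by blast
      then have "shift (translation (j z)) B \<subseteq> shift (translation (j z)) (box (- r) r)" unfolding shift_conv by (rule image_mono)
      also have "\<dots> \<subseteq> box (- r) (2 * r)" using j[OF z] by (intro shift_translation_box) (auto simp: less_imp_le)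
      finally show ?thesis .
    qed
    ultimately show ?thesis unfolding G_def by blast
  qed
  have GUm: "measure lborel (\<Union>G) \<le> (3 * of_int r) ^ ?d * vol 1"
  proof -
    have "\<Union>G \<in> sets borel" using G by (auto simp: bounded_family_def)
    then have "measure lborel (\<Union>G) \<le> measure lborel (box (- r) (2 * r))"
      using emeasure_bounded_finite[OF bounded_box] GU by (intro measure_mono_fmeasurable) (auto simp: fmeasurable_def)
    then show ?thesis using measure_box[of "- r" "2 * r"] r(1) by simp
  qed
  \<comment> \<open>The predictor of the small cell \<open>b z\<close>, translated together with its window.\<close>
  define pr where "pr z P = g (b z) {B\<in>F (b z). shift (translation (j z)) B \<in> P}" for z P
  have pr: "pr z {B\<in>G. S \<inter> B = {}} \<longleftrightarrow> shift (- translation (j z)) S \<in> void_simple (F (b z)) (g (b z))"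
    if S: "S \<in> space config_space" and z: "z \<in> Q" for S z
  proof -
    have "{B\<in>F (b z). shift (translation (j z)) B \<in> {B\<in>G. S \<inter> B = {}}} = {B\<in>F (b z). shift (- translation (j z)) S \<inter> B = {}}"
      using z unfolding G_def by (auto simp: shift_Int_eq_empty)
    then show ?thesis using S unfolding pr_def void_simple_def by (simp add: space_config_space)
  qed
  have Ysh: "shift (- translation (j z)) S \<union> f (shift (- translation (j z)) S) = shift (- translation (j z)) (S \<union> f S)"
    if "S \<in> space config_space" for S z
    using commutes_with_shift_uminus[OF comm[of "j z"]] that by (simp add: commutes_with_shift_def shift_Un)
  have est: "M.prob {S\<in>space M. pr z {B\<in>G. S \<inter> B = {}}} \<le> lam' * vol K + \<eta>"
    "\<eta> \<le> M.prob {S\<in>space M. pr z {B\<in>G. S \<inter> B = {}} \<and> (S \<union> f S) \<inter> cell K z \<noteq> {} \<and> S \<inter> cell K z = {}}"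
    if z: "z \<in> Q" for z
  proof -
    let ?P = "void_simple (F (b z)) (g (b z))" and ?w = "- translation (j z)"
    let ?H = "{S\<in>?P. (S \<union> f S) \<inter> cell K (b z) \<noteq> {} \<and> S \<inter> cell K (b z) = {}}"
    note pe = predictor_estimates[OF sM X Y borel_cell[of K "b z"] bounded_cell[OF K(1)] measure_cell[OF K(1)] E_def void_simple_sets[OF F] err \<eta>2]
    have P: "?P \<in> sets config_space" by (rule void_simple_sets[OF F])
    have "{S\<in>space M. pr z {B\<in>G. S \<inter> B = {}}} = {S\<in>space M. shift ?w S \<in> ?P}" using pr[OF _ z] unfolding sp by blast
    then show "M.prob {S\<in>space M. pr z {B\<in>G. S \<inter> B = {}}} \<le> lam' * vol K + \<eta>"
      using void_process_shift_law[OF sM X P, of ?w] pe(1) by simp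
    have "?H = ?P \<inter> ({S\<in>space M. (S \<union> f S) \<inter> cell K (b z) \<noteq> {}} \<inter> {S\<in>space M. S \<inter> cell K (b z) = {}})"
      unfolding void_simple_def sp by blast
    also have "\<dots> \<in> sets config_space"
      using P occupied_event[OF YD(2) borel_cell] void_event[OF XD(2) borel_cell] unfolding sM by (intro sets.Int)
    finally have H: "?H \<in> sets config_space" .
    have void: "shift ?w S \<inter> cell K (b z) = {} \<longleftrightarrow> S \<inter> cell K z = {}" for S
      unfolding shift_Int_eq_empty zb[of z] by simp
    have "{S\<in>space M. pr z {B\<in>G. S \<inter> B = {}} \<and> (S \<union> f S) \<inter> cell K z \<noteq> {} \<and> S \<inter> cell K z = {}} = {S\<in>space M. shift ?w S \<in> ?H}"
      unfolding sp by (rule Collect_cong, rule conj_cong[OF refl]) (simp only: mem_Collect_eq pr[OF _ z] Ysh void)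
    then show "\<eta> \<le> M.prob {S\<in>space M. pr z {B\<in>G. S \<inter> B = {}} \<and> (S \<union> f S) \<inter> cell K z \<noteq> {} \<and> S \<inter> cell K z = {}}"
      using void_process_shift_law[OF sM X H, of ?w] pe(2) by simp
  qed
  define s where "s = 1 / (lam' * vol K)"
  have s: "1 \<le> s" unfolding s_def using K(2) lam' vK by simp
  have cQ: "real (card Q) = of_int r ^ ?d * real K ^ ?d"
    using r(1) K(1) by (simp add: Q_def card_idx power_mult_distrib mult.commute)
  have "ln s * (real (card Q) * \<eta>) = ln s * (\<Sum>z\<in>Q. \<eta>)" by simp
  also have "\<dots> \<le> ln s * (\<Sum>z\<in>Q. M.prob {S\<in>space M. pr z {B\<in>G. S \<inter> B = {}} \<and> (S \<union> f S) \<inter> cell K z \<noteq> {} \<and> S \<inter> cell K z = {}})"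
    using s est(2) by (intro mult_left_mono sum_mono) auto
  also have "\<dots> \<le> (\<Sum>z\<in>Q. M.prob {S\<in>space M. pr z {B\<in>G. S \<inter> B = {}}}) + ln 2 * leb lam' (\<Union>G)"
  proof (rule predicted_hits_bound[OF Y _ XD(2) _ G _ _ disjoint_cell s])
    show "0 \<le> lam'" using lam' by simp
    show "finite Q" unfolding Q_def by (rule finite_idx)
    show "cell K ` Q \<subseteq> G" unfolding G_def by blast
    show "s * leb lam' (cell K z) \<le> 1" for z unfolding s_def measure_cell[OF K(1)] using lam' vK by simp
  qed auto
  also have "\<dots> \<le> (\<Sum>z\<in>Q. lam' * vol K + \<eta>) + ln 2 * (lam' * ((3 * of_int r) ^ ?d * vol 1))"
    using est(1) GUm lam' by (intro add_mono sum_mono mult_left_mono) auto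
  finally have "ln s * (real (card Q) * \<eta>) \<le> real (card Q) * (lam' * vol K + \<eta>) + ln 2 * (lam' * ((3 * of_int r) ^ ?d * vol 1))" by simp
  then have "of_int r ^ ?d * (\<kappa> * ln s) \<le> of_int r ^ ?d * (lam' * vol 1 + \<kappa> + ln 2 * lam' * 3 ^ ?d * vol 1)"
    unfolding cQ \<kappa> vs by (simp add: algebra_simps power_mult_distrib)
  moreover have "0 < real_of_int r ^ ?d" using r(1) by simp
  ultimately show ?thesis unfolding s_def by (simp only: mult_le_cancel_left_pos)
qed

theorem no_lattice_equivariant_thickening:
  fixes v :: "'n::finite \<Rightarrow> real ^ 'n" and f :: "(real ^ 'n) set \<Rightarrow> (real ^ 'n) set"
  assumes lam: "0 < lam" "lam < lam'" and v: "inj v" "independent (range v)"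
    and f: "thickening lam lam' f" and comm: "\<And>i. commutes_with_shift f (v i)"
  shows False
proof -
  interpret lattice_basis v by standard fact+
  have lam': "0 < lam'" using lam by simp
  obtain M :: "(real ^ 'n) set measure" where sM: "sets M = sets config_space" and X: "void_process M (\<lambda>S. S) (leb lam)"
    using ex_void_process[of lam] lam by auto
  have Y: "void_process M (\<lambda>S. S \<union> f S) (leb lam')"
    using X f lam unfolding thickening_def by (simp flip: poisson_iff_void_process)
  define \<kappa> where "\<kappa> = (lam' - lam) * vol 1 * exp (- (lam' * vol 1)) / 2"
  have \<kappa>: "0 < \<kappa>" unfolding \<kappa>_def using lam vol_pos by simp
  define c where "c = lam' * vol 1 + \<kappa> + ln 2 * lam' * 3 ^ CARD('n) * vol 1"
  \<comment> \<open>The volume of a small cell tends to 0, so the logarithm exceeds \<open>c / \<kappa>\<close> for large \<open>K\<close>.\<close>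
  obtain K where K: "lam' * vol 1 * (exp (c / \<kappa>) + 1) \<le> real K" using real_arch_simple by blast
  have "0 < lam' * vol 1 * (exp (c / \<kappa>) + 1)" using lam' vol_pos by (simp add: add_pos_pos)
  then have K1: "1 \<le> K" using K by (cases K) auto
  have "real K \<le> real K ^ CARD('n)" using K1 by (intro self_le_power) auto
  with K have "lam' * vol 1 * (exp (c / \<kappa>) + 1) \<le> real K ^ CARD('n)" by linarith
  moreover have "0 < lam' * vol 1" using lam' vol_pos by simp
  ultimately have big: "exp (c / \<kappa>) + 1 \<le> real K ^ CARD('n) / (lam' * vol 1)"
    by (simp add: pos_le_divide_eq mult_ac)
  have s: "1 / (lam' * vol K) = real K ^ CARD('n) / (lam' * vol 1)"
    unfolding vol_scale[OF K1] using K1 by simp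
  have vK: "0 < vol K" using vol_pos K1 unfolding vol_scale[OF K1] by (simp add: zero_less_mult_iff)
  have "1 \<le> 1 / (lam' * vol K)" unfolding s using big exp_gt_zero[of "c / \<kappa>"] by linarith
  then have "lam' * vol K \<le> 1" using lam' vK by simp
  from equivariant_thickening_bound[OF lam sM X Y commutes_with_translation[OF comm] K1 this]
  have "\<kappa> * ln (1 / (lam' * vol K)) \<le> c" unfolding \<kappa>_def c_def .
  then have "ln (1 / (lam' * vol K)) \<le> c / \<kappa>" using \<kappa> by (simp add: pos_le_divide_eq mult.commute)
  moreover have "c / \<kappa> < ln (1 / (lam' * vol K))"
  proof -
    have "exp (c / \<kappa>) < 1 / (lam' * vol K)" using big unfolding s by linarith
    then have "ln (exp (c / \<kappa>)) < ln (1 / (lam' * vol K))" using lam' vK by (subst ln_less_cancel_iff) auto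
    then show ?thesis by simp
  qed
  ultimately show False by linarith
qed

theorem theorem1p4:
  fixes lam lam' :: real
  assumes "0 < lam" and "lam < lam'"
  shows "(\<forall>v :: 'n::finite \<Rightarrow> real ^ 'n.
            inj v \<and> independent (range v) \<longrightarrow>
            \<not> (\<exists>f. thickening lam lam' f \<and> (\<forall>i. commutes_with_shift f (v i)))) \<and>
         (\<forall>V :: (real ^ 'n) set.
            subspace V \<and> dim V + 1 = CARD('n) \<longrightarrow>
            (\<exists>f. thickening lam lam' f \<and> (\<forall>v\<in>V. commutes_with_shift f v)))"
proof (intro conjI allI impI notI)
  fix v :: "'n \<Rightarrow> real ^ 'n"
  assume "inj v \<and> independent (range v)" "\<exists>f. thickening lam lam' f \<and> (\<forall>i. commutes_with_shift f (v i))"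
  then show False using no_lattice_equivariant_thickening[OF assms] by blast
next
  fix V :: "(real ^ 'n) set"
  assume "subspace V \<and> dim V + 1 = CARD('n)"
  then show "\<exists>f. thickening lam lam' f \<and> (\<forall>v\<in>V. commutes_with_shift f v)"
    using ex_thickening_subspace[OF assms, of V] by simp
qed

end
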